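(* Let $M$ be a $C^{2,1}$ manifold endowed with a $C^{1,1}$ pseudo-Riemannian metric and the corresponding locally Lipschitz metric compatible connection. Let $\phi\colon S\to M$ be a $C^{1,1}$ embedding of a $k$-dimensional manifold $S$, $k\ge1$, such that the induced metric is pseudo-Riemannian (non-degenerate), and let $\nu(S)$ be the corresponding $n$-dimensional normal bundle with base $\phi(S)$. Then the vector bundle $\nu(S)$ is Lipschitz. Moreover, the map $\exp_{\nu(S)}$ is strongly differentiable on the image of the zero section of $\pi|_{\nu(S)}\colon\nu(S)\to\phi(S)$, and establishes a Lipeomorphism between a neighborhood of the image of the zero section and a neighborhood of $\phi(S)$.
   Context: $C^{k,1}$ means $C^{k,1}_{loc}$. $M$ is an $n$-dimensional paracompact connected manifold, $\pi\colon TM\to M$. Connections are torsionless, so the connection is the Levi-Civita one, with locally Lipschitz Christoffel symbols $\Gamma^\mu_{\alpha\beta}$. $\gamma_v$ is the unique solution of $\ddot x^\mu=-\Gamma^\mu_{\alpha\beta}(x)\dot x^\alpha\dot x^\beta$ with initial velocity $v\in TM$. The normal bundle is $\nu(S)=\{v\in T_qM: q\in\phi(S),\ g(v,w)=0\ \text{for all } w\in T_q\phi(S)\}\subset TM$ (its fibers have dimension $n-k$). $\exp_{\nu(S)}(v):=\gamma_v(1)\in M$ for those $v\in\nu(S)$ for which $\gamma_v$ is defined at least on $[0,1]$. A Lipeomorphism is a homeomorphism $f$ with $f$ and $f^{-1}$ locally Lipschitz. A function $f\colon O\to F$, $O$ open in a Banach space $E$, is strongly differentiable at $p\in O$ with strong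 differential the bounded linear map $L\colon E\to F$ if for every $\epsilon>0$ there is $\delta>0$ such that $|q_1-p|\le\delta$, $|q_2-p|\le\delta$ imply $|f(q_1)-f(q_2)-L(q_1-q_2)|\le\epsilon|q_1-q_2|$. Strong differentiability of $\exp_{\nu(S)}$ is understood in the coordinates $(s,y)\in\mathbb{R}^k\times\mathbb{R}^{n-k}$ of $\nu(S)$ defined by $v=y^je_j(s)$, with $s$ local coordinates of $S$ and $e_j$ a local Lipschitz base of the normal spaces. *)

theory Defs
  imports "HOL-Analysis.Analysis"
begin

text \<open>
  On an open set \<open>U\<close>, \<open>Ck1 k U f\<close> is the local class \<open>C\<^sup>k\<^sup>,\<^sup>1\<close>: all iterated directional derivatives
  up to order \<open>k\<close> exist and those of order \<open>k\<close> are locally Lipschitz.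
\<close>

primrec Ck1 :: "nat \<Rightarrow> 'a::euclidean_space set \<Rightarrow> ('a \<Rightarrow> 'b::real_normed_vector) \<Rightarrow> bool" where
  "Ck1 0 U f \<longleftrightarrow> (\<forall>x\<in>U. \<exists>r>0. \<exists>L. L-lipschitz_on (ball x r \<inter> U) f)"
| "Ck1 (Suc k) U f \<longleftrightarrow>
     (\<forall>x\<in>U. f differentiable (at x)) \<and> (\<forall>v. Ck1 k U (\<lambda>x. frechet_derivative f (at x) v))"

text \<open>
  The Banach space of the definition is here a subspace \<open>E\<close> of the type; since \<open>E\<close> is
  finite-dimensional, a differential defined on \<open>E\<close> may be taken as the restriction of a
  total linear map.
\<close>

definition has_strong_differential ::
  "'a::euclidean_space set \<Rightarrow> 'a set \<Rightarrow> ('a \<Rightarrow> 'b::real_normed_vector) \<Rightarrow> ('a \<Rightarrow> 'b) \<Rightarrow> 'a \<Rightarrow> bool"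
where
  "has_strong_differential E W f L p \<longleftrightarrow>
     subspace E \<and> openin (top_of_set E) W \<and> p \<in> W \<and> bounded_linear L \<and>
     (\<forall>\<epsilon>>0. \<exists>\<delta>>0. \<forall>x\<in>W. \<forall>y\<in>W. norm (x - p) \<le> \<delta> \<longrightarrow> norm (y - p) \<le> \<delta> \<longrightarrow>
        norm (f x - f y - L (x - y)) \<le> \<epsilon> * norm (x - y))"

type_synonym ('p, 'e) chart = "'p set \<times> ('p \<Rightarrow> 'e)"

definition chart_rep :: "('p, 'e) chart \<Rightarrow> ('q, 'f) chart \<Rightarrow> ('p \<Rightarrow> 'q) \<Rightarrow> 'e \<Rightarrow> 'f" where
  "chart_rep a b f = snd b \<circ> f \<circ> inv_into (fst a) (snd a)"

definition paracompact_space :: "'p topology \<Rightarrow> bool" where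
  "paracompact_space X \<longleftrightarrow>
     (\<forall>\<U>. (\<forall>U\<in>\<U>. openin X U) \<and> \<Union>\<U> = topspace X \<longrightarrow>
        (\<exists>\<V>. (\<forall>V\<in>\<V>. openin X V \<and> (\<exists>U\<in>\<U>. V \<subseteq> U)) \<and> \<Union>\<V> = topspace X \<and>
              locally_finite_in X \<V>))"

definition Ck1_map ::
  "nat \<Rightarrow> ('p, 'a::euclidean_space) chart set \<Rightarrow> ('q, 'b::euclidean_space) chart set \<Rightarrow> ('p \<Rightarrow> 'q) \<Rightarrow> bool"
where
  "Ck1_map k A B f \<longleftrightarrow>
     (\<forall>a\<in>A. \<forall>b\<in>B. Ck1 k (snd a ` {p \<in> fst a. f p \<in> fst b}) (chart_rep a b f))"

text \<open>
  The atlas \<open>A\<close> need not be maximal; the dimension of the manifold is \<open>DIM('e)\<close>.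
\<close>

definition Ck1_manifold :: "nat \<Rightarrow> 'p topology \<Rightarrow> ('p, 'e::euclidean_space) chart set \<Rightarrow> bool" where
  "Ck1_manifold k X A \<longleftrightarrow>
     Hausdorff_space X \<and> paracompact_space X \<and>
     (\<Union>c\<in>A. fst c) = topspace X \<and>
     (\<forall>c\<in>A. openin X (fst c) \<and> open (snd c ` fst c) \<and>
        homeomorphic_map (subtopology X (fst c)) (top_of_set (snd c ` fst c)) (snd c)) \<and>
     Ck1_map k A A (\<lambda>p. p)"

text \<open>
  Local Lipschitz continuity on \<open>N\<close> of a map between sets carrying families of coordinates.
  The target atlas \<open>{(UNIV, \<lambda>y. y)}\<close> gives the case of maps into a metric space.
\<close>

definition locally_lipschitz_map ::
  "('p, 'e::metric_space) chart set \<Rightarrow> 'p set \<Rightarrow> ('q, 'f::metric_space) chart set \<Rightarrow> ('p \<Rightarrow> 'q) \<Rightarrow> bool"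
where
  "locally_lipschitz_map A N B f \<longleftrightarrow>
     (\<forall>p\<in>N. \<forall>a\<in>A. \<forall>b\<in>B. p \<in> fst a \<longrightarrow> f p \<in> fst b \<longrightarrow>
        (\<exists>r>0. \<exists>L.
           (\<forall>x \<in> N \<inter> fst a. snd a x \<in> ball (snd a p) r \<longrightarrow> f x \<in> fst b) \<and>
           L-lipschitz_on (ball (snd a p) r \<inter> snd a ` (N \<inter> fst a)) (chart_rep a b f)))"

definition lipeomorphism ::
  "'p topology \<Rightarrow> ('p, 'e::metric_space) chart set \<Rightarrow>
   'q topology \<Rightarrow> ('q, 'f::metric_space) chart set \<Rightarrow> ('p \<Rightarrow> 'q) \<Rightarrow> bool"
where
  "lipeomorphism X A Y B f \<longleftrightarrow>
     homeomorphic_map X Y f \<and>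
     locally_lipschitz_map A (topspace X) B f \<and>
     locally_lipschitz_map B (topspace Y) A (inv_into (topspace X) f)"

text \<open>
  A tangent vector at \<open>p\<close> is the family of its components in all charts of the atlas around \<open>p\<close>,
  related by the Jacobians of the coordinate changes. Components in irrelevant charts are set
  to zero, so that tangent vectors are equal iff their relevant components are.
\<close>

type_synonym ('p, 'e) tvec = "'p \<times> (('p, 'e) chart \<Rightarrow> 'e)"

definition tangent_space ::
  "('p, 'e::euclidean_space) chart set \<Rightarrow> 'p \<Rightarrow> ('p, 'e) tvec set" where
  "tangent_space A p =
     {v. fst v = p \<and>
         (\<forall>c\<in>A. \<forall>d\<in>A. p \<in> fst c \<longrightarrow> p \<in> fst d \<longrightarrow>
            snd v d = frechet_derivative (chart_rep c d (\<lambda>p. p)) (at (snd c p)) (snd v c)) \<and>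
         (\<forall>c. c \<notin> A \<or> p \<notin> fst c \<longrightarrow> snd v c = 0)}"

definition tzero :: "'p \<Rightarrow> ('p, 'e::euclidean_space) tvec" where
  "tzero p = (p, \<lambda>c. 0)"

definition tadd :: "('p, 'e::euclidean_space) tvec \<Rightarrow> ('p, 'e) tvec \<Rightarrow> ('p, 'e) tvec" where
  "tadd v w = (fst v, \<lambda>c. snd v c + snd w c)"

definition tscale :: "real \<Rightarrow> ('p, 'e::euclidean_space) tvec \<Rightarrow> ('p, 'e) tvec" where
  "tscale r v = (fst v, \<lambda>c. r *\<^sub>R snd v c)"

text \<open>The tangent vector at \<open>p\<close> with components \<open>\<xi>\<close> in the chart \<open>c\<close>.\<close>

definition tvec_of ::
  "('p, 'e::euclidean_space) chart set \<Rightarrow> ('p, 'e) chart \<Rightarrow> 'p \<Rightarrow> 'e \<Rightarrow> ('p, 'e) tvec" where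
  "tvec_of A c p \<xi> =
     (p, \<lambda>d. if d \<in> A \<and> p \<in> fst d
             then frechet_derivative (chart_rep c d (\<lambda>p. p)) (at (snd c p)) \<xi> else 0)"

definition tangent_charts ::
  "('p, 'e::euclidean_space) chart set \<Rightarrow> (('p, 'e) tvec, 'e \<times> 'e) chart set" where
  "tangent_charts A =
     (\<lambda>c. ({v. fst v \<in> fst c \<and> v \<in> tangent_space A (fst v)},
           \<lambda>v. (snd c (fst v), snd v c))) ` A"

definition tangent_topology ::
  "('p, 'e::euclidean_space) chart set \<Rightarrow> ('p, 'e) tvec topology" where
  "tangent_topology A =
     topology_generated_by {{v \<in> fst a. snd a v \<in> W} | a W. a \<in> tangent_charts A \<and> open W}"

text \<open>
  The differential of a map; by the chain rule the choice of the chart around the base point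
  is immaterial when the map is differentiable.
\<close>

definition pushforward ::
  "('p, 'a::euclidean_space) chart set \<Rightarrow> ('q, 'b::euclidean_space) chart set \<Rightarrow>
   ('p \<Rightarrow> 'q) \<Rightarrow> ('p, 'a) tvec \<Rightarrow> ('q, 'b) tvec"
where
  "pushforward A B f u =
     (let c = (SOME c. c \<in> A \<and> fst u \<in> fst c) in
      (f (fst u), \<lambda>d. if d \<in> B \<and> f (fst u) \<in> fst d
         then frechet_derivative (chart_rep c d f) (at (snd c (fst u))) (snd u c) else 0))"

definition Ck1_embedding ::
  "nat \<Rightarrow> 'p topology \<Rightarrow> ('p, 'a::euclidean_space) chart set \<Rightarrow>
   'q topology \<Rightarrow> ('q, 'b::euclidean_space) chart set \<Rightarrow> ('p \<Rightarrow> 'q) \<Rightarrow> bool"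
where
  "Ck1_embedding k X A Y B f \<longleftrightarrow>
     embedding_map X Y f \<and> Ck1_map k A B f \<and>
     (\<forall>p\<in>topspace X. inj_on (pushforward A B f) (tangent_space A p))"

type_synonym ('p, 'e) metric_field = "('p, 'e) tvec \<Rightarrow> ('p, 'e) tvec \<Rightarrow> real"

definition metric_comp ::
  "('p, real^'n) chart set \<Rightarrow> ('p, real^'n) metric_field \<Rightarrow> ('p, real^'n) chart \<Rightarrow>
   real^'n \<Rightarrow> 'n \<Rightarrow> 'n \<Rightarrow> real"
where
  "metric_comp A g c x \<alpha> \<beta> =
     (let p = inv_into (fst c) (snd c) x
      in g (tvec_of A c p (axis \<alpha> 1)) (tvec_of A c p (axis \<beta> 1)))"

definition nondegenerate_on ::
  "('p, 'e::euclidean_space) chart set \<Rightarrow> 'p \<Rightarrow> ('p, 'e) metric_field \<Rightarrow> bool" where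
  "nondegenerate_on A p g \<longleftrightarrow>
     (\<forall>u\<in>tangent_space A p. (\<forall>w\<in>tangent_space A p. g u w = 0) \<longrightarrow> u = tzero p)"

definition pseudo_riemannian_metric ::
  "nat \<Rightarrow> 'p topology \<Rightarrow> ('p, real^'n) chart set \<Rightarrow> ('p, real^'n) metric_field \<Rightarrow> bool" where
  "pseudo_riemannian_metric k X A g \<longleftrightarrow>
     (\<forall>p\<in>topspace X.
        (\<forall>u\<in>tangent_space A p. \<forall>v\<in>tangent_space A p. g u v = g v u) \<and>
        (\<forall>u\<in>tangent_space A p. \<forall>v\<in>tangent_space A p. \<forall>w\<in>tangent_space A p. \<forall>r.
           g (tadd u v) w = g u w + g v w \<and> g (tscale r u) w = r * g u w) \<and>
        nondegenerate_on A p g) \<and>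
     (\<forall>c\<in>A. \<forall>\<alpha> \<beta>. Ck1 k (snd c ` fst c) (\<lambda>x. metric_comp A g c x \<alpha> \<beta>))"

text \<open>\<open>\<Gamma> c x \<mu> \<alpha> \<beta>\<close> is the Christoffel symbol with upper index \<open>\<mu>\<close> and lower indices \<open>\<alpha>, \<beta>\<close> at the point of coordinates \<open>x\<close>.\<close>

type_synonym ('p, 'n) symbols =
  "('p, real^'n) chart \<Rightarrow> real^'n \<Rightarrow> 'n \<Rightarrow> 'n \<Rightarrow> 'n \<Rightarrow> real"

definition christoffel ::
  "('p, 'n::finite) symbols \<Rightarrow> ('p, real^'n) chart \<Rightarrow> real^'n \<Rightarrow> real^'n \<Rightarrow> real^'n \<Rightarrow> real^'n" where
  "christoffel \<Gamma> c x u w = (\<chi> \<mu>. \<Sum>\<alpha>\<in>UNIV. \<Sum>\<beta>\<in>UNIV. \<Gamma> c x \<mu> \<alpha> \<beta> * u $ \<alpha> * w $ \<beta>)"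

text \<open>
  A torsionless locally Lipschitz connection. For a coordinate change \<open>\<tau>\<close> from \<open>c\<close> to \<open>d\<close> the last
  clause is the transformation law
  \<open>D\<tau> (\<Gamma>\<^sub>c (u, w)) = D\<^sup>2\<tau> (u, w) + \<Gamma>\<^sub>d (D\<tau> u, D\<tau> w)\<close>.
\<close>

definition lipschitz_connection ::
  "('p, real^'n) chart set \<Rightarrow> ('p, 'n::finite) symbols \<Rightarrow> bool" where
  "lipschitz_connection A \<Gamma> \<longleftrightarrow>
     (\<forall>c\<in>A. \<forall>\<mu> \<alpha> \<beta>. Ck1 0 (snd c ` fst c) (\<lambda>x. \<Gamma> c x \<mu> \<alpha> \<beta>)) \<and>
     (\<forall>c\<in>A. \<forall>x\<in>snd c ` fst c. \<forall>\<mu> \<alpha> \<beta>. \<Gamma> c x \<mu> \<alpha> \<beta> = \<Gamma> c x \<mu> \<beta> \<alpha>) \<and>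
     (\<forall>c\<in>A. \<forall>d\<in>A. \<forall>p \<in> fst c \<inter> fst d. \<forall>u w.
        let \<tau> = chart_rep c d (\<lambda>p. p); x = snd c p; D = (\<lambda>z. frechet_derivative \<tau> (at z))
        in D x (christoffel \<Gamma> c x u w) =
             frechet_derivative (\<lambda>z. D z u) (at x) w + christoffel \<Gamma> d (\<tau> x) (D x u) (D x w))"

definition metric_compatible ::
  "('p, real^'n) chart set \<Rightarrow> ('p, real^'n) metric_field \<Rightarrow> ('p, 'n::finite) symbols \<Rightarrow> bool" where
  "metric_compatible A g \<Gamma> \<longleftrightarrow>
     (\<forall>c\<in>A. \<forall>x\<in>snd c ` fst c. \<forall>\<alpha> \<beta> \<gamma>.
        frechet_derivative (\<lambda>z. metric_comp A g c z \<beta> \<gamma>) (at x) (axis \<alpha> 1) =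
        (\<Sum>\<sigma>\<in>UNIV. \<Gamma> c x \<sigma> \<alpha> \<beta> * metric_comp A g c x \<sigma> \<gamma> + \<Gamma> c x \<sigma> \<alpha> \<gamma> * metric_comp A g c x \<beta> \<sigma>))"

text \<open>
  A geodesic is given by its velocity field \<open>V\<close>, as a solution of the associated first order system;
  the geodesic itself is \<open>fst \<circ> V\<close>.
\<close>

definition geodesic_on ::
  "'p topology \<Rightarrow> ('p, real^'n) chart set \<Rightarrow> ('p, 'n::finite) symbols \<Rightarrow>
   real set \<Rightarrow> (real \<Rightarrow> ('p, real^'n) tvec) \<Rightarrow> bool"
where
  "geodesic_on X A \<Gamma> I V \<longleftrightarrow>
     open I \<and> is_interval I \<and>
     continuous_map (top_of_set I) X (fst \<circ> V) \<and>
     (\<forall>t\<in>I. V t \<in> tangent_space A (fst (V t))) \<and>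
     (\<forall>t\<in>I. \<forall>c\<in>A. fst (V t) \<in> fst c \<longrightarrow>
        ((\<lambda>s. snd c (fst (V s))) has_vector_derivative snd (V t) c) (at t) \<and>
        ((\<lambda>s. snd (V s) c) has_vector_derivative
           - christoffel \<Gamma> c (snd c (fst (V t))) (snd (V t) c) (snd (V t) c)) (at t))"

definition exp_graph ::
  "'p topology \<Rightarrow> ('p, real^'n) chart set \<Rightarrow> ('p, 'n::finite) symbols \<Rightarrow>
   ('p, real^'n) tvec \<Rightarrow> 'p \<Rightarrow> bool"
where
  "exp_graph X A \<Gamma> v q \<longleftrightarrow>
     (\<exists>I V. {0..1} \<subseteq> I \<and> geodesic_on X A \<Gamma> I V \<and> V 0 = v \<and> fst (V 1) = q)"

definition exp_dom ::
  "'p topology \<Rightarrow> ('p, real^'n) chart set \<Rightarrow> ('p, 'n::finite) symbols \<Rightarrow> ('p, real^'n) tvec set" where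
  "exp_dom X A \<Gamma> = {v. \<exists>q. exp_graph X A \<Gamma> v q}"

definition exp_map ::
  "'p topology \<Rightarrow> ('p, real^'n) chart set \<Rightarrow> ('p, 'n::finite) symbols \<Rightarrow> ('p, real^'n) tvec \<Rightarrow> 'p" where
  "exp_map X A \<Gamma> v = (THE q. exp_graph X A \<Gamma> v q)"

text \<open>
  \<open>E\<close> is the total space, \<open>B\<close> the base with coordinates \<open>AB\<close>, \<open>F\<close> the model fibre and \<open>T\<close> a bundle
  atlas. A local trivialisation over \<open>V\<close> is given by its fibre component \<open>\<psi>\<close>, and the transition
  maps are required to depend on the base point in a locally Lipschitz way.
\<close>

definition lipschitz_vector_bundle ::
  "'e topology \<Rightarrow> 'b topology \<Rightarrow> ('b, 'c::metric_space) chart set \<Rightarrow> ('e \<Rightarrow> 'b) \<Rightarrow>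
   ('e \<Rightarrow> 'e \<Rightarrow> 'e) \<Rightarrow> (real \<Rightarrow> 'e \<Rightarrow> 'e) \<Rightarrow> 'v::euclidean_space set \<Rightarrow>
   ('b set \<times> ('e \<Rightarrow> 'v)) set \<Rightarrow> bool"
where
  "lipschitz_vector_bundle E B AB \<pi> add scl F T \<longleftrightarrow>
     subspace F \<and> continuous_map E B \<pi> \<and> \<pi> ` topspace E = topspace B \<and>
     (\<forall>v\<in>topspace E. \<forall>w\<in>topspace E. \<forall>r. \<pi> v = \<pi> w \<longrightarrow>
        add v w \<in> topspace E \<and> \<pi> (add v w) = \<pi> v \<and>
        scl r v \<in> topspace E \<and> \<pi> (scl r v) = \<pi> v) \<and>
     (\<Union>t\<in>T. fst t) = topspace B \<and>
     (\<forall>(V, \<psi>)\<in>T.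
        openin B V \<and>
        homeomorphic_map (subtopology E {v \<in> topspace E. \<pi> v \<in> V})
          (prod_topology (subtopology B V) (top_of_set F)) (\<lambda>v. (\<pi> v, \<psi> v)) \<and>
        (\<forall>v\<in>topspace E. \<forall>w\<in>topspace E. \<forall>r. \<pi> v \<in> V \<longrightarrow> \<pi> v = \<pi> w \<longrightarrow>
           \<psi> (add v w) = \<psi> v + \<psi> w \<and> \<psi> (scl r v) = r *\<^sub>R \<psi> v)) \<and>
     (\<forall>(V, \<psi>)\<in>T. \<forall>(V', \<psi>')\<in>T. \<forall>y\<in>F.
        locally_lipschitz_map AB (V \<inter> V') {(UNIV, \<lambda>z. z)}
          (\<lambda>q. \<psi>' (inv_into {v \<in> topspace E. \<pi> v = q} \<psi> y)))"

text \<open>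
  Below \<open>(M, A)\<close> is the ambient manifold, \<open>(S, B)\<close> the embedded one and \<open>\<phi>\<close> the embedding.
  The image \<open>\<phi> S\<close>, which has the topology induced from \<open>M\<close>, gets its coordinates from \<open>S\<close>.
\<close>

definition image_charts :: "'s topology \<Rightarrow> ('s, 'e) chart set \<Rightarrow> ('s \<Rightarrow> 'm) \<Rightarrow> ('m, 'e) chart set" where
  "image_charts S B \<phi> = (\<lambda>c. (\<phi> ` fst c, snd c \<circ> inv_into (topspace S) \<phi>)) ` B"

definition normal_bundle ::
  "('m, real^'n) chart set \<Rightarrow> ('m, real^'n) metric_field \<Rightarrow>
   's topology \<Rightarrow> ('s, real^'k) chart set \<Rightarrow> ('s \<Rightarrow> 'm) \<Rightarrow> ('m, real^'n) tvec set"
where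
  "normal_bundle A g S B \<phi> =
     {v. \<exists>s\<in>topspace S. v \<in> tangent_space A (\<phi> s) \<and>
           (\<forall>w \<in> pushforward B A \<phi> ` tangent_space B s. g v w = 0)}"

text \<open>
  The fibre model of dimension \<open>d\<close> is the space of vectors supported on an index set \<open>J\<close> of
  cardinality \<open>d\<close>; contrary to \<open>real ^ 'j\<close> this includes \<open>d = 0\<close>, which is needed for
  submanifolds of codimension zero.
\<close>

definition coord_space :: "'n set \<Rightarrow> (real^'n) set" where
  "coord_space J = {y. \<forall>i. i \<notin> J \<longrightarrow> y $ i = 0}"

definition frame_comb ::
  "'n set \<Rightarrow> ('n \<Rightarrow> 'm \<Rightarrow> ('m, real^'n) tvec) \<Rightarrow> 'm \<Rightarrow> real^'n \<Rightarrow> ('m, real^'n) tvec" where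
  "frame_comb J e q y = (q, \<lambda>c. \<Sum>j\<in>J. y $ j *\<^sub>R snd (e j q) c)"

text \<open>
  A locally Lipschitz base \<open>e\<close> of the normal spaces over an open subset \<open>V\<close> of \<open>\<phi> S\<close>, where
  sections are regarded as maps into the tangent bundle.
\<close>

definition normal_frame ::
  "'m topology \<Rightarrow> ('m, real^'n) chart set \<Rightarrow> ('m, real^'n) metric_field \<Rightarrow>
   's topology \<Rightarrow> ('s, real^'k) chart set \<Rightarrow> ('s \<Rightarrow> 'm) \<Rightarrow> 'n set \<Rightarrow>
   'm set \<Rightarrow> ('n \<Rightarrow> 'm \<Rightarrow> ('m, real^'n) tvec) \<Rightarrow> bool"
where
  "normal_frame M A g S B \<phi> J V e \<longleftrightarrow>
     openin (subtopology M (\<phi> ` topspace S)) V \<and>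
     (\<forall>j\<in>J. (\<forall>q\<in>V. e j q \<in> normal_bundle A g S B \<phi> \<and> fst (e j q) = q) \<and>
        locally_lipschitz_map (image_charts S B \<phi>) V (tangent_charts A) (e j)) \<and>
     (\<forall>v\<in>normal_bundle A g S B \<phi>. fst v \<in> V \<longrightarrow>
        (\<exists>!y. y \<in> coord_space J \<and> v = frame_comb J e (fst v) y))"

definition normal_trivs ::
  "'m topology \<Rightarrow> ('m, real^'n) chart set \<Rightarrow> ('m, real^'n) metric_field \<Rightarrow>
   's topology \<Rightarrow> ('s, real^'k) chart set \<Rightarrow> ('s \<Rightarrow> 'm) \<Rightarrow> 'n set \<Rightarrow>
   ('m set \<times> (('m, real^'n) tvec \<Rightarrow> real^'n)) set"
where
  "normal_trivs M A g S B \<phi> J =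
     {(V, \<lambda>v. THE y. y \<in> coord_space J \<and> v = frame_comb J e (fst v) y) | V e.
        normal_frame M A g S B \<phi> J V e}"

text \<open>The coordinates \<open>(s, y)\<close> of the normal bundle given by \<open>v = y\<^sup>j e\<^sub>j(s)\<close>.\<close>

definition normal_charts ::
  "'m topology \<Rightarrow> ('m, real^'n) chart set \<Rightarrow> ('m, real^'n) metric_field \<Rightarrow>
   's topology \<Rightarrow> ('s, real^'k) chart set \<Rightarrow> ('s \<Rightarrow> 'm) \<Rightarrow> 'n set \<Rightarrow>
   (('m, real^'n) tvec, (real^'k) \<times> (real^'n)) chart set"
where
  "normal_charts M A g S B \<phi> J =
     {({v \<in> normal_bundle A g S B \<phi>. fst v \<in> V \<inter> fst \<kappa>}, \<lambda>v. (snd \<kappa> (fst v), \<psi> v)) | \<kappa> V \<psi>.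
        \<kappa> \<in> image_charts S B \<phi> \<and> (V, \<psi>) \<in> normal_trivs M A g S B \<phi> J}"

definition normal_topology ::
  "('m, real^'n) chart set \<Rightarrow> ('m, real^'n) metric_field \<Rightarrow>
   's topology \<Rightarrow> ('s, real^'k) chart set \<Rightarrow> ('s \<Rightarrow> 'm) \<Rightarrow> ('m, real^'n) tvec topology"
where
  "normal_topology A g S B \<phi> = subtopology (tangent_topology A) (normal_bundle A g S B \<phi>)"

end

theory Submission
  imports Defs
begin

text \<open>
  The statement is a tubular neighbourhood theorem. The exponential map is only Lipschitz in
  general, so the \<open>C\<^sup>1\<close> inverse function theorem does not apply to it. On the zero section,
  however, it is strongly differentiable, and an injective strong differential already gives a
  bi-Lipschitz map near the point.

  The acceleration \<open>- Q x u\<close> of a geodesic is quadratic in the velocity \<open>u\<close>. Writing \<open>u = \<delta> w\<close>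
  turns the geodesic equation into a first order system with right-hand side \<open>\<delta> (w, - Q x w)\<close>,
  whose Lipschitz constant on bounded \<open>w\<close> is of order \<open>\<delta>\<close>. Picard iteration gives solutions beyond
  time 1, and comparing two of them shows that the end point minus \<open>x + v\<close> is \<open>\<epsilon>\<close>-Lipschitz in the
  initial data \<open>(x, v)\<close> close to \<open>(p, 0)\<close> (\<open>local_geodesics\<close>). As the geodesic equation does not
  depend on the chart and has unique solutions, this says that the exponential map of \<open>M\<close> is
  strongly differentiable at zero vectors with differential \<open>(\<xi>, \<eta>) \<mapsto> \<xi> + \<eta>\<close>
  (\<open>exp_map_strongly_differentiable_at_zero_vector\<close>).

  In coordinates the normal space at \<open>\<phi> s\<close> is the kernel of a linear map into \<open>\<real>\<^sup>k\<close> that depends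
  on \<open>s\<close> in a Lipschitz way, as the metric and the differential of \<open>\<phi>\<close> do. Nondegeneracy of the
  induced metric says that this kernel meets the tangent space of \<open>\<phi> S\<close> only in zero. Completing
  the linear map by constant rows gives an invertible Lipschitz family, and solving linear
  equations with it gives a local Lipschitz frame (\<open>normal_frame_exists\<close>). The coordinates
  \<open>(s, y)\<close> belonging to such a frame are Lipschitz equivalent to those of \<open>TM\<close>
  (\<open>normal_lip_atlas\<close>), which yields the bundle structure (\<open>normal_bundle_lipschitz\<close>).

  In the coordinates \<open>(s, y)\<close> the strong differential of the normal exponential map at the zero
  section sends \<open>(\<sigma>, y)\<close> to the tangent vector \<open>d\<phi> \<sigma>\<close> plus the normal vector \<open>y\<^sup>j e\<^sub>j\<close>
  (\<open>exp_has_strong_differential\<close>). It is injective, so the map is bi-Lipschitz near each zero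
  vector, and open there by invariance of domain, the dimensions being equal
  (\<open>exp_local_lipeomorphism\<close>).

  It remains to find one neighbourhood for all points. The exponential map inverts the zero
  section over \<open>\<phi> S\<close>, so it embeds the zero section in \<open>M\<close>. A continuous map into a Hausdorff
  space that is injective near each point of a set \<open>Z\<close> and embeds \<open>Z\<close> is injective on a
  neighbourhood of \<open>Z\<close>, provided that \<open>Z\<close> is a countable union of compact sets and its points have
  arbitrarily small compact neighbourhoods (\<open>injective_near_sigma_compact\<close>). Countability holds
  because \<open>M\<close>, being connected and paracompact, is covered by countably many charts
  (\<open>image_sigma_compact\<close>). Together with the local estimates this gives the Lipeomorphism
  (\<open>exp_lipeomorphism\<close>).
\<close>

section \<open>Calculus of the classes \<open>C\<^sup>0\<^sup>,\<^sup>1\<close> and \<open>C\<^sup>1\<^sup>,\<^sup>1\<close>\<close>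

lemma Ck1_0_D:
  assumes "Ck1 0 U f" "open U" "x \<in> U"
  obtains r L where "r > 0" "ball x r \<subseteq> U" "L \<ge> 0"
    "\<And>y z. y \<in> ball x r \<Longrightarrow> z \<in> ball x r \<Longrightarrow> norm (f y - f z) \<le> L * norm (y - z)"
proof -
  obtain r L where r: "r > 0" "L-lipschitz_on (ball x r \<inter> U) f"
    using assms by auto
  obtain r' where r': "r' > 0" "ball x r' \<subseteq> U"
    using assms openE by blast
  show ?thesis
  proof (rule that[of "min r r'" L])
    show "norm (f y - f z) \<le> L * norm (y - z)"
      if "y \<in> ball x (min r r')" "z \<in> ball x (min r r')" for y z
      using lipschitz_onD[OF r(2), of y z] that r' by (auto simp: dist_norm subset_iff)
  qed (use r r' lipschitz_on_nonneg[OF r(2)] in auto)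
qed

text \<open>
  A common ball and constant are what sums over components require: the indices will be those of
  Christoffel symbols and of matrix entries.
\<close>

lemma Ck1_0_uniform:
  fixes f :: "'i::finite \<Rightarrow> 'a::euclidean_space \<Rightarrow> 'b::real_normed_vector"
  assumes f: "\<And>i. Ck1 0 U (f i)" and U: "open U" "x \<in> U"
  obtains r L where "r > 0" "ball x r \<subseteq> U" "L \<ge> 0"
    "\<forall>i. \<forall>y\<in>ball x r. \<forall>z\<in>ball x r. norm (f i y - f i z) \<le> L * norm (y - z)"
proof -
  have "\<exists>r L. r > 0 \<and> ball x r \<subseteq> U \<and> L \<ge> 0 \<and>
      (\<forall>y\<in>ball x r. \<forall>z\<in>ball x r. norm (f i y - f i z) \<le> L * norm (y - z))" for i
    using Ck1_0_D[OF f U, of i] by metis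
  then obtain r L where rL: "\<And>i. r i > 0 \<and> ball x (r i) \<subseteq> U \<and> L i \<ge> 0 \<and>
      (\<forall>y\<in>ball x (r i). \<forall>z\<in>ball x (r i). norm (f i y - f i z) \<le> L i * norm (y - z))"
    by metis
  define R where "R = Min (range r)"
  have R: "R > 0" "R \<le> r i" for i using rL by (auto simp: R_def)
  define K where "K = Max (range L)"
  have K: "L i \<le> K" for i by (simp add: K_def)
  show ?thesis
  proof (rule that[of R K])
    show "ball x R \<subseteq> U" using rL R(2) by (meson subset_ball subset_trans)
    show "K \<ge> 0" using K rL order_trans by blast
    show "\<forall>i. \<forall>y\<in>ball x R. \<forall>z\<in>ball x R. norm (f i y - f i z) \<le> K * norm (y - z)"
    proof (intro allI ballI)
      fix i y z assume "y \<in> ball x R" "z \<in> ball x R"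
      then have "y \<in> ball x (r i)" "z \<in> ball x (r i)" using R(2)[of i] by auto
      then have "norm (f i y - f i z) \<le> L i * norm (y - z)" using rL by blast
      also have "\<dots> \<le> K * norm (y - z)" by (intro mult_right_mono K) auto
      finally show "norm (f i y - f i z) \<le> K * norm (y - z)" .
    qed
  qed (rule R)
qed

lemma Ck1_0_I:
  assumes "\<And>x. x \<in> U \<Longrightarrow> \<exists>r>0. \<exists>L\<ge>0. \<forall>y\<in>ball x r \<inter> U. \<forall>z\<in>ball x r \<inter> U. norm (f y - f z) \<le> L * norm (y - z)"
  shows "Ck1 0 U f"
  using assms by (fastforce simp: lipschitz_on_def dist_norm)

lemma Ck1_0_mult:
  fixes f g :: "'a::euclidean_space \<Rightarrow> real"
  assumes f: "Ck1 0 U f" and g: "Ck1 0 U g" and U: "open U"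
  shows "Ck1 0 U (\<lambda>x. f x * g x)"
proof (rule Ck1_0_I)
  fix x assume x: "x \<in> U"
  obtain r K where r: "r > 0" "K \<ge> 0" "\<And>y z. y \<in> ball x r \<Longrightarrow> z \<in> ball x r \<Longrightarrow> norm (f y - f z) \<le> K * norm (y - z)"
    using Ck1_0_D[OF f U x] by metis
  obtain s L where s: "s > 0" "L \<ge> 0" "\<And>y z. y \<in> ball x s \<Longrightarrow> z \<in> ball x s \<Longrightarrow> norm (g y - g z) \<le> L * norm (y - z)"
    using Ck1_0_D[OF g U x] by metis
  \<comment> \<open>Radius at most 1 turns the Lipschitz constants into bounds of the factors.\<close>
  define t where "t = min 1 (min r s)"
  have t: "t > 0" "t \<le> 1" "t \<le> r" "t \<le> s" using r s by (auto simp: t_def)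
  define F where "F = \<bar>f x\<bar> + K"
  define G where "G = \<bar>g x\<bar> + L"
  have bd: "\<bar>f y\<bar> \<le> F" "\<bar>g y\<bar> \<le> G" if y: "y \<in> ball x t" for y
  proof -
    have "norm (y - x) \<le> 1" using y t by (auto simp: dist_norm norm_minus_commute)
    then have "K * norm (y - x) \<le> K * 1" "L * norm (y - x) \<le> L * 1" using r s by (intro mult_left_mono; simp)+
    moreover have "norm (f y - f x) \<le> K * norm (y - x)" "norm (g y - g x) \<le> L * norm (y - x)"
      using r(1) s(1) y t by (intro r(3) s(3); auto)+
    ultimately show "\<bar>f y\<bar> \<le> F" "\<bar>g y\<bar> \<le> G" by (auto simp: F_def G_def)
  qed
  show "\<exists>r>0. \<exists>L\<ge>0. \<forall>y\<in>ball x r \<inter> U. \<forall>z\<in>ball x r \<inter> U. norm (f y * g y - f z * g z) \<le> L * norm (y - z)"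
  proof (rule exI[of _ t], rule conjI[OF t(1)], rule exI[of _ "F * L + G * K"], rule conjI; (intro ballI)?)
    show "0 \<le> F * L + G * K" using r s by (auto simp: F_def G_def)
    fix y z assume "y \<in> ball x t \<inter> U" "z \<in> ball x t \<inter> U"
    then have y: "y \<in> ball x t" "y \<in> ball x r" "y \<in> ball x s" and z: "z \<in> ball x t" "z \<in> ball x r" "z \<in> ball x s"
      using t by auto
    have "f y * g y - f z * g z = f y * (g y - g z) + g z * (f y - f z)" by (simp add: algebra_simps)
    then have "norm (f y * g y - f z * g z) \<le> \<bar>f y\<bar> * norm (g y - g z) + \<bar>g z\<bar> * norm (f y - f z)"
      by (metis norm_mult norm_triangle_ineq real_norm_def)
    also have "\<dots> \<le> F * (L * norm (y - z)) + G * (K * norm (y - z))"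
      using bd[OF y(1)] bd[OF z(1)] by (intro add_mono mult_mono bd y z r(3) s(3)) auto
    finally show "norm (f y * g y - f z * g z) \<le> (F * L + G * K) * norm (y - z)" by (simp add: algebra_simps)
  qed
qed

lemma Ck1_0_sum:
  fixes f :: "'i::finite \<Rightarrow> 'a::euclidean_space \<Rightarrow> real"
  assumes f: "\<And>i. Ck1 0 U (f i)" and U: "open U"
  shows "Ck1 0 U (\<lambda>x. \<Sum>i\<in>UNIV. f i x)"
proof (rule Ck1_0_I)
  fix x assume x: "x \<in> U"
  obtain r L where r: "r > 0" "L \<ge> 0"
    and rL: "\<forall>i. \<forall>y\<in>ball x r. \<forall>z\<in>ball x r. norm (f i y - f i z) \<le> L * norm (y - z)"
    using Ck1_0_uniform[where f = f, OF f U x] by metis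
  show "\<exists>r>0. \<exists>L\<ge>0. \<forall>y\<in>ball x r \<inter> U. \<forall>z\<in>ball x r \<inter> U. norm ((\<Sum>i\<in>UNIV. f i y) - (\<Sum>i\<in>UNIV. f i z)) \<le> L * norm (y - z)"
  proof (rule exI[of _ r], rule conjI[OF r(1)], rule exI[of _ "of_nat CARD('i) * L"], rule conjI; (intro ballI)?)
    fix y z assume "y \<in> ball x r \<inter> U" "z \<in> ball x r \<inter> U"
    then have "norm (\<Sum>i\<in>UNIV. f i y - f i z) \<le> (\<Sum>i\<in>(UNIV::'i set). L * norm (y - z))"
      using rL by (intro sum_norm_le) auto
    then show "norm ((\<Sum>i\<in>UNIV. f i y) - (\<Sum>i\<in>UNIV. f i z)) \<le> of_nat CARD('i) * L * norm (y - z)"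
      by (simp add: sum_subtractf)
  qed (use r in auto)
qed

lemma Ck1_0_compose:
  assumes h: "Ck1 0 V h" "open V" and f: "Ck1 0 U f" "open U" and fU: "f ` U \<subseteq> V"
  shows "Ck1 0 U (\<lambda>x. h (f x))"
proof (rule Ck1_0_I)
  fix x assume x: "x \<in> U"
  obtain r K where r: "r > 0" "K \<ge> 0" "\<And>y z. y \<in> ball x r \<Longrightarrow> z \<in> ball x r \<Longrightarrow> norm (f y - f z) \<le> K * norm (y - z)"
    using Ck1_0_D[OF f x] by metis
  have "f x \<in> V" using x fU by blast
  then obtain s L where s: "s > 0" "L \<ge> 0" "\<And>y z. y \<in> ball (f x) s \<Longrightarrow> z \<in> ball (f x) s \<Longrightarrow> norm (h y - h z) \<le> L * norm (y - z)"
    using Ck1_0_D[OF h] by metis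
  define t where "t = min r (s / (K + 1))"
  have t: "t > 0" "t \<le> r" "K * t < s"
  proof -
    have "K * t \<le> K * (s / (K + 1))" using r(2) by (intro mult_left_mono) (auto simp: t_def)
    also have "\<dots> < s" using r(2) s(1) by (simp add: field_simps)
    finally show "K * t < s" .
  qed (use r s in \<open>auto simp: t_def\<close>)
  have near: "f y \<in> ball (f x) s" if "y \<in> ball x t" for y
  proof -
    have "norm (f y - f x) \<le> K * norm (y - x)" using that t r by (intro r(3)) auto
    also have "\<dots> \<le> K * t" using that r(2) by (intro mult_left_mono) (auto simp: dist_norm norm_minus_commute)
    finally show ?thesis using t(3) by (simp add: dist_norm norm_minus_commute)
  qed
  show "\<exists>r>0. \<exists>L\<ge>0. \<forall>y\<in>ball x r \<inter> U. \<forall>z\<in>ball x r \<inter> U. norm (h (f y) - h (f z)) \<le> L * norm (y - z)"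
  proof (rule exI[of _ t], rule conjI[OF t(1)], rule exI[of _ "L * K"], rule conjI; (intro ballI)?)
    fix y z assume "y \<in> ball x t \<inter> U" "z \<in> ball x t \<inter> U"
    then have y: "y \<in> ball x t" "y \<in> ball x r" and z: "z \<in> ball x t" "z \<in> ball x r" using t by auto
    have "norm (h (f y) - h (f z)) \<le> L * norm (f y - f z)" by (intro s(3) near y z)
    also have "\<dots> \<le> L * (K * norm (y - z))" using s(2) by (intro mult_left_mono r(3) y z)
    finally show "norm (h (f y) - h (f z)) \<le> L * K * norm (y - z)" by simp
  qed (use t r s in auto)
qed

lemma Ck1_0_component: "Ck1 0 U f \<Longrightarrow> open U \<Longrightarrow> Ck1 0 U (\<lambda>x. f x $ i)" for f :: "'a::euclidean_space \<Rightarrow> real^'n"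
proof (rule Ck1_0_I)
  fix x assume f: "Ck1 0 U f" "open U" and x: "x \<in> U"
  obtain r K where r: "r > 0" "K \<ge> 0" "\<And>y z. y \<in> ball x r \<Longrightarrow> z \<in> ball x r \<Longrightarrow> norm (f y - f z) \<le> K * norm (y - z)"
    using Ck1_0_D[OF f x] by metis
  have "norm (f y $ i - f z $ i) \<le> norm (f y - f z)" for y z
    using component_le_norm_cart[of "f y - f z" i] by simp
  then show "\<exists>r>0. \<exists>L\<ge>0. \<forall>y\<in>ball x r \<inter> U. \<forall>z\<in>ball x r \<inter> U. norm (f y $ i - f z $ i) \<le> L * norm (y - z)"
    using r by (meson IntD1 order_trans)
qed

lemma linear_Basis_expansion:
  fixes T :: "'a::euclidean_space \<Rightarrow> 'b::real_vector"
  assumes "linear T"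
  shows "T v = (\<Sum>b\<in>Basis. (v \<bullet> b) *\<^sub>R T b)"
proof -
  have "T v = T (\<Sum>b\<in>Basis. (v \<bullet> b) *\<^sub>R b)" by (simp add: euclidean_representation)
  also have "\<dots> = (\<Sum>b\<in>Basis. (v \<bullet> b) *\<^sub>R T b)"
    by (simp add: linear_sum[OF assms] linear_cmul[OF assms])
  finally show ?thesis .
qed

lemma linear_cart_expansion:
  assumes "linear (f :: real^'n::finite \<Rightarrow> 'b::real_vector)"
  shows "f u = (\<Sum>\<alpha>\<in>UNIV. u $ \<alpha> *\<^sub>R f (axis \<alpha> 1))"
proof -
  have "f u = f (\<Sum>\<alpha>\<in>UNIV. u $ \<alpha> *\<^sub>R axis \<alpha> 1)"
    using basis_expansion[of u] by (simp add: scalar_mult_eq_scaleR)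
  also have "\<dots> = (\<Sum>\<alpha>\<in>UNIV. u $ \<alpha> *\<^sub>R f (axis \<alpha> 1))"
    by (simp add: linear_sum[OF assms] linear_cmul[OF assms])
  finally show ?thesis .
qed

lemma norm_linear_le_sum_Basis:
  fixes T :: "'a::euclidean_space \<Rightarrow> 'b::real_normed_vector"
  assumes "linear T"
  shows "norm (T v) \<le> (\<Sum>b\<in>Basis. norm (T b)) * norm v"
proof -
  have "T v = (\<Sum>b\<in>Basis. (v \<bullet> b) *\<^sub>R T b)" by (rule linear_Basis_expansion[OF assms])
  also have "norm \<dots> \<le> (\<Sum>b\<in>Basis. norm v * norm (T b))"
    by (rule sum_norm_le) (auto intro!: mult_right_mono simp: Basis_le_norm)
  finally show ?thesis by (simp add: sum_distrib_left mult.commute)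
qed

text \<open>
  The class \<open>C\<^sup>1\<^sup>,\<^sup>1\<close> controls each directional derivative separately. By linearity the finitely
  many basis directions control all others, so the constant is uniform over directions of unit
  length.
\<close>

lemma Ck1_1_derivative_lipschitz:
  fixes f :: "'a::euclidean_space \<Rightarrow> 'b::real_normed_vector"
  assumes f: "Ck1 1 U f" and U: "open U" "x \<in> U"
  obtains r L where "r > 0" "ball x r \<subseteq> U" "L \<ge> 0"
    "\<And>y. y \<in> ball x r \<Longrightarrow> (f has_derivative frechet_derivative f (at y)) (at y)"
    "\<And>y z v. y \<in> ball x r \<Longrightarrow> z \<in> ball x r \<Longrightarrow>
       norm (frechet_derivative f (at y) v - frechet_derivative f (at z) v) \<le> L * norm (y - z) * norm v"
proof -
  let ?D = "\<lambda>y. frechet_derivative f (at y)"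
  have diff: "(f has_derivative ?D y) (at y)" if "y \<in> U" for y
    using f that frechet_derivative_works by (auto simp: One_nat_def simp del: Ck1.simps(1))
  have "\<forall>b. \<exists>r L. r > 0 \<and> ball x r \<subseteq> U \<and> L \<ge> 0 \<and>
      (\<forall>y\<in>ball x r. \<forall>z\<in>ball x r. norm (?D y b - ?D z b) \<le> L * norm (y - z))"
  proof
    fix b
    have "Ck1 0 U (\<lambda>x. ?D x b)" using f by (simp add: One_nat_def del: Ck1.simps(1))
    from Ck1_0_D[OF this U] show "\<exists>r L. r > 0 \<and> ball x r \<subseteq> U \<and> L \<ge> 0 \<and>
      (\<forall>y\<in>ball x r. \<forall>z\<in>ball x r. norm (?D y b - ?D z b) \<le> L * norm (y - z))" by metis
  qed
  then obtain r L where rL: "\<And>b. r b > 0 \<and> ball x (r b) \<subseteq> U \<and> L b \<ge> 0 \<and>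
      (\<forall>y\<in>ball x (r b). \<forall>z\<in>ball x (r b). norm (?D y b - ?D z b) \<le> L b * norm (y - z))"
    by metis
  define R where "R = Min (r ` Basis)"
  have Rr: "R \<le> r b" if "b \<in> Basis" for b using that by (simp add: R_def)
  have R: "R > 0" using rL by (simp add: R_def)
  have RU: "ball x R \<subseteq> U" using rL Rr[OF SOME_Basis]
    by (meson subset_ball subset_trans)
  show ?thesis
  proof (rule that[of R "\<Sum>b\<in>Basis. L b"])
    fix y z v assume yz: "y \<in> ball x R" "z \<in> ball x R"
    then have yzU: "y \<in> U" "z \<in> U" using RU by auto
    have lin: "linear (\<lambda>v. ?D y v - ?D z v)"
      using yzU by (intro linear_compose_sub) (use diff has_derivative_linear in blast)+
    have "norm (?D y v - ?D z v) \<le> (\<Sum>b\<in>Basis. norm (?D y b - ?D z b)) * norm v"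
      by (rule norm_linear_le_sum_Basis[OF lin])
    also have "\<dots> \<le> (\<Sum>b\<in>Basis. L b * norm (y - z)) * norm v"
    proof (intro mult_right_mono sum_mono)
      fix b :: 'a assume "b \<in> Basis"
      then have "y \<in> ball x (r b)" "z \<in> ball x (r b)" using yz Rr[of b] by auto
      then show "norm (?D y b - ?D z b) \<le> L b * norm (y - z)" using rL by blast
    qed simp
    finally show "norm (?D y v - ?D z v) \<le> (\<Sum>b\<in>Basis. L b) * norm (y - z) * norm v"
      by (simp add: sum_distrib_right)
  qed (use R RU diff rL in \<open>auto intro: sum_nonneg\<close>)
qed

text \<open>
  The mean value inequality for \<open>f\<close> minus its differential at \<open>x\<close>: the derivative of this
  difference at \<open>w\<close> is of size \<open>L |w - x|\<close>, hence at most \<open>\<epsilon>\<close> on a small ball.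
\<close>

lemma Ck1_1_strong_differential:
  fixes f :: "'a::euclidean_space \<Rightarrow> 'b::real_normed_vector"
  assumes f: "Ck1 1 U f" and U: "open U" "x \<in> U" and "\<epsilon> > 0"
  obtains r where "r > 0" "ball x r \<subseteq> U"
    "\<forall>y\<in>ball x r. \<forall>z\<in>ball x r. norm (f y - f z - frechet_derivative f (at x) (y - z)) \<le> \<epsilon> * norm (y - z)"
proof -
  let ?D = "\<lambda>y. frechet_derivative f (at y)"
  obtain r L where r: "r > 0" "ball x r \<subseteq> U" "L \<ge> 0"
    and d: "\<And>y. y \<in> ball x r \<Longrightarrow> (f has_derivative ?D y) (at y)"
    and l: "\<And>y z v. y \<in> ball x r \<Longrightarrow> z \<in> ball x r \<Longrightarrow>
       norm (?D y v - ?D z v) \<le> L * norm (y - z) * norm v"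
    using Ck1_1_derivative_lipschitz[OF f U] by metis
  define r' where "r' = min r (\<epsilon> / (L + 1))"
  have r': "r' > 0" "r' \<le> r" "L * r' \<le> \<epsilon>"
  proof -
    have "L * r' \<le> L * (\<epsilon> / (L + 1))" using r(3) by (intro mult_left_mono) (auto simp: r'_def)
    also have "\<dots> \<le> \<epsilon>" using r(3) assms(4) by (simp add: field_simps)
    finally show "L * r' \<le> \<epsilon>" .
  qed (use r assms(4) in \<open>auto simp: r'_def\<close>)
  have lin: "bounded_linear (?D x)" using d r(1) has_derivative_bounded_linear by force
  show ?thesis
  proof (rule that[of r']; (intro ballI)?)
    fix y z assume yz: "y \<in> ball x r'" "z \<in> ball x r'"
    have "norm ((f y - ?D x y) - (f z - ?D x z)) \<le> \<epsilon> * norm (y - z)"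
    proof (rule differentiable_bound[of "ball x r'" "\<lambda>w. f w - ?D x w" "\<lambda>w v. ?D w v - ?D x v"])
      fix w assume w: "w \<in> ball x r'"
      then have w': "w \<in> ball x r" using r' by auto
      show "((\<lambda>w. f w - ?D x w) has_derivative (\<lambda>v. ?D w v - ?D x v)) (at w within ball x r')"
        using d[OF w'] lin
        by (intro has_derivative_diff bounded_linear_imp_has_derivative) (auto intro: has_derivative_at_withinI)
      show "onorm (\<lambda>v. ?D w v - ?D x v) \<le> \<epsilon>"
      proof (rule onorm_le)
        fix v
        have "norm (?D w v - ?D x v) \<le> L * norm (w - x) * norm v" using l[OF w'] r(1) by auto
        also have "\<dots> \<le> \<epsilon> * norm v"
        proof (rule mult_right_mono)
          have "L * norm (w - x) \<le> L * r'" using w r(3)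
            by (intro mult_left_mono) (auto simp: dist_norm norm_minus_commute)
          then show "L * norm (w - x) \<le> \<epsilon>" using r'(3) by linarith
        qed simp
        finally show "norm (?D w v - ?D x v) \<le> \<epsilon> * norm v" .
      qed
    qed (use yz in auto)
    then show "norm (f y - f z - ?D x (y - z)) \<le> \<epsilon> * norm (y - z)"
      using lin by (simp add: linear_diff bounded_linear.linear algebra_simps)
  qed (use r r' in auto)
qed

lemma Ck1_1_imp_Ck1_0:
  fixes f :: "'a::euclidean_space \<Rightarrow> 'b::real_normed_vector"
  assumes f: "Ck1 1 U f" and U: "open U"
  shows "Ck1 0 U f"
proof -
  have "\<exists>r>0. \<exists>L. L-lipschitz_on (ball x r \<inter> U) f" if x: "x \<in> U" for x
  proof -
    let ?D = "frechet_derivative f (at x)"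
    obtain r where r: "r > 0" "ball x r \<subseteq> U"
      "\<forall>y\<in>ball x r. \<forall>z\<in>ball x r. norm (f y - f z - ?D (y - z)) \<le> 1 * norm (y - z)"
      by (rule Ck1_1_strong_differential[OF f U x zero_less_one])
    have bl: "bounded_linear ?D"
      using f x frechet_derivative_works has_derivative_bounded_linear
      by (force simp: One_nat_def simp del: Ck1.simps(1))
    have "(onorm ?D + 1)-lipschitz_on (ball x r \<inter> U) f"
    proof (rule lipschitz_onI)
      fix y z assume "y \<in> ball x r \<inter> U" "z \<in> ball x r \<inter> U"
      then have "norm (f y - f z - ?D (y - z)) \<le> norm (y - z)" using r(3) by auto
      then have "norm (f y - f z) \<le> norm (?D (y - z)) + norm (y - z)"
        by (metis add.commute add_left_mono diff_add_cancel norm_triangle_le)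
      also have "norm (?D (y - z)) \<le> onorm ?D * norm (y - z)" by (rule onorm[OF bl])
      finally show "dist (f y) (f z) \<le> (onorm ?D + 1) * dist y z"
        by (simp add: dist_norm algebra_simps)
    qed (simp add: onorm_pos_le[OF bl])
    then show ?thesis using r(1) by blast
  qed
  then show ?thesis by simp
qed

lemma Ck1_antimono:
  fixes f :: "'a::euclidean_space \<Rightarrow> 'b::real_normed_vector"
  assumes U: "open U"
  shows "Ck1 (Suc k) U f \<Longrightarrow> Ck1 k U f"
proof (induction k arbitrary: f)
  case 0 then show ?case using Ck1_1_imp_Ck1_0[OF _ U] by (simp add: One_nat_def del: Ck1.simps)
next
  case (Suc k)
  show ?case
  proof (subst Ck1.simps(2), intro conjI allI)
    show "\<forall>x\<in>U. f differentiable (at x)" using Suc.prems by (subst (asm) Ck1.simps(2)) blast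
    fix v
    have "Ck1 (Suc k) U (\<lambda>x. frechet_derivative f (at x) v)"
      using Suc.prems by (subst (asm) Ck1.simps(2)) blast
    then show "Ck1 k U (\<lambda>x. frechet_derivative f (at x) v)" by (rule Suc.IH)
  qed
qed

section \<open>Local Lipschitz continuity in charts\<close>

definition chart_ball :: "'p set \<Rightarrow> ('p, 'e::metric_space) chart \<Rightarrow> 'p \<Rightarrow> real \<Rightarrow> 'p set" where
  "chart_ball N a p r = {x \<in> N \<inter> fst a. dist (snd a x) (snd a p) < r}"

lemma chart_ball_mono: "N' \<subseteq> N \<Longrightarrow> r' \<le> r \<Longrightarrow> chart_ball N' a p r' \<subseteq> chart_ball N a p r"
  by (auto simp: chart_ball_def)

lemma chart_ball_center: "p \<in> N \<Longrightarrow> p \<in> fst a \<Longrightarrow> r > 0 \<Longrightarrow> p \<in> chart_ball N a p r"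
  by (simp add: chart_ball_def)

lemma chart_ball_subset: "chart_ball N a p r \<subseteq> N"
  by (auto simp: chart_ball_def)

text \<open>
  The condition of \<open>locally_lipschitz_map\<close> at one point and for one pair of charts. It is stated
  for points rather than coordinates, so that maps compose without inverting charts.
\<close>

definition lip_at ::
  "('p, 'e::metric_space) chart \<Rightarrow> ('q, 'f::metric_space) chart \<Rightarrow> 'p set \<Rightarrow> ('p \<Rightarrow> 'q) \<Rightarrow> 'p \<Rightarrow> bool" where
  "lip_at a b N f p \<longleftrightarrow> (\<exists>r>0. \<exists>L\<ge>0. f ` chart_ball N a p r \<subseteq> fst b \<and>
     (\<forall>x\<in>chart_ball N a p r. \<forall>y\<in>chart_ball N a p r.
        dist (snd b (f x)) (snd b (f y)) \<le> L * dist (snd a x) (snd a y)))"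

lemma lip_atI:
  assumes "r > 0" "L \<ge> 0"
    "\<And>x. x \<in> chart_ball N a p r \<Longrightarrow> f x \<in> fst b"
    "\<And>x y. x \<in> chart_ball N a p r \<Longrightarrow> y \<in> chart_ball N a p r \<Longrightarrow>
        dist (snd b (f x)) (snd b (f y)) \<le> L * dist (snd a x) (snd a y)"
  shows "lip_at a b N f p"
  unfolding lip_at_def using assms(1,2)
  by (intro exI[of _ r] conjI exI[of _ L] image_subsetI ballI assms(3,4)) auto

lemma lip_atE:
  assumes "lip_at a b N f p"
  obtains r L where "r > 0" "L \<ge> 0" "f ` chart_ball N a p r \<subseteq> fst b"
    "\<forall>x\<in>chart_ball N a p r. \<forall>y\<in>chart_ball N a p r.
        dist (snd b (f x)) (snd b (f y)) \<le> L * dist (snd a x) (snd a y)"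
  using assms unfolding lip_at_def by blast

lemma lip_at_local:
  assumes "lip_at a b N' f p" "r0 > 0" "chart_ball N a p r0 \<subseteq> N'"
    "\<And>x. x \<in> chart_ball N a p r0 \<Longrightarrow> f x = g x"
  shows "lip_at a b N g p"
proof -
  obtain r L where *: "r > 0" "L \<ge> 0" "f ` chart_ball N' a p r \<subseteq> fst b"
    "\<forall>x\<in>chart_ball N' a p r. \<forall>y\<in>chart_ball N' a p r.
        dist (snd b (f x)) (snd b (f y)) \<le> L * dist (snd a x) (snd a y)"
    using lip_atE[OF assms(1)] by blast
  have sub: "x \<in> chart_ball N' a p r \<and> f x = g x" if "x \<in> chart_ball N a p (min r r0)" for x
    using that assms(3) assms(4)[of x] by (auto simp: chart_ball_def)
  show ?thesis
  proof (rule lip_atI[of "min r r0" L])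
    fix x y assume "x \<in> chart_ball N a p (min r r0)" "y \<in> chart_ball N a p (min r r0)"
    then show "dist (snd b (g x)) (snd b (g y)) \<le> L * dist (snd a x) (snd a y)"
      using *(4) sub[of x] sub[of y] by metis
  next
    fix x assume "x \<in> chart_ball N a p (min r r0)"
    then show "g x \<in> fst b" using *(3) sub[of x] by auto
  qed (use * assms(2) in auto)
qed

lemma lip_at_mono: "lip_at a b N f p \<Longrightarrow> N' \<subseteq> N \<Longrightarrow> lip_at a b N' f p"
  by (rule lip_at_local[where ?r0.0 = 1]) (auto simp: chart_ball_def)

lemma lip_at_cong: "lip_at a b N f p \<Longrightarrow> (\<And>x. x \<in> N \<Longrightarrow> x \<in> fst a \<Longrightarrow> f x = g x) \<Longrightarrow> lip_at a b N g p"
  by (rule lip_at_local[where ?r0.0 = 1 and f = f and N' = N]) (auto simp: chart_ball_def)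

text \<open>
  Lipschitz dependence on the coordinates includes continuity in terms of chart balls, which is
  what composition needs.
\<close>

lemma lip_at_nbhd:
  assumes f: "lip_at a b N f p" and p: "p \<in> N" "p \<in> fst a" and r: "r > 0" and fN: "f ` (N \<inter> fst a) \<subseteq> N'"
  obtains s where "s > 0" "f ` chart_ball N a p s \<subseteq> chart_ball N' b (f p) r"
proof -
  obtain s L where *: "s > 0" "L \<ge> 0" "f ` chart_ball N a p s \<subseteq> fst b"
    "\<forall>x\<in>chart_ball N a p s. \<forall>y\<in>chart_ball N a p s.
        dist (snd b (f x)) (snd b (f y)) \<le> L * dist (snd a x) (snd a y)"
    using lip_atE[OF f] by blast
  define t where "t = min s (r / (L + 1))"
  have t: "t > 0" "t \<le> s" "L * t < r"
  proof -
    have "L * t \<le> L * (r / (L + 1))" using *(2) by (intro mult_left_mono) (auto simp: t_def)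
    also have "\<dots> < r" using *(2) r by (simp add: field_simps)
    finally show "L * t < r" .
  qed (use * r in \<open>auto simp: t_def\<close>)
  show ?thesis
  proof (rule that[OF t(1)], rule image_subsetI)
    fix x assume x: "x \<in> chart_ball N a p t"
    then have xs: "x \<in> chart_ball N a p s" using t(2) by (auto simp: chart_ball_def)
    have "dist (snd b (f x)) (snd b (f p)) \<le> L * dist (snd a x) (snd a p)"
      using *(4) xs chart_ball_center[OF p *(1)] by blast
    also have "\<dots> \<le> L * t" using x *(2) by (intro mult_left_mono) (auto simp: chart_ball_def)
    also have "\<dots> < r" by (rule t)
    finally show "f x \<in> chart_ball N' b (f p) r"
      using xs *(3) fN by (auto simp: chart_ball_def)
  qed
qed

lemma lip_at_comp:
  assumes f: "lip_at a b N f p" and g: "lip_at b c N' g (f p)"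
    and fN: "f ` (N \<inter> fst a) \<subseteq> N'" and p: "p \<in> N" "p \<in> fst a"
  shows "lip_at a c N (\<lambda>x. g (f x)) p"
proof -
  obtain r L where *: "r > 0" "L \<ge> 0" "f ` chart_ball N a p r \<subseteq> fst b"
    "\<forall>x\<in>chart_ball N a p r. \<forall>y\<in>chart_ball N a p r.
        dist (snd b (f x)) (snd b (f y)) \<le> L * dist (snd a x) (snd a y)"
    using lip_atE[OF f] by blast
  obtain r' L' where **: "r' > 0" "L' \<ge> 0" "g ` chart_ball N' b (f p) r' \<subseteq> fst c"
    "\<forall>x\<in>chart_ball N' b (f p) r'. \<forall>y\<in>chart_ball N' b (f p) r'.
        dist (snd c (g x)) (snd c (g y)) \<le> L' * dist (snd b x) (snd b y)"
    using lip_atE[OF g] by blast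
  obtain s where s: "s > 0" "f ` chart_ball N a p s \<subseteq> chart_ball N' b (f p) r'"
    using lip_at_nbhd[OF f p **(1) fN] by blast
  have near: "x \<in> chart_ball N a p r \<and> f x \<in> chart_ball N' b (f p) r'"
    if "x \<in> chart_ball N a p (min r s)" for x
  proof -
    have "x \<in> chart_ball N a p r" "x \<in> chart_ball N a p s" using that by (auto simp: chart_ball_def)
    then show ?thesis using s(2) by blast
  qed
  show ?thesis
  proof (rule lip_atI[of "min r s" "L' * L"])
    fix x y assume x: "x \<in> chart_ball N a p (min r s)" and y: "y \<in> chart_ball N a p (min r s)"
    have "dist (snd c (g (f x))) (snd c (g (f y))) \<le> L' * dist (snd b (f x)) (snd b (f y))"
      using near[OF x] near[OF y] **(4) by blast
    also have "\<dots> \<le> L' * (L * dist (snd a x) (snd a y))"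
      using *(4) near[OF x] near[OF y] **(2) by (intro mult_left_mono) blast+
    finally show "dist (snd c (g (f x))) (snd c (g (f y))) \<le> L' * L * dist (snd a x) (snd a y)"
      by simp
  next
    fix x assume "x \<in> chart_ball N a p (min r s)"
    then show "g (f x) \<in> fst c" using near **(3) by blast
  qed (use s *(1,2) **(2) in auto)
qed

lemma locally_lipschitz_map_iff_lip_at:
  assumes inj: "\<And>a. a \<in> A \<Longrightarrow> inj_on (snd a) (fst a)"
  shows "locally_lipschitz_map A N B f \<longleftrightarrow>
     (\<forall>p\<in>N. \<forall>a\<in>A. \<forall>b\<in>B. p \<in> fst a \<longrightarrow> f p \<in> fst b \<longrightarrow> lip_at a b N f p)"
proof -
  have rep: "chart_rep a b f (snd a x) = snd b (f x)" if "a \<in> A" "x \<in> fst a" "b \<in> B" for a b x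
    using inj[OF that(1)] that(2) by (simp add: chart_rep_def)
  have im: "ball (snd a p) r \<inter> snd a ` (N \<inter> fst a) = snd a ` chart_ball N a p r" if "a \<in> A" for a p r
    by (auto simp: chart_ball_def dist_commute)
  have "(\<forall>x \<in> N \<inter> fst a. snd a x \<in> ball (snd a p) r \<longrightarrow> f x \<in> fst b) \<and>
           L-lipschitz_on (ball (snd a p) r \<inter> snd a ` (N \<inter> fst a)) (chart_rep a b f)
     \<longleftrightarrow> L \<ge> 0 \<and> f ` chart_ball N a p r \<subseteq> fst b \<and>
     (\<forall>x\<in>chart_ball N a p r. \<forall>y\<in>chart_ball N a p r.
        dist (snd b (f x)) (snd b (f y)) \<le> L * dist (snd a x) (snd a y))" if a: "a \<in> A" "b \<in> B" for p a b r L
    unfolding im[OF a(1)] lipschitz_on_def ball_simps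
    by (auto simp: chart_ball_def rep[OF a(1) _ a(2)] dist_commute)
  then have "(\<exists>r>0. \<exists>L. (\<forall>x \<in> N \<inter> fst a. snd a x \<in> ball (snd a p) r \<longrightarrow> f x \<in> fst b) \<and>
           L-lipschitz_on (ball (snd a p) r \<inter> snd a ` (N \<inter> fst a)) (chart_rep a b f))
     \<longleftrightarrow> lip_at a b N f p" if "a \<in> A" "b \<in> B" for p a b
    using that by (simp only: lip_at_def)
  then show ?thesis unfolding locally_lipschitz_map_def by (simp only: cong: ball_cong)
qed

text \<open>
  The structure common to a manifold, its tangent bundle, the image of an embedding and the normal
  bundle. The coordinates are not asked to fill an open set, because those of the normal bundle
  lie in \<open>\<real>\<^sup>k \<times> coord_space J\<close>.
\<close>

definition lip_atlas :: "'p topology \<Rightarrow> ('p, 'e::metric_space) chart set \<Rightarrow> bool" where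
  "lip_atlas X \<A> \<longleftrightarrow>
     (\<forall>a\<in>\<A>. inj_on (snd a) (fst a)) \<and>
     topspace X \<subseteq> (\<Union>a\<in>\<A>. fst a) \<and>
     (\<forall>G. openin X G \<longleftrightarrow> G \<subseteq> topspace X \<and>
        (\<forall>p\<in>G. \<forall>a\<in>\<A>. p \<in> fst a \<longrightarrow> (\<exists>r>0. chart_ball (topspace X) a p r \<subseteq> G))) \<and>
     (\<forall>p\<in>topspace X. \<forall>a\<in>\<A>. \<forall>b\<in>\<A>. p \<in> fst a \<longrightarrow> p \<in> fst b \<longrightarrow> lip_at a b (topspace X) (\<lambda>x. x) p)"

lemma lip_atlas_inj: "lip_atlas X \<A> \<Longrightarrow> a \<in> \<A> \<Longrightarrow> inj_on (snd a) (fst a)"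
  by (simp add: lip_atlas_def)

lemma lip_atlas_chart: "lip_atlas X \<A> \<Longrightarrow> p \<in> topspace X \<Longrightarrow> \<exists>a\<in>\<A>. p \<in> fst a"
  by (auto simp: lip_atlas_def)

lemma lip_atlas_change:
  "lip_atlas X \<A> \<Longrightarrow> p \<in> topspace X \<Longrightarrow> a \<in> \<A> \<Longrightarrow> b \<in> \<A> \<Longrightarrow> p \<in> fst a \<Longrightarrow> p \<in> fst b \<Longrightarrow>
     lip_at a b (topspace X) (\<lambda>x. x) p"
  by (simp add: lip_atlas_def)

lemma lip_atlas_openin:
  "lip_atlas X \<A> \<Longrightarrow> openin X G \<longleftrightarrow> G \<subseteq> topspace X \<and>
        (\<forall>p\<in>G. \<forall>a\<in>\<A>. p \<in> fst a \<longrightarrow> (\<exists>r>0. chart_ball (topspace X) a p r \<subseteq> G))"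
  unfolding lip_atlas_def by blast

lemma lip_atlas_openin_ball:
  assumes "lip_atlas X \<A>" "openin X G" "p \<in> G" "a \<in> \<A>" "p \<in> fst a"
  obtains r where "r > 0" "chart_ball (topspace X) a p r \<subseteq> G"
  using assms(2-) unfolding lip_atlas_openin[OF assms(1)] by blast

text \<open>
  Chart changes map small chart balls into prescribed ones, so continuity can be tested in a
  single pair of charts around each point.
\<close>

lemma lip_at_continuous:
  assumes X: "lip_atlas X \<A>" and Y: "lip_atlas Y \<B>"
    and im: "f ` topspace X \<subseteq> topspace Y"
    and lip: "\<And>p. p \<in> topspace X \<Longrightarrow> \<exists>a\<in>\<A>. \<exists>b\<in>\<B>. p \<in> fst a \<and> f p \<in> fst b \<and> lip_at a b (topspace X) f p"
  shows "continuous_map X Y f"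
proof (unfold continuous_map_def, intro conjI allI impI)
  show "f \<in> topspace X \<rightarrow> topspace Y" using im by auto
  fix G assume G: "openin Y G"
  show "openin X {x \<in> topspace X. f x \<in> G}"
    unfolding lip_atlas_openin[OF X]
  proof (intro conjI ballI impI)
    fix p a' assume p: "p \<in> {x \<in> topspace X. f x \<in> G}" and a': "a' \<in> \<A>" "p \<in> fst a'"
    then obtain a b where ab: "a \<in> \<A>" "b \<in> \<B>" "p \<in> fst a" "f p \<in> fst b" "lip_at a b (topspace X) f p"
      using lip by blast
    have pX: "p \<in> topspace X" using p by simp
    have lip: "lip_at a' b (topspace X) f p"
      using lip_at_comp[OF lip_atlas_change[OF X pX a'(1) ab(1) a'(2) ab(3)] ab(5)] pX a' by auto
    obtain s where s: "s > 0" "chart_ball (topspace Y) b (f p) s \<subseteq> G"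
      using lip_atlas_openin_ball[OF Y G _ ab(2,4)] p by blast
    obtain r where "r > 0" "f ` chart_ball (topspace X) a' p r \<subseteq> chart_ball (topspace Y) b (f p) s"
      using lip_at_nbhd[OF lip pX a'(2) s(1), of "topspace Y"] im by blast
    then show "\<exists>r>0. chart_ball (topspace X) a' p r \<subseteq> {x \<in> topspace X. f x \<in> G}"
      using s(2) chart_ball_subset[of "topspace X"] by (intro exI[of _ r]) blast
  qed auto
qed

lemma lip_atlas_openin_chart:
  assumes X: "lip_atlas X \<A>" and a: "a \<in> \<A>" and W: "open W"
  shows "openin X {x \<in> topspace X \<inter> fst a. snd a x \<in> W}"
  unfolding lip_atlas_openin[OF X]
proof (intro conjI ballI impI)
  fix p b assume p: "p \<in> {x \<in> topspace X \<inter> fst a. snd a x \<in> W}" and b: "b \<in> \<A>" "p \<in> fst b"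
  obtain s where s: "s > 0" "ball (snd a p) s \<subseteq> W" using W p openE by blast
  have lip: "lip_at b a (topspace X) (\<lambda>x. x) p" using lip_atlas_change[OF X _ b(1) a b(2)] p by simp
  obtain r where "r > 0" "(\<lambda>x. x) ` chart_ball (topspace X) b p r \<subseteq> chart_ball (topspace X) a p s"
    using lip_at_nbhd[OF lip _ b(2) s(1), of "topspace X"] p by blast
  moreover have "chart_ball (topspace X) a p s \<subseteq> {x \<in> topspace X \<inter> fst a. snd a x \<in> W}"
    using s(2) by (auto simp: chart_ball_def dist_commute)
  ultimately show "\<exists>r>0. chart_ball (topspace X) b p r \<subseteq> {x \<in> topspace X \<inter> fst a. snd a x \<in> W}" by auto
qed auto

lemma lip_atlas_openin_chart_ball:
  assumes X: "lip_atlas X \<A>" and a: "a \<in> \<A>"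
  shows "openin X (chart_ball (topspace X) a p r)"
proof -
  have "chart_ball (topspace X) a p r = {x \<in> topspace X \<inter> fst a. snd a x \<in> ball (snd a p) r}"
    by (auto simp: chart_ball_def dist_commute)
  then show ?thesis using lip_atlas_openin_chart[OF X a open_ball] by metis
qed

text \<open>
  The charts need not be restricted: a chart ball is by definition cut down to the space under
  consideration.
\<close>

lemma lip_atlas_subtopology:
  assumes X: "lip_atlas X \<A>"
  shows "lip_atlas (subtopology X N) \<A>"
  unfolding lip_atlas_def
proof (intro conjI ballI impI allI)
  fix a assume "a \<in> \<A>" then show "inj_on (snd a) (fst a)" by (rule lip_atlas_inj[OF X])
next
  show "topspace (subtopology X N) \<subseteq> \<Union> (fst ` \<A>)" using X by (auto simp: lip_atlas_def)
next
  fix p a b assume "p \<in> topspace (subtopology X N)" "a \<in> \<A>" "b \<in> \<A>" "p \<in> fst a" "p \<in> fst b"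
  then show "lip_at a b (topspace (subtopology X N)) (\<lambda>x. x) p"
    by (intro lip_at_mono[OF lip_atlas_change[OF X]]) auto
next
  fix G
  let ?t = "topspace (subtopology X N)"
  show "openin (subtopology X N) G \<longleftrightarrow> G \<subseteq> ?t \<and>
        (\<forall>p\<in>G. \<forall>a\<in>\<A>. p \<in> fst a \<longrightarrow> (\<exists>r>0. chart_ball ?t a p r \<subseteq> G))" (is "_ \<longleftrightarrow> ?R")
  proof
    assume "openin (subtopology X N) G"
    then obtain T where T: "openin X T" "G = T \<inter> N" by (auto simp: openin_subtopology)
    show ?R
    proof (intro conjI ballI impI)
      show "G \<subseteq> ?t" using T openin_subset by fastforce
      fix p a assume p: "p \<in> G" "a \<in> \<A>" "p \<in> fst a"
      have "p \<in> T" using p T by blast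
      then obtain r where "r > 0" "chart_ball (topspace X) a p r \<subseteq> T"
        by (rule lip_atlas_openin_ball[OF X T(1) _ p(2,3)])
      then show "\<exists>r>0. chart_ball ?t a p r \<subseteq> G"
        using T(2) by (intro exI[of _ r]) (auto simp: chart_ball_def)
    qed
  next
    assume R: ?R
    have "\<exists>T. openin X T \<and> p \<in> T \<and> T \<inter> N \<subseteq> G" if p: "p \<in> G" for p
    proof -
      have pX: "p \<in> topspace X" using R p by auto
      then obtain a where a: "a \<in> \<A>" "p \<in> fst a" using lip_atlas_chart[OF X] by blast
      then obtain r where r: "r > 0" "chart_ball ?t a p r \<subseteq> G" using R p by blast
      have "chart_ball (topspace X) a p r \<inter> N = chart_ball ?t a p r"
        by (auto simp: chart_ball_def)
      then show ?thesis
        using r chart_ball_center[OF pX a(2) r(1)] lip_atlas_openin_chart_ball[OF X a(1)] by metis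
    qed
    then obtain T where T: "\<And>p. p \<in> G \<Longrightarrow> openin X (T p) \<and> p \<in> T p \<and> T p \<inter> N \<subseteq> G" by metis
    have "openin X (\<Union>p\<in>G. T p)" using T by blast
    moreover have "G = (\<Union>p\<in>G. T p) \<inter> N" using T R by auto
    ultimately show "openin (subtopology X N) G" unfolding openin_subtopology by blast
  qed
qed

text \<open>
  This replaces ambient coordinates by adapted ones, such as those of a submanifold or of its
  normal bundle, without changing the topology.
\<close>

lemma lip_atlas_transfer:
  assumes X: "lip_atlas X \<A>"
    and inj: "\<And>b. b \<in> \<B> \<Longrightarrow> inj_on (snd b) (fst b)"
    and cov: "topspace X \<subseteq> (\<Union>b\<in>\<B>. fst b)"
    and ab: "\<And>p a b. p \<in> topspace X \<Longrightarrow> a \<in> \<A> \<Longrightarrow> b \<in> \<B> \<Longrightarrow> p \<in> fst a \<Longrightarrow> p \<in> fst b \<Longrightarrow>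
               lip_at a b (topspace X) (\<lambda>x. x) p"
    and ba: "\<And>p a b. p \<in> topspace X \<Longrightarrow> a \<in> \<A> \<Longrightarrow> b \<in> \<B> \<Longrightarrow> p \<in> fst a \<Longrightarrow> p \<in> fst b \<Longrightarrow>
               lip_at b a (topspace X) (\<lambda>x. x) p"
  shows "lip_atlas X \<B>"
  unfolding lip_atlas_def
proof (intro conjI ballI impI allI)
  fix p b b' assume p: "p \<in> topspace X" "b \<in> \<B>" "b' \<in> \<B>" "p \<in> fst b" "p \<in> fst b'"
  obtain a where a: "a \<in> \<A>" "p \<in> fst a" using lip_atlas_chart[OF X p(1)] by blast
  show "lip_at b b' (topspace X) (\<lambda>x. x) p"
    using lip_at_comp[OF ba[OF p(1) a(1) p(2) a(2) p(4)] ab[OF p(1) a(1) p(3) a(2) p(5)]] p by auto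
next
  fix G
  show "openin X G \<longleftrightarrow> G \<subseteq> topspace X \<and> (\<forall>p\<in>G. \<forall>b\<in>\<B>. p \<in> fst b \<longrightarrow>
       (\<exists>r>0. chart_ball (topspace X) b p r \<subseteq> G))" (is "_ \<longleftrightarrow> ?R")
  proof
    assume G: "openin X G"
    show ?R
    proof (intro conjI ballI impI)
      show GX: "G \<subseteq> topspace X" using G by (rule openin_subset)
      fix p b assume pb: "p \<in> G" "b \<in> \<B>" "p \<in> fst b"
      have pX: "p \<in> topspace X" using pb GX by blast
      obtain a where a: "a \<in> \<A>" "p \<in> fst a" using lip_atlas_chart[OF X pX] by blast
      obtain r where r: "r > 0" "chart_ball (topspace X) a p r \<subseteq> G"
        using lip_atlas_openin_ball[OF X G pb(1) a] by blast
      obtain s where "s > 0" "(\<lambda>x. x) ` chart_ball (topspace X) b p s \<subseteq> chart_ball (topspace X) a p r"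
        using lip_at_nbhd[OF ba[OF pX a(1) pb(2) a(2) pb(3)] pX pb(3) r(1), of "topspace X"] by blast
      then show "\<exists>r>0. chart_ball (topspace X) b p r \<subseteq> G" using r(2) by auto
    qed
  next
    assume R: ?R
    show "openin X G" unfolding lip_atlas_openin[OF X]
    proof (intro conjI ballI impI)
      show "G \<subseteq> topspace X" using R by blast
      fix p a assume pa: "p \<in> G" "a \<in> \<A>" "p \<in> fst a"
      then have pX: "p \<in> topspace X" using R by blast
      obtain b where b: "b \<in> \<B>" "p \<in> fst b" using cov pX by blast
      obtain r where r: "r > 0" "chart_ball (topspace X) b p r \<subseteq> G"
        using R pa b by blast
      obtain s where "s > 0" "(\<lambda>x. x) ` chart_ball (topspace X) a p s \<subseteq> chart_ball (topspace X) b p r"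
        using lip_at_nbhd[OF ab[OF pX pa(2) b(1) pa(3) b(2)] pX pa(3) r(1), of "topspace X"] by blast
      then show "\<exists>r>0. chart_ball (topspace X) a p r \<subseteq> G" using r(2) by auto
    qed
  qed
qed (use inj cov in auto)

text \<open>
  The definition of a locally Lipschitz map speaks of all charts; as chart changes are Lipschitz,
  one pair of charts at each point is enough.
\<close>

lemma locally_lipschitz_map_by_some_charts:
  assumes X: "lip_atlas X \<A>" and Y: "lip_atlas Y \<B>"
    and N: "N \<subseteq> topspace X" "f ` N \<subseteq> topspace Y"
    and lip: "\<And>p. p \<in> N \<Longrightarrow> \<exists>a\<in>\<A>. \<exists>b\<in>\<B>. p \<in> fst a \<and> f p \<in> fst b \<and> lip_at a b N f p"
  shows "locally_lipschitz_map \<A> N \<B> f"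
proof (subst locally_lipschitz_map_iff_lip_at, erule lip_atlas_inj[OF X], intro ballI impI)
  fix p a' b' assume p: "p \<in> N" "a' \<in> \<A>" "b' \<in> \<B>" "p \<in> fst a'" "f p \<in> fst b'"
  obtain a b where ab: "a \<in> \<A>" "b \<in> \<B>" "p \<in> fst a" "f p \<in> fst b" "lip_at a b N f p"
    using lip p by blast
  have pX: "p \<in> topspace X" "f p \<in> topspace Y" using p N by auto
  have "lip_at a' a N (\<lambda>x. x) p"
    by (rule lip_at_mono[OF lip_atlas_change[OF X pX(1) p(2) ab(1) p(4) ab(3)] N(1)])
  from lip_at_comp[OF this ab(5)] have 1: "lip_at a' b N f p" using p by auto
  have "lip_at b b' (topspace Y) (\<lambda>x. x) (f p)" using lip_atlas_change[OF Y pX(2)] p ab by blast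
  from lip_at_comp[OF 1 this] show "lip_at a' b' N f p" using p N by blast
qed

abbreviation bilipschitz_in_charts ::
  "('p, 'e::metric_space) chart \<Rightarrow> ('q, 'f::metric_space) chart \<Rightarrow> real \<Rightarrow> real \<Rightarrow> ('p \<Rightarrow> 'q) \<Rightarrow> 'p set \<Rightarrow> bool" where
  "bilipschitz_in_charts a b m L f P \<equiv> \<forall>x\<in>P. \<forall>y\<in>P.
     m * dist (snd a x) (snd a y) \<le> dist (snd b (f x)) (snd b (f y)) \<and>
     dist (snd b (f x)) (snd b (f y)) \<le> L * dist (snd a x) (snd a y)"

text \<open>
  Injectivity is the only global ingredient of a Lipeomorphism: the lower constant \<open>m\<close> makes the
  inverse Lipschitz with constant \<open>1 / m\<close>, and openness of the images of small sets makes the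
  inverse continuous.
\<close>

lemma lipeomorphism_of_local:
  assumes X: "lip_atlas X \<A>" and Y: "lip_atlas Y \<B>"
    and inj: "inj_on f N"
    and loc: "\<And>p. p \<in> N \<Longrightarrow> \<exists>P a b m L. p \<in> P \<and> P \<subseteq> N \<and> openin X P \<and> openin Y (f ` P) \<and>
       a \<in> \<A> \<and> b \<in> \<B> \<and> P \<subseteq> fst a \<and> f ` P \<subseteq> fst b \<and> m > 0 \<and>
       bilipschitz_in_charts a b m L f P"
  shows "openin Y (f ` N)" "lipeomorphism (subtopology X N) \<A> (subtopology Y (f ` N)) \<B> f"
proof -
  have "\<And>p. p \<in> N \<Longrightarrow> \<exists>P. p \<in> P \<and> P \<subseteq> N \<and> openin X P \<and> openin Y (f ` P)"
    by (drule loc, elim exE conjE, intro exI conjI; assumption)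
  then obtain P where P: "\<And>p. p \<in> N \<Longrightarrow> p \<in> P p \<and> P p \<subseteq> N \<and> openin X (P p) \<and> openin Y (f ` P p)"
    by metis
  have NP: "N = (\<Union>p\<in>N. P p)" "f ` N = (\<Union>p\<in>N. f ` P p)" using P by blast+
  have "openin Y (\<Union>p\<in>N. f ` P p)" using P by blast
  then show oY: "openin Y (f ` N)" using NP by simp
  have "openin X (\<Union>p\<in>N. P p)" using P by blast
  then have oX: "openin X N" using NP by simp
  have NX: "N \<subseteq> topspace X" and NY: "f ` N \<subseteq> topspace Y" using oX oY openin_subset by auto
  define h where "h = inv_into N f"
  have hf: "h (f x) = x" if "x \<in> N" for x using inj that by (simp add: h_def)
  have "(\<exists>a\<in>\<A>. \<exists>b\<in>\<B>. p \<in> fst a \<and> f p \<in> fst b \<and> lip_at a b N f p \<and> lip_at b a (f ` N) h (f p))" if pN: "p \<in> N" for p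
  proof -
    obtain P a b m L where P: "p \<in> P" "P \<subseteq> N" "openin X P" "openin Y (f ` P)"
      and ab: "a \<in> \<A>" "b \<in> \<B>" "P \<subseteq> fst a" "f ` P \<subseteq> fst b" and m: "m > (0::real)"
      and bil: "bilipschitz_in_charts a b m L f P"
      using loc[OF pN] by blast
    have pa: "p \<in> fst a" "f p \<in> fst b" "f p \<in> f ` P" using P ab by auto
    obtain r where r: "r > 0" "chart_ball (topspace X) a p r \<subseteq> P"
      using lip_atlas_openin_ball[OF X P(3) P(1) ab(1) pa(1)] by blast
    obtain s where s: "s > 0" "chart_ball (topspace Y) b (f p) s \<subseteq> f ` P"
      using lip_atlas_openin_ball[OF Y P(4) pa(3) ab(2) pa(2)] by blast
    have rP: "chart_ball N a p r \<subseteq> P" using chart_ball_mono[OF NX order_refl] r(2) by blast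
    have sP: "chart_ball (f ` N) b (f p) s \<subseteq> f ` P" using chart_ball_mono[OF NY order_refl] s(2) by blast
    have 1: "lip_at a b N f p"
    proof (rule lip_atI[of r "max L 0"])
      fix x y assume x: "x \<in> chart_ball N a p r" "y \<in> chart_ball N a p r"
      then have "dist (snd b (f x)) (snd b (f y)) \<le> L * dist (snd a x) (snd a y)"
        using rP bil by blast
      also have "\<dots> \<le> max L 0 * dist (snd a x) (snd a y)" by (intro mult_right_mono) auto
      finally show "dist (snd b (f x)) (snd b (f y)) \<le> max L 0 * dist (snd a x) (snd a y)" .
    next
      fix x assume "x \<in> chart_ball N a p r"
      then show "f x \<in> fst b" using rP ab(4) by blast
    qed (use r in auto)
    have 2: "lip_at b a (f ` N) h (f p)"
    proof (rule lip_atI[of s "1 / m"])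
      fix x y assume "x \<in> chart_ball (f ` N) b (f p) s" "y \<in> chart_ball (f ` N) b (f p) s"
      then obtain x' y' where xy: "x' \<in> P" "y' \<in> P" "x = f x'" "y = f y'"
        using sP by blast
      then have "m * dist (snd a x') (snd a y') \<le> dist (snd b (f x')) (snd b (f y'))" using bil by blast
      moreover have "h x = x'" "h y = y'" using hf xy P(2) by auto
      ultimately show "dist (snd a (h x)) (snd a (h y)) \<le> 1 / m * dist (snd b x) (snd b y)"
        using m xy by (simp add: field_simps)
    next
      fix x assume "x \<in> chart_ball (f ` N) b (f p) s"
      then obtain x' where "x' \<in> P" "x = f x'" using sP by blast
      moreover have "h (f x') = x'" using hf P(2) \<open>x' \<in> P\<close> by blast
      ultimately show "h x \<in> fst a" using ab(3) by auto
    qed (use s m in auto)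
    show ?thesis using 1 2 pa ab by blast
  qed
  note ab = this
  have tX: "topspace (subtopology X N) = N" and tY: "topspace (subtopology Y (f ` N)) = f ` N"
    using NX NY by auto
  have c1: "continuous_map (subtopology X N) (subtopology Y (f ` N)) f"
    by (rule lip_at_continuous[OF lip_atlas_subtopology[OF X] lip_atlas_subtopology[OF Y]])
      (unfold tX tY, simp, use ab in blast)
  have inv_lip: "\<exists>b\<in>\<B>. \<exists>a\<in>\<A>. q \<in> fst b \<and> h q \<in> fst a \<and> lip_at b a (f ` N) h q" if q: "q \<in> f ` N" for q
  proof -
    obtain p where "p \<in> N" "q = f p" using q by blast
    then show ?thesis using ab[of p] hf[of p] by auto
  qed
  have c2: "continuous_map (subtopology Y (f ` N)) (subtopology X N) h"
    by (rule lip_at_continuous[OF lip_atlas_subtopology[OF Y] lip_atlas_subtopology[OF X]])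
      (unfold tX tY, use hf inv_lip in auto)
  have hom: "homeomorphic_map (subtopology X N) (subtopology Y (f ` N)) f"
    unfolding homeomorphic_map_maps homeomorphic_maps_def tX tY using c1 c2 hf by (intro exI[of _ h]) auto
  have l1: "locally_lipschitz_map \<A> N \<B> f"
    by (rule locally_lipschitz_map_by_some_charts[OF X Y NX NY]) (use ab in blast)
  have l2: "locally_lipschitz_map \<B> (f ` N) \<A> h"
    by (rule locally_lipschitz_map_by_some_charts[OF Y X NY]) (use hf NX inv_lip in auto)
  show "lipeomorphism (subtopology X N) \<A> (subtopology Y (f ` N)) \<B> f"
    unfolding lipeomorphism_def tX tY using hom l1 l2 unfolding h_def by blast
qed

section \<open>Geodesics of small velocity in coordinates\<close>

text \<open>
  The integral operator is a contraction of the bounded continuous functions on the line. Time is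
  clamped to \<open>[-2, 2]\<close>, which has 1 in its interior. The constant 6 arises because the integral
  starts at \<open>-2\<close> instead of 0: the integrals over \<open>[-2, t]\<close> and \<open>[-2, 0]\<close> contribute 4 and 2.
\<close>

lemma picard_short_time:
  fixes G :: "'a::euclidean_space \<Rightarrow> 'a"
  assumes lip: "K-lipschitz_on UNIV G" and K: "6 * K < 1"
  obtains y where "y 0 = y0"
    "\<And>t. -2 < t \<Longrightarrow> t < 2 \<Longrightarrow> (y has_vector_derivative G (y t)) (at t)"
proof -
  define cl where "cl t = max (-2) (min 2 t)" for t :: real
  have cl: "cl t \<in> {-2..2}" "continuous_on UNIV cl" for t
    by (auto simp: cl_def[abs_def] intro!: continuous_intros)
  have K0: "K \<ge> 0" using lip by (rule lipschitz_on_nonneg)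
  have contG: "continuous_on UNIV G" using lip by (rule lipschitz_on_continuous_on)
  have cont: "continuous_on S (\<lambda>s. G (apply_bcontfun y s))" for y :: "real \<Rightarrow>\<^sub>C 'a" and S
    by (rule continuous_on_compose2[OF contG]) auto
  define F where "F y t = y0 + (integral {-2..cl t} (\<lambda>s. G (apply_bcontfun y s))
      - integral {-2..0} (\<lambda>s. G (apply_bcontfun y s)))" for y :: "real \<Rightarrow>\<^sub>C 'a" and t
  have F_bcont: "F y \<in> bcontfun" for y
  proof -
    let ?I = "\<lambda>x. y0 + (integral {-2..x} (\<lambda>s. G (apply_bcontfun y s))
      - integral {-2..0} (\<lambda>s. G (apply_bcontfun y s)))"
    have c: "continuous_on {-2..2} ?I"
      by (intro continuous_intros indefinite_integral_continuous_1 integrable_continuous_real cont)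
    have 1: "continuous_on UNIV (F y)"
      unfolding F_def[abs_def] by (rule continuous_on_compose2[OF c cl(2)]) (use cl in auto)
    have "range (F y) \<subseteq> ?I ` {-2..2}" unfolding F_def[abs_def] using cl(1) by auto
    moreover have "bounded (?I ` {-2..2})"
      using compact_continuous_image[OF c compact_Icc] compact_imp_bounded by blast
    ultimately show ?thesis using 1 bounded_subset by (auto simp: bcontfun_def)
  qed
  have FT: "apply_bcontfun (Bcontfun (F y)) = F y" for y by (rule Bcontfun_inverse[OF F_bcont])
  have contraction: "dist (Bcontfun (F y)) (Bcontfun (F z)) \<le> 6 * K * dist y z" for y z
  proof (rule dist_bound)
    fix t
    let ?h = "\<lambda>s. G (apply_bcontfun y s) - G (apply_bcontfun z s)"
    have b: "norm (?h s) \<le> K * dist y z" for s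
    proof -
      have "norm (?h s) \<le> K * dist (apply_bcontfun y s) (apply_bcontfun z s)"
        using lipschitz_onD[OF lip] by (simp add: dist_norm)
      also have "\<dots> \<le> K * dist y z" by (intro mult_left_mono dist_bounded K0)
      finally show ?thesis .
    qed
    have ch: "continuous_on S ?h" for S by (intro continuous_intros cont)
    have eq: "integral {-2..x} (\<lambda>s. G (apply_bcontfun y s)) - integral {-2..x} (\<lambda>s. G (apply_bcontfun z s))
        = integral {-2..x} ?h" for x :: real
      by (rule integral_diff[symmetric]) (intro integrable_continuous_real cont)+
    have "F y t - F z t = integral {-2..cl t} ?h - integral {-2..0} ?h"
      unfolding F_def eq[symmetric] by simp
    also have "norm \<dots> \<le> norm (integral {-2..cl t} ?h) + norm (integral {-2..0} ?h)"
      by (rule norm_triangle_ineq4)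
    also have "\<dots> \<le> K * dist y z * (cl t - (-2)) + K * dist y z * (0 - (-2))"
      by (intro add_mono integral_bound ch b) (use cl(1)[of t] in auto)
    also have "\<dots> \<le> K * dist y z * 4 + K * dist y z * 2"
      using cl(1)[of t] K0 by (intro add_mono mult_left_mono) auto
    finally show "dist (apply_bcontfun (Bcontfun (F y)) t) (apply_bcontfun (Bcontfun (F z)) t) \<le> 6 * K * dist y z"
      unfolding FT dist_norm by simp
  qed
  have "\<exists>!y. Bcontfun (F y) = y"
    by (rule banach_fix_type[of "6 * K"]) (use K K0 contraction in auto)
  then obtain y where "Bcontfun (F y) = y" by blast
  then have y: "apply_bcontfun y = F y" using FT[of y] by simp
  show ?thesis
  proof (rule that[of "apply_bcontfun y"])
    show "apply_bcontfun y 0 = y0" by (subst y) (simp add: F_def cl_def)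
    fix t :: real assume t: "-2 < t" "t < 2"
    have "((\<lambda>x. integral {-2..x} (\<lambda>s. G (apply_bcontfun y s))) has_vector_derivative G (apply_bcontfun y t))
        (at t within {-2..2})"
      by (rule integral_has_vector_derivative[OF cont]) (use t in auto)
    moreover have "at t within {-2..2} = at t" by (rule at_within_Icc_at[OF t])
    ultimately have "((\<lambda>x. y0 + (integral {-2..x} (\<lambda>s. G (apply_bcontfun y s))
      - integral {-2..0} (\<lambda>s. G (apply_bcontfun y s)))) has_vector_derivative G (apply_bcontfun y t)) (at t)"
      by (auto intro!: derivative_eq_intros)
    then show "(apply_bcontfun y has_vector_derivative G (apply_bcontfun y t)) (at t)"
    proof (rule has_vector_derivative_transform_within_open[where S = "{-2<..<2}"])
      fix s :: real assume "s \<in> {-2<..<2}"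
      then have "cl s = s" by (simp add: cl_def)
      then show "y0 + (integral {-2..s} (\<lambda>s. G (apply_bcontfun y s))
        - integral {-2..0} (\<lambda>s. G (apply_bcontfun y s))) = apply_bcontfun y s"
        using y F_def by metis
    qed (use t in auto)
  qed
qed

lemma vector_derivative_bound:
  fixes f :: "real \<Rightarrow> 'a::real_normed_vector"
  assumes "convex S" "\<And>t. t \<in> S \<Longrightarrow> (f has_vector_derivative f' t) (at t within S)"
    "\<And>t. t \<in> S \<Longrightarrow> norm (f' t) \<le> B" "s \<in> S" "t \<in> S"
  shows "norm (f t - f s) \<le> B * \<bar>t - s\<bar>"
proof -
  have B: "B \<ge> 0" using assms(3)[OF assms(4)] norm_ge_zero order_trans by blast
  have "norm (f t - f s) \<le> B * norm (t - s)"
  proof (rule differentiable_bound[OF assms(1) _ _ assms(5,4), where f' = "\<lambda>x h. h *\<^sub>R f' x"])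
    fix x assume "x \<in> S"
    then show "(f has_derivative (\<lambda>h. h *\<^sub>R f' x)) (at x within S)"
      using assms(2) by (simp add: has_vector_derivative_def)
    show "onorm (\<lambda>h. h *\<^sub>R f' x) \<le> B"
      by (rule onorm_le) (use assms(3)[OF \<open>x \<in> S\<close>] in \<open>simp add: mult.commute[of B] mult_left_mono\<close>)
  qed
  then show ?thesis by simp
qed

text \<open>
  A Gronwall estimate for short intervals: where the norm of \<open>f\<close> is largest, the mean value
  inequality bounds it by its value at \<open>t0\<close> plus half of itself.
\<close>

lemma linear_growth_bound:
  fixes f :: "real \<Rightarrow> 'a::real_normed_vector"
  assumes f: "\<And>t. t \<in> {a..b} \<Longrightarrow> (f has_vector_derivative f' t) (at t within {a..b})"
    and b: "\<And>t. t \<in> {a..b} \<Longrightarrow> norm (f' t) \<le> \<kappa> * norm (f t)"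
    and \<kappa>: "\<kappa> \<ge> 0" "\<kappa> * (b - a) \<le> 1 / 2" and t0: "t0 \<in> {a..b}" and t: "t \<in> {a..b}"
  shows "norm (f t) \<le> 2 * norm (f t0)"
proof -
  have "continuous_on {a..b} f"
    using f has_vector_derivative_continuous by (metis continuous_on_eq_continuous_within)
  then have c: "continuous_on {a..b} (\<lambda>t. norm (f t))" by (rule continuous_on_norm)
  obtain s where s: "s \<in> {a..b}" "\<And>t. t \<in> {a..b} \<Longrightarrow> norm (f t) \<le> norm (f s)"
    using continuous_attains_sup[OF compact_Icc _ c] t by auto
  have "norm (f s - f t0) \<le> (\<kappa> * norm (f s)) * \<bar>s - t0\<bar>"
  proof (rule vector_derivative_bound[OF convex_real_interval(5) f _ t0 s(1)])
    fix t assume t: "t \<in> {a..b}"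
    have "norm (f' t) \<le> \<kappa> * norm (f t)" by (rule b[OF t])
    also have "\<dots> \<le> \<kappa> * norm (f s)" by (intro mult_left_mono s t \<kappa>)
    finally show "norm (f' t) \<le> \<kappa> * norm (f s)" .
  qed
  also have "\<dots> \<le> (\<kappa> * norm (f s)) * (b - a)"
    using t0 s(1) \<kappa> by (intro mult_left_mono) auto
  also have "\<dots> = (\<kappa> * (b - a)) * norm (f s)" by simp
  also have "\<dots> \<le> 1 / 2 * norm (f s)" by (intro mult_right_mono \<kappa>) auto
  finally have "norm (f s) \<le> norm (f t0) + 1 / 2 * norm (f s)"
    by (metis add.commute add_left_mono norm_triangle_sub order_trans)
  then show ?thesis using s(2)[OF t] by simp
qed

text \<open>
  By homogeneity of \<open>Q\<close> the velocity \<open>u = \<delta> w\<close> satisfies \<open>x' = \<delta> w\<close> and \<open>w' = - \<delta> Q x w\<close>. For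
  \<open>|w| \<le> 2\<close> the right-hand side is bounded by \<open>\<delta> B\<close> and has Lipschitz constant \<open>\<delta> K\<close>. So for small
  \<open>\<delta>\<close> solutions exist up to time 2, and two of them separate by at most a multiple of \<open>\<delta>\<close> times
  their initial distance. In the original variables this is the strong differentiability of the
  end point at \<open>(x0, 0)\<close>; at no place is the flow differentiated with respect to the initial data.
\<close>

lemma local_geodesics:
  fixes Q :: "'a::euclidean_space \<Rightarrow> 'a \<Rightarrow> 'a"
  assumes \<rho>: "\<rho> > 0" and C: "C \<ge> 0" and \<epsilon>: "\<epsilon> > 0"
    and Q_lip: "\<And>x x' u u'. x \<in> cball x0 \<rho> \<Longrightarrow> x' \<in> cball x0 \<rho> \<Longrightarrow>
       norm (Q x u - Q x' u') \<le> C * (norm (x - x') * (norm u)\<^sup>2 + norm (u - u') * (norm u + norm u'))"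
    and Q_hom: "\<And>x u r. x \<in> cball x0 \<rho> \<Longrightarrow> Q x (r *\<^sub>R u) = r\<^sup>2 *\<^sub>R Q x u"
  obtains \<delta> X U where "\<delta> > 0"
    "\<forall>x v. norm (x - x0) < \<delta> \<longrightarrow> norm v < \<delta> \<longrightarrow> X x v 0 = x \<and> U x v 0 = v \<and>
       (\<forall>t. -2 < t \<longrightarrow> t < 2 \<longrightarrow> X x v t \<in> ball x0 \<rho> \<and>
          (X x v has_vector_derivative U x v t) (at t) \<and>
          (U x v has_vector_derivative - Q (X x v t) (U x v t)) (at t))"
    "\<forall>x v x' v'. norm (x - x0) < \<delta> \<longrightarrow> norm v < \<delta> \<longrightarrow> norm (x' - x0) < \<delta> \<longrightarrow> norm v' < \<delta> \<longrightarrow>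
       norm (X x v 1 - X x' v' 1 - (x - x') - (v - v')) \<le> \<epsilon> * (norm (x - x') + norm (v - v'))"
proof -
  \<comment> \<open>The rescaled field has Lipschitz constant \<open>\<delta> K\<close> and bound \<open>\<delta> B\<close>; the first summands come from
    \<open>w\<close>, the others from \<open>Q\<close>.\<close>
  define K where "K = 1 + 8 * C"
  define B where "B = 2 + 4 * C"
  have K: "K \<ge> 1" and B: "B \<ge> 2" using C by (auto simp: K_def B_def)
  define \<delta> where "\<delta> = min (min 1 (\<rho> / 4)) (min (min (\<rho> / (8 * B)) (1 / (4 * B))) (min (1 / (12 * K)) (\<epsilon> / (2 * K))))"
  have \<delta>: "\<delta> > 0" "\<delta> \<le> 1" "\<delta> \<le> \<rho> / 4" "2 * (\<delta> * B) \<le> \<rho> / 4" "2 * (\<delta> * B) \<le> 1 / 2"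
      "6 * (\<delta> * K) < 1" "2 * \<delta> * K \<le> \<epsilon>" "\<delta> * K \<le> 1 / 2"
  proof -
    show "\<delta> > 0" using \<rho> \<epsilon> K B by (simp add: \<delta>_def)
    show "\<delta> \<le> 1" "\<delta> \<le> \<rho> / 4" by (simp_all add: \<delta>_def)
    have "\<delta> \<le> \<rho> / (8 * B)" "\<delta> \<le> 1 / (4 * B)" "\<delta> \<le> 1 / (12 * K)" "\<delta> \<le> \<epsilon> / (2 * K)"
      by (auto simp: \<delta>_def)
    then show "2 * (\<delta> * B) \<le> \<rho> / 4" "2 * (\<delta> * B) \<le> 1 / 2" "6 * (\<delta> * K) < 1" "2 * \<delta> * K \<le> \<epsilon>" "\<delta> * K \<le> 1 / 2"
      using K B by (auto simp: field_simps)
  qed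
  \<comment> \<open>Composing with projections onto balls makes the field globally Lipschitz. Solutions that start
    close to \<open>(x0, 0)\<close> stay in the balls, where the projections act as the identity.\<close>
  define prx where "prx = closest_point (cball x0 \<rho>)"
  define prw where "prw = closest_point (cball (0::'a) 2)"
  have prx: "prx x \<in> cball x0 \<rho>" "norm (prx x - prx x') \<le> norm (x - x')"
      "x \<in> cball x0 \<rho> \<Longrightarrow> prx x = x" for x x'
    using \<rho> closest_point_in_set[of "cball x0 \<rho>" x] closest_point_lipschitz[of "cball x0 \<rho>" x x']
    by (auto simp: prx_def closest_point_self dist_norm)
  have prw: "norm (prw x) \<le> 2" "norm (prw x - prw x') \<le> norm (x - x')"
      "norm x \<le> 2 \<Longrightarrow> prw x = x" for x x'
    using closest_point_in_set[of "cball (0::'a) 2" x] closest_point_lipschitz[of "cball (0::'a) 2" x x']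
    by (auto simp: prw_def closest_point_self dist_norm)
  have Q0: "Q x 0 = 0" if "x \<in> cball x0 \<rho>" for x
    using Q_hom[OF that, of 0 0] by simp
  define G where "G z = \<delta> *\<^sub>R (prw (snd z), - Q (prx (fst z)) (prw (snd z)))" for z
  have G_lip: "(\<delta> * K)-lipschitz_on UNIV G"
  proof (rule lipschitz_onI)
    fix z z' :: "'a \<times> 'a"
    let ?w = "prw (snd z)" and ?w' = "prw (snd z')" and ?x = "prx (fst z)" and ?x' = "prx (fst z')"
    have w: "norm (?w - ?w') \<le> norm (z - z')"
      using prw(2)[of "snd z" "snd z'"] norm_snd_le[of "snd (z - z')" "fst (z - z')"] by (simp add: minus_prod_def)
    have x: "norm (?x - ?x') \<le> norm (z - z')"
      using prx(2)[of "fst z" "fst z'"] norm_fst_le[of "fst (z - z')" "snd (z - z')"] by (simp add: minus_prod_def)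
    have "norm (Q ?x ?w - Q ?x' ?w') \<le> C * (norm (?x - ?x') * (norm ?w)\<^sup>2 + norm (?w - ?w') * (norm ?w + norm ?w'))"
      by (intro Q_lip prx)
    also have "\<dots> \<le> C * (norm (z - z') * 2\<^sup>2 + norm (z - z') * (2 + 2))"
      by (intro mult_left_mono add_mono mult_mono w x power_mono prw C) auto
    finally have q: "norm (Q ?x ?w - Q ?x' ?w') \<le> 8 * C * norm (z - z')" by simp
    have "G z - G z' = \<delta> *\<^sub>R (?w - ?w', - (Q ?x ?w - Q ?x' ?w'))"
      by (simp add: G_def scaleR_diff_right)
    then have "norm (G z - G z') = \<delta> * norm (?w - ?w', - (Q ?x ?w - Q ?x' ?w'))"
      using \<delta>(1) by (simp only: norm_scaleR abs_of_pos)
    also have "\<dots> \<le> \<delta> * (norm (?w - ?w') + norm (- (Q ?x ?w - Q ?x' ?w')))"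
      using \<delta>(1) by (intro mult_left_mono norm_Pair_le) auto
    also have "\<dots> \<le> \<delta> * (norm (z - z') + 8 * C * norm (z - z'))"
      unfolding norm_minus_cancel using \<delta>(1) w q by (intro mult_left_mono add_mono) auto
    finally show "dist (G z) (G z') \<le> \<delta> * K * dist z z'"
      by (simp add: dist_norm K_def algebra_simps)
  qed (use \<delta> K in auto)
  have G_bd: "norm (G z) \<le> \<delta> * B" for z
  proof -
    let ?w = "prw (snd z)" and ?x = "prx (fst z)"
    have "norm (Q ?x ?w - Q ?x 0) \<le> C * (norm (?x - ?x) * (norm ?w)\<^sup>2 + norm (?w - 0) * (norm ?w + norm (0::'a)))"
      by (intro Q_lip prx)
    also have "\<dots> \<le> C * (0 + 2 * (2 + 0))"
      using prw(1)[of "snd z"] C by (intro mult_left_mono add_mono mult_mono) auto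
    finally have q: "norm (Q ?x ?w) \<le> 4 * C" using Q0[OF prx(1)] by simp
    have "norm (G z) = \<delta> * norm (?w, - Q ?x ?w)"
      unfolding G_def norm_scaleR using \<delta>(1) by (simp only: abs_of_pos)
    also have "\<dots> \<le> \<delta> * (norm ?w + norm (- Q ?x ?w))" using \<delta>(1) by (intro mult_left_mono norm_Pair_le) auto
    also have "\<dots> \<le> \<delta> * (2 + 4 * C)"
      unfolding norm_minus_cancel using \<delta>(1) q prw(1) by (intro mult_left_mono add_mono) auto
    finally show ?thesis by (simp add: B_def)
  qed
  have "\<exists>y. y 0 = (x, v /\<^sub>R \<delta>) \<and> (\<forall>t. -2 < t \<longrightarrow> t < 2 \<longrightarrow> (y has_vector_derivative G (y t)) (at t))" for x v
    by (rule picard_short_time[OF G_lip \<delta>(6), of "(x, v /\<^sub>R \<delta>)"]) blast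
  then obtain Y where Y0: "\<And>x v. Y x v 0 = (x, v /\<^sub>R \<delta>)"
    and Y': "\<And>x v t. -2 < t \<Longrightarrow> t < 2 \<Longrightarrow> (Y x v has_vector_derivative G (Y x v t)) (at t)" by metis
  define X where "X x v t = fst (Y x v t)" for x v t
  define U where "U x v t = \<delta> *\<^sub>R snd (Y x v t)" for x v t
  show ?thesis
  proof (rule that[of \<delta> X U]; (intro allI impI)?)
    fix x v :: 'a assume xv: "norm (x - x0) < \<delta>" "norm v < \<delta>"
    have "X x v t \<in> ball x0 \<rho> \<and> (X x v has_vector_derivative U x v t) (at t) \<and>
          (U x v has_vector_derivative - Q (X x v t) (U x v t)) (at t)" if t: "-2 < t" "t < 2" for t
    proof -
      let ?y = "Y x v"
      have "norm (?y t - ?y 0) \<le> (\<delta> * B) * \<bar>t - 0\<bar>"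
        by (rule vector_derivative_bound[where S = "{-2<..<2}" and f' = "\<lambda>t. G (?y t)"])
          (use t Y' G_bd in \<open>auto intro: has_vector_derivative_at_within\<close>)
      also have "\<dots> \<le> (\<delta> * B) * 2" using t \<delta>(1) B by (intro mult_left_mono) auto
      finally have d: "norm (?y t - ?y 0) \<le> \<rho> / 4" "norm (?y t - ?y 0) \<le> 1 / 2" using \<delta>(4,5) by auto
      have "norm (fst (?y t) - x) \<le> \<rho> / 4"
        using d(1) norm_fst_le[of "fst (?y t - ?y 0)" "snd (?y t - ?y 0)"] by (simp add: Y0 minus_prod_def)
      then have "norm (fst (?y t) - x0) < \<rho>"
        using xv(1) \<delta>(3) \<rho> norm_triangle_ineq[of "fst (?y t) - x" "x - x0"] by simp
      then have fx: "fst (?y t) \<in> ball x0 \<rho>" by (simp add: dist_norm norm_minus_commute)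
      have "norm (snd (?y t) - v /\<^sub>R \<delta>) \<le> 1 / 2"
        using d(2) norm_snd_le[of "snd (?y t - ?y 0)" "fst (?y t - ?y 0)"] by (simp add: Y0 minus_prod_def)
      moreover have "norm (v /\<^sub>R \<delta>) \<le> 1" using xv(2) \<delta>(1) by (simp add: field_simps)
      ultimately have fw: "norm (snd (?y t)) \<le> 2"
        using norm_triangle_ineq[of "snd (?y t) - v /\<^sub>R \<delta>" "v /\<^sub>R \<delta>"] by simp
      have G: "G (?y t) = \<delta> *\<^sub>R (snd (?y t), - Q (fst (?y t)) (snd (?y t)))"
        unfolding G_def using fx fw by (simp add: prx(3) prw(3))
      have 1: "((\<lambda>t. fst (?y t)) has_vector_derivative fst (G (?y t))) (at t)"
        by (rule bounded_linear.has_vector_derivative[OF bounded_linear_fst Y'[OF t]])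
      have 2: "((\<lambda>t. \<delta> *\<^sub>R snd (?y t)) has_vector_derivative \<delta> *\<^sub>R snd (G (?y t))) (at t)"
        using bounded_linear.has_vector_derivative[OF bounded_linear_snd Y'[OF t]]
        by (auto intro!: derivative_eq_intros)
      have "\<delta> *\<^sub>R snd (G (?y t)) = - Q (fst (?y t)) (\<delta> *\<^sub>R snd (?y t))"
        using Q_hom[of "fst (?y t)" \<delta> "snd (?y t)"] fx by (simp add: G power2_eq_square)
      then show ?thesis using 1 2 fx by (simp add: X_def[abs_def] U_def[abs_def] G)
    qed
    then show "X x v 0 = x \<and> U x v 0 = v \<and> (\<forall>t. -2 < t \<longrightarrow> t < 2 \<longrightarrow> X x v t \<in> ball x0 \<rho> \<and>
          (X x v has_vector_derivative U x v t) (at t) \<and>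
          (U x v has_vector_derivative - Q (X x v t) (U x v t)) (at t))"
      using \<delta>(1) by (simp add: X_def U_def Y0)
  next
    fix x v x' v' :: 'a assume xv: "norm (x - x0) < \<delta>" "norm v < \<delta>" "norm (x' - x0) < \<delta>" "norm v' < \<delta>"
    let ?d = "\<lambda>t. Y x v t - Y x' v' t" and ?d' = "\<lambda>t. G (Y x v t) - G (Y x' v' t)"
    have der: "(?d has_vector_derivative ?d' t) (at t within {0..1})" if "t \<in> {0..1}" for t
      using that Y' by (intro has_vector_derivative_diff has_vector_derivative_at_within[OF Y']) auto
    have bd: "norm (?d' t) \<le> (\<delta> * K) * norm (?d t)" for t
      using lipschitz_onD[OF G_lip] by (simp add: dist_norm)
    have m: "norm (?d t) \<le> 2 * norm (?d 0)" if "t \<in> {0..1}" for t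
      by (rule linear_growth_bound[OF der bd _ _ _ that]) (use \<delta> K in auto)
    have bd2: "norm (?d' t) \<le> 2 * (\<delta> * K) * norm (?d 0)" if "t \<in> {0..1}" for t
    proof -
      have "(\<delta> * K) * norm (?d t) \<le> (\<delta> * K) * (2 * norm (?d 0))"
        using \<delta> K m[OF that] by (intro mult_left_mono) auto
      then show ?thesis using bd[of t] by simp
    qed
    have G1: "fst (G z - G z') = \<delta> *\<^sub>R (prw (snd z) - prw (snd z'))" for z z'
      by (simp add: G_def scaleR_diff_right)
    have w1: "norm (snd (Y x v t)) \<le> 2" if "norm (x - x0) < \<delta>" "norm v < \<delta>" "t \<in> {0..1}" for x v t
    proof -
      have "norm (Y x v t - Y x v 0) \<le> (\<delta> * B) * \<bar>t - 0\<bar>"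
        by (rule vector_derivative_bound[where S = "{-2<..<2}" and f' = "\<lambda>t. G (Y x v t)"])
          (use that Y' G_bd in \<open>auto intro: has_vector_derivative_at_within\<close>)
      also have "\<dots> \<le> (\<delta> * B) * 2" using that \<delta>(1) B by (intro mult_left_mono) auto
      finally have d: "norm (Y x v t - Y x v 0) \<le> 1 / 2" using \<delta>(5) by auto
      have "norm (snd (Y x v t) - v /\<^sub>R \<delta>) \<le> 1 / 2"
        using d norm_snd_le[of "snd (Y x v t - Y x v 0)" "fst (Y x v t - Y x v 0)"] by (simp add: Y0 minus_prod_def)
      moreover have "norm (v /\<^sub>R \<delta>) \<le> 1" using that(2) \<delta>(1) by (simp add: field_simps)
      ultimately show ?thesis using norm_triangle_ineq[of "snd (Y x v t) - v /\<^sub>R \<delta>" "v /\<^sub>R \<delta>"] by simp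
    qed
    have e: "norm (?d t - ?d 0) \<le> 2 * (\<delta> * K) * norm (?d 0)" if t: "t \<in> {0..1}" for t
    proof -
      have "norm (?d t - ?d 0) \<le> (2 * (\<delta> * K) * norm (?d 0)) * \<bar>t - 0\<bar>"
        by (rule vector_derivative_bound[OF convex_real_interval(5) der bd2]) (use t in auto)
      also have "\<dots> \<le> (2 * (\<delta> * K) * norm (?d 0)) * 1"
        using t \<delta> K by (intro mult_left_mono) auto
      finally show ?thesis by simp
    qed
    \<comment> \<open>The position difference minus the linear drift due to the difference of the initial
      velocities.\<close>
    let ?h = "\<lambda>t. fst (?d t) - t *\<^sub>R (\<delta> *\<^sub>R snd (?d 0))"
    have "norm (?h 1 - ?h 0) \<le> (\<delta> * (2 * (\<delta> * K) * norm (?d 0))) * \<bar>1 - 0\<bar>"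
    proof (rule vector_derivative_bound[OF convex_real_interval(5),
          where f' = "\<lambda>t. \<delta> *\<^sub>R snd (?d t - ?d 0)"])
      fix t :: real assume t: "t \<in> {0..1}"
      have "fst (?d' t) = \<delta> *\<^sub>R snd (?d t)"
        unfolding G1 using w1[OF xv(1,2) t] w1[OF xv(3,4) t] by (simp add: prw(3))
      moreover have "((\<lambda>t. fst (?d t)) has_vector_derivative fst (?d' t)) (at t within {0..1})"
        by (rule bounded_linear.has_vector_derivative[OF bounded_linear_fst der[OF t]])
      ultimately have "((\<lambda>t. fst (?d t)) has_vector_derivative \<delta> *\<^sub>R snd (?d t)) (at t within {0..1})"
        by metis
      moreover have "((\<lambda>t. t *\<^sub>R (\<delta> *\<^sub>R snd (?d 0))) has_vector_derivative \<delta> *\<^sub>R snd (?d 0)) (at t within {0..1})"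
        by (auto intro!: derivative_eq_intros)
      ultimately have "(?h has_vector_derivative (\<delta> *\<^sub>R snd (?d t) - \<delta> *\<^sub>R snd (?d 0))) (at t within {0..1})"
        by (rule has_vector_derivative_diff)
      then show "(?h has_vector_derivative \<delta> *\<^sub>R snd (?d t - ?d 0)) (at t within {0..1})"
        by (simp add: scaleR_diff_right)
      have "norm (snd (?d t - ?d 0)) \<le> 2 * (\<delta> * K) * norm (?d 0)"
        using e[OF t] norm_snd_le[of "snd (?d t - ?d 0)" "fst (?d t - ?d 0)"] by (simp add: minus_prod_def)
      then show "norm (\<delta> *\<^sub>R snd (?d t - ?d 0)) \<le> \<delta> * (2 * (\<delta> * K) * norm (?d 0))"
        using \<delta>(1) by simp
    qed auto
    moreover have "?h 1 - ?h 0 = X x v 1 - X x' v' 1 - (x - x') - (v - v')"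
      using \<delta>(1) by (simp add: X_def Y0 scaleR_diff_right)
    ultimately have 1: "norm (X x v 1 - X x' v' 1 - (x - x') - (v - v')) \<le> 2 * \<delta> * K * (\<delta> * norm (?d 0))"
      by (simp add: mult_ac)
    have "?d 0 = (x - x', (v - v') /\<^sub>R \<delta>)" by (simp add: Y0 scaleR_diff_right)
    then have "norm (?d 0) \<le> norm (x - x') + norm ((v - v') /\<^sub>R \<delta>)" by (metis norm_Pair_le)
    also have "norm ((v - v') /\<^sub>R \<delta>) = norm (v - v') / \<delta>"
      using \<delta>(1) by (simp only: norm_scaleR abs_of_pos positive_imp_inverse_positive divide_inverse mult.commute)
    finally have "\<delta> * norm (?d 0) \<le> \<delta> * (norm (x - x') + norm (v - v') / \<delta>)"
      using \<delta>(1) by (intro mult_left_mono) auto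
    also have "\<dots> = \<delta> * norm (x - x') + norm (v - v')" using \<delta>(1) by (simp add: field_simps)
    also have "\<dots> \<le> norm (x - x') + norm (v - v')"
      using \<delta>(2) by (intro add_right_mono) (simp add: mult_left_le_one_le \<delta>(1) less_imp_le)
    finally have 2: "\<delta> * norm (?d 0) \<le> norm (x - x') + norm (v - v')" .
    have "2 * \<delta> * K * (\<delta> * norm (?d 0)) \<le> \<epsilon> * (norm (x - x') + norm (v - v'))"
      using \<delta> \<epsilon> by (intro mult_mono 2) auto
    with 1 show "norm (X x v 1 - X x' v' 1 - (x - x') - (v - v')) \<le> \<epsilon> * (norm (x - x') + norm (v - v'))"
      by linarith
  qed (rule \<delta>(1))
qed

section \<open>Manifolds of class \<open>C\<^sup>1\<^sup>,\<^sup>1\<close> and their tangent bundles\<close>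

lemma chart_rep_apply: "inj_on (snd a) (fst a) \<Longrightarrow> x \<in> fst a \<Longrightarrow> chart_rep a b f (snd a x) = snd b (f x)"
  by (simp add: chart_rep_def)

lemma chart_rep_derivative_compose:
  fixes a :: "('p, 'a::real_normed_vector) chart" and b :: "('q, 'b::real_normed_vector) chart"
    and c :: "('r, 'c::real_normed_vector) chart"
  assumes inj: "inj_on (snd a) (fst a)" "inj_on (snd b) (fst b)"
    and op: "open (snd a ` {x \<in> fst a. f x \<in> fst b})" and p: "p \<in> fst a" "f p \<in> fst b"
    and f: "(chart_rep a b f has_derivative D1) (at (snd a p))"
    and h: "(chart_rep b c h has_derivative D2) (at (snd b (f p)))"
  shows "(chart_rep a c (\<lambda>x. h (f x)) has_derivative (\<lambda>v. D2 (D1 v))) (at (snd a p))"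
proof (rule has_derivative_transform_within_open[OF _ op])
  have "chart_rep a b f (snd a p) = snd b (f p)" by (rule chart_rep_apply[OF inj(1) p(1)])
  then show "((\<lambda>x. chart_rep b c h (chart_rep a b f x)) has_derivative (\<lambda>v. D2 (D1 v))) (at (snd a p))"
    using diff_chain_at[OF f, of "chart_rep b c h" D2] h by (simp add: o_def)
  show "snd a p \<in> snd a ` {x \<in> fst a. f x \<in> fst b}" using p by auto
  fix y assume "y \<in> snd a ` {x \<in> fst a. f x \<in> fst b}"
  then obtain x where "x \<in> fst a" "f x \<in> fst b" "y = snd a x" by auto
  then show "chart_rep b c h (chart_rep a b f y) = chart_rep a c (\<lambda>x. h (f x)) y"
    using inj by (simp add: chart_rep_apply)
qed

abbreviation trans_map :: "('p, 'e) chart \<Rightarrow> ('p, 'e) chart \<Rightarrow> 'e \<Rightarrow> 'e" where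
  "trans_map c d \<equiv> chart_rep c d (\<lambda>p. p)"

abbreviation trans_deriv :: "('p, 'e::euclidean_space) chart \<Rightarrow> ('p, 'e) chart \<Rightarrow> 'e \<Rightarrow> 'e \<Rightarrow> 'e" where
  "trans_deriv c d x \<equiv> frechet_derivative (trans_map c d) (at x)"

text \<open>
  The preimages of open sets under the charts are a subbasis. Since chart changes are Lipschitz,
  each of them contains a ball of every chart around each of its points, and this property passes
  to finite intersections and unions.
\<close>

lemma lip_atlas_generated:
  assumes inj: "\<And>a. a \<in> \<A> \<Longrightarrow> inj_on (snd a) (fst a)"
    and lip: "\<And>p a b. a \<in> \<A> \<Longrightarrow> b \<in> \<A> \<Longrightarrow> p \<in> fst a \<Longrightarrow> p \<in> fst b \<Longrightarrow>
      lip_at a b (\<Union>a\<in>\<A>. fst a) (\<lambda>x. x) p"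
  shows "lip_atlas (topology_generated_by {{v \<in> fst a. snd a v \<in> W} | a W. a \<in> \<A> \<and> open W}) \<A>"
    and "topspace (topology_generated_by {{v \<in> fst a. snd a v \<in> W} | a W. a \<in> \<A> \<and> open W}) = (\<Union>a\<in>\<A>. fst a)"
proof -
  let ?S = "{{v \<in> fst a. snd a v \<in> W} | a W. a \<in> \<A> \<and> open W}"
  let ?X = "topology_generated_by ?S"
  let ?T = "\<Union>a\<in>\<A>. fst a"
  have "{v \<in> fst a. snd a v \<in> UNIV} \<in> ?S" if "a \<in> \<A>" for a using that by blast
  then have "fst a \<subseteq> \<Union> ?S" if "a \<in> \<A>" for a
    using that Sup_upper[of "{v \<in> fst a. snd a v \<in> UNIV}" ?S] by auto
  then have "?T \<subseteq> \<Union> ?S" by (rule UN_least)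
  moreover have "\<Union> ?S \<subseteq> ?T" by blast
  ultimately show T: "topspace ?X = ?T" by (simp add: topology_generated_by_topspace)
  have "openin ?X G \<longleftrightarrow> G \<subseteq> ?T \<and>
        (\<forall>p\<in>G. \<forall>a\<in>\<A>. p \<in> fst a \<longrightarrow> (\<exists>r>0. chart_ball ?T a p r \<subseteq> G))" (is "_ \<longleftrightarrow> ?R G") for G
  proof
    assume "openin ?X G"
    then have "generate_topology_on ?S G" by (simp add: openin_topology_generated_by_iff)
    then show "?R G"
    proof induction
      case Empty show ?case by simp
    next
      case (Int G H)
      show ?case
      proof (intro conjI ballI impI)
        show "G \<inter> H \<subseteq> ?T" using Int by blast
        fix p a assume p: "p \<in> G \<inter> H" "a \<in> \<A>" "p \<in> fst a"
        then obtain r s where "r > 0" "chart_ball ?T a p r \<subseteq> G" "s > 0" "chart_ball ?T a p s \<subseteq> H"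
          using Int by (meson IntD1 IntD2)
        moreover have "chart_ball ?T a p (min r s) \<subseteq> chart_ball ?T a p r" "chart_ball ?T a p (min r s) \<subseteq> chart_ball ?T a p s"
          by (rule chart_ball_mono; simp)+
        ultimately show "\<exists>r>0. chart_ball ?T a p r \<subseteq> G \<inter> H" by (intro exI[of _ "min r s"]) auto
      qed
    next
      case (UN K)
      show ?case
      proof (intro conjI ballI impI)
        show "\<Union> K \<subseteq> ?T" using UN by blast
        fix p a assume p: "p \<in> \<Union> K" "a \<in> \<A>" "p \<in> fst a"
        then obtain k where k: "k \<in> K" "p \<in> k" by blast
        then obtain r where "r > 0" "chart_ball ?T a p r \<subseteq> k" using UN p by meson
        then show "\<exists>r>0. chart_ball ?T a p r \<subseteq> \<Union> K" using k by blast
      qed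
    next
      case (Basis G)
      then obtain a W where G: "G = {v \<in> fst a. snd a v \<in> W}" "a \<in> \<A>" "open W" by blast
      show ?case
      proof (intro conjI ballI impI)
        show "G \<subseteq> ?T" using G by blast
        fix p b assume p: "p \<in> G" "b \<in> \<A>" "p \<in> fst b"
        obtain s where s: "s > 0" "ball (snd a p) s \<subseteq> W" using p G openE by blast
        have pa: "p \<in> fst a" "p \<in> ?T" using p G by auto
        obtain r where r: "r > 0" "(\<lambda>x. x) ` chart_ball ?T b p r \<subseteq> chart_ball ?T a p s"
          using lip_at_nbhd[OF lip[OF p(2) G(2) p(3) pa(1)] pa(2) p(3) s(1), of ?T] by auto
        have "chart_ball ?T a p s \<subseteq> G" using s(2) G(1) by (auto simp: chart_ball_def dist_commute)
        then show "\<exists>r>0. chart_ball ?T b p r \<subseteq> G" using r by auto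
      qed
    qed
  next
    assume R: "?R G"
    have "\<exists>H. openin ?X H \<and> p \<in> H \<and> H \<subseteq> G" if p: "p \<in> G" for p
    proof -
      obtain a where a: "a \<in> \<A>" "p \<in> fst a" using R p by blast
      obtain r where r: "r > 0" "chart_ball ?T a p r \<subseteq> G" using R p a by meson
      have "chart_ball ?T a p r = {v \<in> fst a. snd a v \<in> ball (snd a p) r}"
        using a by (auto simp: chart_ball_def dist_commute)
      moreover have "{v \<in> fst a. snd a v \<in> ball (snd a p) r} \<in> ?S" using a open_ball by blast
      ultimately have "openin ?X (chart_ball ?T a p r)"
        by (simp add: topology_generated_by_Basis)
      moreover have "p \<in> chart_ball ?T a p r" using a r by (auto simp: chart_ball_def)
      ultimately show ?thesis using r by blast
    qed
    then show "openin ?X G" by (subst openin_subopen) blast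
  qed
  then show "lip_atlas ?X \<A>"
    unfolding lip_atlas_def T using inj lip by auto
qed

locale c11_manifold =
  fixes X :: "'p topology" and A :: "('p, 'e::euclidean_space) chart set"
  assumes manifold: "Ck1_manifold 1 X A"
begin

lemma chart_facts:
  assumes "c \<in> A"
  shows "openin X (fst c)" "open (snd c ` fst c)"
    "homeomorphic_map (subtopology X (fst c)) (top_of_set (snd c ` fst c)) (snd c)"
    "inj_on (snd c) (fst c)" "fst c \<subseteq> topspace X"
proof -
  show 1: "openin X (fst c)" "open (snd c ` fst c)"
    and h: "homeomorphic_map (subtopology X (fst c)) (top_of_set (snd c ` fst c)) (snd c)"
    using manifold assms by (auto simp: Ck1_manifold_def)
  show sub: "fst c \<subseteq> topspace X" using 1(1) openin_subset by blast
  show "inj_on (snd c) (fst c)" using h sub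
    by (simp add: homeomorphic_eq_everything_map inf.absorb2)
qed

lemma chart_exists: "p \<in> topspace X \<Longrightarrow> \<exists>c\<in>A. p \<in> fst c"
  using manifold by (auto simp: Ck1_manifold_def)

lemma open_chart_image:
  assumes c: "c \<in> A" and G: "openin X G"
  shows "open (snd c ` (fst c \<inter> G))"
proof -
  have "openin (subtopology X (fst c)) (fst c \<inter> G)"
    using G by (simp add: openin_subtopology_Int Int_commute)
  moreover have "open_map (subtopology X (fst c)) (top_of_set (snd c ` fst c)) (snd c)"
    using chart_facts(3)[OF c] by (simp add: homeomorphic_eq_everything_map)
  ultimately have "openin (top_of_set (snd c ` fst c)) (snd c ` (fst c \<inter> G))"
    by (simp add: open_map_def)
  then show ?thesis using chart_facts(2)[OF c] by (simp add: openin_open_eq)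
qed

lemma openin_chart_preimage:
  assumes c: "c \<in> A" and W: "open W"
  shows "openin X {p \<in> fst c. snd c p \<in> W}"
proof -
  have "continuous_map (subtopology X (fst c)) euclidean (snd c)"
    using chart_facts(3)[OF c] by (auto simp: homeomorphic_eq_everything_map continuous_map_in_subtopology)
  then have "openin (subtopology X (fst c)) {p \<in> topspace (subtopology X (fst c)). snd c p \<in> W}"
    using W by (auto simp: continuous_map_def)
  moreover have "{p \<in> topspace (subtopology X (fst c)). snd c p \<in> W} = {p \<in> fst c. snd c p \<in> W}"
    using chart_facts(5)[OF c] by auto
  ultimately show ?thesis using chart_facts(1)[OF c] by (metis openin_trans_full)
qed

lemma trans_apply: "c \<in> A \<Longrightarrow> p \<in> fst c \<Longrightarrow> trans_map c d (snd c p) = snd d p"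
  by (simp add: chart_rep_apply chart_facts)

lemma trans_open: "c \<in> A \<Longrightarrow> d \<in> A \<Longrightarrow> open (snd c ` (fst c \<inter> fst d))"
  by (simp add: open_chart_image chart_facts)

lemma trans_Ck1: "c \<in> A \<Longrightarrow> d \<in> A \<Longrightarrow> Ck1 1 (snd c ` (fst c \<inter> fst d)) (trans_map c d)"
  using manifold by (auto simp: Ck1_manifold_def Ck1_map_def Int_def simp del: Ck1.simps)

lemma trans_has_derivative:
  assumes "c \<in> A" "d \<in> A" "p \<in> fst c" "p \<in> fst d"
  shows "(trans_map c d has_derivative trans_deriv c d (snd c p)) (at (snd c p))"
  using trans_Ck1[OF assms(1,2)] assms frechet_derivative_works by (force simp: One_nat_def simp del: Ck1.simps(1))

lemma trans_linear:
  assumes "c \<in> A" "d \<in> A" "p \<in> fst c" "p \<in> fst d"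
  shows "linear (trans_deriv c d (snd c p))"
  using trans_has_derivative[OF assms] has_derivative_linear by blast

lemma trans_chain:
  assumes cde: "c \<in> A" "d \<in> A" "e \<in> A" and p: "p \<in> fst c" "p \<in> fst d" "p \<in> fst e"
  shows "trans_deriv c e (snd c p) v = trans_deriv d e (snd d p) (trans_deriv c d (snd c p) v)"
proof -
  have "(chart_rep c e (\<lambda>x. x) has_derivative (\<lambda>v. trans_deriv d e (snd d p) (trans_deriv c d (snd c p) v))) (at (snd c p))"
    by (rule chart_rep_derivative_compose[where a = c and b = d and c = e and f = "\<lambda>x. x" and h = "\<lambda>x. x",
        OF chart_facts(4)[OF cde(1)] chart_facts(4)[OF cde(2)] trans_open[OF cde(1,2), unfolded Int_def] p(1,2)
          trans_has_derivative[OF cde(1,2) p(1,2)] trans_has_derivative[OF cde(2,3) p(2,3)]])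
  from frechet_derivative_at[OF this] show ?thesis by metis
qed

lemma trans_self:
  assumes "c \<in> A" "p \<in> fst c"
  shows "trans_deriv c c (snd c p) v = v"
proof -
  have "(trans_map c c has_derivative (\<lambda>v. v)) (at (snd c p))"
    by (rule has_derivative_transform_within_open[OF has_derivative_ident chart_facts(2)[OF assms(1)]])
      (use assms in \<open>auto simp: trans_apply\<close>)
  from frechet_derivative_at[OF this] show ?thesis by metis
qed

lemma atlas_lip_at:
  assumes c: "c \<in> A" "d \<in> A" "p \<in> fst c" "p \<in> fst d"
  shows "lip_at c d (topspace X) (\<lambda>x. x) p"
proof -
  let ?U = "snd c ` (fst c \<inter> fst d)"
  have "Ck1 0 ?U (trans_map c d)" by (rule Ck1_1_imp_Ck1_0[OF trans_Ck1 trans_open]) (use c in auto)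
  from Ck1_0_D[OF this trans_open, of "snd c p"] c obtain r L where r: "r > 0" "ball (snd c p) r \<subseteq> ?U" "L \<ge> 0"
    "\<And>y z. y \<in> ball (snd c p) r \<Longrightarrow> z \<in> ball (snd c p) r \<Longrightarrow> norm (trans_map c d y - trans_map c d z) \<le> L * norm (y - z)"
    by blast
  show ?thesis
  proof (rule lip_atI[OF r(1,3)])
    fix x assume "x \<in> chart_ball (topspace X) c p r"
    then have x: "x \<in> fst c" "snd c x \<in> ?U" using r(2) by (auto simp: chart_ball_def dist_commute)
    then obtain x' where x': "x' \<in> fst c" "x' \<in> fst d" "snd c x = snd c x'" by auto
    then have "x = x'" using x chart_facts(4)[OF c(1)] by (meson inj_onD)
    then show "x \<in> fst d" using x' by simp
  next
    fix x y assume "x \<in> chart_ball (topspace X) c p r" "y \<in> chart_ball (topspace X) c p r"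
    then show "dist (snd d x) (snd d y) \<le> L * dist (snd c x) (snd c y)"
      using r(4)[of "snd c x" "snd c y"] c
      by (auto simp: chart_ball_def trans_apply dist_norm norm_minus_commute[of "snd c p"])
  qed
qed

lemma manifold_lip_atlas: "lip_atlas X A"
proof -
  have "openin X G \<longleftrightarrow> G \<subseteq> topspace X \<and>
        (\<forall>p\<in>G. \<forall>a\<in>A. p \<in> fst a \<longrightarrow> (\<exists>r>0. chart_ball (topspace X) a p r \<subseteq> G))" (is "_ \<longleftrightarrow> ?R") for G
  proof
    assume G: "openin X G"
    show ?R
    proof (intro conjI ballI impI)
      show "G \<subseteq> topspace X" using G by (rule openin_subset)
      fix p c assume p: "p \<in> G" "c \<in> A" "p \<in> fst c"
      obtain r where r: "r > 0" "ball (snd c p) r \<subseteq> snd c ` (fst c \<inter> G)"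
        using open_chart_image[OF p(2) G] p by (meson IntI imageI openE)
      have "chart_ball (topspace X) c p r \<subseteq> G"
      proof
        fix x assume x: "x \<in> chart_ball (topspace X) c p r"
        then have "snd c x \<in> snd c ` (fst c \<inter> G)" "x \<in> fst c"
          using r(2) by (auto simp: chart_ball_def dist_commute)
        then show "x \<in> G" using chart_facts(4)[OF p(2)] by (auto dest: inj_onD)
      qed
      then show "\<exists>r>0. chart_ball (topspace X) c p r \<subseteq> G" using r by blast
    qed
  next
    assume R: ?R
    have "\<exists>H. openin X H \<and> p \<in> H \<and> H \<subseteq> G" if p: "p \<in> G" for p
    proof -
      obtain c where c: "c \<in> A" "p \<in> fst c" using R p chart_exists by blast
      obtain r where r: "r > 0" "chart_ball (topspace X) c p r \<subseteq> G" using R p c by meson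
      have "chart_ball (topspace X) c p r = {v \<in> fst c. snd c v \<in> ball (snd c p) r}"
        using chart_facts(5)[OF c(1)] by (auto simp: chart_ball_def dist_commute)
      then have "openin X (chart_ball (topspace X) c p r)"
        by (simp only: openin_chart_preimage[OF c(1) open_ball])
      moreover have "p \<in> chart_ball (topspace X) c p r" using chart_facts(5)[OF c(1)] c r by (auto simp: chart_ball_def)
      ultimately show ?thesis using r by blast
    qed
    then show "openin X G" by (subst openin_subopen) blast
  qed
  then show ?thesis unfolding lip_atlas_def using chart_facts(4) atlas_lip_at chart_exists by auto
qed

lemma tvec_of_fst [simp]: "fst (tvec_of A c p \<xi>) = p"
  by (simp add: tvec_of_def)

lemma tvec_of_comp: "d \<in> A \<Longrightarrow> p \<in> fst d \<Longrightarrow> snd (tvec_of A c p \<xi>) d = trans_deriv c d (snd c p) \<xi>"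
  by (simp add: tvec_of_def)

lemma tvec_of_self: "c \<in> A \<Longrightarrow> p \<in> fst c \<Longrightarrow> snd (tvec_of A c p \<xi>) c = \<xi>"
  by (simp add: tvec_of_comp trans_self)

lemma tvec_of_in: "c \<in> A \<Longrightarrow> p \<in> fst c \<Longrightarrow> tvec_of A c p \<xi> \<in> tangent_space A p"
  unfolding tangent_space_def by (auto simp: tvec_of_def trans_chain[symmetric])

lemma tangent_fst: "v \<in> tangent_space A p \<Longrightarrow> fst v = p"
  by (simp add: tangent_space_def)

lemma tangent_comp:
  "v \<in> tangent_space A p \<Longrightarrow> c \<in> A \<Longrightarrow> d \<in> A \<Longrightarrow> p \<in> fst c \<Longrightarrow> p \<in> fst d \<Longrightarrow>
     snd v d = trans_deriv c d (snd c p) (snd v c)"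
  unfolding tangent_space_def by blast

lemma tangent_eqI:
  assumes u: "u \<in> tangent_space A p" and v: "v \<in> tangent_space A p"
    and c: "c \<in> A" "p \<in> fst c" and eq: "snd u c = snd v c"
  shows "u = v"
proof -
  have "snd u d = snd v d" for d
  proof (cases "d \<in> A \<and> p \<in> fst d")
    case True then show ?thesis using tangent_comp[OF u c(1)] tangent_comp[OF v c(1)] c eq by metis
  next
    case False
    have "\<forall>c. c \<notin> A \<or> p \<notin> fst c \<longrightarrow> snd u c = 0" "\<forall>c. c \<notin> A \<or> p \<notin> fst c \<longrightarrow> snd v c = 0"
      using u v unfolding tangent_space_def by blast+
    with False show ?thesis by metis
  qed
  then show ?thesis using tangent_fst[OF u] tangent_fst[OF v] by (simp add: prod_eq_iff fun_eq_iff)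
qed

lemma tangent_tvec_of: "v \<in> tangent_space A p \<Longrightarrow> c \<in> A \<Longrightarrow> p \<in> fst c \<Longrightarrow> v = tvec_of A c p (snd v c)"
  by (rule tangent_eqI[of _ p _ c]) (auto simp: tvec_of_in tvec_of_self)

lemma tangent_spaceI:
  assumes "fst v = p"
    "\<And>c d. c \<in> A \<Longrightarrow> d \<in> A \<Longrightarrow> p \<in> fst c \<Longrightarrow> p \<in> fst d \<Longrightarrow> snd v d = trans_deriv c d (snd c p) (snd v c)"
    "\<And>c. c \<notin> A \<or> p \<notin> fst c \<Longrightarrow> snd v c = 0"
  shows "v \<in> tangent_space A p"
  unfolding tangent_space_def using assms by blast

lemma tangent_zero: "v \<in> tangent_space A p \<Longrightarrow> c \<notin> A \<or> p \<notin> fst c \<Longrightarrow> snd v c = 0"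
  unfolding tangent_space_def by blast

lemma tzero_in: "tzero p \<in> tangent_space A p"
  by (rule tangent_spaceI) (simp_all add: tzero_def linear_0[OF trans_linear])

lemma tadd_in:
  assumes u: "u \<in> tangent_space A p" and v: "v \<in> tangent_space A p"
  shows "tadd u v \<in> tangent_space A p"
proof (rule tangent_spaceI)
  fix c d assume "c \<in> A" "d \<in> A" "p \<in> fst c" "p \<in> fst d"
  then show "snd (tadd u v) d = trans_deriv c d (snd c p) (snd (tadd u v) c)"
    by (simp add: tadd_def linear_add[OF trans_linear] tangent_comp[OF u, of c d] tangent_comp[OF v, of c d])
qed (use tangent_fst[OF u] tangent_zero[OF u] tangent_zero[OF v] in \<open>simp_all add: tadd_def\<close>)

lemma tscale_in:
  assumes v: "v \<in> tangent_space A p"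
  shows "tscale r v \<in> tangent_space A p"
proof (rule tangent_spaceI)
  fix c d assume "c \<in> A" "d \<in> A" "p \<in> fst c" "p \<in> fst d"
  then show "snd (tscale r v) d = trans_deriv c d (snd c p) (snd (tscale r v) c)"
    by (simp add: tscale_def linear_cmul[OF trans_linear] tangent_comp[OF v, of c d])
qed (use tangent_fst[OF v] tangent_zero[OF v] in \<open>simp_all add: tscale_def\<close>)

definition tchart :: "('p, 'e) chart \<Rightarrow> (('p, 'e) tvec, 'e \<times> 'e) chart" where
  "tchart c = ({v. fst v \<in> fst c \<and> v \<in> tangent_space A (fst v)}, \<lambda>v. (snd c (fst v), snd v c))"

lemma tangent_charts_eq: "tangent_charts A = tchart ` A"
  by (simp add: tangent_charts_def tchart_def)

lemma tchart_inj:
  assumes "c \<in> A" shows "inj_on (snd (tchart c)) (fst (tchart c))"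
proof (rule inj_onI)
  fix u v assume "u \<in> fst (tchart c)" "v \<in> fst (tchart c)" "snd (tchart c) u = snd (tchart c) v"
  then have *: "fst u \<in> fst c" "u \<in> tangent_space A (fst u)" "fst v \<in> fst c" "v \<in> tangent_space A (fst v)"
    "snd c (fst u) = snd c (fst v)" "snd u c = snd v c" by (auto simp: tchart_def)
  then have "fst u = fst v" using chart_facts(4)[OF assms] by (meson inj_onD)
  then show "u = v" using tangent_eqI[of u "fst u" v c] * assms by metis
qed

text \<open>
  The components of a vector change by the Jacobian at its base point. This is linear in the
  components and Lipschitz in the base point, hence jointly Lipschitz as long as the components
  stay bounded.
\<close>

lemma tchart_lip_at:
  assumes c: "c \<in> A" and d: "d \<in> A" and v: "v \<in> fst (tchart c)" "v \<in> fst (tchart d)"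
  shows "lip_at (tchart c) (tchart d) N (\<lambda>x. x) v"
proof -
  let ?U = "snd c ` (fst c \<inter> fst d)" and ?D = "trans_deriv c d"
  have p: "fst v \<in> fst c" "fst v \<in> fst d" using v by (auto simp: tchart_def)
  have pU: "snd c (fst v) \<in> ?U" using p by auto
  obtain r L where r: "r > 0" "ball (snd c (fst v)) r \<subseteq> ?U" "L \<ge> 0"
    and DL: "\<And>y z w. y \<in> ball (snd c (fst v)) r \<Longrightarrow> z \<in> ball (snd c (fst v)) r \<Longrightarrow>
       norm (?D y w - ?D z w) \<le> L * norm (y - z) * norm w"
    using Ck1_1_derivative_lipschitz[OF trans_Ck1[OF c d] trans_open[OF c d] pU] by metis
  obtain s L' where s: "s > 0" "L' \<ge> 0" "(\<lambda>x. x) ` chart_ball (topspace X) c (fst v) s \<subseteq> fst d"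
    and tL: "\<forall>x\<in>chart_ball (topspace X) c (fst v) s. \<forall>y\<in>chart_ball (topspace X) c (fst v) s.
        dist (snd d x) (snd d y) \<le> L' * dist (snd c x) (snd c y)"
    using lip_atE[OF atlas_lip_at[OF c d p]] by metis
  obtain K where K: "K \<ge> 0" "\<And>w. norm (?D (snd c (fst v)) w) \<le> K * norm w"
    using linear_bounded_pos[OF trans_linear[OF c d p]] by (metis less_imp_le)
  define t where "t = min 1 (min r s)"
  have t: "t > 0" "t \<le> 1" "t \<le> r" "t \<le> s" using r s by (auto simp: t_def)
  have ball: "fst u \<in> chart_ball (topspace X) c (fst v) s \<and> snd c (fst u) \<in> ball (snd c (fst v)) r \<and>
      norm (snd u c) \<le> norm (snd v c) + 1 \<and> fst u \<in> fst c \<and> fst u \<in> fst d \<and> u \<in> tangent_space A (fst u)"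
    if u: "u \<in> chart_ball N (tchart c) v t" for u
  proof -
    have u': "fst u \<in> fst c" "u \<in> tangent_space A (fst u)" and
      du: "dist (snd c (fst u), snd u c) (snd c (fst v), snd v c) < t"
      using u by (auto simp: chart_ball_def tchart_def)
    have "dist (snd c (fst u)) (snd c (fst v)) < t"
      using du dist_fst_le[of "(snd c (fst u), snd u c)" "(snd c (fst v), snd v c)"] by simp
    moreover have "dist (snd u c) (snd v c) < t"
      using du dist_snd_le[of "(snd c (fst u), snd u c)" "(snd c (fst v), snd v c)"] by simp
    moreover from this have "norm (snd u c) \<le> norm (snd v c) + 1"
      using t norm_triangle_ineq[of "snd u c - snd v c" "snd v c"] by (simp add: dist_norm)
    moreover have "fst u \<in> topspace X" using u' chart_facts(5)[OF c] by blast
    ultimately have 1: "fst u \<in> chart_ball (topspace X) c (fst v) s \<and> snd c (fst u) \<in> ball (snd c (fst v)) r \<and>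
      norm (snd u c) \<le> norm (snd v c) + 1"
      using u' t by (auto simp: chart_ball_def dist_commute)
    then have "fst u \<in> fst d" using s(3) by blast
    then show ?thesis using 1 u' by blast
  qed
  define B where "B = L' + (K + L * r) + L * (norm (snd v c) + 1)"
  show ?thesis
  proof (rule lip_atI[of t B])
    show "t > 0" by (rule t)
    show "B \<ge> 0" using s(2) K(1) r by (auto simp: B_def)
    fix u assume "u \<in> chart_ball N (tchart c) v t"
    then show "u \<in> fst (tchart d)" using ball[of u] by (simp add: tchart_def)
  next
    fix u w assume u: "u \<in> chart_ball N (tchart c) v t" and w: "w \<in> chart_ball N (tchart c) v t"
    note bu = ball[OF u] and bw = ball[OF w]
    let ?\<Delta> = "dist (snd (tchart c) u) (snd (tchart c) w)"
    have \<Delta>: "norm (snd c (fst u) - snd c (fst w)) \<le> ?\<Delta>" "norm (snd u c - snd w c) \<le> ?\<Delta>"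
      using dist_fst_le[of "snd (tchart c) u" "snd (tchart c) w"] dist_snd_le[of "snd (tchart c) u" "snd (tchart c) w"]
      by (simp_all add: tchart_def dist_norm)
    have su: "snd u d = ?D (snd c (fst u)) (snd u c)" and sw: "snd w d = ?D (snd c (fst w)) (snd w c)"
      using tangent_comp[OF _ c d] bu bw by blast+
    have lin: "linear (?D (snd c (fst u)))" using trans_linear[OF c d] bu by blast
    have e1: "snd u d - snd w d = ?D (snd c (fst u)) (snd u c - snd w c) +
        (?D (snd c (fst u)) (snd w c) - ?D (snd c (fst w)) (snd w c))"
      unfolding su sw by (simp add: linear_diff[OF lin])
    have e2: "norm (?D (snd c (fst u)) (snd u c - snd w c)) \<le> (K + L * r) * ?\<Delta>"
    proof -
      let ?z = "snd u c - snd w c"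
      have "norm (?D (snd c (fst u)) ?z) \<le> norm (?D (snd c (fst v)) ?z) +
          norm (?D (snd c (fst u)) ?z - ?D (snd c (fst v)) ?z)"
        by (rule norm_triangle_sub)
      also have "\<dots> \<le> K * norm ?z + L * norm (snd c (fst u) - snd c (fst v)) * norm ?z"
        using bu r(1) by (intro add_mono K DL) auto
      also have "\<dots> \<le> K * norm ?z + L * r * norm ?z"
        using bu r(3) by (intro add_mono order_refl mult_right_mono mult_left_mono norm_ge_zero)
            (auto simp: dist_norm norm_minus_commute[of "snd c (fst v)"])
      also have "\<dots> = (K + L * r) * norm ?z" by (simp add: algebra_simps)
      also have "\<dots> \<le> (K + L * r) * ?\<Delta>" using K r by (intro mult_left_mono \<Delta>) auto
      finally show ?thesis .
    qed
    have e3: "norm (?D (snd c (fst u)) (snd w c) - ?D (snd c (fst w)) (snd w c)) \<le> L * (norm (snd v c) + 1) * ?\<Delta>"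
    proof -
      have "norm (?D (snd c (fst u)) (snd w c) - ?D (snd c (fst w)) (snd w c))
          \<le> L * norm (snd c (fst u) - snd c (fst w)) * norm (snd w c)"
        using bu bw by (intro DL) auto
      also have "\<dots> \<le> L * ?\<Delta> * (norm (snd v c) + 1)"
        using bw r(3) by (intro mult_mono mult_nonneg_nonneg \<Delta>) auto
      finally show ?thesis by (simp add: mult_ac)
    qed
    have 2: "dist (snd u d) (snd w d) \<le> (K + L * r) * ?\<Delta> + L * (norm (snd v c) + 1) * ?\<Delta>"
      unfolding dist_norm e1 by (rule norm_triangle_le) (use e2 e3 in \<open>simp add: dist_norm\<close>)
    have "dist (snd d (fst u)) (snd d (fst w)) \<le> L' * dist (snd c (fst u)) (snd c (fst w))"
      using tL bu bw by blast
    also have "\<dots> \<le> L' * ?\<Delta>" using s(2) \<Delta>(1) by (intro mult_left_mono) (auto simp: dist_norm)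
    finally have 1: "dist (snd d (fst u)) (snd d (fst w)) \<le> L' * ?\<Delta>" .
    have "dist (snd (tchart d) u) (snd (tchart d) w) \<le> dist (snd d (fst u)) (snd d (fst w)) + dist (snd u d) (snd w d)"
      unfolding tchart_def snd_conv dist_norm diff_Pair by (rule norm_Pair_le)
    also have "\<dots> \<le> B * ?\<Delta>" using 1 2 by (simp add: B_def algebra_simps)
    finally show "dist (snd (tchart d) u) (snd (tchart d) w) \<le> B * ?\<Delta>" .
  qed
qed

lemma tangent_lip_atlas: "lip_atlas (tangent_topology A) (tangent_charts A)"
  and topspace_tangent: "topspace (tangent_topology A) = {v. fst v \<in> topspace X \<and> v \<in> tangent_space A (fst v)}"
proof -
  have "inj_on (snd a) (fst a)" if "a \<in> tangent_charts A" for a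
    using that tchart_inj by (auto simp: tangent_charts_eq)
  moreover have "lip_at a b (\<Union>a\<in>tangent_charts A. fst a) (\<lambda>x. x) p"
    if ab: "a \<in> tangent_charts A" "b \<in> tangent_charts A" "p \<in> fst a" "p \<in> fst b" for a b p
  proof -
    obtain c d where "c \<in> A" "d \<in> A" "a = tchart c" "b = tchart d"
      using ab(1,2) unfolding tangent_charts_eq by blast
    then show ?thesis using tchart_lip_at ab(3,4) by metis
  qed
  ultimately have *: "lip_atlas (tangent_topology A) (tangent_charts A)"
    "topspace (tangent_topology A) = (\<Union>a\<in>tangent_charts A. fst a)"
    unfolding tangent_topology_def using lip_atlas_generated[of "tangent_charts A"] by blast+
  show "lip_atlas (tangent_topology A) (tangent_charts A)" by (rule *)
  show "topspace (tangent_topology A) = {v. fst v \<in> topspace X \<and> v \<in> tangent_space A (fst v)}"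
    unfolding *(2) tangent_charts_eq using chart_exists chart_facts(5) by (auto simp: tchart_def)
qed

end

section \<open>Geodesics and the exponential map\<close>

text \<open>
  The expression of \<open>christoffel\<close> for arbitrary coefficients, so that coefficients and vectors can
  be varied one at a time.
\<close>

definition trilinear_form :: "('n \<Rightarrow> 'n \<Rightarrow> 'n \<Rightarrow> real) \<Rightarrow> real^'n \<Rightarrow> real^'n \<Rightarrow> real^'n::finite" where
  "trilinear_form a u w = (\<chi> \<mu>. \<Sum>\<alpha>\<in>UNIV. \<Sum>\<beta>\<in>UNIV. a \<mu> \<alpha> \<beta> * u $ \<alpha> * w $ \<beta>)"

lemma christoffel_trilinear: "christoffel \<Gamma> c x u w = trilinear_form (\<Gamma> c x) u w"
  by (simp add: christoffel_def trilinear_form_def)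

lemma trilinear_form_bound:
  assumes "\<And>\<mu> \<alpha> \<beta>. \<bar>a \<mu> \<alpha> \<beta>\<bar> \<le> k"
  shows "norm (trilinear_form a u w :: real^'n::finite) \<le> of_nat CARD('n) ^ 3 * k * norm u * norm w"
proof -
  let ?n = "of_nat CARD('n) :: real"
  have 1: "\<bar>trilinear_form a u w $ \<mu>\<bar> \<le> ?n * (?n * (k * norm u * norm w))" for \<mu>
  proof -
    have "\<bar>trilinear_form a u w $ \<mu>\<bar> \<le> (\<Sum>\<alpha>\<in>(UNIV::'n set). \<Sum>\<beta>\<in>(UNIV::'n set). k * norm u * norm w)"
      unfolding trilinear_form_def vec_lambda_beta
    proof (rule order_trans[OF sum_abs sum_mono], rule order_trans[OF sum_abs sum_mono])
      fix \<alpha> \<beta>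
      show "\<bar>a \<mu> \<alpha> \<beta> * u $ \<alpha> * w $ \<beta>\<bar> \<le> k * norm u * norm w"
        unfolding abs_mult using assms[of \<mu> \<alpha> \<beta>]
        by (intro mult_mono component_le_norm_cart) auto
    qed
    then show ?thesis by simp
  qed
  have "norm (trilinear_form a u w) \<le> (\<Sum>\<mu>\<in>UNIV. \<bar>trilinear_form a u w $ \<mu>\<bar>)" by (rule norm_le_l1_cart)
  also have "\<dots> \<le> (\<Sum>\<mu>\<in>(UNIV::'n set). ?n * (?n * (k * norm u * norm w)))" by (intro sum_mono 1)
  finally show ?thesis by (simp add: power3_eq_cube mult_ac)
qed

lemma trilinear_form_diff:
  "trilinear_form a u u - trilinear_form b w w =
     trilinear_form (\<lambda>\<mu> \<alpha> \<beta>. a \<mu> \<alpha> \<beta> - b \<mu> \<alpha> \<beta>) u u + trilinear_form b (u - w) u + trilinear_form b w (u - w)"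
  by (simp add: trilinear_form_def vec_eq_iff sum.distrib[symmetric] sum_subtractf[symmetric] algebra_simps)

lemma trilinear_form_scale: "trilinear_form a (r *\<^sub>R u) (r *\<^sub>R u) = r\<^sup>2 *\<^sub>R trilinear_form a u u"
  by (simp add: trilinear_form_def vec_eq_iff sum_distrib_left power2_eq_square mult_ac)

locale spray_manifold =
  fixes M :: "'m topology" and A :: "('m, real^'n) chart set" and \<Gamma> :: "('m, 'n::finite) symbols"
  assumes M2: "Ck1_manifold 2 M A" and conn: "lipschitz_connection A \<Gamma>"

lemma Ck1_manifold_2_imp_1:
  fixes A :: "('m, 'e::euclidean_space) chart set"
  assumes M: "Ck1_manifold 2 M A" shows "Ck1_manifold 1 M A"
proof -
  have "Ck1 1 (snd a ` {p \<in> fst a. p \<in> fst b}) (chart_rep a b (\<lambda>p. p))" if ab: "a \<in> A" "b \<in> A" for a b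
  proof -
    have op: "openin M (fst a)" "openin M (fst b)" "open (snd a ` fst a)"
      and h: "homeomorphic_map (subtopology M (fst a)) (top_of_set (snd a ` fst a)) (snd a)"
      using M ab by (auto simp: Ck1_manifold_def)
    have "openin (subtopology M (fst a)) {p \<in> fst a. p \<in> fst b}"
      using op by (simp add: openin_subtopology_Int2 Int_def[symmetric])
    moreover have "open_map (subtopology M (fst a)) (top_of_set (snd a ` fst a)) (snd a)"
      using h by (simp add: homeomorphic_eq_everything_map)
    ultimately have "openin (top_of_set (snd a ` fst a)) (snd a ` {p \<in> fst a. p \<in> fst b})"
      by (simp add: open_map_def)
    then have "open (snd a ` {p \<in> fst a. p \<in> fst b})" using op(3) by (simp add: openin_open_eq)
    moreover have "Ck1 (Suc 1) (snd a ` {p \<in> fst a. p \<in> fst b}) (chart_rep a b (\<lambda>p. p))"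
      using M ab by (simp add: Ck1_manifold_def Ck1_map_def numeral_2_eq_2 del: Ck1.simps)
    ultimately show ?thesis by (rule Ck1_antimono)
  qed
  then show ?thesis using M by (simp add: Ck1_manifold_def Ck1_map_def del: Ck1.simps)
qed

sublocale spray_manifold \<subseteq> c11_manifold M A
  by unfold_locales (rule Ck1_manifold_2_imp_1[OF M2])

context spray_manifold begin

abbreviation "Q c x u \<equiv> christoffel \<Gamma> c x u u"

text \<open>
  A quadratic form with Lipschitz coefficients has, in the base point, a Lipschitz constant of
  order \<open>|u|\<^sup>2\<close> and, in \<open>u\<close>, one of order \<open>|u|\<close>. This behaviour for small \<open>u\<close> is what the
  rescaling in \<open>local_geodesics\<close> exploits.
\<close>

lemma spray_estimate:
  assumes c: "c \<in> A" and p: "p \<in> fst c"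
  obtains \<rho> C where "\<rho> > 0" "C \<ge> 0" "cball (snd c p) \<rho> \<subseteq> snd c ` fst c"
    "\<forall>x\<in>cball (snd c p) \<rho>. \<forall>x'\<in>cball (snd c p) \<rho>. \<forall>u u'.
       norm (Q c x u - Q c x' u') \<le> C * (norm (x - x') * (norm u)\<^sup>2 + norm (u - u') * (norm u + norm u'))"
proof -
  let ?x0 = "snd c p"
  have G: "Ck1 0 (snd c ` fst c) (\<lambda>x. \<Gamma> c x \<mu> \<alpha> \<beta>)" for \<mu> \<alpha> \<beta>
    using conn c unfolding lipschitz_connection_def by blast
  have x0: "?x0 \<in> snd c ` fst c" using p by blast
  obtain R LL where R: "R > 0" "ball ?x0 R \<subseteq> snd c ` fst c" and LL0: "LL \<ge> 0"
    and lip0: "\<forall>i::'n \<times> 'n \<times> 'n. \<forall>y\<in>ball ?x0 R. \<forall>z\<in>ball ?x0 R.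
      norm (\<Gamma> c y (fst i) (fst (snd i)) (snd (snd i)) - \<Gamma> c z (fst i) (fst (snd i)) (snd (snd i))) \<le> LL * norm (y - z)"
    by (rule Ck1_0_uniform[where f = "\<lambda>i x. \<Gamma> c x (fst i) (fst (snd i)) (snd (snd i))", OF G chart_facts(2)[OF c] x0])
  have lip: "\<bar>\<Gamma> c y \<mu> \<alpha> \<beta> - \<Gamma> c z \<mu> \<alpha> \<beta>\<bar> \<le> LL * norm (y - z)" if "y \<in> ball ?x0 R" "z \<in> ball ?x0 R" for y z \<mu> \<alpha> \<beta>
    using lip0[rule_format, OF that, of "(\<mu>, \<alpha>, \<beta>)"] by simp
  define K where "K = (\<Sum>\<mu>\<in>UNIV. \<Sum>\<alpha>\<in>UNIV. \<Sum>\<beta>\<in>UNIV. \<bar>\<Gamma> c ?x0 \<mu> \<alpha> \<beta>\<bar>) + LL * R"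
  have K: "\<bar>\<Gamma> c y \<mu> \<alpha> \<beta>\<bar> \<le> K" if y: "y \<in> ball ?x0 R" for y \<mu> \<alpha> \<beta>
  proof -
    have "\<bar>\<Gamma> c ?x0 \<mu> \<alpha> \<beta>\<bar> \<le> (\<Sum>\<beta>\<in>UNIV. \<bar>\<Gamma> c ?x0 \<mu> \<alpha> \<beta>\<bar>)" by (rule member_le_sum) auto
    also have "\<dots> \<le> (\<Sum>\<alpha>\<in>UNIV. \<Sum>\<beta>\<in>UNIV. \<bar>\<Gamma> c ?x0 \<mu> \<alpha> \<beta>\<bar>)" by (rule member_le_sum) (auto intro: sum_nonneg)
    also have "\<dots> \<le> (\<Sum>\<mu>\<in>UNIV. \<Sum>\<alpha>\<in>UNIV. \<Sum>\<beta>\<in>UNIV. \<bar>\<Gamma> c ?x0 \<mu> \<alpha> \<beta>\<bar>)" by (rule member_le_sum) (auto intro: sum_nonneg)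
    finally have 1: "\<bar>\<Gamma> c ?x0 \<mu> \<alpha> \<beta>\<bar> \<le> \<dots>" .
    have "\<bar>\<Gamma> c y \<mu> \<alpha> \<beta> - \<Gamma> c ?x0 \<mu> \<alpha> \<beta>\<bar> \<le> LL * norm (y - ?x0)" using y R by (intro lip) auto
    also have "\<dots> \<le> LL * R" using y LL0 by (intro mult_left_mono) (auto simp: dist_norm norm_minus_commute)
    finally show ?thesis using 1 by (simp add: K_def)
  qed
  have K0: "K \<ge> 0" using LL0 R by (auto simp: K_def intro!: add_nonneg_nonneg sum_nonneg)
  let ?n = "of_nat CARD('n) ^ 3 :: real"
  show ?thesis
  proof (rule that[of "R / 2" "?n * (LL + K)"]; (intro ballI allI)?)
    show "R / 2 > 0" using R by simp
    show "?n * (LL + K) \<ge> 0" using LL0 K0 by simp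
    have "cball ?x0 (R / 2) \<subseteq> ball ?x0 R" using R(1) by (auto simp: subset_iff)
    then show "cball ?x0 (R / 2) \<subseteq> snd c ` fst c" using R(2) by blast
    fix x x' :: "real^'n" and u u' :: "real^'n" assume "x \<in> cball ?x0 (R / 2)" "x' \<in> cball ?x0 (R / 2)"
    then have x: "x \<in> ball ?x0 R" "x' \<in> ball ?x0 R" using R(1) by auto
    have "norm (Q c x u - Q c x' u') \<le> norm (trilinear_form (\<lambda>\<mu> \<alpha> \<beta>. \<Gamma> c x \<mu> \<alpha> \<beta> - \<Gamma> c x' \<mu> \<alpha> \<beta>) u u) +
        norm (trilinear_form (\<Gamma> c x') (u - u') u) + norm (trilinear_form (\<Gamma> c x') u' (u - u'))"
      unfolding christoffel_trilinear trilinear_form_diff by (intro norm_triangle_le add_right_mono norm_triangle_ineq)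
    also have "\<dots> \<le> ?n * (LL * norm (x - x')) * norm u * norm u + ?n * K * norm (u - u') * norm u
        + ?n * K * norm u' * norm (u - u')"
      by (intro add_mono trilinear_form_bound lip K x)
    also have "\<dots> = ?n * (LL * (norm (x - x') * (norm u)\<^sup>2) + K * (norm (u - u') * (norm u + norm u')))"
      by (simp add: algebra_simps power2_eq_square)
    also have "\<dots> \<le> ?n * ((LL + K) * (norm (x - x') * (norm u)\<^sup>2) + (LL + K) * (norm (u - u') * (norm u + norm u')))"
      using LL0 K0 by (intro mult_left_mono add_mono mult_right_mono) auto
    finally show "norm (Q c x u - Q c x' u') \<le> ?n * (LL + K) * (norm (x - x') * (norm u)\<^sup>2 + norm (u - u') * (norm u + norm u'))"
      by (simp add: algebra_simps)
  qed
qed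

lemma spray_scale: "Q c x (r *\<^sub>R u) = r\<^sup>2 *\<^sub>R Q c x u"
  by (simp add: christoffel_trilinear trilinear_form_scale)

lemma trans_second_derivative:
  assumes cd: "c \<in> A" "d \<in> A" and p: "p \<in> fst c" "p \<in> fst d"
  shows "((\<lambda>z. trans_deriv c d z u) has_derivative frechet_derivative (\<lambda>z. trans_deriv c d z u) (at (snd c p))) (at (snd c p))"
proof -
  have "Ck1 (Suc (Suc 0)) (snd c ` {p \<in> fst c. p \<in> fst d}) (trans_map c d)"
    using M2 cd by (simp add: Ck1_manifold_def Ck1_map_def numeral_2_eq_2 del: Ck1.simps)
  then have "(\<lambda>z. trans_deriv c d z u) differentiable (at (snd c p))"
    using p unfolding Ck1.simps(2) by blast
  then show ?thesis by (simp add: frechet_derivative_works)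
qed

text \<open>
  The transformation law of the Christoffel symbols compensates the second derivative of the
  coordinate change that appears when the velocity is differentiated.
\<close>

lemma spray_change_of_chart:
  assumes cd: "c \<in> A" "d \<in> A" and I: "open I" "t \<in> I"
    and xI: "\<And>s. s \<in> I \<Longrightarrow> x s \<in> snd c ` (fst c \<inter> fst d)"
    and x': "(x has_vector_derivative u t) (at t)"
    and u': "(u has_vector_derivative - Q c (x t) (u t)) (at t)"
  shows "((\<lambda>s. trans_map c d (x s)) has_vector_derivative trans_deriv c d (x t) (u t)) (at t)"
    and "((\<lambda>s. trans_deriv c d (x s) (u s)) has_vector_derivative
           - Q d (trans_map c d (x t)) (trans_deriv c d (x t) (u t))) (at t)"
proof -
  obtain p where p: "p \<in> fst c" "p \<in> fst d" "x t = snd c p" using xI[OF I(2)] by auto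
  let ?D = "trans_deriv c d"
  have chain: "((\<lambda>s. h (x s)) has_vector_derivative h' (u t)) (at t)" if "(h has_derivative h') (at (snd c p))"
    for h :: "real^'n \<Rightarrow> real^'n" and h'
    using vector_derivative_diff_chain_within[of x "u t" t UNIV h h'] x' that p(3)
    by (simp add: o_def has_derivative_at_withinI)
  show "((\<lambda>s. trans_map c d (x s)) has_vector_derivative ?D (x t) (u t)) (at t)"
    unfolding p(3) by (rule chain[OF trans_has_derivative[OF cd p(1,2)]])
  have linD: "linear (?D (x s))" if "s \<in> I" for s
    using xI[OF that] trans_linear[OF cd] by auto
  \<comment> \<open>The second derivative of the coordinate change is given for one fixed direction at a time, so
    the moving velocity is expanded in the basis.\<close>
  have expand: "?D (x s) w = (\<Sum>b\<in>Basis. (w \<bullet> b) *\<^sub>R ?D (x s) b)" if "s \<in> I" for s w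
    by (rule linear_Basis_expansion[OF linD[OF that]])
  let ?H = "\<lambda>b. frechet_derivative (\<lambda>z. ?D z b) (at (x t))"
  have H: "((\<lambda>z. ?D z b) has_derivative ?H b) (at (snd c p))" for b
    using trans_second_derivative[OF cd p(1,2)] p(3) by simp
  have Hsum: "?H (u t) w = (\<Sum>b\<in>Basis. (u t \<bullet> b) *\<^sub>R ?H b w)" for w
  proof -
    have e1: "((\<lambda>z. \<Sum>b\<in>Basis. (u t \<bullet> b) *\<^sub>R ?D z b) has_derivative (\<lambda>w. \<Sum>b\<in>Basis. (u t \<bullet> b) *\<^sub>R ?H b w)) (at (snd c p))"
      by (intro has_derivative_sum has_derivative_scaleR_right H)
    have e2: "(\<Sum>b\<in>Basis. (u t \<bullet> b) *\<^sub>R ?D z b) = ?D z (u t)" if "z \<in> snd c ` (fst c \<inter> fst d)" for z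
    proof -
      have "linear (?D z)" using that trans_linear[OF cd] by auto
      then show ?thesis by (rule linear_Basis_expansion[symmetric])
    qed
    have "((\<lambda>z. ?D z (u t)) has_derivative (\<lambda>w. \<Sum>b\<in>Basis. (u t \<bullet> b) *\<^sub>R ?H b w)) (at (snd c p))"
      by (rule has_derivative_transform_within_open[OF e1 trans_open[OF cd] _ e2]) (use p in auto)
    from fun_cong[OF has_derivative_unique[OF this H], of w] show ?thesis by (rule sym)
  qed
  have 1: "((\<lambda>s. \<Sum>b\<in>Basis. (u s \<bullet> b) *\<^sub>R ?D (x s) b) has_vector_derivative
      (\<Sum>b\<in>Basis. (u t \<bullet> b) *\<^sub>R ?H b (u t) + (- Q c (x t) (u t) \<bullet> b) *\<^sub>R ?D (x t) b)) (at t)"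
  proof (rule has_vector_derivative_sum)
    fix b :: "real^'n"
    have "((\<lambda>s. u s \<bullet> b) has_field_derivative (- Q c (x t) (u t) \<bullet> b)) (at t)"
      unfolding has_real_derivative_iff_has_vector_derivative
      by (rule bounded_linear.has_vector_derivative[OF bounded_linear_inner_left u'])
    from has_vector_derivative_scaleR[OF this chain[OF H]]
    show "((\<lambda>s. (u s \<bullet> b) *\<^sub>R ?D (x s) b) has_vector_derivative
        (u t \<bullet> b) *\<^sub>R ?H b (u t) + (- Q c (x t) (u t) \<bullet> b) *\<^sub>R ?D (x t) b) (at t)" .
  qed
  have law: "?D (x t) (Q c (x t) (u t)) = ?H (u t) (u t) + Q d (trans_map c d (x t)) (?D (x t) (u t))"
  proof -
    have "\<forall>p \<in> fst c \<inter> fst d. \<forall>u w.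
        let \<tau> = chart_rep c d (\<lambda>p. p); x = snd c p; D = (\<lambda>z. frechet_derivative \<tau> (at z))
        in D x (christoffel \<Gamma> c x u w) =
             frechet_derivative (\<lambda>z. D z u) (at x) w + christoffel \<Gamma> d (\<tau> x) (D x u) (D x w)"
      using conn cd unfolding lipschitz_connection_def by blast
    then show ?thesis unfolding p(3) Let_def using p by blast
  qed
  have "(\<Sum>b\<in>Basis. (u t \<bullet> b) *\<^sub>R ?H b (u t) + (- Q c (x t) (u t) \<bullet> b) *\<^sub>R ?D (x t) b)
      = ?H (u t) (u t) + ?D (x t) (- Q c (x t) (u t))"
    unfolding Hsum[of "u t"] expand[OF I(2), of "- Q c (x t) (u t)"] by (rule sum.distrib)
  also have "\<dots> = - Q d (trans_map c d (x t)) (?D (x t) (u t))"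
    using law by (simp add: linear_neg[OF linD[OF I(2)]])
  finally have 2: "(\<Sum>b\<in>Basis. (u t \<bullet> b) *\<^sub>R ?H b (u t) + (- Q c (x t) (u t) \<bullet> b) *\<^sub>R ?D (x t) b)
      = - Q d (trans_map c d (x t)) (?D (x t) (u t))" .
  show "((\<lambda>s. ?D (x s) (u s)) has_vector_derivative - Q d (trans_map c d (x t)) (?D (x t) (u t))) (at t)"
    by (rule has_vector_derivative_transform_within_open[OF 1[unfolded 2] I]) (simp add: expand[symmetric])
qed

text \<open>
  A geodesic has to solve its equation in every chart that it meets; by \<open>spray_change_of_chart\<close>
  one chart is enough.
\<close>

lemma geodesic_from_chart:
  assumes c: "c \<in> A" and I: "open I" "is_interval I"
    and xI: "\<And>t. t \<in> I \<Longrightarrow> x t \<in> snd c ` fst c"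
    and x': "\<And>t. t \<in> I \<Longrightarrow> (x has_vector_derivative u t) (at t)"
    and u': "\<And>t. t \<in> I \<Longrightarrow> (u has_vector_derivative - Q c (x t) (u t)) (at t)"
  shows "geodesic_on M A \<Gamma> I (\<lambda>t. tvec_of A c (inv_into (fst c) (snd c) (x t)) (u t))"
proof -
  let ?q = "\<lambda>t. inv_into (fst c) (snd c) (x t)"
  let ?V = "\<lambda>t. tvec_of A c (?q t) (u t)"
  have q: "?q t \<in> fst c" "snd c (?q t) = x t" if "t \<in> I" for t
    using xI[OF that] by (auto simp: inv_into_into f_inv_into_f)
  have contx: "continuous_on I x"
    using x' has_vector_derivative_continuous by (meson continuous_at_imp_continuous_on)
  have qG: "t \<in> I \<Longrightarrow> ?q t \<in> G \<longleftrightarrow> x t \<in> snd c ` (fst c \<inter> G)" for t G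
  proof
    assume t: "t \<in> I" and "x t \<in> snd c ` (fst c \<inter> G)"
    then obtain p where "p \<in> fst c" "p \<in> G" "x t = snd c p" by auto
    moreover from this have "?q t = p" using chart_facts(4)[OF c] by simp
    ultimately show "?q t \<in> G" by simp
  next
    assume t: "t \<in> I" and "?q t \<in> G"
    then show "x t \<in> snd c ` (fst c \<inter> G)" using q[OF t] by (metis IntI imageI)
  qed
  have pre: "openin (top_of_set I) {t \<in> I. ?q t \<in> G}" if G: "openin M G" for G
  proof -
    have "{t \<in> I. ?q t \<in> G} = I \<inter> x -` (snd c ` (fst c \<inter> G))" using qG by auto
    then show ?thesis using continuous_openin_preimage_gen[OF contx open_chart_image[OF c G]] by simp
  qed
  have cont: "continuous_map (top_of_set I) M (fst \<circ> ?V)"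
    unfolding continuous_map_def using pre chart_facts(5)[OF c] q(1) by auto
  have der: "((\<lambda>s. snd d (?q s)) has_vector_derivative snd (?V t) d) (at t) \<and>
        ((\<lambda>s. snd (?V s) d) has_vector_derivative - Q d (snd d (?q t)) (snd (?V t) d)) (at t)"
    if t: "t \<in> I" and d: "d \<in> A" "?q t \<in> fst d" for t d
  proof -
    define I' where "I' = {t \<in> I. ?q t \<in> fst d}"
    have I': "open I'" "t \<in> I'" using pre[OF chart_facts(1)[OF d(1)]] I(1) t d by (auto simp: I'_def openin_open_eq)
    have xI': "x s \<in> snd c ` (fst c \<inter> fst d)" if "s \<in> I'" for s using that qG by (auto simp: I'_def)
    have eq: "trans_map c d (x s) = snd d (?q s)" "trans_deriv c d (x s) (u s) = snd (?V s) d" if "s \<in> I'" for s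
    proof -
      have s: "s \<in> I" "?q s \<in> fst d" using that by (auto simp: I'_def)
      show "trans_map c d (x s) = snd d (?q s)" using trans_apply[OF c q(1)[OF s(1)], of d] q(2)[OF s(1)] by simp
      show "trans_deriv c d (x s) (u s) = snd (?V s) d" using tvec_of_comp[OF d(1) s(2)] q(2)[OF s(1)] by simp
    qed
    note D = spray_change_of_chart[OF c d(1) I' xI' x'[OF t] u'[OF t]]
    show ?thesis
    proof
      show "((\<lambda>s. snd d (?q s)) has_vector_derivative snd (?V t) d) (at t)"
        using has_vector_derivative_transform_within_open[OF D(1) I' eq(1)] eq(2)[OF I'(2)] by simp
      show "((\<lambda>s. snd (?V s) d) has_vector_derivative - Q d (snd d (?q t)) (snd (?V t) d)) (at t)"
        using has_vector_derivative_transform_within_open[OF D(2) I' eq(2)] eq[OF I'(2)] by simp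
    qed
  qed
  show ?thesis
    unfolding geodesic_on_def
  proof (intro conjI ballI impI)
    fix t assume t: "t \<in> I"
    show "?V t \<in> tangent_space A (fst (?V t))" using tvec_of_in[OF c q(1)[OF t]] by simp
    fix d assume "d \<in> A" "fst (?V t) \<in> fst d"
    then have d: "d \<in> A" "?q t \<in> fst d" by auto
    show "((\<lambda>s. snd d (fst (?V s))) has_vector_derivative snd (?V t) d) (at t)"
      "((\<lambda>s. snd (?V s) d) has_vector_derivative - Q d (snd d (fst (?V t))) (snd (?V t) d)) (at t)"
      using der[OF t d] by simp_all
  qed (use I cont in simp_all)
qed

text \<open>
  In a chart the difference of two solutions has a derivative bounded by a multiple of the
  difference itself; since it vanishes at \<open>t0\<close>, it vanishes nearby by \<open>linear_growth_bound\<close>.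
\<close>

lemma geodesic_local_uniqueness:
  assumes V1: "geodesic_on M A \<Gamma> I V1" and V2: "geodesic_on M A \<Gamma> I V2"
    and t0: "t0 \<in> I" and eq: "V1 t0 = V2 t0"
  obtains \<eta> where "\<eta> > 0" "\<And>t. \<bar>t - t0\<bar> < \<eta> \<Longrightarrow> t \<in> I \<and> V1 t = V2 t"
proof -
  let ?p = "fst (V1 t0)"
  have I: "open I" using V1 by (simp add: geodesic_on_def)
  have cont: "continuous_map (top_of_set I) M (fst \<circ> V1)" "continuous_map (top_of_set I) M (fst \<circ> V2)"
    using V1 V2 by (auto simp: geodesic_on_def)
  have "?p \<in> topspace M" using cont(1) t0 by (auto simp: continuous_map_def)
  then obtain c where c: "c \<in> A" "?p \<in> fst c" using chart_exists by blast
  obtain \<rho> C where \<rho>: "\<rho> > 0" "C \<ge> 0"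
    and Ql0: "\<forall>x\<in>cball (snd c ?p) \<rho>. \<forall>x'\<in>cball (snd c ?p) \<rho>. \<forall>u u'.
       norm (Q c x u - Q c x' u') \<le> C * (norm (x - x') * (norm u)\<^sup>2 + norm (u - u') * (norm u + norm u'))"
    by (rule spray_estimate[OF c])
  note Ql = Ql0[rule_format]
  define R where "R = norm (snd (V1 t0) c) + 1"
  have R: "R > 0" by (simp add: R_def add_nonneg_pos)
  have near: "\<exists>e>0. \<forall>t. \<bar>t - t0\<bar> < e \<longrightarrow> t \<in> I \<and> fst (V t) \<in> fst c \<and>
      snd c (fst (V t)) \<in> cball (snd c ?p) \<rho> \<and> norm (snd (V t) c) \<le> R"
    if V: "geodesic_on M A \<Gamma> I V" and V0: "V t0 = V1 t0" for V
  proof -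
    have contV: "continuous_map (top_of_set I) M (fst \<circ> V)" using V by (simp add: geodesic_on_def)
    have "openin (top_of_set I) {t \<in> I. fst (V t) \<in> fst c}"
      using contV chart_facts(1)[OF c(1)] by (auto simp: continuous_map_def)
    then have o: "open {t \<in> I. fst (V t) \<in> fst c}" using I by (simp add: openin_open_eq)
    have e1: "\<forall>\<^sub>F t in at t0. t \<in> I \<and> fst (V t) \<in> fst c"
      using eventually_at_topological[of "\<lambda>t. t \<in> I \<and> fst (V t) \<in> fst c" t0 UNIV] o t0 c(2) V0 by auto
    have pc: "fst (V t0) \<in> fst c" using c(2) V0 by simp
    have d: "((\<lambda>s. snd c (fst (V s))) has_vector_derivative snd (V t0) c) (at t0)"
      "((\<lambda>s. snd (V s) c) has_vector_derivative - Q c (snd c (fst (V t0))) (snd (V t0) c)) (at t0)"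
      using V c(1) t0 pc unfolding geodesic_on_def by blast+
    have lim: "((\<lambda>s. snd c (fst (V s))) \<longlongrightarrow> snd c (fst (V t0))) (at t0)" "((\<lambda>s. snd (V s) c) \<longlongrightarrow> snd (V t0) c) (at t0)"
      using d[THEN has_vector_derivative_continuous] by (simp_all add: isCont_def)
    from e1 tendstoD[OF lim(1) \<rho>(1)] tendstoD[OF lim(2) zero_less_one] have "\<forall>\<^sub>F s in at t0. (s \<in> I \<and> fst (V s) \<in> fst c) \<and> dist (snd c (fst (V s))) (snd c (fst (V t0))) < \<rho> \<and> dist (snd (V s) c) (snd (V t0) c) < 1"
      by eventually_elim simp
    then obtain e where e: "e > 0" "\<And>s. s \<noteq> t0 \<Longrightarrow> dist s t0 < e \<Longrightarrow> (s \<in> I \<and> fst (V s) \<in> fst c) \<and> dist (snd c (fst (V s))) (snd c (fst (V t0))) < \<rho> \<and> dist (snd (V s) c) (snd (V t0) c) < 1"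
      unfolding eventually_at by auto
    show ?thesis
    proof (intro exI[of _ e] conjI allI impI e(1))
      fix t assume t: "\<bar>t - t0\<bar> < e"
      have *: "(t \<in> I \<and> fst (V t) \<in> fst c) \<and> dist (snd c (fst (V t))) (snd c (fst (V t0))) < \<rho> \<and> dist (snd (V t) c) (snd (V t0) c) < 1"
        using e(2)[of t] t t0 pc \<rho>(1) by (cases "t = t0") (auto simp: dist_real_def)
      then show "t \<in> I" "fst (V t) \<in> fst c" by auto
      show "snd c (fst (V t)) \<in> cball (snd c ?p) \<rho>" using * V0 by (auto simp: dist_commute)
      show "norm (snd (V t) c) \<le> R" using * V0 norm_triangle_ineq[of "snd (V t) c - snd (V t0) c" "snd (V t0) c"]
        by (auto simp: R_def dist_norm)
    qed
  qed
  obtain e1 where e1: "e1 > 0" "\<And>t. \<bar>t - t0\<bar> < e1 \<Longrightarrow> t \<in> I \<and> fst (V1 t) \<in> fst c \<and>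
      snd c (fst (V1 t)) \<in> cball (snd c ?p) \<rho> \<and> norm (snd (V1 t) c) \<le> R" using near[OF V1 refl] by blast
  obtain e2 where e2: "e2 > 0" "\<And>t. \<bar>t - t0\<bar> < e2 \<Longrightarrow> t \<in> I \<and> fst (V2 t) \<in> fst c \<and>
      snd c (fst (V2 t)) \<in> cball (snd c ?p) \<rho> \<and> norm (snd (V2 t) c) \<le> R" using near[OF V2 eq[symmetric]] by blast
  \<comment> \<open>The growth rate of the difference while both velocities are at most \<open>R\<close>: 1 from the position,
    the rest from \<open>spray_estimate\<close>.\<close>
  define \<kappa> where "\<kappa> = 1 + C * R\<^sup>2 + C * (2 * R)"
  have \<kappa>: "\<kappa> \<ge> 1" using \<rho>(2) R by (simp add: \<kappa>_def)
  define h where "h = min (min (e1 / 2) (e2 / 2)) (1 / (4 * \<kappa>))"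
  have h: "h > 0" "h < e1" "h < e2" "h * \<kappa> \<le> 1 / 4"
  proof -
    have "h * \<kappa> \<le> (1 / (4 * \<kappa>)) * \<kappa>" using \<kappa> by (intro mult_right_mono) (auto simp: h_def)
    then show "h * \<kappa> \<le> 1 / 4" using \<kappa> by simp
  qed (use e1(1) e2(1) \<kappa> in \<open>auto simp: h_def\<close>)
  let ?x1 = "\<lambda>t. snd c (fst (V1 t))" and ?x2 = "\<lambda>t. snd c (fst (V2 t))"
  let ?u1 = "\<lambda>t. snd (V1 t) c" and ?u2 = "\<lambda>t. snd (V2 t) c"
  let ?f = "\<lambda>t. (?x1 t - ?x2 t, ?u1 t - ?u2 t)"
  let ?f' = "\<lambda>t. (?u1 t - ?u2 t, - Q c (?x1 t) (?u1 t) - (- Q c (?x2 t) (?u2 t)))"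
  have zero: "?f t = 0" if t: "t \<in> {t0 - h..t0 + h}" for t
  proof -
    have near: "\<bar>t - t0\<bar> < e1 \<and> \<bar>t - t0\<bar> < e2" if "t \<in> {t0 - h..t0 + h}" for t using that h by auto
    have "norm (?f t) \<le> 2 * norm (?f t0)"
    proof (rule linear_growth_bound[where f' = ?f' and \<kappa> = \<kappa> and a = "t0 - h" and b = "t0 + h"])
      fix s assume s: "s \<in> {t0 - h..t0 + h}"
      note n1 = e1(2)[OF near[OF s, THEN conjunct1]] and n2 = e2(2)[OF near[OF s, THEN conjunct2]]
      have d1: "(?x1 has_vector_derivative ?u1 s) (at s)" "(?u1 has_vector_derivative - Q c (?x1 s) (?u1 s)) (at s)"
        using V1 c(1) n1 unfolding geodesic_on_def by blast+
      have d2: "(?x2 has_vector_derivative ?u2 s) (at s)" "(?u2 has_vector_derivative - Q c (?x2 s) (?u2 s)) (at s)"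
        using V2 c(1) n2 unfolding geodesic_on_def by blast+
      show "(?f has_vector_derivative ?f' s) (at s within {t0 - h..t0 + h})"
        by (intro has_vector_derivative_at_within[OF has_vector_derivative_Pair] has_vector_derivative_diff d1 d2)
      have n: "norm (?x1 s - ?x2 s) \<le> norm (?f s)" "norm (?u1 s - ?u2 s) \<le> norm (?f s)"
        by (rule norm_fst_le, rule norm_snd_le)
      have "norm (?f' s) \<le> norm (?u1 s - ?u2 s) + norm (- Q c (?x1 s) (?u1 s) - (- Q c (?x2 s) (?u2 s)))"
        by (rule norm_Pair_le)
      also have "norm (- Q c (?x1 s) (?u1 s) - (- Q c (?x2 s) (?u2 s))) = norm (Q c (?x1 s) (?u1 s) - Q c (?x2 s) (?u2 s))"
        by (simp only: minus_diff_minus norm_minus_cancel)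
      also have "\<dots> \<le> C * (norm (?x1 s - ?x2 s) * (norm (?u1 s))\<^sup>2 + norm (?u1 s - ?u2 s) * (norm (?u1 s) + norm (?u2 s)))"
        using n1 n2 by (intro Ql) auto
      also have "\<dots> \<le> C * (norm (?f s) * R\<^sup>2 + norm (?f s) * (R + R))"
        using n1 n2 \<rho>(2) R by (intro mult_left_mono add_mono mult_mono power_mono n) auto
      finally have "norm (?f' s) \<le> norm (?u1 s - ?u2 s) + C * (norm (?f s) * R\<^sup>2 + norm (?f s) * (R + R))" by simp
      also have "\<dots> \<le> norm (?f s) + C * (norm (?f s) * R\<^sup>2 + norm (?f s) * (R + R))" using n(2) by simp
      finally show "norm (?f' s) \<le> \<kappa> * norm (?f s)" by (simp add: \<kappa>_def algebra_simps)
    qed (use \<kappa> h t in \<open>auto simp: algebra_simps\<close>)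
    also have "norm (?f t0) = 0" using eq by simp
    finally show ?thesis by simp
  qed
  show ?thesis
  proof (rule that[OF h(1)])
    fix t assume t: "\<bar>t - t0\<bar> < h"
    then have n1: "t \<in> I" "fst (V1 t) \<in> fst c" and n2: "fst (V2 t) \<in> fst c" using e1(2)[of t] e2(2)[of t] h by auto
    have z: "?x1 t = ?x2 t" "?u1 t = ?u2 t"
    proof -
      have "t \<in> {t0 - h..t0 + h}" using t by auto
      from zero[OF this] show "?x1 t = ?x2 t" "?u1 t = ?u2 t" by (simp_all add: zero_prod_def)
    qed
    have f: "fst (V1 t) = fst (V2 t)" using z(1) n1 n2 chart_facts(4)[OF c(1)] by (meson inj_onD)
    have "V1 t \<in> tangent_space A (fst (V1 t))" "V2 t \<in> tangent_space A (fst (V2 t))"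
      using V1 V2 n1 by (auto simp: geodesic_on_def)
    then have "V1 t = V2 t" using tangent_eqI[of "V1 t" "fst (V1 t)" "V2 t" c] f z(2) c(1) n1 by simp
    then show "t \<in> I \<and> V1 t = V2 t" using n1 by simp
  qed
qed

lemma geodesic_on_subset:
  assumes "geodesic_on M A \<Gamma> I V" "J \<subseteq> I" "open J" "is_interval J"
  shows "geodesic_on M A \<Gamma> J V"
proof -
  have "continuous_map (top_of_set I) M (fst \<circ> V)" using assms(1) by (simp add: geodesic_on_def)
  then have "continuous_map (top_of_set J) M (fst \<circ> V)"
    using continuous_map_from_subtopology_mono assms(2) by blast
  then show ?thesis using assms unfolding geodesic_on_def by blast
qed

text \<open>
  The set where both velocity fields agree is open by local uniqueness. It is relatively closed:
  distinct base points are separated by the Hausdorff property, and distinct velocities over the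
  same point by continuity in a chart. An interval is connected.
\<close>

lemma geodesic_uniqueness:
  assumes V1: "geodesic_on M A \<Gamma> I V1" and V2: "geodesic_on M A \<Gamma> I V2"
    and s: "s \<in> I" "V1 s = V2 s" and t: "t \<in> I"
  shows "V1 t = V2 t"
proof -
  let ?E = "{t \<in> I. V1 t = V2 t}"
  have I: "open I" "is_interval I" using V1 by (auto simp: geodesic_on_def)
  have "open ?E"
  proof (subst open_dist, rule ballI)
    fix t0 assume t0: "t0 \<in> ?E"
    obtain \<eta> where "\<eta> > 0" "\<And>t. \<bar>t - t0\<bar> < \<eta> \<Longrightarrow> t \<in> I \<and> V1 t = V2 t"
      using geodesic_local_uniqueness[OF V1 V2, of t0] t0 by blast
    then show "\<exists>e>0. \<forall>y. dist y t0 < e \<longrightarrow> y \<in> ?E" by (auto simp: dist_real_def)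
  qed
  moreover have "openin (top_of_set I) (I - ?E)"
  proof (subst openin_subopen, rule ballI)
    fix t0 assume t0: "t0 \<in> I - ?E"
    have cont: "continuous_map (top_of_set I) M (fst \<circ> V1)" "continuous_map (top_of_set I) M (fst \<circ> V2)"
      using V1 V2 by (auto simp: geodesic_on_def)
    have top: "fst (V1 t0) \<in> topspace M" "fst (V2 t0) \<in> topspace M"
      using cont t0 by (auto simp: continuous_map_def)
    have "\<exists>T. open T \<and> t0 \<in> T \<and> (\<forall>t\<in>T \<inter> I. V1 t \<noteq> V2 t)"
    proof (cases "fst (V1 t0) = fst (V2 t0)")
      case False
      have "Hausdorff_space M" using M2 by (simp add: Ck1_manifold_def)
      then obtain P R where PR: "openin M P" "openin M R" "fst (V1 t0) \<in> P" "fst (V2 t0) \<in> R" "disjnt P R"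
        unfolding Hausdorff_space_def using top False by meson
      have "openin (top_of_set I) {t \<in> I. fst (V1 t) \<in> P}" "openin (top_of_set I) {t \<in> I. fst (V2 t) \<in> R}"
        using cont PR by (auto simp: continuous_map_def)
      then have "open ({t \<in> I. fst (V1 t) \<in> P} \<inter> {t \<in> I. fst (V2 t) \<in> R})"
        using I(1) by (intro open_Int) (simp_all add: openin_open_eq)
      then show ?thesis using PR t0
        by (intro exI[of _ "{t \<in> I. fst (V1 t) \<in> P} \<inter> {t \<in> I. fst (V2 t) \<in> R}"]) (auto simp: disjnt_def)
    next
      case True
      obtain c where c: "c \<in> A" "fst (V1 t0) \<in> fst c" using chart_exists top by blast
      have tI: "t0 \<in> I" using t0 by blast
      have T: "V1 t0 \<in> tangent_space A (fst (V1 t0))" "V2 t0 \<in> tangent_space A (fst (V2 t0))"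
        using V1 V2 tI by (auto simp: geodesic_on_def)
      have ne: "snd (V1 t0) c \<noteq> snd (V2 t0) c"
        using tangent_eqI[OF T(1) T(2)[folded True] c] t0 by auto
      have c2: "fst (V2 t0) \<in> fst c" using True c by simp
      have "((\<lambda>s. snd (V1 s) c) has_vector_derivative - Q c (snd c (fst (V1 t0))) (snd (V1 t0) c)) (at t0)"
        using V1 c tI unfolding geodesic_on_def by blast
      moreover have "((\<lambda>s. snd (V2 s) c) has_vector_derivative - Q c (snd c (fst (V2 t0))) (snd (V2 t0) c)) (at t0)"
        using V2 c(1) c2 tI unfolding geodesic_on_def by blast
      ultimately have "isCont (\<lambda>s. snd (V1 s) c - snd (V2 s) c) t0"
        by (intro continuous_intros) (auto dest: has_vector_derivative_continuous)
      then have "\<forall>\<^sub>F s in at t0. snd (V1 s) c - snd (V2 s) c \<noteq> 0"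
        unfolding isCont_def by (rule tendsto_imp_eventually_ne) (use ne in simp)
      then obtain T where "open T" "t0 \<in> T" "\<forall>s\<in>T. s \<noteq> t0 \<longrightarrow> snd (V1 s) c - snd (V2 s) c \<noteq> 0"
        unfolding eventually_at_topological by auto
      then show ?thesis using ne by (intro exI[of _ T]) (metis IntD1 right_minus_eq)
    qed
    then obtain T where T: "open T" "t0 \<in> T" "\<forall>t\<in>T \<inter> I. V1 t \<noteq> V2 t" by blast
    then show "\<exists>T. openin (top_of_set I) T \<and> t0 \<in> T \<and> T \<subseteq> I - ?E"
      using t0 by (intro exI[of _ "I \<inter> T"]) (auto simp: openin_open_Int)
  qed
  moreover from this have "open (I - ?E)" using I(1) openin_open_eq by blast
  moreover have "connected I" using I(2) is_interval_connected by blast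
  ultimately have "?E \<inter> I = {} \<or> (I - ?E) \<inter> I = {}"
    by (intro connectedD[of I ?E "I - ?E"]) auto
  then show ?thesis using s t by blast
qed

text \<open>
  Two geodesics that reach time 1 may have different domains; they are compared on the
  intersection, which is an interval containing 0 and 1.
\<close>

lemma exp_map_eq:
  assumes "exp_graph M A \<Gamma> v q"
  shows "exp_map M A \<Gamma> v = q" "v \<in> exp_dom M A \<Gamma>"
proof -
  show "v \<in> exp_dom M A \<Gamma>" using assms by (auto simp: exp_dom_def)
  show "exp_map M A \<Gamma> v = q"
    unfolding exp_map_def
  proof (rule the_equality)
    show "exp_graph M A \<Gamma> v q" by (rule assms)
    fix q' assume q': "exp_graph M A \<Gamma> v q'"
    obtain I V where V: "{0..1} \<subseteq> I" "geodesic_on M A \<Gamma> I V" "V 0 = v" "fst (V 1) = q"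
      using assms by (auto simp: exp_graph_def)
    obtain I' V' where V': "{0..1} \<subseteq> I'" "geodesic_on M A \<Gamma> I' V'" "V' 0 = v" "fst (V' 1) = q'"
      using q' by (auto simp: exp_graph_def)
    have J: "open (I \<inter> I')" "is_interval (I \<inter> I')"
      using V(2) V'(2) by (auto simp: geodesic_on_def intro: is_interval_Int)
    have g: "geodesic_on M A \<Gamma> (I \<inter> I') V" "geodesic_on M A \<Gamma> (I \<inter> I') V'"
      using geodesic_on_subset[OF V(2) _ J] geodesic_on_subset[OF V'(2) _ J] by auto
    have "(0::real) \<in> {0..1}" "(1::real) \<in> {0..1}" by auto
    then have "0 \<in> I \<inter> I'" "1 \<in> I \<inter> I'" using V(1) V'(1) by blast+
    then have "V 1 = V' 1" using geodesic_uniqueness[OF g, of 0 1] V(3) V'(3) by simp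
    then show "q' = q" using V(4) V'(4) by simp
  qed
qed

text \<open>
  In the coordinates of \<open>TM\<close> given by \<open>c\<close>, the strong differential at the zero vector over \<open>p\<close> is
  the sum of the base and the fibre component.
\<close>

lemma exp_map_strongly_differentiable_at_zero_vector:
  assumes c: "c \<in> A" and p: "p \<in> fst c" and \<epsilon>: "\<epsilon> > 0"
  obtains \<delta> where "\<delta> > 0"
    "\<forall>v\<in>fst (tchart c). norm (snd c (fst v) - snd c p) < \<delta> \<longrightarrow> norm (snd v c) < \<delta> \<longrightarrow>
       v \<in> exp_dom M A \<Gamma> \<and> exp_map M A \<Gamma> v \<in> fst c"
    "\<forall>v\<in>fst (tchart c). \<forall>v'\<in>fst (tchart c).
       norm (snd c (fst v) - snd c p) < \<delta> \<longrightarrow> norm (snd v c) < \<delta> \<longrightarrow>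
       norm (snd c (fst v') - snd c p) < \<delta> \<longrightarrow> norm (snd v' c) < \<delta> \<longrightarrow>
       norm (snd c (exp_map M A \<Gamma> v) - snd c (exp_map M A \<Gamma> v')
          - (snd c (fst v) - snd c (fst v')) - (snd v c - snd v' c))
         \<le> \<epsilon> * (norm (snd c (fst v) - snd c (fst v')) + norm (snd v c - snd v' c))"
proof -
  obtain \<rho> C where \<rho>: "\<rho> > 0" "C \<ge> 0" "cball (snd c p) \<rho> \<subseteq> snd c ` fst c"
    and Ql: "\<forall>x\<in>cball (snd c p) \<rho>. \<forall>x'\<in>cball (snd c p) \<rho>. \<forall>u u'.
       norm (Q c x u - Q c x' u') \<le> C * (norm (x - x') * (norm u)\<^sup>2 + norm (u - u') * (norm u + norm u'))"
    using spray_estimate[OF c p] by blast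
  obtain \<delta> X U where \<delta>: "\<delta> > 0" and
    XU: "\<forall>x v. norm (x - snd c p) < \<delta> \<longrightarrow> norm v < \<delta> \<longrightarrow> X x v 0 = x \<and> U x v 0 = v \<and>
       (\<forall>t. -2 < t \<longrightarrow> t < 2 \<longrightarrow> X x v t \<in> ball (snd c p) \<rho> \<and>
          (X x v has_vector_derivative U x v t) (at t) \<and>
          (U x v has_vector_derivative - Q c (X x v t) (U x v t)) (at t))" and
    est: "\<forall>x v x' v'. norm (x - snd c p) < \<delta> \<longrightarrow> norm v < \<delta> \<longrightarrow> norm (x' - snd c p) < \<delta> \<longrightarrow> norm v' < \<delta> \<longrightarrow>
       norm (X x v 1 - X x' v' 1 - (x - x') - (v - v')) \<le> \<epsilon> * (norm (x - x') + norm (v - v'))"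
    using local_geodesics[OF \<rho>(1,2) \<epsilon> Ql[rule_format] spray_scale] by blast
  have ex: "v \<in> exp_dom M A \<Gamma> \<and> exp_map M A \<Gamma> v \<in> fst c \<and>
      snd c (exp_map M A \<Gamma> v) = X (snd c (fst v)) (snd v c) 1"
    if v: "v \<in> fst (tchart c)" "norm (snd c (fst v) - snd c p) < \<delta>" "norm (snd v c) < \<delta>" for v
  proof -
    let ?x = "X (snd c (fst v)) (snd v c)" and ?u = "U (snd c (fst v)) (snd v c)"
    note * = XU[rule_format, OF v(2,3)]
    have in_c: "?x t \<in> snd c ` fst c" if "t \<in> {-2<..<2}" for t
      using * that \<rho>(3) ball_subset_cball by fastforce
    let ?V = "\<lambda>t. tvec_of A c (inv_into (fst c) (snd c) (?x t)) (?u t)"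
    have g: "geodesic_on M A \<Gamma> {-2<..<2} ?V"
      by (rule geodesic_from_chart[OF c]) (use * in_c is_interval_oo in auto)
    have vc: "fst v \<in> fst c" "v \<in> tangent_space A (fst v)" using v(1) by (auto simp: tchart_def)
    have "inv_into (fst c) (snd c) (?x 0) = fst v" using * vc(1) chart_facts(4)[OF c] by simp
    then have "?V 0 = tvec_of A c (fst v) (snd v c)" using * by simp
    also have "\<dots> = v" by (rule tangent_tvec_of[OF vc(2) c vc(1), symmetric])
    finally have V0: "?V 0 = v" .
    have 1: "(1::real) \<in> {-2<..<2}" by simp
    have "exp_graph M A \<Gamma> v (inv_into (fst c) (snd c) (?x 1))"
      unfolding exp_graph_def using g V0 by (intro exI[of _ "{-2<..<2}"] exI[of _ ?V]) auto
    from exp_map_eq[OF this] show ?thesis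
      using in_c[OF 1] by (auto simp: inv_into_into f_inv_into_f)
  qed
  show ?thesis
  proof (rule that[OF \<delta>]; intro ballI impI)
    fix v v' assume "v \<in> fst (tchart c)" "v' \<in> fst (tchart c)"
       "norm (snd c (fst v) - snd c p) < \<delta>" "norm (snd v c) < \<delta>" "norm (snd c (fst v') - snd c p) < \<delta>" "norm (snd v' c) < \<delta>"
    then show "norm (snd c (exp_map M A \<Gamma> v) - snd c (exp_map M A \<Gamma> v')
          - (snd c (fst v) - snd c (fst v')) - (snd v c - snd v' c))
         \<le> \<epsilon> * (norm (snd c (fst v) - snd c (fst v')) + norm (snd v c - snd v' c))"
      using ex est by simp
  qed (use ex in blast)
qed

end

section \<open>The image of the embedding\<close>

locale c11_submanifold = M: c11_manifold M A + S: c11_manifold S B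
  for M :: "'m topology" and A :: "('m, real^'n::finite) chart set"
    and S :: "'s topology" and B :: "('s, real^'k::finite) chart set" +
  fixes g :: "('m, real^'n) metric_field" and \<phi> :: "'s \<Rightarrow> 'm" and J :: "'n set"
  assumes metric: "pseudo_riemannian_metric 1 M A g"
    and emb: "Ck1_embedding 1 S B M A \<phi>"
    and nondeg: "\<And>s. s \<in> topspace S \<Longrightarrow>
           nondegenerate_on B s (\<lambda>u w. g (pushforward B A \<phi> u) (pushforward B A \<phi> w))"
    and card_J: "card J = CARD('n) - CARD('k)"
begin

abbreviation "img \<equiv> \<phi> ` topspace S"

lemma \<phi>_embedding: "embedding_map S M \<phi>" and \<phi>_Ck1: "Ck1_map 1 B A \<phi>"
  using emb by (auto simp: Ck1_embedding_def)

lemma \<phi>_continuous: "continuous_map S M \<phi>"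
  using \<phi>_embedding unfolding embedding_map_def homeomorphic_eq_everything_map
  by (meson continuous_map_in_subtopology)

lemma \<phi>_inj: "inj_on \<phi> (topspace S)"
  using \<phi>_embedding by (simp add: embedding_map_def homeomorphic_map_def)

lemma \<phi>_in: "s \<in> topspace S \<Longrightarrow> \<phi> s \<in> topspace M"
  using \<phi>_continuous by (auto simp: continuous_map_def)

lemma \<phi>_open:
  assumes "openin S G" shows "openin (subtopology M img) (\<phi> ` G)"
  using \<phi>_embedding assms unfolding embedding_map_def homeomorphic_eq_everything_map open_map_def by blast

lemma topspace_img [simp]: "topspace (subtopology M img) = img"
  using \<phi>_in by auto

abbreviation \<Phi> :: "('s, real^'k) chart \<Rightarrow> ('m, real^'n) chart \<Rightarrow> real^'k \<Rightarrow> real^'n" where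
  "\<Phi> b c \<equiv> chart_rep b c \<phi>"

abbreviation D\<Phi> where "D\<Phi> b c x \<equiv> frechet_derivative (\<Phi> b c) (at x)"

abbreviation dom\<Phi> where "dom\<Phi> b c \<equiv> snd b ` {s \<in> fst b. \<phi> s \<in> fst c}"

lemma dom\<Phi>_open: assumes "b \<in> B" "c \<in> A" shows "open (dom\<Phi> b c)"
proof -
  have "openin S {s \<in> topspace S. \<phi> s \<in> fst c}"
    using \<phi>_continuous M.chart_facts(1)[OF assms(2)] by (auto simp: continuous_map_def)
  then have "open (snd b ` (fst b \<inter> {s \<in> topspace S. \<phi> s \<in> fst c}))" by (rule S.open_chart_image[OF assms(1)])
  moreover have "fst b \<inter> {s \<in> topspace S. \<phi> s \<in> fst c} = {s \<in> fst b. \<phi> s \<in> fst c}"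
    using S.chart_facts(5)[OF assms(1)] by auto
  ultimately show ?thesis by simp
qed

lemma \<Phi>_apply: "b \<in> B \<Longrightarrow> s \<in> fst b \<Longrightarrow> \<Phi> b c (snd b s) = snd c (\<phi> s)"
  by (simp add: chart_rep_apply S.chart_facts)

lemma \<Phi>_Ck1: "b \<in> B \<Longrightarrow> c \<in> A \<Longrightarrow> Ck1 1 (dom\<Phi> b c) (\<Phi> b c)"
  using \<phi>_Ck1 by (simp add: Ck1_map_def del: Ck1.simps)

lemma \<Phi>_has_derivative:
  assumes "b \<in> B" "c \<in> A" "x \<in> dom\<Phi> b c"
  shows "(\<Phi> b c has_derivative D\<Phi> b c x) (at x)"
proof -
  have "\<forall>x\<in>dom\<Phi> b c. \<Phi> b c differentiable (at x)"
    using \<Phi>_Ck1[OF assms(1,2)] unfolding One_nat_def Ck1.simps(2) by (rule conjunct1)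
  then have "\<Phi> b c differentiable (at x)" using assms(3) by (rule bspec)
  then show ?thesis by (simp add: frechet_derivative_works)
qed

lemma D\<Phi>_linear: "b \<in> B \<Longrightarrow> c \<in> A \<Longrightarrow> x \<in> dom\<Phi> b c \<Longrightarrow> linear (D\<Phi> b c x)"
  using \<Phi>_has_derivative has_derivative_linear by blast

lemma dom\<Phi>I: "s \<in> fst b \<Longrightarrow> \<phi> s \<in> fst c \<Longrightarrow> snd b s \<in> dom\<Phi> b c"
  by auto

lemma D\<Phi>_change_source:
  assumes b: "b \<in> B" "b' \<in> B" "s \<in> fst b" "s \<in> fst b'" and c: "c \<in> A" "\<phi> s \<in> fst c"
  shows "D\<Phi> b c (snd b s) w = D\<Phi> b' c (snd b' s) (frechet_derivative (chart_rep b b' (\<lambda>s. s)) (at (snd b s)) w)"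
proof -
  have "(chart_rep b c (\<lambda>s. \<phi> s) has_derivative (\<lambda>w. D\<Phi> b' c (snd b' s) (frechet_derivative (chart_rep b b' (\<lambda>s. s)) (at (snd b s)) w))) (at (snd b s))"
    by (rule chart_rep_derivative_compose[where a = b and b = b' and c = c and f = "\<lambda>x. x" and h = \<phi>,
        OF S.chart_facts(4)[OF b(1)] S.chart_facts(4)[OF b(2)] S.trans_open[OF b(1,2), unfolded Int_def] b(3,4)
          S.trans_has_derivative[OF b] \<Phi>_has_derivative[OF b(2) c(1) dom\<Phi>I[OF b(4) c(2)]]])
  from frechet_derivative_at[OF this] show ?thesis by metis
qed

lemma D\<Phi>_change_target:
  assumes b: "b \<in> B" "s \<in> fst b" and c: "c \<in> A" "d \<in> A" "\<phi> s \<in> fst c" "\<phi> s \<in> fst d"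
  shows "D\<Phi> b d (snd b s) w = trans_deriv c d (snd c (\<phi> s)) (D\<Phi> b c (snd b s) w)"
proof -
  have "(chart_rep b d (\<lambda>s. \<phi> s) has_derivative (\<lambda>w. trans_deriv c d (snd c (\<phi> s)) (D\<Phi> b c (snd b s) w))) (at (snd b s))"
    by (rule chart_rep_derivative_compose[where a = b and b = c and c = d and f = \<phi> and h = "\<lambda>x. x",
        OF S.chart_facts(4)[OF b(1)] M.chart_facts(4)[OF c(1)] dom\<Phi>_open[OF b(1) c(1)] b(2) c(3)
          \<Phi>_has_derivative[OF b(1) c(1) dom\<Phi>I[OF b(2) c(3)]] M.trans_has_derivative[OF c]])
  from frechet_derivative_at[OF this] show ?thesis by metis
qed

text \<open>
  The definition of \<open>pushforward\<close> picks some chart around the base point; by the chain rule every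
  other chart gives the same result.
\<close>

lemma pushforward_comp:
  assumes u: "u \<in> tangent_space B s" and b: "b \<in> B" "s \<in> fst b" and c: "c \<in> A" "\<phi> s \<in> fst c"
  shows "snd (pushforward B A \<phi> u) c = D\<Phi> b c (snd b s) (snd u b)"
proof -
  have fu: "fst u = s" using S.tangent_fst[OF u] .
  define b' where "b' = (SOME b. b \<in> B \<and> s \<in> fst b)"
  have b': "b' \<in> B" "s \<in> fst b'" using someI[of "\<lambda>b. b \<in> B \<and> s \<in> fst b" b] b by (auto simp: b'_def)
  have "snd (pushforward B A \<phi> u) c = D\<Phi> b' c (snd b' s) (snd u b')"
    using c by (simp add: pushforward_def Let_def b'_def fu)
  also have "snd u b' = frechet_derivative (chart_rep b b' (\<lambda>s. s)) (at (snd b s)) (snd u b)"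
    by (rule S.tangent_comp[OF u b(1) b'(1) b(2) b'(2)])
  also have "D\<Phi> b' c (snd b' s) \<dots> = D\<Phi> b c (snd b s) (snd u b)"
    by (rule D\<Phi>_change_source[OF b(1) b'(1) b(2) b'(2) c, symmetric])
  finally show ?thesis .
qed

lemma pushforward_in:
  assumes u: "u \<in> tangent_space B s" and s: "s \<in> topspace S"
  shows "pushforward B A \<phi> u \<in> tangent_space A (\<phi> s)"
proof (rule M.tangent_spaceI)
  have fu: "fst u = s" using S.tangent_fst[OF u] .
  then show "fst (pushforward B A \<phi> u) = \<phi> s" by (simp add: pushforward_def Let_def)
  obtain b where b: "b \<in> B" "s \<in> fst b" using S.chart_exists[OF s] by blast
  show "snd (pushforward B A \<phi> u) d = trans_deriv c d (snd c (\<phi> s)) (snd (pushforward B A \<phi> u) c)"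
    if "c \<in> A" "d \<in> A" "\<phi> s \<in> fst c" "\<phi> s \<in> fst d" for c d
    unfolding pushforward_comp[OF u b that(1,3)] pushforward_comp[OF u b that(2,4)]
    by (rule D\<Phi>_change_target[OF b that])
  show "snd (pushforward B A \<phi> u) c = 0" if "c \<notin> A \<or> \<phi> s \<notin> fst c" for c
    using that by (auto simp: pushforward_def Let_def fu)
qed

lemma D\<Phi>_inj:
  assumes b: "b \<in> B" "s \<in> fst b" and c: "c \<in> A" "\<phi> s \<in> fst c"
  shows "inj (D\<Phi> b c (snd b s))"
proof (rule injI)
  fix w w' assume eq: "D\<Phi> b c (snd b s) w = D\<Phi> b c (snd b s) w'"
  have s: "s \<in> topspace S" using S.chart_facts(5)[OF b(1)] b(2) by blast
  let ?u = "tvec_of B b s w" and ?u' = "tvec_of B b s w'"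
  have in_T: "?u \<in> tangent_space B s" "?u' \<in> tangent_space B s" by (rule S.tvec_of_in[OF b])+
  have "snd (pushforward B A \<phi> ?u) c = snd (pushforward B A \<phi> ?u') c"
    using eq by (simp add: pushforward_comp[OF in_T(1) b c] pushforward_comp[OF in_T(2) b c] S.tvec_of_self[OF b])
  then have "pushforward B A \<phi> ?u = pushforward B A \<phi> ?u'"
    by (rule M.tangent_eqI[OF pushforward_in[OF in_T(1) s] pushforward_in[OF in_T(2) s] c])
  moreover have "inj_on (pushforward B A \<phi>) (tangent_space B s)"
    using emb s by (simp add: Ck1_embedding_def)
  ultimately have "?u = ?u'" using in_T by (meson inj_onD)
  then show "w = w'" using S.tvec_of_self[OF b] by metis
qed

definition ichart :: "('s, real^'k) chart \<Rightarrow> ('m, real^'k) chart" where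
  "ichart b = (\<phi> ` fst b, snd b \<circ> inv_into (topspace S) \<phi>)"

lemma image_charts_eq: "image_charts S B \<phi> = ichart ` B"
  by (simp add: image_charts_def ichart_def)

lemma ichart_apply: "s \<in> topspace S \<Longrightarrow> snd (ichart b) (\<phi> s) = snd b s"
  using \<phi>_inj by (simp add: ichart_def)

lemma ichart_dom: "b \<in> B \<Longrightarrow> s \<in> topspace S \<Longrightarrow> \<phi> s \<in> fst (ichart b) \<longleftrightarrow> s \<in> fst b"
  unfolding ichart_def fst_conv by (rule inj_on_image_mem_iff[OF \<phi>_inj _ S.chart_facts(5)])

lemma ichart_lip_at:
  assumes b: "b \<in> B" "s \<in> fst b" and c: "c \<in> A" "\<phi> s \<in> fst c"
  shows "lip_at (ichart b) c img (\<lambda>q. q) (\<phi> s)"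
proof -
  have s: "s \<in> topspace S" using S.chart_facts(5)[OF b(1)] b(2) by blast
  have "Ck1 0 (dom\<Phi> b c) (\<Phi> b c)" by (rule Ck1_1_imp_Ck1_0[OF \<Phi>_Ck1 dom\<Phi>_open]) (use b c in auto)
  from Ck1_0_D[OF this dom\<Phi>_open[OF b(1) c(1)] dom\<Phi>I[OF b(2) c(2)]]
  obtain r L where r: "r > 0" "ball (snd b s) r \<subseteq> dom\<Phi> b c" "L \<ge> 0"
    "\<And>y z. y \<in> ball (snd b s) r \<Longrightarrow> z \<in> ball (snd b s) r \<Longrightarrow> norm (\<Phi> b c y - \<Phi> b c z) \<le> L * norm (y - z)"
    by blast
  have elem: "\<exists>s'. s' \<in> fst b \<and> x = \<phi> s' \<and> snd b s' \<in> ball (snd b s) r \<and> snd (ichart b) x = snd b s'"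
    if x: "x \<in> chart_ball img (ichart b) (\<phi> s) r" for x
  proof -
    have "x \<in> fst (ichart b)" using x by (auto simp: chart_ball_def)
    then obtain s' where s': "s' \<in> fst b" "x = \<phi> s'" by (auto simp: ichart_def)
    have "s' \<in> topspace S" using s' S.chart_facts(5)[OF b(1)] by blast
    then have "snd (ichart b) x = snd b s'" using s' ichart_apply by simp
    moreover have "dist (snd (ichart b) x) (snd (ichart b) (\<phi> s)) < r" using x by (simp add: chart_ball_def)
    ultimately show ?thesis using s' ichart_apply[OF s] by (intro exI[of _ s']) (auto simp: dist_commute)
  qed
  show ?thesis
  proof (rule lip_atI[OF r(1,3)])
    fix x assume "x \<in> chart_ball img (ichart b) (\<phi> s) r"
    then obtain s' where s': "s' \<in> fst b" "x = \<phi> s'" "snd b s' \<in> ball (snd b s) r" using elem by blast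
    then have "snd b s' \<in> dom\<Phi> b c" using r(2) by blast
    then obtain s'' where "s'' \<in> fst b" "\<phi> s'' \<in> fst c" "snd b s' = snd b s''" by auto
    then show "x \<in> fst c" using s' S.chart_facts(4)[OF b(1)] by (metis inj_onD)
  next
    fix x y assume "x \<in> chart_ball img (ichart b) (\<phi> s) r" "y \<in> chart_ball img (ichart b) (\<phi> s) r"
    then obtain s' t' where "s' \<in> fst b" "x = \<phi> s'" "snd b s' \<in> ball (snd b s) r" "snd (ichart b) x = snd b s'"
      "t' \<in> fst b" "y = \<phi> t'" "snd b t' \<in> ball (snd b s) r" "snd (ichart b) y = snd b t'" using elem by meson
    then show "dist (snd c x) (snd c y) \<le> L * dist (snd (ichart b) x) (snd (ichart b) y)"
      using r(4)[of "snd b s'" "snd b t'"] \<Phi>_apply[OF b(1)] by (simp add: dist_norm)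
  qed
qed

text \<open>
  The injective strong differential of \<open>\<phi>\<close> bounds distances in \<open>M\<close> from below by distances of
  parameters, but only for parameters close to \<open>s\<close>. That points of the image close to \<open>\<phi> s\<close> have
  such parameters is the embedding property.
\<close>

lemma lip_at_ichart:
  assumes b: "b \<in> B" "s \<in> fst b" and c: "c \<in> A" "\<phi> s \<in> fst c"
  shows "lip_at c (ichart b) img (\<lambda>q. q) (\<phi> s)"
proof -
  have s: "s \<in> topspace S" using S.chart_facts(5)[OF b(1)] b(2) by blast
  let ?D = "D\<Phi> b c (snd b s)"
  have lin: "linear ?D" by (rule D\<Phi>_linear[OF b(1) c(1) dom\<Phi>I[OF b(2) c(2)]])
  obtain m where m: "m > 0" "\<And>w. m * norm w \<le> norm (?D w)"
    using linear_inj_bounded_below_pos[OF lin D\<Phi>_inj[OF b c]] by metis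
  have m2: "m / 2 > 0" using m(1) by simp
  obtain r where r: "r > 0" "ball (snd b s) r \<subseteq> dom\<Phi> b c"
    "\<forall>y\<in>ball (snd b s) r. \<forall>z\<in>ball (snd b s) r.
       norm (\<Phi> b c y - \<Phi> b c z - ?D (y - z)) \<le> (m / 2) * norm (y - z)"
    by (rule Ck1_1_strong_differential[OF \<Phi>_Ck1[OF b(1) c(1)] dom\<Phi>_open[OF b(1) c(1)] dom\<Phi>I[OF b(2) c(2)] m2])
  have low: "(m / 2) * norm (y - z) \<le> norm (\<Phi> b c y - \<Phi> b c z)"
    if "y \<in> ball (snd b s) r" "z \<in> ball (snd b s) r" for y z
  proof -
    have "m * norm (y - z) \<le> norm (?D (y - z))" by (rule m(2))
    also have "\<dots> \<le> norm (\<Phi> b c y - \<Phi> b c z) + norm (\<Phi> b c y - \<Phi> b c z - ?D (y - z))"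
      by (metis norm_minus_commute norm_triangle_sub)
    also have "\<dots> \<le> norm (\<Phi> b c y - \<Phi> b c z) + (m / 2) * norm (y - z)" using r(3) that by auto
    finally show ?thesis by simp
  qed
  have "openin S {s' \<in> fst b. snd b s' \<in> ball (snd b s) r}" by (rule S.openin_chart_preimage[OF b(1) open_ball])
  then have o1: "openin (subtopology M img) (\<phi> ` {s' \<in> fst b. snd b s' \<in> ball (snd b s) r})" by (rule \<phi>_open)
  have o2: "\<phi> s \<in> \<phi> ` {s' \<in> fst b. snd b s' \<in> ball (snd b s) r}" using b(2) r(1) by auto
  obtain t where t: "t > 0" "chart_ball img c (\<phi> s) t \<subseteq> \<phi> ` {s' \<in> fst b. snd b s' \<in> ball (snd b s) r}"
    by (rule lip_atlas_openin_ball[OF lip_atlas_subtopology[OF M.manifold_lip_atlas] o1 o2 c, unfolded topspace_img])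
  have elem: "\<exists>s'. s' \<in> fst b \<and> x = \<phi> s' \<and> snd b s' \<in> ball (snd b s) r \<and> snd (ichart b) x = snd b s'"
    if x: "x \<in> chart_ball img c (\<phi> s) t" for x
  proof -
    obtain s' where s': "s' \<in> fst b" "x = \<phi> s'" "snd b s' \<in> ball (snd b s) r" using x t(2) by blast
    moreover have "s' \<in> topspace S" using s' S.chart_facts(5)[OF b(1)] by blast
    ultimately show ?thesis using ichart_apply by blast
  qed
  show ?thesis
  proof (rule lip_atI[OF t(1), of "2 / m"])
    fix x assume "x \<in> chart_ball img c (\<phi> s) t"
    then show "x \<in> fst (ichart b)" using elem unfolding ichart_def by fastforce
  next
    fix x y assume "x \<in> chart_ball img c (\<phi> s) t" "y \<in> chart_ball img c (\<phi> s) t"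
    then obtain s' t' where "s' \<in> fst b" "x = \<phi> s'" "snd b s' \<in> ball (snd b s) r" "snd (ichart b) x = snd b s'"
      "t' \<in> fst b" "y = \<phi> t'" "snd b t' \<in> ball (snd b s) r" "snd (ichart b) y = snd b t'" using elem by meson
    then show "dist (snd (ichart b) x) (snd (ichart b) y) \<le> 2 / m * dist (snd c x) (snd c y)"
      using low[of "snd b s'" "snd b t'"] \<Phi>_apply[OF b(1)] m(1) by (simp add: dist_norm field_simps)
  qed (use m in auto)
qed

lemma ichart_inj: "b \<in> B \<Longrightarrow> inj_on (snd (ichart b)) (fst (ichart b))"
proof (rule inj_onI)
  fix x y assume b: "b \<in> B" and "x \<in> fst (ichart b)" "y \<in> fst (ichart b)" and eq: "snd (ichart b) x = snd (ichart b) y"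
  then obtain s t where st: "s \<in> fst b" "t \<in> fst b" "x = \<phi> s" "y = \<phi> t" by (auto simp: ichart_def)
  then have "s \<in> topspace S" "t \<in> topspace S" using S.chart_facts(5)[OF b] by auto
  then have "snd b s = snd b t" using eq st ichart_apply by simp
  then show "x = y" using st S.chart_facts(4)[OF b] by (metis inj_onD)
qed

lemma image_lip_atlas: "lip_atlas (subtopology M img) (image_charts S B \<phi>)"
proof (rule lip_atlas_transfer[OF lip_atlas_subtopology[OF M.manifold_lip_atlas]])
  show "inj_on (snd k) (fst k)" if "k \<in> image_charts S B \<phi>" for k
    using that ichart_inj by (auto simp: image_charts_eq)
  show "topspace (subtopology M img) \<subseteq> (\<Union>k\<in>image_charts S B \<phi>. fst k)"
    unfolding topspace_img image_charts_eq using S.chart_exists ichart_dom by fastforce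
  fix q c k assume "q \<in> topspace (subtopology M img)" and c: "c \<in> A" "q \<in> fst c" and k: "k \<in> image_charts S B \<phi>" "q \<in> fst k"
  then obtain b s where b: "b \<in> B" "k = ichart b" and s: "s \<in> topspace S" "q = \<phi> s"
    unfolding topspace_img image_charts_eq by blast
  have sb: "s \<in> fst b" using k(2) b s ichart_dom by blast
  show "lip_at c k (topspace (subtopology M img)) (\<lambda>x. x) q" "lip_at k c (topspace (subtopology M img)) (\<lambda>x. x) q"
    unfolding topspace_img b s(2)
    using lip_at_ichart[OF b(1) sb c(1)] ichart_lip_at[OF b(1) sb c(1)] c(2) s(2) by auto
qed

end

section \<open>Normal spaces and Lipschitz frames\<close>

lemma coord_space_subspace: "subspace (coord_space J)"
  by (auto simp: coord_space_def subspace_def)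

lemma dim_coord_space: "dim (coord_space (J :: 'n::finite set)) = card J"
proof -
  let ?d = "(\<lambda>j. axis j (1::real)) ` J"
  have "?d \<subseteq> Basis" by (auto simp: axis_in_Basis_iff)
  moreover have "{x::real^'n. \<forall>i\<in>Basis. i \<notin> ?d \<longrightarrow> x \<bullet> i = 0} = coord_space J"
    by (auto simp: coord_space_def Basis_vec_def inner_axis axis_eq_axis)
  moreover have "card ?d = card J" by (intro card_image) (auto simp: inj_on_def axis_eq_axis)
  ultimately show ?thesis using dim_substandard[of ?d] by simp
qed

lemma coord_space_expansion:
  fixes y :: "real^'n::finite"
  assumes "y \<in> coord_space J" shows "(\<Sum>j\<in>J. y $ j *\<^sub>R axis j 1) = y"
proof -
  have "(\<Sum>j\<in>J. y $ j *\<^sub>R axis j 1) = (\<Sum>j\<in>UNIV. y $ j *\<^sub>R axis j (1::real))"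
    using assms by (intro sum.mono_neutral_left) (auto simp: coord_space_def)
  then show ?thesis using basis_expansion[of y] by (simp add: scalar_mult_eq_scaleR)
qed

context c11_submanifold begin

definition gform :: "('m, real^'n) chart \<Rightarrow> real^'n \<Rightarrow> real^'n \<Rightarrow> real^'n \<Rightarrow> real" where
  "gform c x u w = (\<Sum>\<alpha>\<in>UNIV. u $ \<alpha> * (\<Sum>\<beta>\<in>UNIV. metric_comp A g c x \<alpha> \<beta> * w $ \<beta>))"

lemma metric_facts:
  assumes "p \<in> topspace M" "u \<in> tangent_space A p" "v \<in> tangent_space A p" "w \<in> tangent_space A p"
  shows "g u v = g v u" "g (tadd u v) w = g u w + g v w" "g (tscale r u) w = r * g u w"
  using metric assms unfolding pseudo_riemannian_metric_def by blast+

lemma metric_chart: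
  assumes c: "c \<in> A" "p \<in> fst c" and u: "u \<in> tangent_space A p" and w: "w \<in> tangent_space A p"
  shows "g u w = gform c (snd c p) (snd u c) (snd w c)"
proof -
  have p: "p \<in> topspace M" using M.chart_facts(5)[OF c(1)] c(2) by blast
  define h where "h \<xi> \<eta> = g (tvec_of A c p \<xi>) (tvec_of A c p \<eta>)" for \<xi> \<eta>
  note T = M.tvec_of_in[OF c]
  have add: "tvec_of A c p (\<xi> + \<eta>) = tadd (tvec_of A c p \<xi>) (tvec_of A c p \<eta>)" for \<xi> \<eta>
    by (rule M.tangent_eqI[OF T M.tadd_in[OF T T] c]) (simp add: M.tvec_of_self[OF c] tadd_def)
  have scl: "tvec_of A c p (r *\<^sub>R \<xi>) = tscale r (tvec_of A c p \<xi>)" for r \<xi>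
    by (rule M.tangent_eqI[OF T M.tscale_in[OF T] c]) (simp add: M.tvec_of_self[OF c] tscale_def)
  have l1: "linear (\<lambda>\<xi>. h \<xi> \<eta>)" for \<eta>
    by (rule linearI) (simp_all add: h_def add scl metric_facts[OF p T T T])
  have hsym: "(\<lambda>\<xi>. h \<xi> \<eta>) = h \<eta>" for \<eta>
    unfolding h_def by (rule ext) (rule metric_facts(1)[OF p T T T])
  have l2: "linear (h \<xi>)" for \<xi> using l1[of \<xi>] unfolding hsym .
  have mc: "metric_comp A g c (snd c p) \<alpha> \<beta> = h (axis \<alpha> 1) (axis \<beta> 1)" for \<alpha> \<beta>
    using c M.chart_facts(4)[OF c(1)] by (simp add: metric_comp_def h_def)
  have "g u w = h (snd u c) (snd w c)"
    unfolding h_def by (simp add: M.tangent_tvec_of[OF u c, symmetric] M.tangent_tvec_of[OF w c, symmetric])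
  also have "\<dots> = (\<Sum>\<alpha>\<in>UNIV. snd u c $ \<alpha> *\<^sub>R h (axis \<alpha> 1) (snd w c))"
    by (rule linear_cart_expansion[OF l1])
  also have "\<dots> = gform c (snd c p) (snd u c) (snd w c)"
    unfolding gform_def mc
    by (subst linear_cart_expansion[OF l2, of _ "snd w c"]) (simp add: mult.commute)
  finally show ?thesis .
qed

lemma gform_linear1: "linear (\<lambda>u. gform c x u w)"
  by (rule linearI) (simp_all add: gform_def sum.distrib sum_distrib_left algebra_simps)

lemma gform_linear2: "linear (gform c x u)"
  by (rule linearI) (simp_all add: gform_def sum.distrib sum_distrib_left algebra_simps)

text \<open>
  The products of \<open>\<xi>\<close> with the coordinate basis of the tangent space of the image: the kernel is
  the normal space.
\<close>

definition nform :: "('s, real^'k) chart \<Rightarrow> ('m, real^'n) chart \<Rightarrow> real^'k \<Rightarrow> real^'n \<Rightarrow> real^'k" where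
  "nform b c \<sigma> \<xi> = (\<chi> i. gform c (\<Phi> b c \<sigma>) \<xi> (D\<Phi> b c \<sigma> (axis i 1)))"

lemma nform_linear: "linear (nform b c \<sigma>)"
proof (rule linearI)
  fix u v :: "real^'n" and r :: real
  show "nform b c \<sigma> (u + v) = nform b c \<sigma> u + nform b c \<sigma> v"
    by (simp add: nform_def vec_eq_iff linear_add[OF gform_linear1])
  show "nform b c \<sigma> (r *\<^sub>R u) = r *\<^sub>R nform b c \<sigma> u"
    by (simp add: nform_def vec_eq_iff linear_cmul[OF gform_linear1])
qed

lemma nform_zero_iff:
  assumes "b \<in> B" "c \<in> A" "\<sigma> \<in> dom\<Phi> b c"
  shows "nform b c \<sigma> \<xi> = 0 \<longleftrightarrow> (\<forall>w. gform c (\<Phi> b c \<sigma>) \<xi> (D\<Phi> b c \<sigma> w) = 0)"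
proof
  assume 0: "nform b c \<sigma> \<xi> = 0"
  show "\<forall>w. gform c (\<Phi> b c \<sigma>) \<xi> (D\<Phi> b c \<sigma> w) = 0"
  proof
    fix w
    have lin: "linear (\<lambda>w. gform c (\<Phi> b c \<sigma>) \<xi> (D\<Phi> b c \<sigma> w))"
      using linear_compose[OF D\<Phi>_linear[OF assms] gform_linear2] by (simp add: o_def)
    have "gform c (\<Phi> b c \<sigma>) \<xi> (D\<Phi> b c \<sigma> (axis i 1)) = 0" for i
      using arg_cong[OF 0, of "\<lambda>v. v $ i"] by (simp add: nform_def)
    then show "gform c (\<Phi> b c \<sigma>) \<xi> (D\<Phi> b c \<sigma> w) = 0"
      by (subst linear_cart_expansion[OF lin]) simp
  qed
qed (simp add: nform_def vec_eq_iff)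

text \<open>
  The matrix entries are sums of products of metric components along \<open>\<phi>\<close> with components of its
  differential. The former are \<open>C\<^sup>1\<^sup>,\<^sup>1\<close> functions of a Lipschitz map, the latter Lipschitz.
\<close>

lemma nform_lipschitz:
  assumes b: "b \<in> B" "s \<in> fst b" and c: "c \<in> A" "\<phi> s \<in> fst c"
  obtains r L where "r > 0" "ball (snd b s) r \<subseteq> dom\<Phi> b c" "L \<ge> 0"
    "\<forall>\<sigma>\<in>ball (snd b s) r. \<forall>\<sigma>'\<in>ball (snd b s) r. \<forall>\<xi>.
       norm (nform b c \<sigma> \<xi> - nform b c \<sigma>' \<xi>) \<le> L * norm (\<sigma> - \<sigma>') * norm \<xi>"
proof -
  note op = dom\<Phi>_open[OF b(1) c(1)]
  define a where "a i \<sigma> = (\<Sum>\<beta>\<in>UNIV. metric_comp A g c (\<Phi> b c \<sigma>) (snd i) \<beta> * D\<Phi> b c \<sigma> (axis (fst i) 1) $ \<beta>)"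
    for i :: "'k \<times> 'n" and \<sigma>
  have P: "Ck1 0 (dom\<Phi> b c) (\<Phi> b c)" by (rule Ck1_1_imp_Ck1_0[OF \<Phi>_Ck1[OF b(1) c(1)] op])
  have D: "Ck1 0 (dom\<Phi> b c) (\<lambda>\<sigma>. D\<Phi> b c \<sigma> w)" for w
    using \<Phi>_Ck1[OF b(1) c(1)] unfolding One_nat_def Ck1.simps(2) by blast
  have "Ck1 1 (snd c ` fst c) (\<lambda>x. metric_comp A g c x \<alpha> \<beta>)" for \<alpha> \<beta>
    using metric c(1) unfolding pseudo_riemannian_metric_def by blast
  then have mc: "Ck1 0 (snd c ` fst c) (\<lambda>x. metric_comp A g c x \<alpha> \<beta>)" for \<alpha> \<beta>
    by (rule Ck1_1_imp_Ck1_0[OF _ M.chart_facts(2)[OF c(1)]])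
  have im: "\<Phi> b c ` dom\<Phi> b c \<subseteq> snd c ` fst c" using \<Phi>_apply[OF b(1), of _ c] by auto
  have "Ck1 0 (dom\<Phi> b c) (a i)" for i
    unfolding a_def
    by (intro Ck1_0_sum Ck1_0_mult op Ck1_0_compose[OF mc M.chart_facts(2)[OF c(1)] P op im] Ck1_0_component[OF D op])
  then obtain r L where r: "r > 0" "ball (snd b s) r \<subseteq> dom\<Phi> b c" "L \<ge> 0"
    and L: "\<forall>i. \<forall>y\<in>ball (snd b s) r. \<forall>z\<in>ball (snd b s) r. norm (a i y - a i z) \<le> L * norm (y - z)"
    by (rule Ck1_0_uniform[OF _ op dom\<Phi>I[OF b(2) c(2)]])
  have comp: "nform b c \<sigma> \<xi> $ i = (\<Sum>\<alpha>\<in>UNIV. a (i, \<alpha>) \<sigma> * \<xi> $ \<alpha>)" for \<sigma> \<xi> i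
    by (simp add: nform_def gform_def a_def mult.commute)
  let ?K = "of_nat CARD('k) * (of_nat CARD('n) * L)"
  have "norm (nform b c \<sigma> \<xi> - nform b c \<sigma>' \<xi>) \<le> ?K * norm (\<sigma> - \<sigma>') * norm \<xi>"
    if \<sigma>: "\<sigma> \<in> ball (snd b s) r" "\<sigma>' \<in> ball (snd b s) r" for \<sigma> \<sigma>' \<xi>
  proof -
    have "\<bar>(nform b c \<sigma> \<xi> - nform b c \<sigma>' \<xi>) $ i\<bar> \<le> of_nat CARD('n) * (L * norm (\<sigma> - \<sigma>') * norm \<xi>)" for i
    proof -
      have "(nform b c \<sigma> \<xi> - nform b c \<sigma>' \<xi>) $ i = (\<Sum>\<alpha>\<in>UNIV. (a (i, \<alpha>) \<sigma> - a (i, \<alpha>) \<sigma>') * \<xi> $ \<alpha>)"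
        by (simp add: comp sum_subtractf algebra_simps)
      also have "\<bar>\<dots>\<bar> \<le> (\<Sum>\<alpha>\<in>(UNIV::'n set). L * norm (\<sigma> - \<sigma>') * norm \<xi>)"
      proof (rule order_trans[OF sum_abs sum_mono])
        fix \<alpha>
        have "\<bar>a (i, \<alpha>) \<sigma> - a (i, \<alpha>) \<sigma>'\<bar> \<le> L * norm (\<sigma> - \<sigma>')" using L \<sigma> by auto
        then show "\<bar>(a (i, \<alpha>) \<sigma> - a (i, \<alpha>) \<sigma>') * \<xi> $ \<alpha>\<bar> \<le> L * norm (\<sigma> - \<sigma>') * norm \<xi>"
          unfolding abs_mult using r(3) by (intro mult_mono component_le_norm_cart) auto
      qed
      finally show ?thesis by simp
    qed
    then have "(\<Sum>i\<in>UNIV. \<bar>(nform b c \<sigma> \<xi> - nform b c \<sigma>' \<xi>) $ i\<bar>) \<le>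
        (\<Sum>i\<in>(UNIV::'k set). of_nat CARD('n) * (L * norm (\<sigma> - \<sigma>') * norm \<xi>))" by (intro sum_mono)
    also have "\<dots> = ?K * norm (\<sigma> - \<sigma>') * norm \<xi>" by (simp add: mult_ac)
    finally show ?thesis using norm_le_l1_cart[of "nform b c \<sigma> \<xi> - nform b c \<sigma>' \<xi>"] by linarith
  qed
  then show ?thesis using that[of r ?K] r by auto
qed

abbreviation "\<nu> \<equiv> normal_bundle A g S B \<phi>"

lemma normal_bundle_iff:
  assumes b: "b \<in> B" "s \<in> fst b" and c: "c \<in> A" "\<phi> s \<in> fst c"
  shows "v \<in> \<nu> \<and> fst v = \<phi> s \<longleftrightarrow> v \<in> tangent_space A (\<phi> s) \<and> nform b c (snd b s) (snd v c) = 0"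
proof -
  have s: "s \<in> topspace S" using S.chart_facts(5)[OF b(1)] b(2) by blast
  have dom: "snd b s \<in> dom\<Phi> b c" by (rule dom\<Phi>I[OF b(2) c(2)])
  have *: "(\<forall>w \<in> pushforward B A \<phi> ` tangent_space B s. g v w = 0) \<longleftrightarrow> nform b c (snd b s) (snd v c) = 0"
    if v: "v \<in> tangent_space A (\<phi> s)" for v
  proof -
    have eq: "g v (pushforward B A \<phi> u) = gform c (\<Phi> b c (snd b s)) (snd v c) (D\<Phi> b c (snd b s) (snd u b))"
      if u: "u \<in> tangent_space B s" for u
      by (simp add: metric_chart[OF c v pushforward_in[OF u s]] pushforward_comp[OF u b c] \<Phi>_apply[OF b])
    show ?thesis unfolding nform_zero_iff[OF b(1) c(1) dom]
    proof
      assume l: "\<forall>w \<in> pushforward B A \<phi> ` tangent_space B s. g v w = 0"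
      show "\<forall>w. gform c (\<Phi> b c (snd b s)) (snd v c) (D\<Phi> b c (snd b s) w) = 0"
      proof
        fix w
        have "g v (pushforward B A \<phi> (tvec_of B b s w)) = 0" using l S.tvec_of_in[OF b] by blast
        then show "gform c (\<Phi> b c (snd b s)) (snd v c) (D\<Phi> b c (snd b s) w) = 0"
          by (simp add: eq[OF S.tvec_of_in[OF b]] S.tvec_of_self[OF b])
      qed
    next
      assume "\<forall>w. gform c (\<Phi> b c (snd b s)) (snd v c) (D\<Phi> b c (snd b s) w) = 0"
      then show "\<forall>w \<in> pushforward B A \<phi> ` tangent_space B s. g v w = 0" using eq by auto
    qed
  qed
  show ?thesis
  proof
    assume v: "v \<in> \<nu> \<and> fst v = \<phi> s"
    then obtain s' where s': "s' \<in> topspace S" "v \<in> tangent_space A (\<phi> s')"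
      "\<forall>w \<in> pushforward B A \<phi> ` tangent_space B s'. g v w = 0" by (auto simp: normal_bundle_def)
    have "\<phi> s' = \<phi> s" using v M.tangent_fst[OF s'(2)] by simp
    then have "s' = s" using \<phi>_inj s s'(1) by (meson inj_onD)
    then show "v \<in> tangent_space A (\<phi> s) \<and> nform b c (snd b s) (snd v c) = 0" using s' * by simp
  next
    assume v: "v \<in> tangent_space A (\<phi> s) \<and> nform b c (snd b s) (snd v c) = 0"
    then have "\<forall>w \<in> pushforward B A \<phi> ` tangent_space B s. g v w = 0" using * by blast
    then show "v \<in> \<nu> \<and> fst v = \<phi> s" using v s M.tangent_fst unfolding normal_bundle_def by blast
  qed
qed

lemma normal_bundle_base: "v \<in> \<nu> \<Longrightarrow> \<exists>s\<in>topspace S. fst v = \<phi> s \<and> v \<in> tangent_space A (\<phi> s)"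
  using M.tangent_fst unfolding normal_bundle_def by blast

text \<open>
  Nondegeneracy of the induced metric, expressed in coordinates.
\<close>

lemma tangent_normal_disjoint:
  assumes b: "b \<in> B" "s \<in> fst b" and c: "c \<in> A" "\<phi> s \<in> fst c"
    and n: "nform b c (snd b s) (D\<Phi> b c (snd b s) w) = 0"
  shows "w = 0"
proof -
  have s: "s \<in> topspace S" using S.chart_facts(5)[OF b(1)] b(2) by blast
  let ?u = "tvec_of B b s w"
  note uT = S.tvec_of_in[OF b, of w]
  have sn: "snd (pushforward B A \<phi> ?u) c = D\<Phi> b c (snd b s) w"
    by (simp add: pushforward_comp[OF uT b c] S.tvec_of_self[OF b])
  have "pushforward B A \<phi> ?u \<in> \<nu> \<and> fst (pushforward B A \<phi> ?u) = \<phi> s"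
    by (subst normal_bundle_iff[OF b c]) (simp add: sn n pushforward_in[OF uT s])
  then obtain s' where s': "s' \<in> topspace S" "pushforward B A \<phi> ?u \<in> tangent_space A (\<phi> s')"
      "\<forall>w \<in> pushforward B A \<phi> ` tangent_space B s'. g (pushforward B A \<phi> ?u) w = 0"
      "fst (pushforward B A \<phi> ?u) = \<phi> s" by (auto simp: normal_bundle_def)
  have "\<phi> s' = \<phi> s" using s'(4) M.tangent_fst[OF s'(2)] by simp
  then have "s' = s" using \<phi>_inj s s'(1) by (meson inj_onD)
  then have "\<forall>w\<in>tangent_space B s. g (pushforward B A \<phi> ?u) (pushforward B A \<phi> w) = 0" using s'(3) by blast
  then have "?u = tzero s" using nondeg[OF s] uT unfolding nondegenerate_on_def by blast
  then show "w = 0" using S.tvec_of_self[OF b, of w] by (simp add: tzero_def)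
qed

text \<open>
  The tangent space has dimension \<open>k\<close> and meets the normal space only in zero, so the two
  dimensions add up to at most \<open>n\<close>.
\<close>

lemma dim_normal_space:
  assumes b: "b \<in> B" "s \<in> fst b" and c: "c \<in> A" "\<phi> s \<in> fst c"
  shows "dim {\<xi>. nform b c (snd b s) \<xi> = 0} \<le> card J" "CARD('k) \<le> CARD('n)"
proof -
  let ?N = "{\<xi>. nform b c (snd b s) \<xi> = 0}" and ?D = "D\<Phi> b c (snd b s)"
  have linD: "linear ?D" by (rule D\<Phi>_linear[OF b(1) c(1) dom\<Phi>I[OF b(2) c(2)]])
  have sub: "subspace ?N" using linear_subspace_kernel[OF nform_linear] .
  have subR: "subspace (range ?D)" using linear_subspace_image[OF linD subspace_UNIV] .
  have dimR: "dim (range ?D) = CARD('k)"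
    using dim_image_eq[OF linD, of UNIV] D\<Phi>_inj[OF b c] by (simp add: dim_UNIV)
  have "?N \<inter> range ?D \<subseteq> {0}" using tangent_normal_disjoint[OF b c] linear_0[OF linD] by auto
  then have d0: "dim (?N \<inter> range ?D) = 0" by simp
  have eq: "dim {x + y |x y. x \<in> ?N \<and> y \<in> range ?D} = dim ?N + CARD('k)"
    using dim_sums_Int[OF sub subR] unfolding dimR d0 by simp
  have "dim {x + y |x y. x \<in> ?N \<and> y \<in> range ?D} \<le> CARD('n)"
    using dim_subset_UNIV[of "{x + y |x y. x \<in> ?N \<and> y \<in> range ?D}"] by simp
  then show "dim ?N \<le> card J" using eq card_J by simp
  show "CARD('k) \<le> CARD('n)" using dim_subset_UNIV[of "range ?D"] dimR by simp
qed

lemma frame_comb_tvec: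
  assumes c: "c \<in> A" "q \<in> fst c" and e: "\<And>j. j \<in> J \<Longrightarrow> e j q \<in> tangent_space A q"
  shows "frame_comb J e q y = tvec_of A c q (\<Sum>j\<in>J. y $ j *\<^sub>R snd (e j q) c)"
proof (rule M.tangent_eqI[OF _ M.tvec_of_in[OF c] c])
  show "frame_comb J e q y \<in> tangent_space A q"
  proof (rule M.tangent_spaceI)
    fix c d assume cd: "c \<in> A" "d \<in> A" "q \<in> fst c" "q \<in> fst d"
    note lin = M.trans_linear[OF cd]
    show "snd (frame_comb J e q y) d = trans_deriv c d (snd c q) (snd (frame_comb J e q y) c)"
      unfolding frame_comb_def snd_conv linear_sum[OF lin] linear_cmul[OF lin]
      by (rule sum.cong[OF refl]) (simp add: M.tangent_comp[OF e cd])
  next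
    fix c assume "c \<notin> A \<or> q \<notin> fst c"
    then show "snd (frame_comb J e q y) c = 0"
      using M.tangent_zero[OF e] by (simp add: frame_comb_def)
  qed (simp add: frame_comb_def)
  show "snd (frame_comb J e q y) c = snd (tvec_of A c q (\<Sum>j\<in>J. y $ j *\<^sub>R snd (e j q) c)) c"
    by (simp add: M.tvec_of_self[OF c] frame_comb_def)
qed

text \<open>
  At the centre of the frame, choose a linear map \<open>h\<close> that embeds the normal space in the fibre
  model. Then \<open>T \<sigma> \<xi> = (nform \<xi>, h \<xi>)\<close> is injective at the centre, and it stays so nearby because
  the first component is Lipschitz in \<open>\<sigma>\<close>. The frame solves \<open>T \<sigma> (e\<^sub>j) = (0, axis j 1)\<close>. A lower
  bound for \<open>T\<close>, uniform in \<open>\<sigma>\<close>, takes the place of a bound for the inverse matrix and shows that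
  the solutions are Lipschitz. The second component \<open>h\<close> returns the coefficients of a normal
  vector, hence their uniqueness.
\<close>

lemma normal_frame_exists:
  assumes s: "s \<in> topspace S"
  shows "\<exists>V e. \<phi> s \<in> V \<and> normal_frame M A g S B \<phi> J V e"
proof -
  obtain b where b: "b \<in> B" "s \<in> fst b" using S.chart_exists[OF s] by blast
  obtain c where c: "c \<in> A" "\<phi> s \<in> fst c" using M.chart_exists[OF \<phi>_in[OF s]] by blast
  let ?x = "snd b s"
  let ?N = "{\<xi>. nform b c ?x \<xi> = 0}"
  have subN: "subspace ?N" using linear_subspace_kernel[OF nform_linear] .
  obtain f where f: "linear f" "f \<in> ?N \<rightarrow> coord_space J" "\<And>\<xi>. \<xi> \<in> ?N \<Longrightarrow> norm (f \<xi>) = norm \<xi>"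
    using isometry_subset_subspace[OF subN coord_space_subspace, of J] dim_normal_space(1)[OF b c]
    unfolding dim_coord_space by metis
  \<comment> \<open>\<open>f\<close> is known to map into the fibre model only on the normal space; cutting off components
    makes \<open>h\<close> do so everywhere.\<close>
  define h where "h \<xi> = (\<chi> i. if i \<in> J then f \<xi> $ i else 0)" for \<xi>
  have h_in: "h \<xi> \<in> coord_space J" for \<xi> by (simp add: h_def coord_space_def)
  have h_eq: "h \<xi> = f \<xi>" if "f \<xi> \<in> coord_space J" for \<xi>
    using that by (auto simp: h_def coord_space_def vec_eq_iff)
  have h_lin: "linear h"
    by (rule linearI) (simp_all add: h_def vec_eq_iff linear_add[OF f(1)] linear_cmul[OF f(1)])
  define T where "T \<sigma> \<xi> = (nform b c \<sigma> \<xi>, h \<xi>)" for \<sigma> \<xi>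
  have T_lin: "linear (T \<sigma>)" for \<sigma>
    unfolding T_def by (rule linearI) (simp_all add: linear_add[OF nform_linear] linear_cmul[OF nform_linear]
        linear_add[OF h_lin] linear_cmul[OF h_lin])
  have "inj (T ?x)"
  proof (subst linear_injective_0[OF T_lin], intro allI impI)
    fix \<xi> assume "T ?x \<xi> = 0"
    then have "\<xi> \<in> ?N" "h \<xi> = 0" by (auto simp: T_def zero_prod_def)
    then show "\<xi> = 0" using f(2,3) h_eq by fastforce
  qed
  then obtain m where m: "m > 0" "\<And>\<xi>. m * norm \<xi> \<le> norm (T ?x \<xi>)"
    using linear_inj_bounded_below_pos[OF T_lin] by metis
  obtain r0 L where r0: "r0 > 0" "ball ?x r0 \<subseteq> dom\<Phi> b c" "L \<ge> 0"
    and L: "\<forall>\<sigma>\<in>ball ?x r0. \<forall>\<sigma>'\<in>ball ?x r0. \<forall>\<xi>.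
       norm (nform b c \<sigma> \<xi> - nform b c \<sigma>' \<xi>) \<le> L * norm (\<sigma> - \<sigma>') * norm \<xi>"
    by (rule nform_lipschitz[OF b c])
  \<comment> \<open>On this ball \<open>T \<sigma>\<close> differs from its value at the centre by at most \<open>m / 2\<close>.\<close>
  define r where "r = min r0 (m / (2 * (L + 1)))"
  have r: "r > 0" "r \<le> r0" "L * r \<le> m / 2"
  proof -
    have "L * r \<le> L * (m / (2 * (L + 1)))" using r0(3) by (intro mult_left_mono) (auto simp: r_def)
    also have "\<dots> \<le> m / 2" using r0(3) m(1) by (simp add: field_simps)
    finally show "L * r \<le> m / 2" .
  qed (use r0 m in \<open>auto simp: r_def\<close>)
  have low: "(m / 2) * norm \<xi> \<le> norm (T \<sigma> \<xi>)" if \<sigma>: "\<sigma> \<in> ball ?x r" for \<sigma> \<xi>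
  proof -
    have "T ?x \<xi> - T \<sigma> \<xi> = (nform b c ?x \<xi> - nform b c \<sigma> \<xi>, 0)" by (simp add: T_def)
    then have "norm (T ?x \<xi> - T \<sigma> \<xi>) = norm (nform b c ?x \<xi> - nform b c \<sigma> \<xi>)" by (simp add: norm_Pair)
    also have "\<dots> \<le> L * norm (?x - \<sigma>) * norm \<xi>" using L \<sigma> r r0 by auto
    also have "\<dots> \<le> L * r * norm \<xi>"
      using \<sigma> r0(3) by (intro mult_right_mono mult_left_mono) (auto simp: dist_norm)
    also have "\<dots> \<le> (m / 2) * norm \<xi>" using r(3) by (intro mult_right_mono) auto
    finally have "norm (T ?x \<xi> - T \<sigma> \<xi>) \<le> (m / 2) * norm \<xi>" .
    moreover have "m * norm \<xi> \<le> norm (T \<sigma> \<xi>) + norm (T ?x \<xi> - T \<sigma> \<xi>)"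
      using m(2)[of \<xi>] norm_triangle_sub[of "T ?x \<xi>" "T \<sigma> \<xi>"] by linarith
    ultimately show ?thesis by simp
  qed
  have T_inj: "inj (T \<sigma>)" if "\<sigma> \<in> ball ?x r" for \<sigma>
  proof (subst linear_injective_0[OF T_lin], intro allI impI)
    fix \<xi> assume "T \<sigma> \<xi> = 0"
    then show "\<xi> = 0" using low[OF that, of \<xi>] m(1) by (simp add: mult_le_0_iff)
  qed
  \<comment> \<open>A count of dimensions: \<open>k + card J = n\<close>.\<close>
  have T_surj: "range (T \<sigma>) = UNIV \<times> coord_space J" if \<sigma>: "\<sigma> \<in> ball ?x r" for \<sigma>
  proof (rule subspace_dim_equal)
    show "subspace (range (T \<sigma>))" by (rule linear_subspace_image[OF T_lin subspace_UNIV])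
    show "subspace ((UNIV :: (real^'k) set) \<times> coord_space J)"
      by (rule subspace_Times[OF subspace_UNIV coord_space_subspace])
    show "range (T \<sigma>) \<subseteq> UNIV \<times> coord_space J" using h_in by (auto simp: T_def)
    have "dim (range (T \<sigma>)) = CARD('n)"
      using dim_image_eq[OF T_lin, where S = UNIV] T_inj[OF \<sigma>] by (simp add: dim_UNIV)
    moreover have "dim ((UNIV :: (real^'k) set) \<times> coord_space J) = CARD('k) + card J"
      by (subst dim_Times[OF subspace_UNIV coord_space_subspace]) (simp add: dim_coord_space)
    ultimately show "dim (range (T \<sigma>)) \<ge> dim ((UNIV :: (real^'k) set) \<times> coord_space J)"
      using card_J dim_normal_space(2)[OF b c] by simp
  qed
  define X where "X \<sigma> j = inv (T \<sigma>) (0, axis j 1)" for \<sigma> j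
  have TX: "T \<sigma> (X \<sigma> j) = (0, axis j 1)" if "\<sigma> \<in> ball ?x r" "j \<in> J" for \<sigma> j
  proof -
    have "(0, axis j 1) \<in> range (T \<sigma>)"
      unfolding T_surj[OF that(1)] using that(2) by (auto simp: coord_space_def axis_def)
    then show ?thesis unfolding X_def by (rule f_inv_into_f)
  qed
  have TXsum: "T \<sigma> (\<Sum>j\<in>J. y $ j *\<^sub>R X \<sigma> j) = (0, y)" if "\<sigma> \<in> ball ?x r" "y \<in> coord_space J" for \<sigma> y
  proof -
    have "T \<sigma> (\<Sum>j\<in>J. y $ j *\<^sub>R X \<sigma> j) = (\<Sum>j\<in>J. y $ j *\<^sub>R (0, axis j 1))"
      unfolding linear_sum[OF T_lin] linear_cmul[OF T_lin] by (rule sum.cong) (simp_all add: TX[OF that(1)])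
    also have "\<dots> = (0, \<Sum>j\<in>J. y $ j *\<^sub>R axis j 1)" by (simp add: sum_prod)
    finally show ?thesis by (simp add: coord_space_expansion[OF that(2)])
  qed
  define W where "W = {s' \<in> fst b. snd b s' \<in> ball ?x r}"
  define V where "V = \<phi> ` W"
  have W: "s' \<in> topspace S \<and> s' \<in> fst b \<and> \<phi> s' \<in> fst c \<and> snd b s' \<in> ball ?x r" if "s' \<in> W" for s'
  proof -
    have s': "s' \<in> fst b" "snd b s' \<in> ball ?x r" using that by (auto simp: W_def)
    then have "snd b s' \<in> dom\<Phi> b c" using r0(2) r(2) by auto
    then obtain s'' where "s'' \<in> fst b" "\<phi> s'' \<in> fst c" "snd b s' = snd b s''" by auto
    then have "\<phi> s' \<in> fst c" using s' S.chart_facts(4)[OF b(1)] by (metis inj_onD)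
    then show ?thesis using s' S.chart_facts(5)[OF b(1)] by blast
  qed
  define e where "e j q = tvec_of A c q (X (snd (ichart b) q) j)" for j q
  have oW: "openin S W" unfolding W_def by (rule S.openin_chart_preimage[OF b(1) open_ball])
  have V: "openin (subtopology M img) V" unfolding V_def by (rule \<phi>_open[OF oW])
  have eT: "e j (\<phi> s') \<in> tangent_space A (\<phi> s')" "snd (e j (\<phi> s')) c = X (snd b s') j" if "s' \<in> W" for s' j
    using W[OF that] M.tvec_of_in[OF c(1)] M.tvec_of_self[OF c(1)] ichart_apply by (auto simp: e_def)
  have e_normal: "e j (\<phi> s') \<in> \<nu> \<and> fst (e j (\<phi> s')) = \<phi> s'" if s': "s' \<in> W" and j: "j \<in> J" for s' j
  proof -
    have "T (snd b s') (X (snd b s') j) = (0, axis j 1)" using TX W[OF s'] j by blast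
    then have "nform b c (snd b s') (X (snd b s') j) = 0" by (simp add: T_def)
    then show ?thesis using normal_bundle_iff[OF b(1) _ c(1)] W[OF s'] eT[OF s'] by auto
  qed
  have lipX: "norm (X \<sigma> j - X \<sigma>' j) \<le> (2 / m) * (L * (2 / m)) * norm (\<sigma> - \<sigma>')"
    if \<sigma>: "\<sigma> \<in> ball ?x r" "\<sigma>' \<in> ball ?x r" and j: "j \<in> J" for \<sigma> \<sigma>' j
  proof -
    have "(m / 2) * norm (X \<sigma>' j) \<le> norm (T \<sigma>' (X \<sigma>' j))" by (rule low[OF \<sigma>(2)])
    also have "\<dots> = 1" by (simp add: TX[OF \<sigma>(2) j] norm_Pair norm_axis_1)
    finally have X': "norm (X \<sigma>' j) \<le> 2 / m" using m(1) by (simp add: field_simps)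
    have "T \<sigma> (X \<sigma> j - X \<sigma>' j) = T \<sigma>' (X \<sigma>' j) - T \<sigma> (X \<sigma>' j)"
      by (simp add: linear_diff[OF T_lin] TX[OF \<sigma>(1) j] TX[OF \<sigma>(2) j])
    also have "\<dots> = (nform b c \<sigma>' (X \<sigma>' j) - nform b c \<sigma> (X \<sigma>' j), 0)" by (simp add: T_def)
    finally have "norm (T \<sigma> (X \<sigma> j - X \<sigma>' j)) = norm (nform b c \<sigma>' (X \<sigma>' j) - nform b c \<sigma> (X \<sigma>' j))"
      by (simp add: norm_Pair)
    also have "\<dots> \<le> L * norm (\<sigma>' - \<sigma>) * norm (X \<sigma>' j)" using L \<sigma> r(2) by auto
    also have "\<dots> \<le> L * norm (\<sigma>' - \<sigma>) * (2 / m)" using r0(3) X' by (intro mult_left_mono) auto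
    finally have "(m / 2) * norm (X \<sigma> j - X \<sigma>' j) \<le> L * norm (\<sigma> - \<sigma>') * (2 / m)"
      using low[OF \<sigma>(1), of "X \<sigma> j - X \<sigma>' j"] by (simp add: norm_minus_commute)
    then show ?thesis using m(1) by (simp add: field_simps)
  qed
  have Vimg: "V \<subseteq> topspace (subtopology M img)" using openin_subset[OF V] .
  have e_lip: "locally_lipschitz_map (image_charts S B \<phi>) V (tangent_charts A) (e j)" if j: "j \<in> J" for j
  proof (rule locally_lipschitz_map_by_some_charts[OF image_lip_atlas M.tangent_lip_atlas Vimg])
    show "e j ` V \<subseteq> topspace (tangent_topology A)"
    proof (rule image_subsetI)
      fix q assume "q \<in> V"
      then obtain s' where s': "s' \<in> W" "q = \<phi> s'" by (auto simp: V_def)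
      then show "e j q \<in> topspace (tangent_topology A)"
        unfolding M.topspace_tangent
        using eT(1)[OF s'(1), of j] W[OF s'(1)] \<phi>_in[of s'] M.tangent_fst[OF eT(1)[OF s'(1), of j]] by simp
    qed
    fix q assume "q \<in> V"
    then obtain s' where s': "s' \<in> W" "q = \<phi> s'" by (auto simp: V_def)
    note Ws = W[OF s'(1)]
    have lip1: "lip_at (ichart b) c V (\<lambda>q. q) q"
      unfolding s'(2) by (rule lip_at_mono[OF ichart_lip_at[OF b(1) _ c(1)]]) (use Ws Vimg in auto)
    obtain t K where t: "t > 0" "K \<ge> 0" "(\<lambda>q. q) ` chart_ball V (ichart b) q t \<subseteq> fst c"
       "\<forall>x\<in>chart_ball V (ichart b) q t. \<forall>y\<in>chart_ball V (ichart b) q t.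
        dist (snd c x) (snd c y) \<le> K * dist (snd (ichart b) x) (snd (ichart b) y)"
      by (rule lip_atE[OF lip1])
    have "lip_at (ichart b) (M.tchart c) V (e j) q"
    proof (rule lip_atI[OF t(1), of "K + (2 / m) * (L * (2 / m))"])
      show "0 \<le> K + (2 / m) * (L * (2 / m))" using t(2) m(1) r0(3) by simp
      fix x assume "x \<in> chart_ball V (ichart b) q t"
      then obtain s1 where "s1 \<in> W" "x = \<phi> s1" by (auto simp: chart_ball_def V_def)
      then show "e j x \<in> fst (M.tchart c)" using eT(1)[of s1 j] W[of s1] M.tangent_fst[of "e j x" x]
        by (simp add: M.tchart_def)
    next
      fix x y assume xy: "x \<in> chart_ball V (ichart b) q t" "y \<in> chart_ball V (ichart b) q t"
      then obtain s1 s2 where s12: "s1 \<in> W" "x = \<phi> s1" "s2 \<in> W" "y = \<phi> s2" by (auto simp: chart_ball_def V_def)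
      have bx: "snd (ichart b) x = snd b s1" "snd (ichart b) y = snd b s2"
        using s12 W ichart_apply by auto
      have "dist (snd (M.tchart c) (e j x)) (snd (M.tchart c) (e j y))
          = norm (snd c x - snd c y, X (snd b s1) j - X (snd b s2) j)"
        using s12 eT M.tangent_fst[OF eT(1)] by (simp add: M.tchart_def dist_norm)
      also have "\<dots> \<le> norm (snd c x - snd c y) + norm (X (snd b s1) j - X (snd b s2) j)" by (rule norm_Pair_le)
      also have "\<dots> \<le> K * dist (snd (ichart b) x) (snd (ichart b) y) +
          (2 / m) * (L * (2 / m)) * dist (snd (ichart b) x) (snd (ichart b) y)"
      proof (rule add_mono)
        show "norm (snd c x - snd c y) \<le> K * dist (snd (ichart b) x) (snd (ichart b) y)"
          using t(4) xy by (simp add: dist_norm)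
        show "norm (X (snd b s1) j - X (snd b s2) j) \<le> (2 / m) * (L * (2 / m)) * dist (snd (ichart b) x) (snd (ichart b) y)"
          unfolding bx dist_norm by (rule lipX[OF _ _ j]) (use W s12 in blast)+
      qed
      finally show "dist (snd (M.tchart c) (e j x)) (snd (M.tchart c) (e j y)) \<le>
          (K + (2 / m) * (L * (2 / m))) * dist (snd (ichart b) x) (snd (ichart b) y)"
        by (simp only: distrib_right)
    qed
    moreover have "q \<in> fst (ichart b)" using s' Ws by (simp add: ichart_dom[OF b(1)])
    moreover have "e j q \<in> fst (M.tchart c)"
      using eT(1)[OF s'(1), of j] Ws s'(2) M.tangent_fst[of "e j q" q] by (simp add: M.tchart_def)
    ultimately show "\<exists>k\<in>image_charts S B \<phi>. \<exists>a\<in>tangent_charts A. q \<in> fst k \<and> e j q \<in> fst a \<and> lip_at k a V (e j) q"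
      unfolding image_charts_eq M.tangent_charts_eq using b(1) c(1) by blast
  qed
  have unique: "\<exists>!y. y \<in> coord_space J \<and> v = frame_comb J e (fst v) y" if v: "v \<in> \<nu>" "fst v \<in> V" for v
  proof -
    obtain s' where s': "s' \<in> W" "fst v = \<phi> s'" using v(2) by (auto simp: V_def)
    note Ws = W[OF s'(1)]
    let ?\<sigma> = "snd b s'"
    have vT: "v \<in> tangent_space A (\<phi> s')" "nform b c ?\<sigma> (snd v c) = 0"
      using normal_bundle_iff[OF b(1) _ c(1), of s' v] Ws v s'(2) by auto
    have fc: "frame_comb J e (\<phi> s') y = tvec_of A c (\<phi> s') (\<Sum>j\<in>J. y $ j *\<^sub>R X ?\<sigma> j)" for y
      using frame_comb_tvec[OF c(1), of "\<phi> s'" e y] Ws eT[OF s'(1)] by simp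
    \<comment> \<open>Applying the injective map \<open>T\<close> to \<open>v = y\<^sup>j e\<^sub>j\<close> gives the pair \<open>(0, h v) = (0, y)\<close>.\<close>
    have eqv: "v = frame_comb J e (fst v) y \<longleftrightarrow> y = h (snd v c)" if y: "y \<in> coord_space J" for y
    proof -
      have "v = frame_comb J e (fst v) y \<longleftrightarrow> snd v c = (\<Sum>j\<in>J. y $ j *\<^sub>R X ?\<sigma> j)"
        unfolding s'(2) fc
      proof
        assume "v = tvec_of A c (\<phi> s') (\<Sum>j\<in>J. y $ j *\<^sub>R X ?\<sigma> j)"
        then show "snd v c = (\<Sum>j\<in>J. y $ j *\<^sub>R X ?\<sigma> j)"
          using M.tvec_of_self[OF c(1), of "\<phi> s'"] Ws by simp
      next
        assume "snd v c = (\<Sum>j\<in>J. y $ j *\<^sub>R X ?\<sigma> j)"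
        then show "v = tvec_of A c (\<phi> s') (\<Sum>j\<in>J. y $ j *\<^sub>R X ?\<sigma> j)"
          using M.tangent_tvec_of[OF vT(1) c(1)] Ws by simp
      qed
      also have "\<dots> \<longleftrightarrow> T ?\<sigma> (snd v c) = T ?\<sigma> (\<Sum>j\<in>J. y $ j *\<^sub>R X ?\<sigma> j)"
        using T_inj[of ?\<sigma>] Ws by (auto dest: injD)
      also have "\<dots> \<longleftrightarrow> y = h (snd v c)" using TXsum[OF _ y, of ?\<sigma>] Ws vT(2) by (auto simp: T_def)
      finally show ?thesis .
    qed
    show ?thesis
    proof (rule ex1I[of _ "h (snd v c)"])
      show "h (snd v c) \<in> coord_space J \<and> v = frame_comb J e (fst v) (h (snd v c))" using h_in eqv by blast
      show "\<And>y. y \<in> coord_space J \<and> v = frame_comb J e (fst v) y \<Longrightarrow> y = h (snd v c)" using eqv by blast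
    qed
  qed
  have "normal_frame M A g S B \<phi> J V e"
    unfolding normal_frame_def using V e_normal e_lip unique by (auto simp: V_def)
  moreover have "\<phi> s \<in> V" using b(2) r(1) by (auto simp: V_def W_def)
  ultimately show ?thesis by blast
qed

end

context c11_submanifold begin

section \<open>Charts of the normal bundle\<close>

abbreviation "frame \<equiv> normal_frame M A g S B \<phi> J"

definition fiber_coord :: "('n \<Rightarrow> 'm \<Rightarrow> ('m, real^'n) tvec) \<Rightarrow> ('m, real^'n) tvec \<Rightarrow> real^'n" where
  "fiber_coord e v = (THE y. y \<in> coord_space J \<and> v = frame_comb J e (fst v) y)"

definition nchart :: "('s, real^'k) chart \<Rightarrow> 'm set \<Rightarrow> ('n \<Rightarrow> 'm \<Rightarrow> ('m, real^'n) tvec) \<Rightarrow>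
    (('m, real^'n) tvec, (real^'k) \<times> (real^'n)) chart" where
  "nchart b V e = ({v \<in> \<nu>. fst v \<in> V \<inter> fst (ichart b)}, \<lambda>v. (snd (ichart b) (fst v), fiber_coord e v))"

lemma normal_trivs_eq: "normal_trivs M A g S B \<phi> J = {(V, fiber_coord e) | V e. frame V e}"
  unfolding normal_trivs_def fiber_coord_def by simp

lemma normal_charts_eq: "normal_charts M A g S B \<phi> J = {nchart b V e | b V e. b \<in> B \<and> frame V e}"
  unfolding normal_charts_def normal_trivs_eq image_charts_eq nchart_def by blast

lemma normal_tangent: "v \<in> \<nu> \<Longrightarrow> fst v \<in> img \<and> v \<in> tangent_space A (fst v)"
  using normal_bundle_base by fastforce

lemma frame_facts:
  assumes "frame V e"
  shows "openin (subtopology M img) V" "V \<subseteq> img"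
    "\<And>j q. j \<in> J \<Longrightarrow> q \<in> V \<Longrightarrow> e j q \<in> \<nu> \<and> fst (e j q) = q"
    "\<And>j. j \<in> J \<Longrightarrow> locally_lipschitz_map (image_charts S B \<phi>) V (tangent_charts A) (e j)"
    "\<And>v. v \<in> \<nu> \<Longrightarrow> fst v \<in> V \<Longrightarrow> \<exists>!y. y \<in> coord_space J \<and> v = frame_comb J e (fst v) y"
proof -
  show V: "openin (subtopology M img) V" using assms unfolding normal_frame_def by blast
  show "V \<subseteq> img" using openin_subset[OF V] by auto
qed (use assms in \<open>unfold normal_frame_def, blast+\<close>)

lemma frame_tangent: "frame V e \<Longrightarrow> j \<in> J \<Longrightarrow> q \<in> V \<Longrightarrow> e j q \<in> tangent_space A q"
  using frame_facts(3) normal_tangent by metis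

lemma fiber_coord_spec:
  assumes "frame V e" "v \<in> \<nu>" "fst v \<in> V"
  shows "fiber_coord e v \<in> coord_space J" "frame_comb J e (fst v) (fiber_coord e v) = v"
  using theI'[OF frame_facts(5)[OF assms]] unfolding fiber_coord_def by auto

lemma fiber_coord_unique:
  assumes "frame V e" "v \<in> \<nu>" "fst v \<in> V" "y \<in> coord_space J" "v = frame_comb J e (fst v) y"
  shows "fiber_coord e v = y"
  unfolding fiber_coord_def using frame_facts(5)[OF assms(1-3)] assms(4,5) by (intro the1_equality) auto

definition frame_map :: "('n \<Rightarrow> 'm \<Rightarrow> ('m, real^'n) tvec) \<Rightarrow> ('m, real^'n) chart \<Rightarrow> 'm \<Rightarrow> real^'n \<Rightarrow> real^'n" where
  "frame_map e c q y = (\<Sum>j\<in>J. y $ j *\<^sub>R snd (e j q) c)"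

lemma frame_comb_fst [simp]: "fst (frame_comb J e q y) = q"
  by (simp add: frame_comb_def)

lemma frame_comb_snd: "snd (frame_comb J e q y) c = frame_map e c q y"
  by (simp add: frame_comb_def frame_map_def)

lemma frame_map_linear: "linear (frame_map e c q)"
  by (rule linearI) (simp_all add: frame_map_def sum.distrib scaleR_sum_right algebra_simps)

lemma frame_comb_tangent:
  assumes "frame V e" "q \<in> V" shows "frame_comb J e q y \<in> tangent_space A q"
proof -
  have "q \<in> topspace M" using assms frame_facts(2) \<phi>_in by blast
  then obtain c where c: "c \<in> A" "q \<in> fst c" using M.chart_exists by blast
  show ?thesis by (subst frame_comb_tvec[where e = e and q = q, OF c frame_tangent[OF assms(1) _ assms(2)]]) (auto intro: M.tvec_of_in[OF c])
qed

lemma frame_comb_normal: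
  assumes "frame V e" "q \<in> V" shows "frame_comb J e q y \<in> \<nu>"
proof -
  obtain s where s: "s \<in> topspace S" "q = \<phi> s" using assms frame_facts(2) by blast
  obtain b where b: "b \<in> B" "s \<in> fst b" using S.chart_exists[OF s(1)] by blast
  obtain c where c: "c \<in> A" "\<phi> s \<in> fst c" using M.chart_exists[OF \<phi>_in[OF s(1)]] by blast
  have "nform b c (snd b s) (snd (e j q) c) = 0" if "j \<in> J" for j
    using normal_bundle_iff[OF b c, of "e j q"] frame_facts(3)[OF assms(1) that assms(2)] s(2) by simp
  then have "nform b c (snd b s) (frame_map e c q y) = 0"
    unfolding frame_map_def linear_sum[OF nform_linear] linear_cmul[OF nform_linear] by simp
  then show ?thesis
    using normal_bundle_iff[OF b c, of "frame_comb J e q y"] frame_comb_tangent[OF assms] s(2)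
    by (simp add: frame_comb_snd)
qed

lemma fiber_coord_frame_comb:
  assumes "frame V e" "q \<in> V" "y \<in> coord_space J"
  shows "fiber_coord e (frame_comb J e q y) = y"
  using fiber_coord_unique[OF assms(1) frame_comb_normal[OF assms(1,2), of y] _ assms(3)] assms(2) by simp

lemma normal_snd:
  assumes "frame V e" "v \<in> \<nu>" "fst v \<in> V"
  shows "snd v c = frame_map e c (fst v) (fiber_coord e v)"
  using fiber_coord_spec(2)[OF assms] frame_comb_snd by metis

lemma tzero_normal: "s \<in> topspace S \<Longrightarrow> tzero (\<phi> s) \<in> \<nu>"
proof -
  assume s: "s \<in> topspace S"
  obtain b where b: "b \<in> B" "s \<in> fst b" using S.chart_exists[OF s] by blast
  obtain c where c: "c \<in> A" "\<phi> s \<in> fst c" using M.chart_exists[OF \<phi>_in[OF s]] by blast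
  show "tzero (\<phi> s) \<in> \<nu>"
    using normal_bundle_iff[OF b c, of "tzero (\<phi> s)"] M.tzero_in[of "\<phi> s"] linear_0[OF nform_linear]
    by (simp add: tzero_def)
qed

lemma fiber_coord_tzero: "frame V e \<Longrightarrow> q \<in> V \<Longrightarrow> fiber_coord e (tzero q) = 0"
proof -
  assume f: "frame V e" and q: "q \<in> V"
  have "q \<in> img" using f q frame_facts(2) by blast
  then have "tzero q \<in> \<nu>" using tzero_normal by blast
  moreover have "tzero q = frame_comb J e q 0" by (simp add: tzero_def frame_comb_def)
  ultimately show ?thesis using fiber_coord_unique[OF f, of "tzero q" 0] q
    by (simp add: tzero_def subspace_0[OF coord_space_subspace])
qed

text \<open>
  Uniqueness of coefficients says that the frame map is injective on the fibre model; in finite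
  dimension this gives a lower bound.
\<close>

lemma frame_map_lower:
  assumes f: "frame V e" and q: "q \<in> V" "c \<in> A" "q \<in> fst c"
  obtains m where "m > 0" "\<forall>y\<in>coord_space J. m * norm y \<le> norm (frame_map e c q y)"
proof -
  have "y = 0" if y: "y \<in> coord_space J" "frame_map e c q y = 0" for y
  proof -
    have "frame_comb J e q y = tzero q"
      by (rule M.tangent_eqI[OF frame_comb_tangent[OF f q(1)] M.tzero_in q(2,3)])
        (simp add: frame_comb_snd y(2) tzero_def)
    then show ?thesis using fiber_coord_frame_comb[OF f q(1) y(1)] fiber_coord_tzero[OF f q(1)] by simp
  qed
  then show ?thesis
    using injective_imp_isometric[OF closed_subspace[OF coord_space_subspace] coord_space_subspace, of "frame_map e c q"]
      linear_conv_bounded_linear[THEN iffD1, OF frame_map_linear[of e c q]] that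
    by (metis mult.commute)
qed

lemma frame_map_lipschitz:
  assumes f: "frame V e" and b: "b \<in> B" "s \<in> fst b" and c: "c \<in> A" "\<phi> s \<in> fst c" and sV: "\<phi> s \<in> V"
  obtains r L where "r > 0" "L \<ge> 0" "chart_ball V (ichart b) (\<phi> s) r \<subseteq> fst c"
    "\<forall>x\<in>chart_ball V (ichart b) (\<phi> s) r. \<forall>x'\<in>chart_ball V (ichart b) (\<phi> s) r. \<forall>y.
       norm (frame_map e c x y - frame_map e c x' y) \<le> L * dist (snd (ichart b) x) (snd (ichart b) x') * norm y"
proof -
  have s: "s \<in> topspace S" using S.chart_facts(5)[OF b(1)] b(2) by blast
  have sb: "\<phi> s \<in> fst (ichart b)" using ichart_dom[OF b(1) s] b(2) by blast
  have "\<exists>r L. r > 0 \<and> L \<ge> 0 \<and> (\<forall>x\<in>chart_ball V (ichart b) (\<phi> s) r. \<forall>x'\<in>chart_ball V (ichart b) (\<phi> s) r.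
       norm (snd (e j x) c - snd (e j x') c) \<le> L * dist (snd (ichart b) x) (snd (ichart b) x'))" if j: "j \<in> J" for j
  proof -
    have "e j (\<phi> s) \<in> fst (M.tchart c)"
      using frame_tangent[OF f j sV] c(2) M.tangent_fst[OF frame_tangent[OF f j sV]] by (simp add: M.tchart_def)
    then have "lip_at (ichart b) (M.tchart c) V (e j) (\<phi> s)"
      using locally_lipschitz_map_iff_lip_at[of "image_charts S B \<phi>" V "tangent_charts A" "e j", OF lip_atlas_inj[OF image_lip_atlas]]
        frame_facts(4)[OF f j] sV sb b(1) c(1) unfolding image_charts_eq M.tangent_charts_eq by blast
    then obtain r L where r: "r > 0" "L \<ge> 0"
      "\<forall>x\<in>chart_ball V (ichart b) (\<phi> s) r. \<forall>x'\<in>chart_ball V (ichart b) (\<phi> s) r.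
        dist (snd (M.tchart c) (e j x)) (snd (M.tchart c) (e j x')) \<le> L * dist (snd (ichart b) x) (snd (ichart b) x')"
      by (rule lip_atE)
    have "norm (snd (e j x) c - snd (e j x') c) \<le> dist (snd (M.tchart c) (e j x)) (snd (M.tchart c) (e j x'))" for x x'
      using dist_snd_le[of "snd (M.tchart c) (e j x)" "snd (M.tchart c) (e j x')"] by (simp add: M.tchart_def dist_norm)
    then show ?thesis using r by (meson order_trans)
  qed
  then obtain r L where rL: "\<And>j. j \<in> J \<Longrightarrow> r j > 0 \<and> L j \<ge> 0 \<and> (\<forall>x\<in>chart_ball V (ichart b) (\<phi> s) (r j). \<forall>x'\<in>chart_ball V (ichart b) (\<phi> s) (r j).
       norm (snd (e j x) c - snd (e j x') c) \<le> L j * dist (snd (ichart b) x) (snd (ichart b) x'))" by metis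
  have "lip_at (ichart b) c V (\<lambda>q. q) (\<phi> s)"
    by (rule lip_at_mono[OF ichart_lip_at[OF b c] frame_facts(2)[OF f]])
  then obtain r0 K where r0: "r0 > 0" "(\<lambda>q. q) ` chart_ball V (ichart b) (\<phi> s) r0 \<subseteq> fst c" by (rule lip_atE)
  define R where "R = Min (insert r0 (r ` J))"
  have R: "R > 0" "R \<le> r0" "\<And>j. j \<in> J \<Longrightarrow> R \<le> r j"
    using rL r0(1) by (auto simp: R_def)
  have sub: "chart_ball V (ichart b) (\<phi> s) R \<subseteq> chart_ball V (ichart b) (\<phi> s) r'" if "R \<le> r'" for r'
    using chart_ball_mono[OF order_refl that] .
  show ?thesis
  proof (rule that[of R "\<Sum>j\<in>J. L j"])
    show "chart_ball V (ichart b) (\<phi> s) R \<subseteq> fst c" using r0(2) sub[OF R(2)] by auto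
    show "(\<Sum>j\<in>J. L j) \<ge> 0" using rL by (intro sum_nonneg) auto
    show "\<forall>x\<in>chart_ball V (ichart b) (\<phi> s) R. \<forall>x'\<in>chart_ball V (ichart b) (\<phi> s) R. \<forall>y.
       norm (frame_map e c x y - frame_map e c x' y) \<le> (\<Sum>j\<in>J. L j) * dist (snd (ichart b) x) (snd (ichart b) x') * norm y"
    proof (intro ballI allI)
      fix x x' and y :: "real^'n" assume x: "x \<in> chart_ball V (ichart b) (\<phi> s) R" "x' \<in> chart_ball V (ichart b) (\<phi> s) R"
      let ?d = "dist (snd (ichart b) x) (snd (ichart b) x')"
      have "norm (frame_map e c x y - frame_map e c x' y) = norm (\<Sum>j\<in>J. y $ j *\<^sub>R (snd (e j x) c - snd (e j x') c))"
        by (simp add: frame_map_def sum_subtractf scaleR_diff_right)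
      also have "\<dots> \<le> (\<Sum>j\<in>J. norm y * (L j * ?d))"
      proof (rule sum_norm_le)
        fix j assume j: "j \<in> J"
        have "norm (snd (e j x) c - snd (e j x') c) \<le> L j * ?d" using rL[OF j] x sub[OF R(3)[OF j]] by blast
        then show "norm (y $ j *\<^sub>R (snd (e j x) c - snd (e j x') c)) \<le> norm y * (L j * ?d)"
          unfolding norm_scaleR by (intro mult_mono component_le_norm_cart) auto
      qed
      also have "\<dots> = (\<Sum>j\<in>J. L j) * ?d * norm y" by (simp add: sum_distrib_left sum_distrib_right mult_ac)
      finally show "norm (frame_map e c x y - frame_map e c x' y) \<le> (\<Sum>j\<in>J. L j) * ?d * norm y" .
    qed
  qed (rule R(1))
qed

lemma nchart_elim:
  assumes "v \<in> fst (nchart b V e)"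
  shows "v \<in> \<nu>" "fst v \<in> V" "fst v \<in> fst (ichart b)" "v \<in> tangent_space A (fst v)"
  using assms normal_tangent by (auto simp: nchart_def)

text \<open>
  The vector \<open>y\<^sup>j e\<^sub>j(s)\<close> is linear in \<open>y\<close> and Lipschitz in \<open>s\<close>, hence jointly Lipschitz where \<open>y\<close>
  is bounded.
\<close>

lemma nchart_lip_tchart:
  assumes f: "frame V e" and b: "b \<in> B" and c: "c \<in> A" and v0: "v0 \<in> fst (nchart b V e)" "v0 \<in> fst (M.tchart c)"
  shows "lip_at (nchart b V e) (M.tchart c) \<nu> (\<lambda>v. v) v0"
proof -
  let ?\<kappa> = "snd (ichart b)"
  note v0' = nchart_elim[OF v0(1)]
  obtain s where s: "s \<in> topspace S" "fst v0 = \<phi> s" using normal_bundle_base[OF v0'(1)] by blast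
  have sb: "s \<in> fst b" using v0'(3) s ichart_dom[OF b] by simp
  have sc: "\<phi> s \<in> fst c" using v0(2) s(2) by (simp add: M.tchart_def)
  have sV: "\<phi> s \<in> V" using v0' s by simp
  obtain r L where r: "r > 0" "L \<ge> 0" "chart_ball V (ichart b) (\<phi> s) r \<subseteq> fst c"
    and L: "\<forall>x\<in>chart_ball V (ichart b) (\<phi> s) r. \<forall>x'\<in>chart_ball V (ichart b) (\<phi> s) r. \<forall>y.
       norm (frame_map e c x y - frame_map e c x' y) \<le> L * dist (?\<kappa> x) (?\<kappa> x') * norm y"
    by (rule frame_map_lipschitz[OF f b sb c sc sV])
  have "lip_at (ichart b) c V (\<lambda>q. q) (\<phi> s)"
    by (rule lip_at_mono[OF ichart_lip_at[OF b sb c sc] frame_facts(2)[OF f]])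
  then obtain r1 K where r1: "r1 > 0" "K \<ge> 0"
    "\<forall>x\<in>chart_ball V (ichart b) (\<phi> s) r1. \<forall>y\<in>chart_ball V (ichart b) (\<phi> s) r1.
        dist (snd c x) (snd c y) \<le> K * dist (?\<kappa> x) (?\<kappa> y)" by (rule lip_atE)
  obtain K0 where K0: "K0 \<ge> 0" "\<And>y. norm (frame_map e c (\<phi> s) y) \<le> K0 * norm y"
    using linear_bounded_pos[OF frame_map_linear] by (metis less_imp_le)
  define t where "t = min 1 (min r r1)"
  have t: "t > 0" "t \<le> 1" "t \<le> r" "t \<le> r1" using r r1 by (auto simp: t_def)
  define Y where "Y = norm (fiber_coord e v0) + 1"
  have near: "v \<in> \<nu> \<and> fst v \<in> V \<and> fst v \<in> chart_ball V (ichart b) (\<phi> s) r \<and> fst v \<in> chart_ball V (ichart b) (\<phi> s) r1 \<and>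
      norm (fiber_coord e v) \<le> Y" if v: "v \<in> chart_ball \<nu> (nchart b V e) v0 t" for v
  proof -
    have vn: "v \<in> fst (nchart b V e)" "dist (snd (nchart b V e) v) (snd (nchart b V e) v0) < t"
      using v by (auto simp: chart_ball_def)
    have "dist (?\<kappa> (fst v)) (?\<kappa> (\<phi> s)) < t" "dist (fiber_coord e v) (fiber_coord e v0) < t"
      using vn(2) dist_fst_le[of "snd (nchart b V e) v" "snd (nchart b V e) v0"]
        dist_snd_le[of "snd (nchart b V e) v" "snd (nchart b V e) v0"] s(2) by (auto simp: nchart_def)
    then show ?thesis
      using nchart_elim[OF vn(1)] t norm_triangle_ineq[of "fiber_coord e v - fiber_coord e v0" "fiber_coord e v0"]
      by (auto simp: chart_ball_def Y_def dist_norm)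
  qed
  let ?C = "K + (K0 + L * r) + L * Y"
  have Y0: "Y \<ge> 0" by (simp add: Y_def)
  show ?thesis
  proof (rule lip_atI[OF t(1), of ?C])
    show "?C \<ge> 0" using r r1 K0 Y0 by simp
    fix v assume "v \<in> chart_ball \<nu> (nchart b V e) v0 t"
    then show "v \<in> fst (M.tchart c)" using near[of v] r(3) normal_tangent[of v] by (auto simp: M.tchart_def)
  next
    fix v w assume v: "v \<in> chart_ball \<nu> (nchart b V e) v0 t" and w: "w \<in> chart_ball \<nu> (nchart b V e) v0 t"
    note nv = near[OF v] and nw = near[OF w]
    let ?\<Delta> = "dist (snd (nchart b V e) v) (snd (nchart b V e) w)"
    let ?y = "fiber_coord e v" and ?z = "fiber_coord e w"
    have \<Delta>: "dist (?\<kappa> (fst v)) (?\<kappa> (fst w)) \<le> ?\<Delta>" "norm (?y - ?z) \<le> ?\<Delta>"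
      using dist_fst_le[of "snd (nchart b V e) v" "snd (nchart b V e) w"]
        dist_snd_le[of "snd (nchart b V e) v" "snd (nchart b V e) w"] by (auto simp: nchart_def dist_norm)
    have "dist (snd c (fst v)) (snd c (fst w)) \<le> K * dist (?\<kappa> (fst v)) (?\<kappa> (fst w))" using r1(3) nv nw by blast
    also have "\<dots> \<le> K * ?\<Delta>" by (intro mult_left_mono \<Delta> r1)
    finally have 1: "dist (snd c (fst v)) (snd c (fst w)) \<le> K * ?\<Delta>" .
    have e1: "snd v c - snd w c = frame_map e c (fst v) (?y - ?z) + (frame_map e c (fst v) ?z - frame_map e c (fst w) ?z)"
      using normal_snd[OF f, of v c] normal_snd[OF f, of w c] nv nw by (simp add: linear_diff[OF frame_map_linear])
    have e2: "norm (frame_map e c (fst v) (?y - ?z)) \<le> (K0 + L * r) * ?\<Delta>"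
    proof -
      have c0: "\<phi> s \<in> chart_ball V (ichart b) (\<phi> s) r" using sV v0'(3) s r by (auto intro: chart_ball_center)
      have "norm (frame_map e c (fst v) (?y - ?z)) \<le> norm (frame_map e c (\<phi> s) (?y - ?z)) +
          norm (frame_map e c (fst v) (?y - ?z) - frame_map e c (\<phi> s) (?y - ?z))" by (rule norm_triangle_sub)
      also have "\<dots> \<le> K0 * norm (?y - ?z) + L * dist (?\<kappa> (fst v)) (?\<kappa> (\<phi> s)) * norm (?y - ?z)"
        using L nv c0 by (intro add_mono K0) blast
      also have "\<dots> \<le> K0 * norm (?y - ?z) + L * r * norm (?y - ?z)"
        using nv r(2) by (intro add_mono mult_right_mono mult_left_mono) (auto simp: chart_ball_def)
      also have "\<dots> = (K0 + L * r) * norm (?y - ?z)" by (simp add: algebra_simps)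
      also have "\<dots> \<le> (K0 + L * r) * ?\<Delta>" using K0 r by (intro mult_left_mono \<Delta>) auto
      finally show ?thesis .
    qed
    have e3: "norm (frame_map e c (fst v) ?z - frame_map e c (fst w) ?z) \<le> L * Y * ?\<Delta>"
    proof -
      have "norm (frame_map e c (fst v) ?z - frame_map e c (fst w) ?z) \<le> L * dist (?\<kappa> (fst v)) (?\<kappa> (fst w)) * norm ?z"
        using L nv nw by blast
      also have "\<dots> \<le> L * ?\<Delta> * Y" using nw r(2) by (intro mult_mono mult_nonneg_nonneg \<Delta>) auto
      finally show ?thesis by (simp add: mult_ac)
    qed
    have "norm (snd v c - snd w c) \<le> (K0 + L * r) * ?\<Delta> + L * Y * ?\<Delta>"
      unfolding e1 by (rule norm_triangle_le) (use e2 e3 in simp)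
    moreover have "dist (snd (M.tchart c) v) (snd (M.tchart c) w) \<le> dist (snd c (fst v)) (snd c (fst w)) + norm (snd v c - snd w c)"
      unfolding M.tchart_def snd_conv dist_norm diff_Pair by (rule norm_Pair_le)
    ultimately have "dist (snd (M.tchart c) v) (snd (M.tchart c) w) \<le> K * ?\<Delta> + ((K0 + L * r) * ?\<Delta> + L * Y * ?\<Delta>)"
      using 1 by linarith
    also have "\<dots> = ?C * ?\<Delta>" by (simp only: distrib_right add.assoc)
    finally show "dist (snd (M.tchart c) v) (snd (M.tchart c) w) \<le> ?C * ?\<Delta>" .
  qed
qed

text \<open>
  A lower bound for the frame map at the centre persists nearby. It controls the difference of the
  coefficients of two normal vectors by the difference of the vectors, up to the variation of the
  frame between the two base points.
\<close>

lemma tchart_lip_nchart: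
  assumes f: "frame V e" and b: "b \<in> B" and c: "c \<in> A" and v0: "v0 \<in> fst (nchart b V e)" "v0 \<in> fst (M.tchart c)"
  shows "lip_at (M.tchart c) (nchart b V e) \<nu> (\<lambda>v. v) v0"
proof -
  let ?\<kappa> = "snd (ichart b)"
  note v0' = nchart_elim[OF v0(1)]
  obtain s where s: "s \<in> topspace S" "fst v0 = \<phi> s" using normal_bundle_base[OF v0'(1)] by blast
  have sb: "s \<in> fst b" using v0'(3) s ichart_dom[OF b] by simp
  have sc: "\<phi> s \<in> fst c" using v0(2) s(2) by (simp add: M.tchart_def)
  have sV: "\<phi> s \<in> V" using v0' s by simp
  have simg: "\<phi> s \<in> img" using s by blast
  obtain r L where r: "r > 0" "L \<ge> 0" "chart_ball V (ichart b) (\<phi> s) r \<subseteq> fst c"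
    and L: "\<forall>x\<in>chart_ball V (ichart b) (\<phi> s) r. \<forall>x'\<in>chart_ball V (ichart b) (\<phi> s) r. \<forall>y.
       norm (frame_map e c x y - frame_map e c x' y) \<le> L * dist (?\<kappa> x) (?\<kappa> x') * norm y"
    by (rule frame_map_lipschitz[OF f b sb c sc sV])
  obtain m where m: "m > 0" "\<forall>y\<in>coord_space J. m * norm y \<le> norm (frame_map e c (\<phi> s) y)"
    by (rule frame_map_lower[OF f sV c sc])
  define r' where "r' = min r (m / (2 * (L + 1)))"
  have r': "r' > 0" "r' \<le> r" "L * r' \<le> m / 2"
  proof -
    have "L * r' \<le> L * (m / (2 * (L + 1)))" using r(2) by (intro mult_left_mono) (auto simp: r'_def)
    also have "\<dots> \<le> m / 2" using r(2) m(1) by (simp add: field_simps)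
    finally show "L * r' \<le> m / 2" .
  qed (use r m in \<open>auto simp: r'_def\<close>)
  note lipc = lip_at_ichart[OF b sb c sc]
  obtain r1 K where r1: "r1 > 0" "K \<ge> 0" "(\<lambda>q. q) ` chart_ball img c (\<phi> s) r1 \<subseteq> fst (ichart b)"
    "\<forall>x\<in>chart_ball img c (\<phi> s) r1. \<forall>y\<in>chart_ball img c (\<phi> s) r1. dist (?\<kappa> x) (?\<kappa> y) \<le> K * dist (snd c x) (snd c y)"
    by (rule lip_atE[OF lipc])
  obtain r2 where r2: "r2 > 0" "(\<lambda>q. q) ` chart_ball img c (\<phi> s) r2 \<subseteq> chart_ball img (ichart b) (\<phi> s) r'"
    by (rule lip_at_nbhd[OF lipc simg sc r'(1), of img]) auto
  obtain r3 where r3: "r3 > 0" "chart_ball img c (\<phi> s) r3 \<subseteq> V"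
    by (rule lip_atlas_openin_ball[OF lip_atlas_subtopology[OF M.manifold_lip_atlas] frame_facts(1)[OF f] sV c sc, unfolded topspace_img])
  define t where "t = min 1 (min r1 (min r2 r3))"
  have t: "t > 0" "t \<le> 1" "t \<le> r1" "t \<le> r2" "t \<le> r3" using r1 r2 r3 by (auto simp: t_def)
  define U where "U = norm (snd v0 c) + 1"
  have near: "v \<in> \<nu> \<and> fst v \<in> V \<and> fst v \<in> chart_ball V (ichart b) (\<phi> s) r \<and> dist (?\<kappa> (fst v)) (?\<kappa> (\<phi> s)) < r' \<and>
      fst v \<in> chart_ball img c (\<phi> s) r1 \<and> norm (snd v c) \<le> U" if v: "v \<in> chart_ball \<nu> (M.tchart c) v0 t" for v
  proof -
    have vn: "v \<in> \<nu>" "fst v \<in> fst c" "dist (snd (M.tchart c) v) (snd (M.tchart c) v0) < t"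
      using v by (auto simp: chart_ball_def M.tchart_def)
    have d: "dist (snd c (fst v)) (snd c (\<phi> s)) < t" "dist (snd v c) (snd v0 c) < t"
      using vn(3) dist_fst_le[of "snd (M.tchart c) v" "snd (M.tchart c) v0"]
        dist_snd_le[of "snd (M.tchart c) v" "snd (M.tchart c) v0"] s(2) by (auto simp: M.tchart_def)
    have "fst v \<in> img" using vn(1) normal_tangent by blast
    then have 1: "fst v \<in> chart_ball img c (\<phi> s) r1" "fst v \<in> chart_ball img c (\<phi> s) r2" "fst v \<in> chart_ball img c (\<phi> s) r3"
      using d(1) vn(2) t by (auto simp: chart_ball_def)
    then have "fst v \<in> chart_ball img (ichart b) (\<phi> s) r'" "fst v \<in> V" using r2 r3 by auto
    moreover have "norm (snd v c) \<le> U" using d(2) t norm_triangle_ineq[of "snd v c - snd v0 c" "snd v0 c"]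
      by (simp add: U_def dist_norm)
    ultimately show ?thesis using vn(1) 1 r'(2) by (auto simp: chart_ball_def)
  qed
  have c0: "\<phi> s \<in> chart_ball V (ichart b) (\<phi> s) r" using sV v0'(3) s r by (auto intro: chart_ball_center)
  have low: "(m / 2) * norm y \<le> norm (frame_map e c (fst v) y)"
    if v: "v \<in> chart_ball \<nu> (M.tchart c) v0 t" and y: "y \<in> coord_space J" for v y
  proof -
    note nv = near[OF v]
    have "norm (frame_map e c (\<phi> s) y - frame_map e c (fst v) y) \<le> L * dist (?\<kappa> (\<phi> s)) (?\<kappa> (fst v)) * norm y"
      using L nv c0 by blast
    also have "\<dots> \<le> L * r' * norm y" using nv r(2) by (intro mult_right_mono mult_left_mono) (auto simp: dist_commute)
    also have "\<dots> \<le> (m / 2) * norm y" by (intro mult_right_mono r') auto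
    finally have "norm (frame_map e c (\<phi> s) y - frame_map e c (fst v) y) \<le> (m / 2) * norm y" .
    moreover have "m * norm y \<le> norm (frame_map e c (fst v) y) + norm (frame_map e c (\<phi> s) y - frame_map e c (fst v) y)"
      using m(2) y norm_triangle_sub[of "frame_map e c (\<phi> s) y" "frame_map e c (fst v) y"] by force
    ultimately show ?thesis by simp
  qed
  let ?C = "K + (2 / m) * (1 + L * K * ((2 / m) * U))"
  have U0: "U \<ge> 0" by (simp add: U_def)
  show ?thesis
  proof (rule lip_atI[OF t(1), of ?C])
    show "?C \<ge> 0" using r r1 m U0 by simp
    fix v assume "v \<in> chart_ball \<nu> (M.tchart c) v0 t"
    then show "v \<in> fst (nchart b V e)" using near[of v] r1(3) by (auto simp: nchart_def)
  next
    fix v w assume v: "v \<in> chart_ball \<nu> (M.tchart c) v0 t" and w: "w \<in> chart_ball \<nu> (M.tchart c) v0 t"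
    note nv = near[OF v] and nw = near[OF w]
    let ?\<Delta> = "dist (snd (M.tchart c) v) (snd (M.tchart c) w)"
    let ?y = "fiber_coord e v" and ?z = "fiber_coord e w"
    have yz: "?y \<in> coord_space J" "?z \<in> coord_space J" using fiber_coord_spec(1)[OF f] nv nw by auto
    have \<Delta>: "dist (snd c (fst v)) (snd c (fst w)) \<le> ?\<Delta>" "norm (snd v c - snd w c) \<le> ?\<Delta>"
      using dist_fst_le[of "snd (M.tchart c) v" "snd (M.tchart c) w"]
        dist_snd_le[of "snd (M.tchart c) v" "snd (M.tchart c) w"] by (auto simp: M.tchart_def dist_norm)
    have "dist (?\<kappa> (fst v)) (?\<kappa> (fst w)) \<le> K * dist (snd c (fst v)) (snd c (fst w))" using r1(4) nv nw by blast
    also have "\<dots> \<le> K * ?\<Delta>" by (intro mult_left_mono \<Delta> r1)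
    finally have 1: "dist (?\<kappa> (fst v)) (?\<kappa> (fst w)) \<le> K * ?\<Delta>" .
    have "(m / 2) * norm ?z \<le> norm (snd w c)"
      using low[OF w yz(2)] normal_snd[OF f, of w c] nw by simp
    then have z: "norm ?z \<le> (2 / m) * U" using nw m(1) by (simp add: field_simps)
    have e1: "frame_map e c (fst v) (?y - ?z) = (snd v c - snd w c) + (frame_map e c (fst w) ?z - frame_map e c (fst v) ?z)"
      using normal_snd[OF f, of v c] normal_snd[OF f, of w c] nv nw by (simp add: linear_diff[OF frame_map_linear])
    have e3: "norm (frame_map e c (fst w) ?z - frame_map e c (fst v) ?z) \<le> L * K * ((2 / m) * U) * ?\<Delta>"
    proof -
      have "norm (frame_map e c (fst w) ?z - frame_map e c (fst v) ?z) \<le> L * dist (?\<kappa> (fst w)) (?\<kappa> (fst v)) * norm ?z"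
        using L nv nw by blast
      also have "\<dots> \<le> L * (K * ?\<Delta>) * ((2 / m) * U)"
        using 1 z r(2) r1(2) by (intro mult_mono mult_nonneg_nonneg) (auto simp: dist_commute)
      finally show ?thesis by (simp only: mult_ac)
    qed
    have "(m / 2) * norm (?y - ?z) \<le> norm (frame_map e c (fst v) (?y - ?z))"
      by (rule low[OF v subspace_diff[OF coord_space_subspace yz]])
    also have "\<dots> \<le> ?\<Delta> + L * K * ((2 / m) * U) * ?\<Delta>"
      unfolding e1 by (rule norm_triangle_le) (use \<Delta>(2) e3 in simp)
    also have "\<dots> = (1 + L * K * ((2 / m) * U)) * ?\<Delta>" by (simp only: distrib_right mult_1)
    finally have "norm (?y - ?z) \<le> (2 / m) * ((1 + L * K * ((2 / m) * U)) * ?\<Delta>)" using m(1) by (simp add: field_simps)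
    moreover have "dist (snd (nchart b V e) v) (snd (nchart b V e) w) \<le> dist (?\<kappa> (fst v)) (?\<kappa> (fst w)) + norm (?y - ?z)"
      unfolding nchart_def snd_conv dist_norm diff_Pair by (rule norm_Pair_le)
    ultimately have "dist (snd (nchart b V e) v) (snd (nchart b V e) w) \<le> K * ?\<Delta> + (2 / m) * ((1 + L * K * ((2 / m) * U)) * ?\<Delta>)"
      using 1 by linarith
    also have "\<dots> = ?C * ?\<Delta>" by (simp only: distrib_right mult.assoc)
    finally show "dist (snd (nchart b V e) v) (snd (nchart b V e) w) \<le> ?C * ?\<Delta>" .
  qed
qed

lemma nchart_inj:
  assumes f: "frame V e" and b: "b \<in> B" shows "inj_on (snd (nchart b V e)) (fst (nchart b V e))"
proof (rule inj_onI)
  fix v w assume v: "v \<in> fst (nchart b V e)" and w: "w \<in> fst (nchart b V e)"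
    and eq: "snd (nchart b V e) v = snd (nchart b V e) w"
  note v' = nchart_elim[OF v] and w' = nchart_elim[OF w]
  have eq': "snd (ichart b) (fst v) = snd (ichart b) (fst w)" "fiber_coord e v = fiber_coord e w"
    using eq by (auto simp: nchart_def)
  have "fst v = fst w" using eq'(1) v'(3) w'(3) ichart_inj[OF b] by (meson inj_onD)
  then show "v = w" using fiber_coord_spec(2)[OF f v'(1,2)] fiber_coord_spec(2)[OF f w'(1,2)] eq'(2) by metis
qed

abbreviation "NT \<equiv> normal_topology A g S B \<phi>"
abbreviation "NC \<equiv> normal_charts M A g S B \<phi> J"

lemma topspace_NT [simp]: "topspace NT = \<nu>"
  unfolding normal_topology_def using normal_tangent \<phi>_in by (fastforce simp: M.topspace_tangent)

lemma nchart_exists: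
  assumes "v \<in> \<nu>"
  obtains b V e where "b \<in> B" "frame V e" "v \<in> fst (nchart b V e)"
proof -
  obtain s where s: "s \<in> topspace S" "fst v = \<phi> s" using normal_bundle_base[OF assms] by blast
  obtain b where b: "b \<in> B" "s \<in> fst b" using S.chart_exists[OF s(1)] by blast
  obtain V e where Ve: "\<phi> s \<in> V" "frame V e" using normal_frame_exists[OF s(1)] by blast
  have "v \<in> fst (nchart b V e)" using assms s Ve ichart_dom[OF b(1) s(1)] b(2) by (simp add: nchart_def)
  then show ?thesis using that b(1) Ve(2) by blast
qed

text \<open>
  The topology of the normal bundle is induced from \<open>TM\<close>, while its coordinates come from frames;
  both descriptions agree since the two kinds of coordinates are Lipschitz equivalent.
\<close>

lemma normal_lip_atlas: "lip_atlas NT NC"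
  unfolding normal_topology_def
proof (rule lip_atlas_transfer[OF lip_atlas_subtopology[OF M.tangent_lip_atlas]], fold normal_topology_def)
  show "inj_on (snd a) (fst a)" if "a \<in> NC" for a using that nchart_inj by (auto simp: normal_charts_eq)
  show "topspace NT \<subseteq> (\<Union>a\<in>NC. fst a)"
  proof
    fix v assume "v \<in> topspace NT"
    then have "v \<in> \<nu>" by simp
    then obtain b V e where "b \<in> B" "frame V e" "v \<in> fst (nchart b V e)" by (rule nchart_exists)
    then show "v \<in> (\<Union>a\<in>NC. fst a)" unfolding normal_charts_eq by blast
  qed
  fix v a a' assume "v \<in> topspace NT" and a: "a \<in> tangent_charts A" "v \<in> fst a" and a': "a' \<in> NC" "v \<in> fst a'"
  obtain c where c: "c \<in> A" "a = M.tchart c" using a(1) unfolding M.tangent_charts_eq by blast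
  obtain b V e where b: "b \<in> B" "frame V e" "a' = nchart b V e" using a'(1) unfolding normal_charts_eq by blast
  show "lip_at a a' (topspace NT) (\<lambda>x. x) v"
    unfolding topspace_NT c(2) b(3) using tchart_lip_nchart[OF b(2,1) c(1)] a a' c b by blast
  show "lip_at a' a (topspace NT) (\<lambda>x. x) v"
    unfolding topspace_NT c(2) b(3) using nchart_lip_tchart[OF b(2,1) c(1)] a a' c b by blast
qed

end

section \<open>The normal bundle as a Lipschitz vector bundle\<close>

lemma lip_atlas_euclidean: "lip_atlas (euclidean :: 'a::metric_space topology) {(UNIV, \<lambda>z. z)}"
  unfolding lip_atlas_def
proof (intro conjI ballI allI impI)
  fix G :: "'a set"
  have "chart_ball UNIV (UNIV, \<lambda>z. z) p r = {x. dist x p < r}" for p :: 'a and r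
    by (simp add: chart_ball_def)
  then show "openin euclidean G \<longleftrightarrow> G \<subseteq> topspace euclidean \<and>
        (\<forall>p\<in>G. \<forall>a\<in>{(UNIV, \<lambda>z. z)}. p \<in> fst a \<longrightarrow> (\<exists>r>0. chart_ball (topspace euclidean) a p r \<subseteq> G))"
    by (simp add: open_dist subset_iff)
next
  fix p :: 'a and a b :: "('a, 'a) chart" assume "a \<in> {(UNIV, \<lambda>z::'a. z)}" "b \<in> {(UNIV, \<lambda>z::'a. z)}"
  then show "lip_at a b (topspace euclidean) (\<lambda>x. x) p" by (intro lip_atI[of 1 1]) auto
qed auto

context c11_submanifold begin

lemma fiber_coord_lip_at: "lip_at (nchart b V e) (UNIV, \<lambda>z. z) N (fiber_coord e) v"
proof (rule lip_atI[of 1 1])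
  fix x y
  show "dist (snd (UNIV, \<lambda>z. z) (fiber_coord e x)) (snd (UNIV, \<lambda>z. z) (fiber_coord e y))
      \<le> 1 * dist (snd (nchart b V e) x) (snd (nchart b V e) y)"
    using dist_snd_le[of "snd (nchart b V e) x" "snd (nchart b V e) y"] by (simp add: nchart_def)
qed auto

lemma frame_comb_in_nchart:
  assumes f: "frame V e" and q: "q \<in> V" "q \<in> fst (ichart b)" and y: "y \<in> coord_space J"
  shows "frame_comb J e q y \<in> fst (nchart b V e)" "snd (nchart b V e) (frame_comb J e q y) = (snd (ichart b) q, y)"
  using frame_comb_normal[OF f q(1), of y] fiber_coord_frame_comb[OF f q(1) y] q by (auto simp: nchart_def)

lemma normal_projection_continuous: "continuous_map NT (subtopology M img) fst"
proof (rule lip_at_continuous[OF normal_lip_atlas image_lip_atlas])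
  show "fst ` topspace NT \<subseteq> topspace (subtopology M img)"
    unfolding topspace_NT topspace_img using normal_tangent by blast
  fix v assume "v \<in> topspace NT"
  then have v: "v \<in> \<nu>" by simp
  then obtain b V e where b: "b \<in> B" "frame V e" "v \<in> fst (nchart b V e)" by (rule nchart_exists)
  have "lip_at (nchart b V e) (ichart b) \<nu> fst v"
  proof (rule lip_atI[of 1 1])
    fix x assume "x \<in> chart_ball \<nu> (nchart b V e) v 1"
    then show "fst x \<in> fst (ichart b)" by (auto simp: chart_ball_def nchart_def)
  next
    fix x y
    show "dist (snd (ichart b) (fst x)) (snd (ichart b) (fst y)) \<le> 1 * dist (snd (nchart b V e) x) (snd (nchart b V e) y)"
      using dist_fst_le[of "snd (nchart b V e) x" "snd (nchart b V e) y"] by (simp add: nchart_def)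
  qed auto
  moreover have "fst v \<in> fst (ichart b)" by (rule nchart_elim[OF b(3)])
  ultimately show "\<exists>a\<in>NC. \<exists>k\<in>image_charts S B \<phi>. v \<in> fst a \<and> fst v \<in> fst k \<and> lip_at a k (topspace NT) fst v"
    unfolding normal_charts_eq image_charts_eq topspace_NT using b by blast
qed

lemma image_chart_exists:
  assumes "q \<in> img"
  obtains b where "b \<in> B" "q \<in> fst (ichart b)"
proof -
  obtain s where s: "s \<in> topspace S" "q = \<phi> s" using assms by blast
  obtain b where "b \<in> B" "s \<in> fst b" using S.chart_exists[OF s(1)] by blast
  then show ?thesis using that ichart_dom[OF _ s(1)] s(2) by blast
qed

lemma normal_add_scale:
  assumes v: "v \<in> \<nu>" and w: "w \<in> \<nu>" and eq: "fst v = fst w"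
  shows "tadd v w \<in> \<nu>" "tscale r v \<in> \<nu>"
proof -
  obtain s where s: "s \<in> topspace S" "fst v = \<phi> s" using normal_bundle_base[OF v] by blast
  obtain b where b: "b \<in> B" "s \<in> fst b" using S.chart_exists[OF s(1)] by blast
  obtain c where c: "c \<in> A" "\<phi> s \<in> fst c" using M.chart_exists[OF \<phi>_in[OF s(1)]] by blast
  have v': "v \<in> tangent_space A (\<phi> s)" "nform b c (snd b s) (snd v c) = 0"
    and w': "w \<in> tangent_space A (\<phi> s)" "nform b c (snd b s) (snd w c) = 0"
    using normal_bundle_iff[OF b c, of v] normal_bundle_iff[OF b c, of w] v w s eq by auto
  have "nform b c (snd b s) (snd (tadd v w) c) = 0" "nform b c (snd b s) (snd (tscale r v) c) = 0"
    using v'(2) w'(2) by (simp_all add: tadd_def tscale_def linear_add[OF nform_linear] linear_cmul[OF nform_linear])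
  then show "tadd v w \<in> \<nu>" "tscale r v \<in> \<nu>"
    using normal_bundle_iff[OF b c] M.tadd_in[OF v'(1) w'(1)] M.tscale_in[OF v'(1)] by blast+
qed

lemma fiber_coord_add_scale:
  assumes f: "frame V e" and v: "v \<in> \<nu>" "fst v \<in> V" and w: "w \<in> \<nu>" and eq: "fst v = fst w"
  shows "fiber_coord e (tadd v w) = fiber_coord e v + fiber_coord e w"
    "fiber_coord e (tscale r v) = r *\<^sub>R fiber_coord e v"
proof -
  note V = fiber_coord_spec[OF f v] and W = fiber_coord_spec[OF f w, folded eq, OF v(2)]
  have "tadd (frame_comb J e (fst v) (fiber_coord e v)) (frame_comb J e (fst v) (fiber_coord e w))
      = frame_comb J e (fst v) (fiber_coord e v + fiber_coord e w)"
    by (simp add: frame_comb_def tadd_def sum.distrib scaleR_add_left)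
  then have 1: "tadd v w = frame_comb J e (fst (tadd v w)) (fiber_coord e v + fiber_coord e w)"
    unfolding V(2) W(2) by (simp add: tadd_def)
  show "fiber_coord e (tadd v w) = fiber_coord e v + fiber_coord e w"
    by (rule fiber_coord_unique[OF f normal_add_scale(1)[OF v(1) w eq] _ subspace_add[OF coord_space_subspace V(1) W(1)] 1])
      (use v in \<open>simp add: tadd_def\<close>)
  have "tscale r (frame_comb J e (fst v) (fiber_coord e v)) = frame_comb J e (fst v) (r *\<^sub>R fiber_coord e v)"
    by (simp add: frame_comb_def tscale_def scaleR_sum_right)
  then have 2: "tscale r v = frame_comb J e (fst (tscale r v)) (r *\<^sub>R fiber_coord e v)"
    unfolding V(2) by (simp add: tscale_def)
  show "fiber_coord e (tscale r v) = r *\<^sub>R fiber_coord e v"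
    by (rule fiber_coord_unique[OF f normal_add_scale(2)[OF v(1) w eq] _ subspace_scale[OF coord_space_subspace V(1)] 2])
      (use v in \<open>simp add: tscale_def\<close>)
qed

text \<open>
  Over the coordinates of the base, the trivialization and its inverse are the identity of the
  coordinates \<open>(s, y)\<close>.
\<close>

lemma normal_trivialization:
  assumes f: "frame V e"
  shows "homeomorphic_map (subtopology NT {v \<in> topspace NT. fst v \<in> V})
      (prod_topology (subtopology (subtopology M img) V) (top_of_set (coord_space J))) (\<lambda>v. (fst v, fiber_coord e v))"
proof -
  let ?X = "subtopology NT {v \<in> topspace NT. fst v \<in> V}"
  let ?Y = "subtopology (subtopology M img) V"
  let ?P = "prod_topology ?Y (top_of_set (coord_space J))"
  have tX: "topspace ?X = {v \<in> \<nu>. fst v \<in> V}" by auto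
  have VM: "V \<subseteq> topspace (subtopology M img)" using frame_facts(2)[OF f] topspace_img by blast
  have tY: "topspace ?Y = V" using VM by (simp only: topspace_subtopology_subset)
  have tP: "topspace ?P = V \<times> coord_space J" unfolding topspace_prod_topology tY by simp
  note XL = lip_atlas_subtopology[OF normal_lip_atlas, of "{v \<in> topspace NT. fst v \<in> V}"]
  have c1: "continuous_map ?X ?Y fst"
    by (intro continuous_map_into_subtopology continuous_map_from_subtopology normal_projection_continuous) auto
  have "continuous_map ?X euclidean (fiber_coord e)"
  proof (rule lip_at_continuous[OF XL lip_atlas_euclidean])
    fix v assume "v \<in> topspace ?X"
    then have v: "v \<in> \<nu>" "fst v \<in> V" unfolding tX by auto
    then obtain b where b: "b \<in> B" "fst v \<in> fst (ichart b)" using image_chart_exists normal_tangent by blast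
    have "v \<in> fst (nchart b V e)" using v b by (simp add: nchart_def)
    moreover have "nchart b V e \<in> NC" unfolding normal_charts_eq using b(1) f by blast
    ultimately show "\<exists>a\<in>NC. \<exists>k\<in>{(UNIV, \<lambda>z. z)}. v \<in> fst a \<and> fiber_coord e v \<in> fst k \<and> lip_at a k (topspace ?X) (fiber_coord e) v"
      using fiber_coord_lip_at by fastforce
  qed simp
  then have c2: "continuous_map ?X (top_of_set (coord_space J)) (fiber_coord e)"
    by (rule continuous_map_into_subtopology) (use fiber_coord_spec(1)[OF f] tX in auto)
  let ?h = "\<lambda>z. frame_comb J e (fst z) (snd z)"
  have hX: "?h z \<in> topspace ?X" if "z \<in> V \<times> coord_space J" for z
    unfolding tX using frame_comb_normal[OF f] that by auto
  have c3: "continuous_map ?P ?X ?h"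
    unfolding continuous_map_def
  proof (intro conjI allI impI)
    show "?h \<in> topspace ?P \<rightarrow> topspace ?X" unfolding tP using hX by blast
    fix G assume G: "openin ?X G"
    show "openin ?P {z \<in> topspace ?P. ?h z \<in> G}"
      unfolding openin_prod_topology_alt
    proof (intro allI impI)
      fix q y assume "(q, y) \<in> {z \<in> topspace ?P. ?h z \<in> G}"
      then have q: "q \<in> V" "y \<in> coord_space J" "frame_comb J e q y \<in> G" unfolding tP by auto
      obtain b where b: "b \<in> B" "q \<in> fst (ichart b)" using image_chart_exists frame_facts(2)[OF f] q(1) by blast
      have a: "nchart b V e \<in> NC" unfolding normal_charts_eq using b(1) f by blast
      note fc = frame_comb_in_nchart[OF f q(1) b(2) q(2)]
      obtain r where r: "r > 0" "chart_ball (topspace ?X) (nchart b V e) (frame_comb J e q y) r \<subseteq> G"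
        by (rule lip_atlas_openin_ball[OF XL G q(3) a fc(1)])
      let ?U = "chart_ball V (ichart b) q (r / 2)" and ?W = "coord_space J \<inter> ball y (r / 2)"
      have "ichart b \<in> image_charts S B \<phi>" unfolding image_charts_eq using b(1) by blast
      from lip_atlas_openin_chart_ball[OF lip_atlas_subtopology[OF image_lip_atlas, of V] this]
      have oU: "openin ?Y ?U" unfolding tY .
      have oW: "openin (top_of_set (coord_space J)) ?W" by (rule openin_open_Int) simp
      have "?U \<times> ?W \<subseteq> {z \<in> topspace ?P. ?h z \<in> G}"
      proof (rule subsetI)
        fix z assume "z \<in> ?U \<times> ?W"
        then obtain q' y' where z: "z = (q', y')" "q' \<in> V" "q' \<in> fst (ichart b)" "dist (snd (ichart b) q') (snd (ichart b) q) < r / 2"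
           "y' \<in> coord_space J" "dist y y' < r / 2" by (auto simp: chart_ball_def)
        note fc' = frame_comb_in_nchart[OF f z(2,3,5)]
        have "dist (snd (ichart b) q', y') (snd (ichart b) q, y) \<le> dist (snd (ichart b) q') (snd (ichart b) q) + dist y' y"
          unfolding dist_norm diff_Pair by (rule norm_Pair_le)
        also have "\<dots> < r" using z by (simp add: dist_commute)
        finally have "frame_comb J e q' y' \<in> chart_ball (topspace ?X) (nchart b V e) (frame_comb J e q y) r"
          using fc' fc hX[of "(q', y')"] z by (simp add: chart_ball_def)
        then have "frame_comb J e q' y' \<in> G" using r(2) by blast
        then show "z \<in> {z \<in> topspace ?P. ?h z \<in> G}" unfolding tP using z by simp
      qed
      moreover have "q \<in> ?U" by (rule chart_ball_center[OF q(1) b(2)]) (use r in simp)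
      moreover have "y \<in> ?W" using q(2) r(1) by simp
      ultimately show "\<exists>U W. openin ?Y U \<and> openin (top_of_set (coord_space J)) W \<and> q \<in> U \<and> y \<in> W \<and>
          U \<times> W \<subseteq> {z \<in> topspace ?P. ?h z \<in> G}" using oU oW by blast
    qed
  qed
  have "homeomorphic_maps ?X ?P (\<lambda>v. (fst v, fiber_coord e v)) ?h"
    unfolding homeomorphic_maps_def
  proof (intro conjI ballI)
    show "continuous_map ?X ?P (\<lambda>v. (fst v, fiber_coord e v))" unfolding continuous_map_paired using c1 c2 by blast
    show "continuous_map ?P ?X ?h" by (rule c3)
    show "?h (fst v, fiber_coord e v) = v" if "v \<in> topspace ?X" for v
      using that fiber_coord_spec(2)[OF f, of v] unfolding tX by simp
    show "(fst (?h z), fiber_coord e (?h z)) = z" if "z \<in> topspace ?P" for z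
      using that fiber_coord_frame_comb[OF f] unfolding tP by auto
  qed
  then show ?thesis using homeomorphic_maps_map by blast
qed

text \<open>
  For fixed \<open>y\<close> the inverse trivialization is the Lipschitz section \<open>q \<mapsto> y\<^sup>j e\<^sub>j(q)\<close>; its
  coefficients with respect to another frame are Lipschitz because changes of normal charts are.
\<close>

lemma normal_transition_lipschitz:
  assumes f: "frame V e" and f': "frame V' e'" and y: "y \<in> coord_space J"
  shows "locally_lipschitz_map (image_charts S B \<phi>) (V \<inter> V') {(UNIV, \<lambda>z. z)}
          (\<lambda>q. fiber_coord e' (inv_into {v \<in> topspace NT. fst v = q} (fiber_coord e) y))"
proof (rule locally_lipschitz_map_by_some_charts[OF image_lip_atlas lip_atlas_euclidean])
  show VV: "V \<inter> V' \<subseteq> topspace (subtopology M img)" using frame_facts(2)[OF f] topspace_img by blast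
  fix q assume q: "q \<in> V \<inter> V'"
  obtain b where b: "b \<in> B" "q \<in> fst (ichart b)" using image_chart_exists frame_facts(2)[OF f] q by blast
  have a: "nchart b V e \<in> NC" "nchart b V' e' \<in> NC" unfolding normal_charts_eq using b(1) f f' by blast+
  have fcq: "frame_comb J e q y \<in> fst (nchart b V e)" using frame_comb_in_nchart(1)[OF f _ b(2) y] q by blast
  have fcn: "frame_comb J e q y \<in> topspace NT" using nchart_elim(1)[OF fcq] by simp
  have fcq': "frame_comb J e q y \<in> fst (nchart b V' e')" using fcn q b by (simp add: nchart_def)
  have 1: "lip_at (ichart b) (nchart b V e) (V \<inter> V') (\<lambda>q. frame_comb J e q y) q"
  proof (rule lip_atI[of 1 1])
    fix x assume "x \<in> chart_ball (V \<inter> V') (ichart b) q 1"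
    then show "frame_comb J e x y \<in> fst (nchart b V e)" using frame_comb_in_nchart(1)[OF f _ _ y] by (simp add: chart_ball_def)
  next
    fix x x' assume "x \<in> chart_ball (V \<inter> V') (ichart b) q 1" "x' \<in> chart_ball (V \<inter> V') (ichart b) q 1"
    then have "snd (nchart b V e) (frame_comb J e x y) = (snd (ichart b) x, y)" "snd (nchart b V e) (frame_comb J e x' y) = (snd (ichart b) x', y)"
      using frame_comb_in_nchart(2)[OF f _ _ y] by (auto simp: chart_ball_def)
    then show "dist (snd (nchart b V e) (frame_comb J e x y)) (snd (nchart b V e) (frame_comb J e x' y)) \<le> 1 * dist (snd (ichart b) x) (snd (ichart b) x')"
      by (simp add: dist_Pair_Pair)
  qed auto
  have im: "(\<lambda>q. frame_comb J e q y) ` ((V \<inter> V') \<inter> fst (ichart b)) \<subseteq> topspace NT"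
    using frame_comb_normal[OF f] by auto
  have 2: "lip_at (ichart b) (nchart b V' e') (V \<inter> V') (\<lambda>q. frame_comb J e q y) q"
    by (rule lip_at_comp[OF 1 lip_atlas_change[OF normal_lip_atlas fcn a fcq fcq'] im q b(2)])
  have 3: "lip_at (ichart b) (UNIV, \<lambda>z. z) (V \<inter> V') (\<lambda>q. fiber_coord e' (frame_comb J e q y)) q"
    by (rule lip_at_comp[OF 2 fiber_coord_lip_at im q b(2)])
  have eq: "inv_into {v \<in> topspace NT. fst v = x} (fiber_coord e) y = frame_comb J e x y" if x: "x \<in> V \<inter> V'" for x
  proof -
    have xV: "x \<in> V" using x by blast
    have "inj_on (fiber_coord e) {v \<in> topspace NT. fst v = x}"
    proof (rule inj_onI)
      fix v w assume "v \<in> {v \<in> topspace NT. fst v = x}" "w \<in> {v \<in> topspace NT. fst v = x}" "fiber_coord e v = fiber_coord e w"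
      then show "v = w" using fiber_coord_spec(2)[OF f, of v] fiber_coord_spec(2)[OF f, of w] xV by simp
    qed
    from inv_into_f_f[OF this, of "frame_comb J e x y"]
    show ?thesis using frame_comb_normal[OF f xV, of y] fiber_coord_frame_comb[OF f xV y] by simp
  qed
  have "lip_at (ichart b) (UNIV, \<lambda>z. z) (V \<inter> V') (\<lambda>q. fiber_coord e' (inv_into {v \<in> topspace NT. fst v = q} (fiber_coord e) y)) q"
    by (rule lip_at_cong[OF 3]) (simp only: eq)
  then show "\<exists>k\<in>image_charts S B \<phi>. \<exists>u\<in>{(UNIV, \<lambda>z. z)}. q \<in> fst k \<and>
      fiber_coord e' (inv_into {v \<in> topspace NT. fst v = q} (fiber_coord e) y) \<in> fst u \<and>
      lip_at k u (V \<inter> V') (\<lambda>q. fiber_coord e' (inv_into {v \<in> topspace NT. fst v = q} (fiber_coord e) y)) q"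
    unfolding image_charts_eq using b by fastforce
qed simp

theorem normal_bundle_lipschitz:
  "lipschitz_vector_bundle NT (subtopology M img) (image_charts S B \<phi>) fst tadd tscale
     (coord_space J) (normal_trivs M A g S B \<phi> J)"
  unfolding lipschitz_vector_bundle_def
proof (intro conjI)
  show "subspace (coord_space J)" by (rule coord_space_subspace)
  show "continuous_map NT (subtopology M img) fst" by (rule normal_projection_continuous)
  show "fst ` topspace NT = topspace (subtopology M img)"
  proof
    show "fst ` topspace NT \<subseteq> topspace (subtopology M img)"
    unfolding topspace_NT topspace_img using normal_tangent by blast
    show "topspace (subtopology M img) \<subseteq> fst ` topspace NT"
    proof
      fix q assume "q \<in> topspace (subtopology M img)"
      then have "tzero q \<in> \<nu>" using tzero_normal unfolding topspace_img by blast
      moreover have "q = fst (tzero q)" by (simp add: tzero_def)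
      ultimately show "q \<in> fst ` topspace NT" unfolding topspace_NT by blast
    qed
  qed
  show "\<forall>v\<in>topspace NT. \<forall>w\<in>topspace NT. \<forall>r. fst v = fst w \<longrightarrow>
        tadd v w \<in> topspace NT \<and> fst (tadd v w) = fst v \<and> tscale r v \<in> topspace NT \<and> fst (tscale r v) = fst v"
    using normal_add_scale by (simp add: tadd_def tscale_def)
  show "(\<Union>t\<in>normal_trivs M A g S B \<phi> J. fst t) = topspace (subtopology M img)"
    unfolding topspace_img normal_trivs_eq using frame_facts(2) normal_frame_exists by fastforce
  show "\<forall>(V, \<psi>)\<in>normal_trivs M A g S B \<phi> J. openin (subtopology M img) V \<and>
        homeomorphic_map (subtopology NT {v \<in> topspace NT. fst v \<in> V})
          (prod_topology (subtopology (subtopology M img) V) (top_of_set (coord_space J))) (\<lambda>v. (fst v, \<psi> v)) \<and>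
        (\<forall>v\<in>topspace NT. \<forall>w\<in>topspace NT. \<forall>r. fst v \<in> V \<longrightarrow> fst v = fst w \<longrightarrow>
           \<psi> (tadd v w) = \<psi> v + \<psi> w \<and> \<psi> (tscale r v) = r *\<^sub>R \<psi> v)"
  proof (intro ballI, clarify)
    fix V \<psi> assume "(V, \<psi>) \<in> normal_trivs M A g S B \<phi> J"
    then obtain e where f: "frame V e" and \<psi>: "\<psi> = fiber_coord e" unfolding normal_trivs_eq by blast
    show "openin (subtopology M img) V \<and>
        homeomorphic_map (subtopology NT {v \<in> topspace NT. fst v \<in> V})
          (prod_topology (subtopology (subtopology M img) V) (top_of_set (coord_space J))) (\<lambda>v. (fst v, \<psi> v)) \<and>
        (\<forall>v\<in>topspace NT. \<forall>w\<in>topspace NT. \<forall>r. fst v \<in> V \<longrightarrow> fst v = fst w \<longrightarrow>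
           \<psi> (tadd v w) = \<psi> v + \<psi> w \<and> \<psi> (tscale r v) = r *\<^sub>R \<psi> v)"
      unfolding \<psi>
    proof (intro conjI ballI allI impI frame_facts(1)[OF f] normal_trivialization[OF f])
      fix v w r assume "v \<in> topspace NT" "w \<in> topspace NT" "fst v \<in> V" "fst v = fst w"
      then show "fiber_coord e (tadd v w) = fiber_coord e v + fiber_coord e w"
        "fiber_coord e (tscale r v) = r *\<^sub>R fiber_coord e v"
        by (intro fiber_coord_add_scale[OF f]; simp)+
    qed
  qed
  show "\<forall>(V, \<psi>)\<in>normal_trivs M A g S B \<phi> J. \<forall>(V', \<psi>')\<in>normal_trivs M A g S B \<phi> J. \<forall>y\<in>coord_space J.
        locally_lipschitz_map (image_charts S B \<phi>) (V \<inter> V') {(UNIV, \<lambda>z. z)}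
          (\<lambda>q. \<psi>' (inv_into {v \<in> topspace NT. fst v = q} \<psi> y))"
  proof (intro ballI, clarify)
    fix V \<psi> V' \<psi>' y
    assume t: "(V, \<psi>) \<in> normal_trivs M A g S B \<phi> J" "(V', \<psi>') \<in> normal_trivs M A g S B \<phi> J" and y: "y \<in> coord_space J"
    obtain e where e: "frame V e" "\<psi> = fiber_coord e" using t(1) unfolding normal_trivs_eq by blast
    obtain e' where e': "frame V' e'" "\<psi>' = fiber_coord e'" using t(2) unfolding normal_trivs_eq by blast
    show "locally_lipschitz_map (image_charts S B \<phi>) (V \<inter> V') {(UNIV, \<lambda>z. z)}
          (\<lambda>q. \<psi>' (inv_into {v \<in> topspace NT. fst v = q} \<psi> y))"
      unfolding e(2) e'(2) by (rule normal_transition_lipschitz[OF e(1) e'(1) y])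
  qed
qed

text \<open>
  Openness in the model space has two sources: the base of a frame is open in the image of \<open>\<phi>\<close>,
  and every element of the fibre model occurs as coefficients.
\<close>

lemma nchart_image_open:
  assumes f: "frame V e" and b: "b \<in> B" and G: "openin NT G"
  shows "openin (top_of_set (UNIV \<times> coord_space J)) (snd (nchart b V e) ` (fst (nchart b V e) \<inter> G))"
  unfolding openin_euclidean_subtopology_iff
proof (intro conjI ballI)
  let ?a = "nchart b V e"
  have aN: "?a \<in> NC" unfolding normal_charts_eq using b f by blast
  show "snd ?a ` (fst ?a \<inter> G) \<subseteq> UNIV \<times> coord_space J"
  proof (rule image_subsetI)
    fix v assume "v \<in> fst ?a \<inter> G"
    then have "v \<in> fst ?a" by blast
    from fiber_coord_spec(1)[OF f nchart_elim(1,2)[OF this]] show "snd ?a v \<in> UNIV \<times> coord_space J"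
      by (simp add: nchart_def)
  qed
  fix x assume "x \<in> snd ?a ` (fst ?a \<inter> G)"
  then obtain v where v: "v \<in> fst ?a" "v \<in> G" "x = snd ?a v" by auto
  note v' = nchart_elim[OF v(1)]
  obtain s where s: "s \<in> topspace S" "fst v = \<phi> s" using normal_bundle_base[OF v'(1)] by blast
  have sb: "s \<in> fst b" using v'(3) s ichart_dom[OF b] by simp
  obtain r1 where r1: "r1 > 0" "chart_ball \<nu> ?a v r1 \<subseteq> G"
    by (rule lip_atlas_openin_ball[OF normal_lip_atlas G v(2) aN v(1), unfolded topspace_NT])
  have "openin S {t \<in> topspace S. \<phi> t \<in> V}"
  proof -
    have "continuous_map S (subtopology M img) \<phi>" using \<phi>_continuous by (simp add: continuous_map_in_subtopology)
    then show ?thesis using frame_facts(1)[OF f] unfolding continuous_map_def by blast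
  qed
  then have "open (snd b ` (fst b \<inter> {t \<in> topspace S. \<phi> t \<in> V}))" by (rule S.open_chart_image[OF b])
  moreover have "snd b s \<in> snd b ` (fst b \<inter> {t \<in> topspace S. \<phi> t \<in> V})" using sb s v'(2) by auto
  ultimately obtain r2 where r2: "r2 > 0" "ball (snd b s) r2 \<subseteq> snd b ` (fst b \<inter> {t \<in> topspace S. \<phi> t \<in> V})"
    using openE by blast
  have x: "x = (snd b s, fiber_coord e v)" using v(3) s ichart_apply by (simp add: nchart_def)
  show "\<exists>r>0. \<forall>x'\<in>UNIV \<times> coord_space J. dist x' x < r \<longrightarrow> x' \<in> snd ?a ` (fst ?a \<inter> G)"
  proof (intro exI[of _ "min r1 r2"] conjI ballI impI)
    fix x' :: "(real^'k) \<times> (real^'n)" assume x': "x' \<in> UNIV \<times> coord_space J" "dist x' x < min r1 r2"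
    obtain \<sigma> y where xy: "x' = (\<sigma>, y)" "y \<in> coord_space J" using x'(1) by auto
    have "dist \<sigma> (snd b s) < r2" using x'(2) dist_fst_le[of x' x] xy x by simp
    then have "\<sigma> \<in> ball (snd b s) r2" by (simp add: dist_commute)
    then obtain t where t: "t \<in> fst b" "t \<in> topspace S" "\<phi> t \<in> V" "\<sigma> = snd b t" using r2(2) by blast
    have tb: "\<phi> t \<in> fst (ichart b)" using ichart_dom[OF b t(2)] t(1) by blast
    note fc = frame_comb_in_nchart[OF f t(3) tb xy(2)]
    have eq: "snd ?a (frame_comb J e (\<phi> t) y) = x'" using fc(2) ichart_apply[OF t(2)] t(4) xy by simp
    have "frame_comb J e (\<phi> t) y \<in> chart_ball \<nu> ?a v r1"
      using fc(1) nchart_elim(1)[OF fc(1)] x'(2) v(3) eq by (simp add: chart_ball_def)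
    then have "frame_comb J e (\<phi> t) y \<in> fst ?a \<inter> G" using r1(2) fc(1) by blast
    then show "x' \<in> snd ?a ` (fst ?a \<inter> G)" unfolding eq[symmetric] by (rule imageI)
  qed (use r1 r2 in simp)
qed

text \<open>
  A point of \<open>S\<close> guarantees that \<open>k \<le> n\<close>, so that the subtraction in the cardinality of \<open>J\<close> is not
  truncated.
\<close>

lemma dim_model:
  assumes "topspace S \<noteq> {}"
  shows "dim ((UNIV :: (real^'k) set) \<times> coord_space J) = CARD('n)"
proof -
  obtain s where s: "s \<in> topspace S" using assms by blast
  obtain b where b: "b \<in> B" "s \<in> fst b" using S.chart_exists[OF s] by blast
  obtain c where c: "c \<in> A" "\<phi> s \<in> fst c" using M.chart_exists[OF \<phi>_in[OF s]] by blast
  show ?thesis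
    using card_J dim_normal_space(2)[OF b c]
    by (subst dim_Times[OF subspace_UNIV coord_space_subspace]) (simp add: dim_coord_space)
qed

end

section \<open>The normal exponential map near the zero section\<close>

locale normal_exponential = c11_submanifold M A S B g \<phi> J + spray_manifold M A \<Gamma>
  for M :: "'m topology" and A :: "('m, real^'n::finite) chart set"
    and S :: "'s topology" and B :: "('s, real^'k::finite) chart set"
    and g \<phi> and J :: "'n set" and \<Gamma> :: "('m, 'n) symbols"
begin

text \<open>
  The candidate for the differential at the zero vector over \<open>\<phi> s\<close>: the exponential map of \<open>M\<close>
  adds the displacement of the base point, which is tangent, and the velocity, which is normal.
\<close>

definition exp_diff :: "('s, real^'k) chart \<Rightarrow> ('n \<Rightarrow> 'm \<Rightarrow> ('m, real^'n) tvec) \<Rightarrow> ('m, real^'n) chart \<Rightarrow>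
    's \<Rightarrow> (real^'k) \<times> (real^'n) \<Rightarrow> real^'n" where
  "exp_diff b e d s z = D\<Phi> b d (snd b s) (fst z) + frame_map e d (\<phi> s) (snd z)"

lemma exp_diff_linear:
  assumes "b \<in> B" "s \<in> fst b" "d \<in> A" "\<phi> s \<in> fst d"
  shows "linear (exp_diff b e d s)"
proof (rule linearI)
  note lin = D\<Phi>_linear[OF assms(1,3) dom\<Phi>I[OF assms(2,4)]]
  fix z w :: "(real^'k) \<times> (real^'n)" and r :: real
  show "exp_diff b e d s (z + w) = exp_diff b e d s z + exp_diff b e d s w"
    by (simp add: exp_diff_def linear_add[OF lin] linear_add[OF frame_map_linear])
  show "exp_diff b e d s (r *\<^sub>R z) = r *\<^sub>R exp_diff b e d s z"
    by (simp add: exp_diff_def linear_cmul[OF lin] linear_cmul[OF frame_map_linear] scaleR_add_right)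
qed

text \<open>
  If the sum of a tangent and a normal vector vanishes, then the tangent one is also normal, hence
  zero by nondegeneracy; the normal one then vanishes too, and with it its coefficients.
\<close>

lemma exp_diff_injective:
  assumes f: "frame V e" and b: "b \<in> B" "s \<in> fst b" and d: "d \<in> A" "\<phi> s \<in> fst d" and sV: "\<phi> s \<in> V"
    and y: "y \<in> coord_space J" and 0: "exp_diff b e d s (\<sigma>, y) = 0"
  shows "(\<sigma>, y) = 0"
proof -
  let ?D = "D\<Phi> b d (snd b s)" and ?F = "frame_map e d (\<phi> s) y"
  have eq: "?D \<sigma> = - ?F" using 0 by (simp add: exp_diff_def eq_neg_iff_add_eq_0)
  have "nform b d (snd b s) (snd (frame_comb J e (\<phi> s) y) d) = 0"
    using normal_bundle_iff[OF b d, of "frame_comb J e (\<phi> s) y"] frame_comb_normal[OF f sV, of y] by simp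
  then have "nform b d (snd b s) (?D \<sigma>) = 0"
    unfolding eq frame_comb_snd by (simp add: linear_neg[OF nform_linear])
  then have \<sigma>: "\<sigma> = 0" by (rule tangent_normal_disjoint[OF b d])
  then have "?F = 0" using eq linear_0[OF D\<Phi>_linear[OF b(1) d(1) dom\<Phi>I[OF b(2) d(2)]]] by simp
  moreover obtain m where "m > 0" "\<forall>y\<in>coord_space J. m * norm y \<le> norm (frame_map e d (\<phi> s) y)"
    by (rule frame_map_lower[OF f sV d])
  ultimately have "y = 0" using y by (fastforce simp: mult_le_0_iff)
  then show ?thesis using \<sigma> by (simp add: zero_prod_def)
qed

lemma tzero_in_nchart:
  assumes f: "frame V e" and b: "b \<in> B" "s \<in> fst b" and sV: "\<phi> s \<in> V"
  shows "tzero (\<phi> s) \<in> fst (nchart b V e)" "snd (nchart b V e) (tzero (\<phi> s)) = (snd b s, 0)"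
proof -
  have s: "s \<in> topspace S" using S.chart_facts(5)[OF b(1)] b(2) by blast
  show "tzero (\<phi> s) \<in> fst (nchart b V e)"
    using tzero_normal[OF s] sV ichart_dom[OF b(1) s] b(2) by (simp add: nchart_def tzero_def)
  show "snd (nchart b V e) (tzero (\<phi> s)) = (snd b s, 0)"
    using fiber_coord_tzero[OF f sV] ichart_apply[OF s] by (simp add: nchart_def tzero_def)
qed

text \<open>
  Composition of three estimates: the exponential map of \<open>M\<close> at a zero vector, the strong
  differential of \<open>\<phi>\<close>, and the frame map. The latter is not strongly differentiable in \<open>s\<close> at a
  general vector, but near the zero section its variation with \<open>s\<close> is multiplied by the small
  coefficients \<open>y\<close>.
\<close>

lemma exp_strongly_differentiable:
  assumes f: "frame V e" and b: "b \<in> B" "s \<in> fst b" and d: "d \<in> A" "\<phi> s \<in> fst d" and sV: "\<phi> s \<in> V"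
    and \<epsilon>: "\<epsilon> > 0"
  obtains \<delta> where "\<delta> > 0"
    "\<forall>v\<in>chart_ball \<nu> (nchart b V e) (tzero (\<phi> s)) \<delta>. v \<in> exp_dom M A \<Gamma> \<and> exp_map M A \<Gamma> v \<in> fst d"
    "\<forall>v\<in>chart_ball \<nu> (nchart b V e) (tzero (\<phi> s)) \<delta>. \<forall>w\<in>chart_ball \<nu> (nchart b V e) (tzero (\<phi> s)) \<delta>.
       norm (snd d (exp_map M A \<Gamma> v) - snd d (exp_map M A \<Gamma> w)
          - exp_diff b e d s (snd (nchart b V e) v - snd (nchart b V e) w))
         \<le> \<epsilon> * norm (snd (nchart b V e) v - snd (nchart b V e) w)"
proof -
  let ?a = "nchart b V e" and ?z = "tzero (\<phi> s)" and ?\<kappa> = "snd (ichart b)"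
  let ?D = "D\<Phi> b d (snd b s)" and ?F = "frame_map e d (\<phi> s)"
  have s: "s \<in> topspace S" using S.chart_facts(5)[OF b(1)] b(2) by blast
  have dom: "snd b s \<in> dom\<Phi> b d" by (rule dom\<Phi>I[OF b(2) d(2)])
  have linD: "linear ?D" by (rule D\<Phi>_linear[OF b(1) d(1) dom])
  note z = tzero_in_nchart[OF f b sV]
  obtain K1 where K1: "K1 > 0" "\<And>w. norm (?D w) \<le> K1 * norm w" using linear_bounded_pos[OF linD] by metis
  obtain K2 where K2: "K2 > 0" "\<And>y. norm (?F y) \<le> K2 * norm y" using linear_bounded_pos[OF frame_map_linear] by metis
  \<comment> \<open>The errors add up to \<open>\<eta> (K1 + 1)\<close> and \<open>\<eta> (K2 + 1)\<close> from the exponential map of \<open>M\<close>, and \<open>\<eta>\<close>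
    each from the base and the fibre component.\<close>
  define \<eta> where "\<eta> = min 1 (\<epsilon> / (K1 + K2 + 4))"
  have \<eta>: "\<eta> > 0" "\<eta> \<le> 1" "\<eta> * (K1 + K2 + 4) \<le> \<epsilon>"
  proof -
    have "\<eta> * (K1 + K2 + 4) \<le> (\<epsilon> / (K1 + K2 + 4)) * (K1 + K2 + 4)" using K1 K2 by (intro mult_right_mono) (auto simp: \<eta>_def)
    then show "\<eta> * (K1 + K2 + 4) \<le> \<epsilon>" using K1 K2 by simp
  qed (use K1 K2 \<epsilon> in \<open>auto simp: \<eta>_def\<close>)
  obtain r1 where r1: "r1 > 0" "ball (snd b s) r1 \<subseteq> dom\<Phi> b d"
    and est2: "\<forall>\<sigma>\<in>ball (snd b s) r1. \<forall>\<sigma>'\<in>ball (snd b s) r1.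
       norm (\<Phi> b d \<sigma> - \<Phi> b d \<sigma>' - ?D (\<sigma> - \<sigma>')) \<le> \<eta> * norm (\<sigma> - \<sigma>')"
    by (rule Ck1_1_strong_differential[OF \<Phi>_Ck1[OF b(1) d(1)] dom\<Phi>_open[OF b(1) d(1)] dom \<eta>(1)])
  obtain r2 L where r2: "r2 > 0" "L \<ge> 0" "chart_ball V (ichart b) (\<phi> s) r2 \<subseteq> fst d"
    and est3: "\<forall>x\<in>chart_ball V (ichart b) (\<phi> s) r2. \<forall>x'\<in>chart_ball V (ichart b) (\<phi> s) r2. \<forall>y.
       norm (frame_map e d x y - frame_map e d x' y) \<le> L * dist (?\<kappa> x) (?\<kappa> x') * norm y"
    by (rule frame_map_lipschitz[OF f b d sV])
  obtain \<delta>1 where \<delta>1: "\<delta>1 > 0"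
    and ex: "\<forall>v\<in>fst (M.tchart d). norm (snd d (fst v) - snd d (\<phi> s)) < \<delta>1 \<longrightarrow> norm (snd v d) < \<delta>1 \<longrightarrow>
       v \<in> exp_dom M A \<Gamma> \<and> exp_map M A \<Gamma> v \<in> fst d"
    and est1: "\<forall>v\<in>fst (M.tchart d). \<forall>v'\<in>fst (M.tchart d).
       norm (snd d (fst v) - snd d (\<phi> s)) < \<delta>1 \<longrightarrow> norm (snd v d) < \<delta>1 \<longrightarrow>
       norm (snd d (fst v') - snd d (\<phi> s)) < \<delta>1 \<longrightarrow> norm (snd v' d) < \<delta>1 \<longrightarrow>
       norm (snd d (exp_map M A \<Gamma> v) - snd d (exp_map M A \<Gamma> v')
          - (snd d (fst v) - snd d (fst v')) - (snd v d - snd v' d))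
         \<le> \<eta> * (norm (snd d (fst v) - snd d (fst v')) + norm (snd v d - snd v' d))"
    by (rule exp_map_strongly_differentiable_at_zero_vector[OF d \<eta>(1)])
  \<comment> \<open>The third bound makes the variation of the frame small, the fourth keeps base points and
    velocities in the range of the estimate for the exponential map of \<open>M\<close>.\<close>
  define \<delta> where "\<delta> = min (min r1 r2) (min (\<eta> / (2 * (L + 1))) (\<delta>1 / (K1 + K2 + 2)))"
  have \<delta>: "\<delta> > 0" "\<delta> \<le> r1" "\<delta> \<le> r2" "2 * L * \<delta> \<le> \<eta>" "(K1 + K2 + 2) * \<delta> \<le> \<delta>1"
  proof -
    have "2 * L * \<delta> \<le> 2 * L * (\<eta> / (2 * (L + 1)))" using r2(2) by (intro mult_left_mono) (auto simp: \<delta>_def)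
    also have "\<dots> \<le> \<eta>" using r2(2) \<eta>(1) by (simp add: field_simps)
    finally show "2 * L * \<delta> \<le> \<eta>" .
    have "(K1 + K2 + 2) * \<delta> \<le> (K1 + K2 + 2) * (\<delta>1 / (K1 + K2 + 2))"
      using K1 K2 by (intro mult_left_mono) (auto simp: \<delta>_def)
    then show "(K1 + K2 + 2) * \<delta> \<le> \<delta>1" using K1 K2 by simp
    show "\<delta> > 0" using r1(1) r2(1,2) \<eta>(1) \<delta>1 K1 K2 by (simp add: \<delta>_def)
  qed (auto simp: \<delta>_def)
  let ?P = "chart_ball \<nu> ?a ?z \<delta>"
  have zP: "?z \<in> ?P" using chart_ball_center[OF _ z(1) \<delta>(1)] nchart_elim(1)[OF z(1)] by blast
  have coords: "\<exists>t. t \<in> fst b \<and> fst v = \<phi> t \<and> snd b t = ?\<kappa> (fst v)" if "v \<in> fst ?a" for v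
  proof -
    note v' = nchart_elim[OF that]
    obtain t where "t \<in> topspace S" "fst v = \<phi> t" using normal_bundle_base[OF v'(1)] by blast
    then show ?thesis using v'(3) ichart_dom[OF b(1)] ichart_apply by metis
  qed
  have near: "v \<in> fst ?a \<and> ?\<kappa> (fst v) \<in> ball (snd b s) r1 \<and> fst v \<in> chart_ball V (ichart b) (\<phi> s) r2 \<and>
      norm (fiber_coord e v) < \<delta> \<and> dist (?\<kappa> (fst v)) (?\<kappa> (\<phi> s)) < \<delta> \<and> v \<in> fst (M.tchart d)"
    if v: "v \<in> ?P" for v
  proof -
    have vn: "v \<in> fst ?a" "dist (snd ?a v) (snd b s, 0) < \<delta>" using v z(2) by (auto simp: chart_ball_def)
    note v' = nchart_elim[OF vn(1)]
    have d1: "dist (?\<kappa> (fst v)) (snd b s) < \<delta>" and d2: "norm (fiber_coord e v) < \<delta>"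
      using vn(2) dist_fst_le[of "snd ?a v" "(snd b s, 0)"] dist_snd_le[of "snd ?a v" "(snd b s, 0)"]
      by (auto simp: nchart_def dist_norm)
    have 1: "fst v \<in> chart_ball V (ichart b) (\<phi> s) r2"
      using d1 \<delta>(3) v' ichart_apply[OF s] by (simp add: chart_ball_def)
    then have "fst v \<in> fst d" using r2(3) by blast
    then show ?thesis using vn(1) v' 1 d1 d2 \<delta>(2) ichart_apply[OF s]
      by (simp add: dist_commute M.tchart_def)
  qed
  have base: "norm (snd d (fst v) - snd d (fst w) - ?D (?\<kappa> (fst v) - ?\<kappa> (fst w))) \<le> \<eta> * norm (snd ?a v - snd ?a w)"
    if v: "v \<in> ?P" and w: "w \<in> ?P" for v w
  proof -
    obtain t where t: "t \<in> fst b" "fst v = \<phi> t" "snd b t = ?\<kappa> (fst v)" using coords near[OF v] by blast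
    obtain u where u: "u \<in> fst b" "fst w = \<phi> u" "snd b u = ?\<kappa> (fst w)" using coords near[OF w] by blast
    have "snd d (fst v) = \<Phi> b d (?\<kappa> (fst v))" "snd d (fst w) = \<Phi> b d (?\<kappa> (fst w))"
      using \<Phi>_apply[OF b(1) t(1), of d] \<Phi>_apply[OF b(1) u(1), of d] t u by auto
    then have "norm (snd d (fst v) - snd d (fst w) - ?D (?\<kappa> (fst v) - ?\<kappa> (fst w))) \<le> \<eta> * norm (?\<kappa> (fst v) - ?\<kappa> (fst w))"
      using est2 near[OF v] near[OF w] by auto
    also have "\<dots> \<le> \<eta> * norm (snd ?a v - snd ?a w)"
      using \<eta>(1) norm_fst_le[of "?\<kappa> (fst v) - ?\<kappa> (fst w)" "fiber_coord e v - fiber_coord e w"]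
      by (intro mult_left_mono) (auto simp: nchart_def)
    finally show ?thesis .
  qed
  have fibre: "norm (snd v d - snd w d - ?F (fiber_coord e v - fiber_coord e w)) \<le> \<eta> * norm (snd ?a v - snd ?a w)"
    if v: "v \<in> ?P" and w: "w \<in> ?P" for v w
  proof -
    let ?y = "fiber_coord e v" and ?y' = "fiber_coord e w" and ?\<Delta> = "norm (snd ?a v - snd ?a w)"
    note nv = near[OF v] and nw = near[OF w]
    have \<Delta>: "dist (?\<kappa> (fst v)) (?\<kappa> (fst w)) \<le> ?\<Delta>" "norm (?y - ?y') \<le> ?\<Delta>"
      using norm_fst_le[of "?\<kappa> (fst v) - ?\<kappa> (fst w)" "?y - ?y'"] norm_snd_le[of "?y - ?y'" "?\<kappa> (fst v) - ?\<kappa> (fst w)"]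
      by (auto simp: nchart_def dist_norm)
    have c0: "\<phi> s \<in> chart_ball V (ichart b) (\<phi> s) r2"
      using sV r2(1) ichart_dom[OF b(1) s] b(2) by (auto intro: chart_ball_center)
    have "snd v d - snd w d - ?F (?y - ?y') = (frame_map e d (fst v) ?y - frame_map e d (fst w) ?y)
        + (frame_map e d (fst w) (?y - ?y') - ?F (?y - ?y'))"
    proof -
      have "v \<in> \<nu>" "fst v \<in> V" "w \<in> \<nu>" "fst w \<in> V" using nchart_elim(1,2) nv nw by blast+
      then show ?thesis by (simp add: normal_snd[OF f] linear_diff[OF frame_map_linear])
    qed
    then have "norm (snd v d - snd w d - ?F (?y - ?y')) \<le> norm (frame_map e d (fst v) ?y - frame_map e d (fst w) ?y)
        + norm (frame_map e d (fst w) (?y - ?y') - ?F (?y - ?y'))" by (metis norm_triangle_ineq)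
    also have "\<dots> \<le> L * dist (?\<kappa> (fst v)) (?\<kappa> (fst w)) * norm ?y + L * dist (?\<kappa> (fst w)) (?\<kappa> (\<phi> s)) * norm (?y - ?y')"
      using est3 nv nw c0 by (intro add_mono) blast+
    also have "\<dots> \<le> L * ?\<Delta> * \<delta> + L * \<delta> * ?\<Delta>"
      using nv nw r2(2) \<delta>(1) by (intro add_mono mult_mono mult_nonneg_nonneg \<Delta>) auto
    also have "\<dots> = (2 * L * \<delta>) * ?\<Delta>" by simp
    also have "\<dots> \<le> \<eta> * ?\<Delta>" by (intro mult_right_mono \<delta>) auto
    finally show ?thesis .
  qed
  have base_bd: "norm (snd d (fst v) - snd d (fst w)) \<le> (K1 + 1) * norm (snd ?a v - snd ?a w)"
    if v: "v \<in> ?P" and w: "w \<in> ?P" for v w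
  proof -
    let ?\<Delta> = "norm (snd ?a v - snd ?a w)" and ?x = "snd d (fst v) - snd d (fst w)" and ?\<sigma> = "?\<kappa> (fst v) - ?\<kappa> (fst w)"
    have "norm ?x \<le> norm (?D ?\<sigma>) + norm (?x - ?D ?\<sigma>)" by (rule norm_triangle_sub)
    also have "\<dots> \<le> K1 * norm ?\<sigma> + \<eta> * ?\<Delta>" by (intro add_mono K1 base v w)
    also have "\<dots> \<le> K1 * ?\<Delta> + 1 * ?\<Delta>"
      using K1(1) \<eta>(2) norm_fst_le[of ?\<sigma> "fiber_coord e v - fiber_coord e w"]
      by (intro add_mono mult_left_mono mult_right_mono) (auto simp: nchart_def)
    finally show ?thesis by (simp add: algebra_simps)
  qed
  have fibre_bd: "norm (snd v d - snd w d) \<le> (K2 + 1) * norm (snd ?a v - snd ?a w)"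
    if v: "v \<in> ?P" and w: "w \<in> ?P" for v w
  proof -
    let ?\<Delta> = "norm (snd ?a v - snd ?a w)" and ?x = "snd v d - snd w d" and ?y = "fiber_coord e v - fiber_coord e w"
    have "norm ?x \<le> norm (?F ?y) + norm (?x - ?F ?y)" by (rule norm_triangle_sub)
    also have "\<dots> \<le> K2 * norm ?y + \<eta> * ?\<Delta>" by (intro add_mono K2 fibre v w)
    also have "\<dots> \<le> K2 * ?\<Delta> + 1 * ?\<Delta>"
      using K2(1) \<eta>(2) norm_snd_le[of ?y "?\<kappa> (fst v) - ?\<kappa> (fst w)"]
      by (intro add_mono mult_left_mono mult_right_mono) (auto simp: nchart_def)
    finally show ?thesis by (simp add: algebra_simps)
  qed
  have small: "norm (snd d (fst v) - snd d (\<phi> s)) < \<delta>1" "norm (snd v d) < \<delta>1" if v: "v \<in> ?P" for v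
  proof -
    let ?\<Delta> = "norm (snd ?a v - snd ?a ?z)"
    have \<Delta>: "?\<Delta> < \<delta>" using v by (simp add: chart_ball_def dist_norm)
    have "(K1 + 1) * ?\<Delta> \<le> (K1 + K2 + 2) * ?\<Delta>" "(K2 + 1) * ?\<Delta> \<le> (K1 + K2 + 2) * ?\<Delta>"
      using K1(1) K2(1) by (intro mult_right_mono; simp)+
    moreover have "(K1 + K2 + 2) * ?\<Delta> < (K1 + K2 + 2) * \<delta>" using K1(1) K2(1) \<Delta> by (intro mult_strict_left_mono) auto
    moreover have "norm (snd d (fst v) - snd d (\<phi> s)) \<le> (K1 + 1) * ?\<Delta>" "norm (snd v d) \<le> (K2 + 1) * ?\<Delta>"
      using base_bd[OF v zP] fibre_bd[OF v zP] by (simp_all add: tzero_def)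
    ultimately show "norm (snd d (fst v) - snd d (\<phi> s)) < \<delta>1" "norm (snd v d) < \<delta>1" using \<delta>(5) by linarith+
  qed
  show ?thesis
  proof (rule that[OF \<delta>(1)]; intro ballI)
    fix v assume v: "v \<in> ?P"
    show "v \<in> exp_dom M A \<Gamma> \<and> exp_map M A \<Gamma> v \<in> fst d" using ex near[OF v] small[OF v] by blast
  next
    fix v w assume v: "v \<in> ?P" and w: "w \<in> ?P"
    let ?\<Delta> = "norm (snd ?a v - snd ?a w)"
    let ?E = "snd d (exp_map M A \<Gamma> v) - snd d (exp_map M A \<Gamma> w)"
    let ?x = "snd d (fst v) - snd d (fst w)" and ?u = "snd v d - snd w d"
    have "norm (?E - ?x - ?u) \<le> \<eta> * (norm ?x + norm ?u)" using est1 near[OF v] near[OF w] small[OF v] small[OF w] by blast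
    also have "\<dots> \<le> \<eta> * ((K1 + 1) * ?\<Delta> + (K2 + 1) * ?\<Delta>)"
      using \<eta>(1) by (intro mult_left_mono add_mono base_bd fibre_bd v w) auto
    finally have 1: "norm (?E - ?x - ?u) \<le> \<eta> * ((K1 + 1) * ?\<Delta> + (K2 + 1) * ?\<Delta>)" .
    have eq: "?E - exp_diff b e d s (snd ?a v - snd ?a w) = (?E - ?x - ?u) + ((?x - ?D (?\<kappa> (fst v) - ?\<kappa> (fst w))) + (?u - ?F (fiber_coord e v - fiber_coord e w)))"
      by (simp add: exp_diff_def nchart_def)
    have "norm (?E - exp_diff b e d s (snd ?a v - snd ?a w)) \<le> norm (?E - ?x - ?u) +
       (norm (?x - ?D (?\<kappa> (fst v) - ?\<kappa> (fst w))) + norm (?u - ?F (fiber_coord e v - fiber_coord e w)))"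
      unfolding eq by (intro norm_triangle_le add_left_mono norm_triangle_ineq)
    also have "\<dots> \<le> \<eta> * ((K1 + 1) * ?\<Delta> + (K2 + 1) * ?\<Delta>) + (\<eta> * ?\<Delta> + \<eta> * ?\<Delta>)"
      by (intro add_mono 1 base fibre v w)
    also have "\<dots> = (\<eta> * (K1 + K2 + 4)) * ?\<Delta>" by (simp add: algebra_simps)
    also have "\<dots> \<le> \<epsilon> * ?\<Delta>" by (intro mult_right_mono \<eta>) auto
    finally show "norm (?E - exp_diff b e d s (snd ?a v - snd ?a w)) \<le> \<epsilon> * ?\<Delta>" .
  qed
qed

theorem exp_has_strong_differential:
  assumes f: "frame V e" and b: "b \<in> B" "s \<in> fst b" and d: "d \<in> A" "\<phi> s \<in> fst d" and sV: "\<phi> s \<in> V"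
  shows "\<exists>W. W \<subseteq> snd (nchart b V e) ` {v \<in> fst (nchart b V e) \<inter> exp_dom M A \<Gamma>. exp_map M A \<Gamma> v \<in> fst d} \<and>
     has_strong_differential (UNIV \<times> coord_space J) W (chart_rep (nchart b V e) d (exp_map M A \<Gamma>))
       (exp_diff b e d s) (snd (nchart b V e) (tzero (\<phi> s)))"
proof -
  let ?a = "nchart b V e" and ?z = "tzero (\<phi> s)"
  note z = tzero_in_nchart[OF f b sV]
  have aN: "?a \<in> NC" unfolding normal_charts_eq using b f by blast
  obtain \<delta> where \<delta>: "\<delta> > 0"
    "\<forall>v\<in>chart_ball \<nu> ?a ?z \<delta>. v \<in> exp_dom M A \<Gamma> \<and> exp_map M A \<Gamma> v \<in> fst d"
    by (rule exp_strongly_differentiable[OF f b d sV zero_less_one])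
  let ?P = "chart_ball \<nu> ?a ?z \<delta>"
  let ?W = "snd ?a ` ?P"
  have Pa: "?P \<subseteq> fst ?a" by (auto simp: chart_ball_def)
  have rep: "chart_rep ?a d (exp_map M A \<Gamma>) (snd ?a v) = snd d (exp_map M A \<Gamma> v)" if "v \<in> fst ?a" for v
    by (rule chart_rep_apply[OF nchart_inj[OF f b(1)] that])
  have "openin NT ?P" using lip_atlas_openin_chart_ball[OF normal_lip_atlas aN] unfolding topspace_NT .
  from nchart_image_open[OF f b(1) this] have oW: "openin (top_of_set (UNIV \<times> coord_space J)) ?W"
    using Pa by (simp add: inf.absorb2)
  have "?W \<subseteq> snd ?a ` {v \<in> fst ?a \<inter> exp_dom M A \<Gamma>. exp_map M A \<Gamma> v \<in> fst d}" using \<delta>(2) Pa by blast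
  moreover have "has_strong_differential (UNIV \<times> coord_space J) ?W (chart_rep ?a d (exp_map M A \<Gamma>)) (exp_diff b e d s) (snd ?a ?z)"
    unfolding has_strong_differential_def
  proof (intro conjI allI impI)
    show "subspace ((UNIV :: (real^'k) set) \<times> coord_space J)"
      by (rule subspace_Times[OF subspace_UNIV coord_space_subspace])
    show "openin (top_of_set (UNIV \<times> coord_space J)) ?W" by (rule oW)
    have "?z \<in> ?P" by (rule chart_ball_center[OF nchart_elim(1)[OF z(1)] z(1) \<delta>(1)])
    then show "snd ?a ?z \<in> ?W" by (rule imageI)
    show "bounded_linear (exp_diff b e d s)"
      using exp_diff_linear[OF b d] by (simp add: linear_conv_bounded_linear)
    fix \<epsilon> :: real assume "\<epsilon> > 0"
    then obtain \<delta>' where \<delta>': "\<delta>' > 0" and est: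
      "\<forall>v\<in>chart_ball \<nu> ?a ?z \<delta>'. \<forall>w\<in>chart_ball \<nu> ?a ?z \<delta>'.
       norm (snd d (exp_map M A \<Gamma> v) - snd d (exp_map M A \<Gamma> w) - exp_diff b e d s (snd ?a v - snd ?a w))
         \<le> \<epsilon> * norm (snd ?a v - snd ?a w)"
      by (rule exp_strongly_differentiable[OF f b d sV])
    show "\<exists>\<delta>>0. \<forall>x\<in>?W. \<forall>y\<in>?W. norm (x - snd ?a ?z) \<le> \<delta> \<longrightarrow> norm (y - snd ?a ?z) \<le> \<delta> \<longrightarrow>
        norm (chart_rep ?a d (exp_map M A \<Gamma>) x - chart_rep ?a d (exp_map M A \<Gamma>) y - exp_diff b e d s (x - y)) \<le> \<epsilon> * norm (x - y)"
    proof (intro exI[of _ "\<delta>' / 2"] conjI ballI impI)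
      fix x y assume xy: "x \<in> ?W" "y \<in> ?W" "norm (x - snd ?a ?z) \<le> \<delta>' / 2" "norm (y - snd ?a ?z) \<le> \<delta>' / 2"
      then obtain v w where v: "v \<in> ?P" "x = snd ?a v" and w: "w \<in> ?P" "y = snd ?a w" by blast
      have "v \<in> chart_ball \<nu> ?a ?z \<delta>'" "w \<in> chart_ball \<nu> ?a ?z \<delta>'"
        using v w xy(3,4) \<delta>' by (auto simp: chart_ball_def dist_norm)
      then have est': "norm (snd d (exp_map M A \<Gamma> v) - snd d (exp_map M A \<Gamma> w) - exp_diff b e d s (x - y)) \<le> \<epsilon> * norm (x - y)"
        using est unfolding v(2) w(2) by blast
      show "norm (chart_rep ?a d (exp_map M A \<Gamma>) x - chart_rep ?a d (exp_map M A \<Gamma>) y - exp_diff b e d s (x - y)) \<le> \<epsilon> * norm (x - y)"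
      proof -
        have "v \<in> fst ?a" "w \<in> fst ?a" using v(1) w(1) Pa by blast+
        then show ?thesis
          using est' by (simp only: v(2) w(2) rep)
      qed
    qed (use \<delta>' in simp)
  qed
  ultimately show ?thesis by blast
qed

text \<open>
  The neighbourhoods that an inverse function theorem would provide. Openness is required for all
  open subsets, which makes the notion stable under shrinking.
\<close>

definition exp_bilipschitz_on :: "('m, real^'n) tvec set \<Rightarrow> bool" where
  "exp_bilipschitz_on P \<longleftrightarrow> openin NT P \<and> P \<subseteq> exp_dom M A \<Gamma> \<and>
     (\<exists>a\<in>NC. \<exists>d\<in>A. \<exists>m>0. \<exists>L. P \<subseteq> fst a \<and> exp_map M A \<Gamma> ` P \<subseteq> fst d \<and>
       bilipschitz_in_charts a d m L (exp_map M A \<Gamma>) P) \<and>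
     (\<forall>P'. P' \<subseteq> P \<longrightarrow> openin NT P' \<longrightarrow> openin M (exp_map M A \<Gamma> ` P'))"

lemma exp_bilipschitz_onE:
  assumes "exp_bilipschitz_on P"
  obtains a d m L where "a \<in> NC" "d \<in> A" "m > 0" "P \<subseteq> fst a" "exp_map M A \<Gamma> ` P \<subseteq> fst d"
    "bilipschitz_in_charts a d m L (exp_map M A \<Gamma>) P"
  using assms unfolding exp_bilipschitz_on_def by (elim conjE bexE exE)

lemma exp_bilipschitz_on_subset:
  assumes P: "exp_bilipschitz_on P" and P': "P' \<subseteq> P" "openin NT P'"
  shows "exp_bilipschitz_on P'"
proof -
  obtain a d m L where a: "a \<in> NC" "d \<in> A" "m > 0" "P \<subseteq> fst a" "exp_map M A \<Gamma> ` P \<subseteq> fst d"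
    "bilipschitz_in_charts a d m L (exp_map M A \<Gamma>) P"
    by (rule exp_bilipschitz_onE[OF P])
  show ?thesis
    unfolding exp_bilipschitz_on_def
  proof (intro conjI)
    show "P' \<subseteq> exp_dom M A \<Gamma>" "\<forall>P''. P'' \<subseteq> P' \<longrightarrow> openin NT P'' \<longrightarrow> openin M (exp_map M A \<Gamma> ` P'')"
      using P P'(1) unfolding exp_bilipschitz_on_def by (meson subset_trans)+
    show "\<exists>a\<in>NC. \<exists>d\<in>A. \<exists>m>0. \<exists>L. P' \<subseteq> fst a \<and> exp_map M A \<Gamma> ` P' \<subseteq> fst d \<and>
       bilipschitz_in_charts a d m L (exp_map M A \<Gamma>) P'"
      by (rule bexI[OF _ a(1)], rule bexI[OF _ a(2)], rule exI[of _ m], rule conjI[OF a(3)], rule exI[of _ L])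
        (use a(4-6) P'(1) in \<open>meson image_mono subset_trans subsetD\<close>)
  qed (rule P'(2))
qed

text \<open>
  If the differential expands lengths at least by \<open>m\<close> on the model space, then an error of \<open>m / 2\<close>
  in the strong differentiability leaves a lower Lipschitz constant \<open>m / 2\<close>. The model space and
  the charts of \<open>M\<close> have the same dimension, so the map is open by invariance of domain.
\<close>

lemma exp_local_lipeomorphism:
  assumes s: "s \<in> topspace S"
  shows "\<exists>P. tzero (\<phi> s) \<in> P \<and> exp_bilipschitz_on P"
proof -
  let ?ex = "exp_map M A \<Gamma>"
  obtain b where b: "b \<in> B" "s \<in> fst b" using S.chart_exists[OF s] by blast
  obtain d where d: "d \<in> A" "\<phi> s \<in> fst d" using M.chart_exists[OF \<phi>_in[OF s]] by blast
  obtain V e where sV: "\<phi> s \<in> V" and f: "frame V e" using normal_frame_exists[OF s] by blast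
  let ?a = "nchart b V e" and ?z = "tzero (\<phi> s)" and ?U = "(UNIV :: (real^'k) set) \<times> coord_space J"
  note z = tzero_in_nchart[OF f b sV]
  have aN: "?a \<in> NC" unfolding normal_charts_eq using b f by blast
  have subU: "subspace ?U" by (rule subspace_Times[OF subspace_UNIV coord_space_subspace])
  have lin: "linear (exp_diff b e d s)" by (rule exp_diff_linear[OF b d])
  then have bl: "bounded_linear (exp_diff b e d s)" by (simp add: linear_conv_bounded_linear)
  have "\<forall>x\<in>?U. exp_diff b e d s x = 0 \<longrightarrow> x = 0" using exp_diff_injective[OF f b d sV] by auto
  from injective_imp_isometric[OF closed_subspace[OF subU] subU bl this]
  obtain m where m: "m > 0" "\<forall>x\<in>?U. norm (exp_diff b e d s x) \<ge> m * norm x" by auto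
  obtain K where K: "K > 0" "\<And>x. norm (exp_diff b e d s x) \<le> K * norm x" using linear_bounded_pos[OF lin] by metis
  have m2: "m / 2 > 0" using m(1) by simp
  obtain \<delta> where \<delta>: "\<delta> > 0"
    "\<forall>v\<in>chart_ball \<nu> ?a ?z \<delta>. v \<in> exp_dom M A \<Gamma> \<and> ?ex v \<in> fst d"
    and est: "\<forall>v\<in>chart_ball \<nu> ?a ?z \<delta>. \<forall>w\<in>chart_ball \<nu> ?a ?z \<delta>.
       norm (snd d (?ex v) - snd d (?ex w) - exp_diff b e d s (snd ?a v - snd ?a w)) \<le> m / 2 * norm (snd ?a v - snd ?a w)"
    by (rule exp_strongly_differentiable[OF f b d sV m2])
  define P where "P = chart_ball \<nu> ?a ?z \<delta>"
  have Pa: "P \<subseteq> fst ?a" by (auto simp: chart_ball_def P_def)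
  have oP: "openin NT P" using lip_atlas_openin_chart_ball[OF normal_lip_atlas aN] unfolding topspace_NT P_def .
  have aU: "snd ?a v \<in> ?U" if "v \<in> fst ?a" for v
    using fiber_coord_spec(1)[OF f nchart_elim(1,2)[OF that]] by (simp add: nchart_def)
  have bil: "m / 2 * dist (snd ?a x) (snd ?a y) \<le> dist (snd d (?ex x)) (snd d (?ex y)) \<and>
        dist (snd d (?ex x)) (snd d (?ex y)) \<le> (K + m / 2) * dist (snd ?a x) (snd ?a y)" if xy: "x \<in> P" "y \<in> P" for x y
  proof -
    let ?w = "snd ?a x - snd ?a y" and ?E = "snd d (?ex x) - snd d (?ex y)"
    have e: "norm (?E - exp_diff b e d s ?w) \<le> m / 2 * norm ?w" using est xy unfolding P_def by blast
    have "?w \<in> ?U" using xy Pa by (intro subspace_diff[OF subU] aU) auto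
    then have "m * norm ?w \<le> norm (exp_diff b e d s ?w)" by (rule bspec[OF m(2)])
    moreover have "norm (exp_diff b e d s ?w) \<le> norm ?E + norm (?E - exp_diff b e d s ?w)"
      unfolding norm_minus_commute[of ?E] by (rule norm_triangle_sub)
    ultimately have 1: "m / 2 * norm ?w \<le> norm ?E" using e by simp
    have "norm ?E \<le> norm (exp_diff b e d s ?w) + norm (?E - exp_diff b e d s ?w)" by (rule norm_triangle_sub)
    also have "\<dots> \<le> K * norm ?w + m / 2 * norm ?w" by (intro add_mono K e)
    finally show ?thesis using 1 by (simp add: dist_norm algebra_simps)
  qed
  have "openin M (?ex ` P')" if P': "P' \<subseteq> P" "openin NT P'" for P'
  proof -
    let ?D = "snd ?a ` P'" and ?F = "chart_rep ?a d ?ex"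
    have P'a: "P' \<subseteq> fst ?a" using P' Pa by blast
    have rep: "?F (snd ?a v) = snd d (?ex v)" if "v \<in> P'" for v
      by (rule chart_rep_apply[OF nchart_inj[OF f b(1)] subsetD[OF P'a that]])
    have oD: "openin (top_of_set ?U) ?D" using nchart_image_open[OF f b(1) P'(2)] P'a by (simp add: inf.absorb2)
    have "(K + m / 2)-lipschitz_on ?D ?F"
    proof (rule lipschitz_onI)
      fix x y assume "x \<in> ?D" "y \<in> ?D"
      then obtain v w where "v \<in> P'" "w \<in> P'" "x = snd ?a v" "y = snd ?a w" by blast
      then show "dist (?F x) (?F y) \<le> (K + m / 2) * dist x y" using bil[OF subsetD[OF P'(1)] subsetD[OF P'(1)], of v w] by (simp add: rep)
    qed (use K m in simp)
    then have cont: "continuous_on ?D ?F" by (rule lipschitz_on_continuous_on)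
    have inj: "inj_on ?F ?D"
    proof (rule inj_onI)
      fix x y assume "x \<in> ?D" "y \<in> ?D" and eq: "?F x = ?F y"
      then obtain v w where vw: "v \<in> P'" "w \<in> P'" "x = snd ?a v" "y = snd ?a w" by blast
      then have "snd d (?ex v) = snd d (?ex w)" using eq by (simp add: rep)
      then have "m / 2 * dist x y \<le> 0" using bil[OF subsetD[OF P'(1)] subsetD[OF P'(1)], of v w] vw by simp
      then show "x = y" using m(1) by (simp add: mult_le_0_iff)
    qed
    have "topspace S \<noteq> {}" using s by blast
    from dim_model[OF this] have dims: "dim (UNIV :: (real^'n) set) \<le> dim ?U" by (simp only: dim_UNIV DIM_cart DIM_real mult_1_right order_refl)
    from invariance_of_domain_subspaces[OF oD subU subspace_UNIV dims cont _ inj]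
    have "open (?F ` ?D)" by simp
    moreover have "?F ` ?D = (\<lambda>v. snd d (?ex v)) ` P'" unfolding image_image using rep by (intro image_cong) auto
    ultimately have "openin M {p \<in> fst d. snd d p \<in> (\<lambda>v. snd d (?ex v)) ` P'}"
      using M.openin_chart_preimage[OF d(1)] by simp
    moreover have "{p \<in> fst d. snd d p \<in> (\<lambda>v. snd d (?ex v)) ` P'} = ?ex ` P'"
    proof
      show "{p \<in> fst d. snd d p \<in> (\<lambda>v. snd d (?ex v)) ` P'} \<subseteq> ?ex ` P'"
      proof
        fix p assume "p \<in> {p \<in> fst d. snd d p \<in> (\<lambda>v. snd d (?ex v)) ` P'}"
        then obtain v where "p \<in> fst d" "v \<in> P'" "snd d p = snd d (?ex v)" by blast
        moreover from this have "?ex v \<in> fst d" using \<delta>(2) P'(1) unfolding P_def by blast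
        ultimately have "p = ?ex v" using M.chart_facts(4)[OF d(1)] by (meson inj_onD)
        then show "p \<in> ?ex ` P'" using \<open>v \<in> P'\<close> by blast
      qed
      show "?ex ` P' \<subseteq> {p \<in> fst d. snd d p \<in> (\<lambda>v. snd d (?ex v)) ` P'}" using \<delta>(2) P'(1) unfolding P_def by blast
    qed
    ultimately show ?thesis by simp
  qed
  then have opens: "\<forall>P'. P' \<subseteq> P \<longrightarrow> openin NT P' \<longrightarrow> openin M (?ex ` P')" by blast
  have zP: "?z \<in> P" unfolding P_def by (rule chart_ball_center[OF nchart_elim(1)[OF z(1)] z(1) \<delta>(1)])
  have exP: "P \<subseteq> exp_dom M A \<Gamma>" "?ex ` P \<subseteq> fst d" using \<delta>(2) by (auto simp: P_def)
  show ?thesis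
    unfolding exp_bilipschitz_on_def
    by (rule exI[of _ P], intro conjI zP oP exP opens, rule bexI[OF _ aN], rule bexI[OF _ d(1)],
        rule exI[of _ "m / 2"], rule conjI[OF m2], rule exI[of _ "K + m / 2"])
      (intro conjI exP Pa ballI bil[THEN conjunct1] bil[THEN conjunct2])
qed

text \<open>
  The constant curve is the geodesic with zero velocity.
\<close>

lemma exp_zero:
  assumes s: "s \<in> topspace S"
  shows "exp_map M A \<Gamma> (tzero (\<phi> s)) = \<phi> s"
proof -
  have c0: "christoffel \<Gamma> c x 0 0 = 0" for c x by (simp add: christoffel_def vec_eq_iff)
  have "geodesic_on M A \<Gamma> UNIV (\<lambda>t. tzero (\<phi> s))"
    unfolding geodesic_on_def
  proof (intro conjI ballI impI)
    show "continuous_map (top_of_set UNIV) M (fst \<circ> (\<lambda>t. tzero (\<phi> s)))" using \<phi>_in[OF s] by (simp add: tzero_def o_def)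
    show "tzero (\<phi> s) \<in> tangent_space A (fst (tzero (\<phi> s)))" using M.tzero_in[of "\<phi> s"] by (simp add: tzero_def)
  qed (auto simp: tzero_def c0 is_interval_univ)
  then have "exp_graph M A \<Gamma> (tzero (\<phi> s)) (\<phi> s)"
    unfolding exp_graph_def by (intro exI[of _ UNIV] exI[of _ "\<lambda>t. tzero (\<phi> s)"]) (simp add: tzero_def)
  then show ?thesis by (rule exp_map_eq)
qed

end

section \<open>From local to global injectivity\<close>

text \<open>
  In a locally finite refinement by relatively compact sets each member meets only finitely many
  others. Starting from one member and adding neighbours repeatedly reaches countably many
  members; their union and the union of the remaining ones are open and disjoint, so by
  connectedness nothing remains.
\<close>

lemma connected_paracompact_countable_cover:
  assumes conn: "connected_space X" and para: "paracompact_space X"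
    and U: "\<And>U. U \<in> \<U> \<Longrightarrow> openin X U \<and> (\<exists>K. compactin X K \<and> U \<subseteq> K)" and cov: "\<Union>\<U> = topspace X"
  obtains \<W> where "countable \<W>" "\<Union>\<W> = topspace X" "\<forall>W\<in>\<W>. \<exists>U\<in>\<U>. W \<subseteq> U"
proof -
  have "(\<forall>U\<in>\<U>. openin X U) \<and> \<Union>\<U> = topspace X" using U cov by blast
  then obtain \<V> where V: "\<And>V. V \<in> \<V> \<Longrightarrow> openin X V \<and> (\<exists>U\<in>\<U>. V \<subseteq> U)" "\<Union>\<V> = topspace X" "locally_finite_in X \<V>"
    using para unfolding paracompact_space_def by metis
  have fin: "finite {V' \<in> \<V>. V' \<inter> V \<noteq> {}}" if VV: "V \<in> \<V>" for V
  proof -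
    obtain K where K: "compactin X K" "V \<subseteq> K" using V(1)[OF VV] U by (meson subset_trans)
    let ?\<N> = "{N. openin X N \<and> finite {V' \<in> \<V>. V' \<inter> N \<noteq> {}}}"
    have "K \<subseteq> \<Union>?\<N>"
    proof
      fix x assume "x \<in> K"
      then have "x \<in> topspace X" using compactin_subset_topspace[OF K(1)] by blast
      then obtain N where "openin X N" "x \<in> N" "finite {V' \<in> \<V>. V' \<inter> N \<noteq> {}}"
        using V(3) unfolding locally_finite_in_def by blast
      then show "x \<in> \<Union>?\<N>" by blast
    qed
    then obtain \<F> where F: "finite \<F>" "\<F> \<subseteq> ?\<N>" "K \<subseteq> \<Union>\<F>" using compactinD[OF K(1), of ?\<N>] by blast
    have "{V' \<in> \<V>. V' \<inter> V \<noteq> {}} \<subseteq> (\<Union>N\<in>\<F>. {V' \<in> \<V>. V' \<inter> N \<noteq> {}})" using K(2) F(3) by blast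
    moreover have "finite (\<Union>N\<in>\<F>. {V' \<in> \<V>. V' \<inter> N \<noteq> {}})" using F by auto
    ultimately show ?thesis by (rule finite_subset)
  qed
  show ?thesis
  proof (cases "topspace X = {}")
    case True then show ?thesis by (intro that[of "{}"]) auto
  next
    case False
    then obtain V0 where V0: "V0 \<in> \<V>" "V0 \<noteq> {}" using V(2) by fastforce
    \<comment> \<open>\<open>layer n\<close> contains the members reached from \<open>V0\<close> by chains of \<open>n\<close> overlaps.\<close>
    define layer where "layer = rec_nat {V0} (\<lambda>_ \<L>. {V \<in> \<V>. \<exists>W\<in>\<L>. V \<inter> W \<noteq> {}})"
    have layer_0: "layer 0 = {V0}" and layer_Suc: "layer (Suc n) = {V \<in> \<V>. \<exists>W\<in>layer n. V \<inter> W \<noteq> {}}" for n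
      by (simp_all add: layer_def)
    have layer: "finite (layer n) \<and> layer n \<subseteq> \<V>" for n
    proof (induction n)
      case 0 then show ?case using V0 by (simp add: layer_0)
    next
      case (Suc n)
      have "layer (Suc n) = (\<Union>W\<in>layer n. {V \<in> \<V>. V \<inter> W \<noteq> {}})" unfolding layer_Suc by blast
      moreover have "finite (\<Union>W\<in>layer n. {V \<in> \<V>. V \<inter> W \<noteq> {}})"
        by (rule finite_UN_I) (use Suc fin in blast)+
      ultimately show ?case by (simp add: layer_Suc subset_iff)
    qed
    define \<W> where "\<W> = (\<Union>n. layer n)"
    have W: "\<W> \<subseteq> \<V>" using layer unfolding \<W>_def by blast
    have cW: "countable \<W>" unfolding \<W>_def
      by (rule countable_UN[OF countableI_type], rule countable_finite) (use layer in blast)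
    have "\<Union>\<W> \<inter> \<Union>(\<V> - \<W>) = {}"
    proof (rule ccontr)
      assume "\<Union>\<W> \<inter> \<Union>(\<V> - \<W>) \<noteq> {}"
      then obtain V W where VW: "W \<in> \<W>" "V \<in> \<V>" "V \<notin> \<W>" "V \<inter> W \<noteq> {}" by blast
      then obtain n where "W \<in> layer n" by (auto simp: \<W>_def)
      then have "V \<in> layer (Suc n)" using VW by (auto simp: layer_Suc)
      then show False using VW(3) by (auto simp: \<W>_def)
    qed
    moreover have "openin X (\<Union>\<W>)" "openin X (\<Union>(\<V> - \<W>))" using V(1) W by auto
    moreover have "topspace X \<subseteq> \<Union>\<W> \<union> \<Union>(\<V> - \<W>)" using V(2) by blast
    moreover have "\<Union>\<W> \<noteq> {}" using V0 layer_0 unfolding \<W>_def by blast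
    ultimately have "\<Union>(\<V> - \<W>) = {}" using conn unfolding connected_space_def by blast
    then have "\<Union>\<W> = topspace X" using V(2) W by blast
    then show ?thesis using that[of \<W>] W cW V(1) by (meson subsetD)
  qed
qed

lemma chart_compactin:
  assumes X: "lip_atlas X \<A>" and a: "a \<in> \<A>" "fst a \<subseteq> topspace X" and C: "compact C" "C \<subseteq> snd a ` fst a"
  shows "compactin X {x \<in> fst a. snd a x \<in> C}"
proof -
  let ?h = "inv_into (fst a) (snd a)"
  note inj = lip_atlas_inj[OF X a(1)]
  have "continuous_map (top_of_set (snd a ` fst a)) X ?h"
    unfolding continuous_map_def
  proof (intro conjI allI impI)
    show "?h \<in> topspace (top_of_set (snd a ` fst a)) \<rightarrow> topspace X"
    proof
      fix z assume "z \<in> topspace (top_of_set (snd a ` fst a))"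
      then have "?h z \<in> fst a" by (simp add: inv_into_into)
      then show "?h z \<in> topspace X" using a(2) by blast
    qed
    fix G assume G: "openin X G"
    show "openin (top_of_set (snd a ` fst a)) {z \<in> topspace (top_of_set (snd a ` fst a)). ?h z \<in> G}"
      unfolding openin_euclidean_subtopology_iff
    proof (intro conjI ballI)
      fix z assume "z \<in> {z \<in> topspace (top_of_set (snd a ` fst a)). ?h z \<in> G}"
      then obtain p where p: "p \<in> fst a" "z = snd a p" "p \<in> G" using inj by auto
      obtain r where r: "r > 0" "chart_ball (topspace X) a p r \<subseteq> G"
        using lip_atlas_openin_ball[OF X G p(3) a(1) p(1)] by blast
      show "\<exists>e>0. \<forall>x'\<in>snd a ` fst a. dist x' z < e \<longrightarrow> x' \<in> {z \<in> topspace (top_of_set (snd a ` fst a)). ?h z \<in> G}"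
      proof (intro exI[of _ r] conjI ballI impI r(1))
        fix z' assume "z' \<in> snd a ` fst a" "dist z' z < r"
        then obtain q where q: "q \<in> fst a" "z' = snd a q" "dist (snd a q) (snd a p) < r" using p by auto
        then have "q \<in> chart_ball (topspace X) a p r" using a(2) by (auto simp: chart_ball_def)
        then show "z' \<in> {z \<in> topspace (top_of_set (snd a ` fst a)). ?h z \<in> G}" using r(2) q inj by auto
      qed
    qed auto
  qed
  moreover have "compactin (top_of_set (snd a ` fst a)) C" using C by (simp add: compactin_subtopology)
  ultimately have "compactin X (?h ` C)" by (rule image_compactin[rotated])
  moreover have "?h ` C = {x \<in> fst a. snd a x \<in> C}"
  proof
    show "?h ` C \<subseteq> {x \<in> fst a. snd a x \<in> C}" using C(2) by (auto simp: inv_into_into f_inv_into_f subset_iff)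
    show "{x \<in> fst a. snd a x \<in> C} \<subseteq> ?h ` C"
    proof
      fix x assume x: "x \<in> {x \<in> fst a. snd a x \<in> C}"
      then have "x = ?h (snd a x)" using inj by simp
      then show "x \<in> ?h ` C" using x by (intro image_eqI[of x ?h "snd a x"]) auto
    qed
  qed
  ultimately show ?thesis by simp
qed

text \<open>
  The inductive step: the compact set \<open>C\<close>, on which \<open>f\<close> is already injective, is enlarged by a
  compact neighbourhood of \<open>K\<close>. A point of \<open>K\<close> and a point of \<open>C \<union> K\<close> have neighbourhoods between
  which \<open>f\<close> identifies no two distinct points, by local injectivity if they coincide and by the
  Hausdorff property otherwise; Wallace's theorem makes these neighbourhoods uniform over the
  compact sets.

  The set \<open>Z\<close> is carried along in the injectivity statement although it is not compact. Here the
  embedding property \<open>emb\<close> enters: a point of \<open>Z\<close> with the same image as a point close to \<open>z\<close> lies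
  itself close to \<open>z\<close>, where \<open>f\<close> is injective.
\<close>

lemma injective_near_compact_step:
  assumes HY: "Hausdorff_space Y" and D: "openin X D" and cont: "continuous_map (subtopology X D) Y f" and ZD: "Z \<subseteq> D"
    and locinj: "\<And>z. z \<in> Z \<Longrightarrow> \<exists>U. openin X U \<and> z \<in> U \<and> inj_on f U"
    and emb: "\<And>z U. z \<in> Z \<Longrightarrow> openin X U \<Longrightarrow> z \<in> U \<Longrightarrow> \<exists>G. openin Y G \<and> f z \<in> G \<and> (\<forall>w\<in>Z. f w \<in> G \<longrightarrow> w \<in> U)"
    and lc: "\<And>z U. z \<in> Z \<Longrightarrow> openin X U \<Longrightarrow> z \<in> U \<Longrightarrow> \<exists>V C. openin X V \<and> compactin X C \<and> z \<in> V \<and> V \<subseteq> C \<and> C \<subseteq> U"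
    and C: "compactin X C" "C \<subseteq> D" "inj_on f (C \<union> Z)" and K: "compactin X K" "K \<subseteq> Z"
  shows "\<exists>C'. (compactin X C' \<and> C' \<subseteq> D \<and> inj_on f (C' \<union> Z)) \<and> C \<subseteq> C' \<and> (\<exists>V. openin X V \<and> K \<subseteq> V \<and> V \<subseteq> C')"
proof -
  have pre: "openin X {x \<in> D. f x \<in> G}" if "openin Y G" for G
  proof -
    have "openin (subtopology X D) {x \<in> topspace (subtopology X D). f x \<in> G}" using cont that by (auto simp: continuous_map_def)
    moreover have "{x \<in> topspace (subtopology X D). f x \<in> G} = {x \<in> D. f x \<in> G}" using openin_subset[OF D] by auto
    ultimately show ?thesis using D by (metis openin_trans_full)
  qed
  have fY: "f x \<in> topspace Y" if "x \<in> D" for x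
    using cont that openin_subset[OF D] by (auto simp: continuous_map_def)
  let ?good = "\<lambda>P Q. openin X P \<and> openin X Q \<and> (\<forall>x\<in>P. \<forall>y\<in>Q. f x = f y \<longrightarrow> x = y)"
  have pair: "\<exists>P Q. ?good P Q \<and> x \<in> P \<and> y \<in> Q" if x: "x \<in> K" and y: "y \<in> C \<union> K" for x y
  proof (cases "x = y")
    case True
    obtain U where "openin X U" "x \<in> U" "inj_on f U" using locinj x K(2) by blast
    then show ?thesis using True by (intro exI[of _ U]) (auto dest: inj_onD)
  next
    case False
    then have "f x \<noteq> f y" using C(3) x y K(2) by (auto dest: inj_onD)
    moreover have xy: "x \<in> D" "y \<in> D" using x y K(2) ZD C(2) by auto
    ultimately obtain O1 O2 where O: "openin Y O1" "openin Y O2" "f x \<in> O1" "f y \<in> O2" "disjnt O1 O2"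
      using HY fY unfolding Hausdorff_space_def by metis
    show ?thesis
      by (intro exI[of _ "{x \<in> D. f x \<in> O1}"] exI[of _ "{x \<in> D. f x \<in> O2}"])
        (use O xy pre in \<open>auto simp: disjnt_def\<close>)
  qed
  define W where "W = \<Union>{P \<times> Q | P Q. ?good P Q}"
  have oW: "openin (prod_topology X X) W"
    unfolding W_def by (rule openin_Union) (auto simp: openin_prod_Times_iff)
  have KW: "K \<times> (C \<union> K) \<subseteq> W"
  proof (rule subsetI, clarify)
    fix x y assume "x \<in> K" "y \<in> C \<union> K"
    from pair[OF this] show "(x, y) \<in> W" unfolding W_def by blast
  qed
  obtain U V where UV: "openin X U" "openin X V" "K \<subseteq> U" "C \<union> K \<subseteq> V" "U \<times> V \<subseteq> W"
    by (rule Wallace_theorem_prod_topology[OF K(1) compactin_Un[OF C(1) K(1)] oW KW])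
  have eqUV: "x = y" if "x \<in> U" "y \<in> V" "f x = f y" for x y
  proof -
    have "(x, y) \<in> W" using UV(5) that by blast
    then show ?thesis using that(3) unfolding W_def by blast
  qed
  have "\<exists>P. openin X P \<and> z \<in> P \<and> (\<forall>x\<in>P. \<forall>y\<in>Z. f x = f y \<longrightarrow> x = y)" if z: "z \<in> K" for z
  proof -
    have zZ: "z \<in> Z" using z K(2) by blast
    obtain P0 where P0: "openin X P0" "z \<in> P0" "inj_on f P0" using locinj[OF zZ] by blast
    obtain G where G: "openin Y G" "f z \<in> G" "\<forall>w\<in>Z. f w \<in> G \<longrightarrow> w \<in> P0" using emb[OF zZ P0(1,2)] by blast
    show ?thesis
    proof (intro exI[of _ "P0 \<inter> {x \<in> D. f x \<in> G}"] conjI ballI impI)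
      show "openin X (P0 \<inter> {x \<in> D. f x \<in> G})" by (intro openin_Int P0 pre G)
      show "z \<in> P0 \<inter> {x \<in> D. f x \<in> G}" using P0 G zZ ZD by auto
      fix x y assume "x \<in> P0 \<inter> {x \<in> D. f x \<in> G}" "y \<in> Z" "f x = f y"
      then have "x \<in> P0" "y \<in> P0" using G(3) by auto
      then show "x = y" using P0(3) \<open>f x = f y\<close> by (meson inj_onD)
    qed
  qed
  then obtain P where P: "\<And>z. z \<in> K \<Longrightarrow> openin X (P z) \<and> z \<in> P z \<and> (\<forall>x\<in>P z. \<forall>y\<in>Z. f x = f y \<longrightarrow> x = y)" by metis
  \<comment> \<open>Three requirements at once: no collision with \<open>C \<union> K\<close> (\<open>U\<close>), the neighbourhood may itself
    serve as a partner (\<open>V\<close>), no collision with \<open>Z\<close> (\<open>P\<close>).\<close>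
  define U' where "U' = U \<inter> V \<inter> (\<Union>z\<in>K. P z) \<inter> D"
  have U': "openin X U'" "K \<subseteq> U'"
    unfolding U'_def using UV P D K(2) ZD by (auto intro!: openin_Int)
  have "\<exists>V C. openin X V \<and> compactin X C \<and> z \<in> V \<and> V \<subseteq> C \<and> C \<subseteq> U'" if "z \<in> K" for z
    using lc[OF _ U'(1)] that U'(2) K(2) by blast
  then obtain VV CC where VC: "\<And>z. z \<in> K \<Longrightarrow> openin X (VV z) \<and> compactin X (CC z) \<and> z \<in> VV z \<and> VV z \<subseteq> CC z \<and> CC z \<subseteq> U'" by metis
  obtain F where F: "finite F" "F \<subseteq> K" "K \<subseteq> (\<Union>z\<in>F. VV z)"
  proof -
    have "\<exists>\<F>. finite \<F> \<and> \<F> \<subseteq> VV ` K \<and> K \<subseteq> \<Union>\<F>" by (rule compactinD[OF K(1)]) (use VC in auto)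
    then obtain \<F> where "finite \<F>" "\<F> \<subseteq> VV ` K" "K \<subseteq> \<Union>\<F>" by blast
    then show ?thesis using that finite_subset_image by metis
  qed
  define D' where "D' = (\<Union>z\<in>F. CC z)"
  have D': "compactin X D'" unfolding D'_def using F VC by (intro compactin_Union) auto
  have D'U: "D' \<subseteq> U'" unfolding D'_def using F(2) VC by blast
  have VD: "openin X (\<Union>z\<in>F. VV z)" "(\<Union>z\<in>F. VV z) \<subseteq> D'" unfolding D'_def using F(2) VC by blast+
  have one: "x = y" if x: "x \<in> D'" and y: "y \<in> C \<union> D' \<union> Z" and eq: "f x = f y" for x y
  proof -
    have xU: "x \<in> U" "x \<in> (\<Union>z\<in>K. P z)" using x D'U by (auto simp: U'_def)
    consider "y \<in> V" | "y \<in> Z" using y UV(4) D'U by (auto simp: U'_def)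
    then show ?thesis
    proof cases
      case 1 then show ?thesis using eqUV xU eq by blast
    next
      case 2 then show ?thesis using xU P eq by blast
    qed
  qed
  have "inj_on f ((C \<union> D') \<union> Z)"
  proof (rule inj_onI)
    fix x y assume x: "x \<in> (C \<union> D') \<union> Z" and y: "y \<in> (C \<union> D') \<union> Z" and eq: "f x = f y"
    show "x = y"
    proof (cases "x \<in> D' \<or> y \<in> D'")
      case True then show ?thesis using one[of x y] one[of y x] x y eq by auto
    next
      case False then show ?thesis using x y eq C(3) by (auto dest: inj_onD)
    qed
  qed
  moreover have "compactin X (C \<union> D')" by (rule compactin_Un[OF C(1) D'])
  moreover have "C \<union> D' \<subseteq> D" using C(2) D'U by (auto simp: U'_def)
  moreover have "(\<Union>z\<in>F. VV z) \<subseteq> C \<union> D'" using VD(2) by blast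
  ultimately show ?thesis using VD(1) F(3) by (intro exI[of _ "C \<union> D'"]) blast
qed

text \<open>
  Iteration of \<open>injective_near_compact_step\<close> gives an increasing sequence of compact sets, each
  containing a neighbourhood of the next piece of \<open>Z\<close>. Any two points of the union of these
  neighbourhoods lie in a common member of the sequence.
\<close>

lemma injective_near_sigma_compact:
  assumes HY: "Hausdorff_space Y" and D: "openin X D" and cont: "continuous_map (subtopology X D) Y f" and ZD: "Z \<subseteq> D"
    and inj: "inj_on f Z"
    and locinj: "\<And>z. z \<in> Z \<Longrightarrow> \<exists>U. openin X U \<and> z \<in> U \<and> inj_on f U"
    and emb: "\<And>z U. z \<in> Z \<Longrightarrow> openin X U \<Longrightarrow> z \<in> U \<Longrightarrow> \<exists>G. openin Y G \<and> f z \<in> G \<and> (\<forall>w\<in>Z. f w \<in> G \<longrightarrow> w \<in> U)"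
    and lc: "\<And>z U. z \<in> Z \<Longrightarrow> openin X U \<Longrightarrow> z \<in> U \<Longrightarrow> \<exists>V C. openin X V \<and> compactin X C \<and> z \<in> V \<and> V \<subseteq> C \<and> C \<subseteq> U"
    and K: "\<And>n::nat. compactin X (K n)" "Z = (\<Union>n. K n)"
  shows "\<exists>N. openin X N \<and> Z \<subseteq> N \<and> N \<subseteq> D \<and> inj_on f N"
proof -
  let ?P = "\<lambda>C. compactin X C \<and> C \<subseteq> D \<and> inj_on f (C \<union> Z)"
  let ?Q = "\<lambda>n C C'. C \<subseteq> C' \<and> (\<exists>V. openin X V \<and> K n \<subseteq> V \<and> V \<subseteq> C')"
  have "\<exists>C. \<forall>n. ?P (C n) \<and> ?Q n (C n) (C (Suc n))"
  proof (rule dependent_nat_choice)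
    show "\<exists>C. ?P C" using inj by (intro exI[of _ "{}"]) simp
    fix C n assume C: "?P C"
    have "K n \<subseteq> Z" unfolding K(2) by blast
    show "\<exists>C'. ?P C' \<and> ?Q n C C'"
      by (rule injective_near_compact_step[OF HY D cont ZD locinj emb lc _ _ _ K(1)[of n] \<open>K n \<subseteq> Z\<close>])
        (use C in simp_all)
  qed
  then obtain C where C: "\<And>n. ?P (C n)" "\<And>n. ?Q n (C n) (C (Suc n))" by blast
  then obtain V where V: "\<And>n. openin X (V n) \<and> K n \<subseteq> V n \<and> V n \<subseteq> C (Suc n)" by metis
  have mono: "C m \<subseteq> C n" if "m \<le> n" for m n using lift_Suc_mono_le[of C, OF _ that] C(2) by blast
  show ?thesis
  proof (intro exI[of _ "\<Union>n. V n"] conjI)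
    show "openin X (\<Union>n. V n)" using V by blast
    show "Z \<subseteq> (\<Union>n. V n)" using V K(2) by blast
    show "(\<Union>n. V n) \<subseteq> D" using V C(1) by blast
    show "inj_on f (\<Union>n. V n)"
    proof (rule inj_onI)
      fix x y assume "x \<in> (\<Union>n. V n)" "y \<in> (\<Union>n. V n)" and eq: "f x = f y"
      then obtain m n where "x \<in> V m" "y \<in> V n" by blast
      then have "x \<in> C (Suc m)" "y \<in> C (Suc n)" using V by blast+
      then have "x \<in> C (max (Suc m) (Suc n))" "y \<in> C (max (Suc m) (Suc n))"
        using mono[of "Suc m" "max (Suc m) (Suc n)"] mono[of "Suc n" "max (Suc m) (Suc n)"] by auto
      then show "x = y" using C(1)[of "max (Suc m) (Suc n)"] eq by (meson UnI1 inj_onD)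
    qed
  qed
qed

text \<open>
  Coordinate balls with compact closure inside a chart are the relatively compact open sets to
  which \<open>connected_paracompact_countable_cover\<close> applies.
\<close>

lemma (in c11_manifold) countable_chart_cover:
  assumes conn: "connected_space X"
  obtains \<C> where "countable \<C>" "\<C> \<subseteq> A" "topspace X \<subseteq> (\<Union>c\<in>\<C>. fst c)"
proof -
  let ?\<U> = "{U. openin X U \<and> (\<exists>K. compactin X K \<and> U \<subseteq> K) \<and> (\<exists>c\<in>A. U \<subseteq> fst c)}"
  have "\<Union>?\<U> = topspace X"
  proof
    show "\<Union>?\<U> \<subseteq> topspace X" using openin_subset by blast
    show "topspace X \<subseteq> \<Union>?\<U>"
    proof
      fix p assume "p \<in> topspace X"
      then obtain c where c: "c \<in> A" "p \<in> fst c" using chart_exists by blast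
      have "snd c p \<in> snd c ` fst c" using c(2) by (rule imageI)
      then obtain r where r: "r > 0" "cball (snd c p) r \<subseteq> snd c ` fst c"
        using chart_facts(2)[OF c(1)] open_contains_cball by blast
      have "compactin X {x \<in> fst c. snd c x \<in> cball (snd c p) r}"
        by (rule chart_compactin[OF manifold_lip_atlas c(1) chart_facts(5)[OF c(1)] compact_cball r(2)])
      moreover have "openin X {x \<in> fst c. snd c x \<in> ball (snd c p) r}" by (rule openin_chart_preimage[OF c(1) open_ball])
      moreover have "{x \<in> fst c. snd c x \<in> ball (snd c p) r} \<subseteq> {x \<in> fst c. snd c x \<in> cball (snd c p) r}" by auto
      ultimately have "{x \<in> fst c. snd c x \<in> ball (snd c p) r} \<in> ?\<U>" using c(1) by blast
      moreover have "p \<in> {x \<in> fst c. snd c x \<in> ball (snd c p) r}" using c(2) r(1) by simp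
      ultimately show "p \<in> \<Union>?\<U>" by (rule UnionI)
    qed
  qed
  then have cov: "\<Union>?\<U> = topspace X" .
  have para: "paracompact_space X" using manifold unfolding Ck1_manifold_def by blast
  have hU: "openin X U \<and> (\<exists>K. compactin X K \<and> U \<subseteq> K)" if "U \<in> ?\<U>" for U using that by blast
  obtain \<W> where W: "countable \<W>" "\<Union>\<W> = topspace X" "\<forall>W\<in>\<W>. \<exists>U\<in>?\<U>. W \<subseteq> U"
    by (rule connected_paracompact_countable_cover[OF conn para hU cov])
  have "\<forall>W\<in>\<W>. \<exists>c. c \<in> A \<and> W \<subseteq> fst c"
  proof
    fix W assume "W \<in> \<W>"
    then obtain U where U: "U \<in> ?\<U>" "W \<subseteq> U" using W(3) by (meson bspec bexE)
    then obtain c where "c \<in> A" "U \<subseteq> fst c" by auto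
    then show "\<exists>c. c \<in> A \<and> W \<subseteq> fst c" using U(2) by blast
  qed
  from bchoice[OF this] obtain ch where ch: "\<forall>W\<in>\<W>. ch W \<in> A \<and> W \<subseteq> fst (ch W)" by blast
  show ?thesis
  proof (rule that[of "ch ` \<W>"])
    show "topspace X \<subseteq> (\<Union>c\<in>ch ` \<W>. fst c)" unfolding W(2)[symmetric] using ch by blast
  qed (use W(1) ch in auto)
qed

context c11_submanifold begin

text \<open>
  The manifold \<open>S\<close> need not be connected, so countability has to come from \<open>M\<close>. Compact coordinate
  neighbourhoods in the image contain the traces of coordinate balls of \<open>M\<close>, and by the Lindelof
  property of euclidean space countably many of them cover the part of the image in one chart of
  \<open>M\<close>.
\<close>

lemma image_sigma_compact:
  assumes conn: "connected_space M"
  obtains K :: "nat \<Rightarrow> 'm set" where "\<And>n. compactin (subtopology M img) (K n)" "img = (\<Union>n. K n)"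
proof -
  obtain \<C> where C: "countable \<C>" "\<C> \<subseteq> A" "topspace M \<subseteq> (\<Union>c\<in>\<C>. fst c)" by (rule M.countable_chart_cover[OF conn])
  note MI = lip_atlas_subtopology[OF M.manifold_lip_atlas, of img]
  have "\<exists>K U. compactin (subtopology M img) K \<and> openin (subtopology M img) U \<and> q \<in> U \<and> U \<subseteq> K" if q: "q \<in> img" for q
  proof -
    obtain s where s: "s \<in> topspace S" "q = \<phi> s" using q by blast
    obtain b where b: "b \<in> B" "s \<in> fst b" using S.chart_exists[OF s(1)] by blast
    have k: "ichart b \<in> image_charts S B \<phi>" "fst (ichart b) \<subseteq> topspace (subtopology M img)"
      using b(1) S.chart_facts(5)[OF b(1)] unfolding topspace_img by (auto simp: image_charts_eq ichart_def)
    have im: "snd (ichart b) ` fst (ichart b) = snd b ` fst b"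
    proof -
      have "snd (ichart b) ` \<phi> ` fst b = snd b ` fst b"
        unfolding image_image using ichart_apply[of _ b] S.chart_facts(5)[OF b(1)] by (intro image_cong) auto
      then show ?thesis by (simp add: ichart_def)
    qed
    have qb: "q \<in> fst (ichart b)" using ichart_dom[OF b(1) s(1)] b(2) s(2) by simp
    then have "snd (ichart b) q \<in> snd b ` fst b" using im by blast
    then obtain r where r: "r > 0" "cball (snd (ichart b) q) r \<subseteq> snd (ichart b) ` fst (ichart b)"
      using S.chart_facts(2)[OF b(1)] open_contains_cball unfolding im by blast
    have "compactin (subtopology M img) {x \<in> fst (ichart b). snd (ichart b) x \<in> cball (snd (ichart b) q) r}"
      by (rule chart_compactin[OF image_lip_atlas k compact_cball r(2)])
    moreover have "openin (subtopology M img) (chart_ball (topspace (subtopology M img)) (ichart b) q r)"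
      by (rule lip_atlas_openin_chart_ball[OF image_lip_atlas k(1)])
    moreover have "q \<in> chart_ball (topspace (subtopology M img)) (ichart b) q r"
      by (rule chart_ball_center) (use q qb r topspace_img in auto)
    moreover have "chart_ball (topspace (subtopology M img)) (ichart b) q r \<subseteq> {x \<in> fst (ichart b). snd (ichart b) x \<in> cball (snd (ichart b) q) r}"
      by (auto simp: chart_ball_def dist_commute)
    ultimately show ?thesis by blast
  qed
  then obtain K U where KU: "\<And>q. q \<in> img \<Longrightarrow> compactin (subtopology M img) (K q) \<and> openin (subtopology M img) (U q) \<and> q \<in> U q \<and> U q \<subseteq> K q"
    by metis
  have "\<exists>Q. countable Q \<and> Q \<subseteq> img \<and> img \<inter> fst c \<subseteq> (\<Union>q\<in>Q. K q)" if c: "c \<in> A" for c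
  proof -
    have "\<exists>r>0. chart_ball img c q r \<subseteq> K q" if q: "q \<in> img \<inter> fst c" for q
    proof -
      have qq: "q \<in> img" "q \<in> fst c" using q by auto
      obtain r where "r > 0" "chart_ball img c q r \<subseteq> U q"
        using lip_atlas_openin_ball[OF MI _ _ c qq(2), of "U q"] KU[OF qq(1)] unfolding topspace_img by blast
      then show ?thesis using KU[OF qq(1)] by blast
    qed
    then obtain r where r: "\<And>q. q \<in> img \<inter> fst c \<Longrightarrow> r q > 0 \<and> chart_ball img c q (r q) \<subseteq> K q" by metis
    let ?\<F> = "(\<lambda>q. ball (snd c q) (r q)) ` (img \<inter> fst c)"
    obtain \<F>' where F: "\<F>' \<subseteq> ?\<F>" "countable \<F>'" "\<Union>\<F>' = \<Union>?\<F>" using Lindelof[of ?\<F>] by blast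
    have "countable \<F>' \<and> \<F>' \<subseteq> ?\<F>" using F by blast
    then obtain Q where Q: "countable Q" "Q \<subseteq> img \<inter> fst c" "\<F>' = (\<lambda>q. ball (snd c q) (r q)) ` Q"
      unfolding countable_subset_image by (elim exE conjE)
    have "img \<inter> fst c \<subseteq> (\<Union>q\<in>Q. K q)"
    proof
      fix x assume x: "x \<in> img \<inter> fst c"
      have "snd c x \<in> ball (snd c x) (r x)" using r[OF x] by simp
      then have "snd c x \<in> \<Union>\<F>'" unfolding F(3) using x by blast
      then obtain q where q: "q \<in> Q" "snd c x \<in> ball (snd c q) (r q)" unfolding Q(3) by blast
      then have "x \<in> chart_ball img c q (r q)" using x by (auto simp: chart_ball_def dist_commute)
      moreover have "chart_ball img c q (r q) \<subseteq> K q" using r[OF subsetD[OF Q(2) q(1)]] by (rule conjunct2)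
      ultimately show "x \<in> (\<Union>q\<in>Q. K q)" using q(1) by (meson UN_I subsetD)
    qed
    moreover have "Q \<subseteq> img" using Q(2) by blast
    ultimately show ?thesis using Q(1) by (intro exI[of _ Q] conjI)
  qed
  then obtain Q where Q: "\<And>c. c \<in> A \<Longrightarrow> countable (Q c) \<and> Q c \<subseteq> img \<and> img \<inter> fst c \<subseteq> (\<Union>q\<in>Q c. K q)" by metis
  define R where "R = (\<Union>c\<in>\<C>. Q c)"
  have "countable R" unfolding R_def by (rule countable_UN[OF C(1)]) (use C(2) Q in blast)
  moreover have "R \<subseteq> img" unfolding R_def using C(2) Q by blast
  ultimately have R: "countable R" "R \<subseteq> img" by blast+
  have cov: "img \<subseteq> (\<Union>q\<in>R. K q)"
  proof
    fix x assume x: "x \<in> img"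
    then have "x \<in> topspace M" using \<phi>_in by blast
    then obtain c where c: "c \<in> \<C>" "x \<in> fst c" using C(3) by blast
    have "img \<inter> fst c \<subseteq> (\<Union>q\<in>Q c. K q)" using Q[OF subsetD[OF C(2) c(1)]] by (elim conjE)
    then have "x \<in> (\<Union>q\<in>Q c. K q)" using x c(2) by (meson IntI subsetD)
    then show "x \<in> (\<Union>q\<in>R. K q)" unfolding R_def using c(1) by blast
  qed
  have Ksub: "K q \<subseteq> img" if "q \<in> R" for q
  proof -
    have "compactin (subtopology M img) (K q)" using KU[OF subsetD[OF R(2) that]] by (rule conjunct1)
    from compactin_subset_topspace[OF this] show ?thesis unfolding topspace_img .
  qed
  show ?thesis
  proof (cases "R = {}")
    case True
    then show ?thesis using cov by (intro that[of "\<lambda>_. {}"]) auto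
  next
    case False
    show ?thesis
    proof (rule that[of "\<lambda>n. K (from_nat_into R n)"])
      show "compactin (subtopology M img) (K (from_nat_into R n))" for n
        using KU[OF subsetD[OF R(2) from_nat_into[OF False]]] by (rule conjunct1)
      have "(\<Union>n. K (from_nat_into R n)) = (\<Union>q\<in>range (from_nat_into R). K q)" by (simp only: image_image)
      also have "\<dots> = (\<Union>q\<in>R. K q)" by (simp only: range_from_nat_into[OF False R(1)])
      finally have "(\<Union>n. K (from_nat_into R n)) = (\<Union>q\<in>R. K q)" .
      moreover have "(\<Union>q\<in>R. K q) \<subseteq> img" by (rule UN_least) (rule Ksub)
      ultimately show "img = (\<Union>n. K (from_nat_into R n))" using cov by (simp only: subset_antisym)
    qed
  qed
qed

lemma zero_section_continuous: "continuous_map (subtopology M img) NT tzero"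
proof (rule lip_at_continuous[OF image_lip_atlas normal_lip_atlas])
  show "tzero ` topspace (subtopology M img) \<subseteq> topspace NT" unfolding topspace_img topspace_NT using tzero_normal by blast
  fix q assume "q \<in> topspace (subtopology M img)"
  then have qi: "q \<in> img" unfolding topspace_img .
  then obtain s where s: "s \<in> topspace S" "q = \<phi> s" by blast
  obtain b where b: "b \<in> B" "q \<in> fst (ichart b)" using image_chart_exists[OF qi] by blast
  obtain V e where V: "q \<in> V" and f: "frame V e" using normal_frame_exists[OF s(1)] s(2) by blast
  have a: "nchart b V e \<in> NC" unfolding normal_charts_eq using b(1) f by blast
  have k: "ichart b \<in> image_charts S B \<phi>" unfolding image_charts_eq using b(1) by blast
  have in_a: "tzero x \<in> fst (nchart b V e) \<and> snd (nchart b V e) (tzero x) = (snd (ichart b) x, 0)"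
    if "x \<in> V" "x \<in> fst (ichart b)" for x
    using that tzero_normal frame_facts(2)[OF f] fiber_coord_tzero[OF f that(1)] by (auto simp: nchart_def tzero_def)
  obtain r where r: "r > 0" "chart_ball img (ichart b) q r \<subseteq> V"
    by (rule lip_atlas_openin_ball[OF image_lip_atlas frame_facts(1)[OF f] V k b(2), unfolded topspace_img])
  have rV: "x \<in> V \<and> x \<in> fst (ichart b)" if "x \<in> chart_ball img (ichart b) q r" for x
    using that r(2) by (auto simp: chart_ball_def)
  have "lip_at (ichart b) (nchart b V e) img tzero q"
  proof (rule lip_atI[OF r(1), of 1])
    fix x y assume "x \<in> chart_ball img (ichart b) q r" "y \<in> chart_ball img (ichart b) q r"
    then show "dist (snd (nchart b V e) (tzero x)) (snd (nchart b V e) (tzero y)) \<le> 1 * dist (snd (ichart b) x) (snd (ichart b) y)"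
      using in_a rV by (simp add: dist_Pair_Pair)
  qed (use in_a rV in auto)
  then show "\<exists>k\<in>image_charts S B \<phi>. \<exists>a\<in>NC. q \<in> fst k \<and> tzero q \<in> fst a \<and> lip_at k a (topspace (subtopology M img)) tzero q"
    unfolding topspace_img using a k b(2) in_a[OF V b(2)] by blast
qed

text \<open>
  The model space is closed, so its closed balls are compact; a small one pulls back to a compact
  neighbourhood.
\<close>

lemma normal_bundle_locally_compact:
  assumes v: "v \<in> \<nu>" and U: "openin NT U" "v \<in> U"
  shows "\<exists>V C. openin NT V \<and> compactin NT C \<and> v \<in> V \<and> V \<subseteq> C \<and> C \<subseteq> U"
proof -
  obtain b V e where b: "b \<in> B" and f: "frame V e" and va: "v \<in> fst (nchart b V e)" by (rule nchart_exists[OF v])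
  let ?a = "nchart b V e" and ?H = "(UNIV :: (real^'k) set) \<times> coord_space J"
  have aN: "?a \<in> NC" unfolding normal_charts_eq using b f by blast
  have aT: "fst ?a \<subseteq> topspace NT" unfolding topspace_NT using nchart_elim(1) by blast
  have aH: "snd ?a w \<in> ?H" if "w \<in> fst ?a" for w
    using fiber_coord_spec(1)[OF f nchart_elim(1,2)[OF that]] by (simp add: nchart_def)
  obtain r where r: "r > 0" "chart_ball \<nu> ?a v r \<subseteq> U"
    by (rule lip_atlas_openin_ball[OF normal_lip_atlas U aN va, unfolded topspace_NT])
  have "openin (top_of_set ?H) (snd ?a ` fst ?a)"
    using nchart_image_open[OF f b openin_topspace] aT by (simp add: inf.absorb1)
  then obtain \<rho> where \<rho>: "\<rho> > 0" "ball (snd ?a v) \<rho> \<inter> ?H \<subseteq> snd ?a ` fst ?a"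
    using va unfolding openin_contains_ball by blast
  define t where "t = min r \<rho> / 2"
  have t: "t > 0" "t < r" "t < \<rho>" using r(1) \<rho>(1) by (auto simp: t_def)
  let ?C = "cball (snd ?a v) t \<inter> ?H"
  have "closed ?H" by (rule closed_subspace[OF subspace_Times[OF subspace_UNIV coord_space_subspace]])
  then have "compact ?C" by (intro compact_Int_closed compact_cball)
  moreover have "?C \<subseteq> snd ?a ` fst ?a" using \<rho>(2) t(3) by (auto simp: subset_iff)
  ultimately have "compactin NT {w \<in> fst ?a. snd ?a w \<in> ?C}" by (rule chart_compactin[OF normal_lip_atlas aN aT])
  moreover have "openin NT (chart_ball \<nu> ?a v t)"
    using lip_atlas_openin_chart_ball[OF normal_lip_atlas aN] unfolding topspace_NT .
  moreover have "v \<in> chart_ball \<nu> ?a v t" by (rule chart_ball_center[OF v va t(1)])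
  moreover have "chart_ball \<nu> ?a v t \<subseteq> {w \<in> fst ?a. snd ?a w \<in> ?C}"
  proof
    fix w assume w: "w \<in> chart_ball \<nu> ?a v t"
    then have wa: "w \<in> fst ?a" by (simp add: chart_ball_def)
    then show "w \<in> {w \<in> fst ?a. snd ?a w \<in> ?C}" using aH[OF wa] w by (auto simp: chart_ball_def dist_commute)
  qed
  moreover have "{w \<in> fst ?a. snd ?a w \<in> ?C} \<subseteq> U"
  proof
    fix w assume "w \<in> {w \<in> fst ?a. snd ?a w \<in> ?C}"
    then have "w \<in> chart_ball \<nu> ?a v r" using t(2) nchart_elim(1)[of w b V e] by (auto simp: chart_ball_def dist_commute)
    then show "w \<in> U" using r(2) by blast
  qed
  ultimately show ?thesis by blast
qed

end

section \<open>The tubular neighbourhood\<close>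

context normal_exponential begin

text \<open>
  The globalization is applied to the union \<open>D\<close> of all neighbourhoods on which the map is
  bi-Lipschitz and to the zero section as \<open>Z\<close>. Since the map takes \<open>tzero q\<close> to \<open>q\<close>, continuity of
  the zero section is the required embedding property.
\<close>

theorem exp_lipeomorphism:
  assumes conn: "connected_space M"
  shows "\<exists>N W. openin NT N \<and> tzero ` img \<subseteq> N \<and> N \<subseteq> exp_dom M A \<Gamma> \<and> openin M W \<and> img \<subseteq> W \<and>
     lipeomorphism (subtopology NT N) NC (subtopology M W) A (exp_map M A \<Gamma>)"
proof -
  let ?ex = "exp_map M A \<Gamma>"
  define D where "D = \<Union>{P. exp_bilipschitz_on P}"
  have good: "\<exists>P. v \<in> P \<and> exp_bilipschitz_on P" if "v \<in> D" for v
    using that unfolding D_def by blast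
  have oD: "openin NT D" unfolding D_def by (rule openin_Union) (simp add: exp_bilipschitz_on_def)
  have DX: "D \<subseteq> exp_dom M A \<Gamma>" unfolding D_def by (auto simp: exp_bilipschitz_on_def)
  have ZD: "tzero ` img \<subseteq> D"
  proof (rule subsetI)
    fix v :: "('m, real^'n) tvec" assume "v \<in> tzero ` img"
    then obtain s where "s \<in> topspace S" "v = tzero (\<phi> s)" by blast
    then show "v \<in> D" using exp_local_lipeomorphism[of s] unfolding D_def by blast
  qed
  have D\<nu>: "D \<subseteq> \<nu>" using openin_subset[OF oD] by simp
  have tD: "topspace (subtopology NT D) = D" using D\<nu> by auto
  have cont: "continuous_map (subtopology NT D) M ?ex"
  proof (rule lip_at_continuous[OF lip_atlas_subtopology[OF normal_lip_atlas] M.manifold_lip_atlas], unfold tD)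
    show "?ex ` D \<subseteq> topspace M"
    proof (rule image_subsetI)
      fix v assume "v \<in> D"
      then obtain P where P: "v \<in> P" "exp_bilipschitz_on P" using good by blast
      obtain a d where "d \<in> A" "?ex ` P \<subseteq> fst d" by (rule exp_bilipschitz_onE[OF P(2)])
      then show "?ex v \<in> topspace M" using M.chart_facts(5)[of d] P(1) by blast
    qed
    fix v assume "v \<in> D"
    then obtain P where v: "v \<in> P" and g: "exp_bilipschitz_on P" using good by blast
    obtain a d m L where g1: "a \<in> NC" "d \<in> A" "m > 0" "P \<subseteq> fst a" "?ex ` P \<subseteq> fst d"
      and g2: "bilipschitz_in_charts a d m L ?ex P"
      by (rule exp_bilipschitz_onE[OF g])
    have oP: "openin NT P" using g unfolding exp_bilipschitz_on_def by (rule conjunct1)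
    have va: "v \<in> fst a" using v g1(4) by blast
    obtain r where r: "r > 0" "chart_ball \<nu> a v r \<subseteq> P"
      by (rule lip_atlas_openin_ball[OF normal_lip_atlas oP v g1(1) va, unfolded topspace_NT])
    have rP: "chart_ball D a v r \<subseteq> P" using r(2) chart_ball_mono[OF D\<nu> order_refl] by blast
    have "lip_at a d D ?ex v"
    proof (rule lip_atI[OF r(1), of "max L 0"])
      fix x y assume "x \<in> chart_ball D a v r" "y \<in> chart_ball D a v r"
      then have "dist (snd d (?ex x)) (snd d (?ex y)) \<le> L * dist (snd a x) (snd a y)" using rP g2 by blast
      also have "\<dots> \<le> max L 0 * dist (snd a x) (snd a y)" by (intro mult_right_mono) auto
      finally show "dist (snd d (?ex x)) (snd d (?ex y)) \<le> max L 0 * dist (snd a x) (snd a y)" .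
    next
      fix x assume "x \<in> chart_ball D a v r"
      then show "?ex x \<in> fst d" using rP g1(5) by blast
    qed simp
    then show "\<exists>a\<in>NC. \<exists>d\<in>A. v \<in> fst a \<and> ?ex v \<in> fst d \<and> lip_at a d D ?ex v" using g1 va v by blast
  qed
  have inj: "inj_on ?ex (tzero ` img)"
  proof (rule inj_onI)
    fix v w :: "('m, real^'n) tvec" assume "v \<in> tzero ` img" "w \<in> tzero ` img" and eq: "?ex v = ?ex w"
    then obtain s t where "s \<in> topspace S" "v = tzero (\<phi> s)" "t \<in> topspace S" "w = tzero (\<phi> t)" by blast
    then show "v = w" using eq exp_zero by simp
  qed
  have locinj: "\<exists>U. openin NT U \<and> z \<in> U \<and> inj_on ?ex U" if "z \<in> tzero ` img" for z
  proof -
    have "z \<in> D" using that ZD by blast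
    then obtain P where v: "z \<in> P" and g: "exp_bilipschitz_on P" using good by blast
    obtain a d m L where g1: "a \<in> NC" "d \<in> A" "m > 0" "P \<subseteq> fst a" "?ex ` P \<subseteq> fst d"
      and g2: "bilipschitz_in_charts a d m L ?ex P"
      by (rule exp_bilipschitz_onE[OF g])
    have oP: "openin NT P" using g unfolding exp_bilipschitz_on_def by (rule conjunct1)
    have "inj_on ?ex P"
    proof (rule inj_onI)
      fix x y assume xy: "x \<in> P" "y \<in> P" "?ex x = ?ex y"
      then have "m * dist (snd a x) (snd a y) \<le> 0" using g2 by force
      then have "snd a x = snd a y" using g1(3) by (simp add: mult_le_0_iff)
      then show "x = y" using lip_atlas_inj[OF normal_lip_atlas g1(1)] xy g1(4) by (meson inj_onD subsetD)
    qed
    then show ?thesis using v oP by blast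
  qed
  have emb: "\<exists>G. openin M G \<and> ?ex z \<in> G \<and> (\<forall>w\<in>tzero ` img. ?ex w \<in> G \<longrightarrow> w \<in> U)"
    if z: "z \<in> tzero ` img" and U: "openin NT U" "z \<in> U" for z U
  proof -
    have "openin (subtopology M img) {q \<in> topspace (subtopology M img). tzero q \<in> U}"
      using zero_section_continuous U(1) unfolding continuous_map_def by blast
    then obtain T where T: "openin M T" "{q \<in> img. tzero q \<in> U} = T \<inter> img" unfolding topspace_img openin_subtopology by blast
    have zero: "?ex (tzero q) = q" if "q \<in> img" for q using that exp_zero by blast
    obtain q where q: "q \<in> img" "z = tzero q" using z by blast
    show ?thesis
    proof (intro exI[of _ T] conjI ballI impI T(1))
      show "?ex z \<in> T" using q zero U(2) T(2) by auto
      fix w assume "w \<in> tzero ` img" "?ex w \<in> T"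
      then obtain q' where q': "q' \<in> img" "w = tzero q'" "?ex (tzero q') \<in> T" by blast
      then have "q' \<in> T" by (simp only: zero)
      then show "w \<in> U" using T(2) q' by blast
    qed
  qed
  obtain K :: "nat \<Rightarrow> 'm set" where K: "\<And>n. compactin (subtopology M img) (K n)" "img = (\<Union>n. K n)"
    by (rule image_sigma_compact[OF conn]) blast
  have Hausdorff: "Hausdorff_space M" using M.manifold by (simp add: Ck1_manifold_def)
  have lc: "\<exists>V C. openin NT V \<and> compactin NT C \<and> z \<in> V \<and> V \<subseteq> C \<and> C \<subseteq> U"
    if "z \<in> tzero ` img" "openin NT U" "z \<in> U" for z U
    using normal_bundle_locally_compact[OF _ that(2,3)] that(1) tzero_normal by blast
  have Kc: "compactin NT (tzero ` K n)" for n by (rule image_compactin[OF K(1) zero_section_continuous])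
  have KU: "tzero ` img = (\<Union>n. tzero ` K n)" using K(2) by blast
  obtain N where N: "openin NT N" "tzero ` img \<subseteq> N" "N \<subseteq> D" "inj_on ?ex N"
    using injective_near_sigma_compact[OF Hausdorff oD cont ZD inj locinj emb lc Kc KU] by blast
  have loc: "\<exists>P a b m L. p \<in> P \<and> P \<subseteq> N \<and> openin NT P \<and> openin M (?ex ` P) \<and>
       a \<in> NC \<and> b \<in> A \<and> P \<subseteq> fst a \<and> ?ex ` P \<subseteq> fst b \<and> m > 0 \<and>
       bilipschitz_in_charts a b m L ?ex P" if p: "p \<in> N" for p
  proof -
    have "p \<in> D" using p N(3) by blast
    then obtain P where v: "p \<in> P" and g: "exp_bilipschitz_on P" using good by blast
    have oP: "openin NT (P \<inter> N)" using g N(1) unfolding exp_bilipschitz_on_def by (meson openin_Int)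
    have g': "exp_bilipschitz_on (P \<inter> N)" by (rule exp_bilipschitz_on_subset[OF g Int_lower1 oP])
    then have "openin M (?ex ` (P \<inter> N))" using oP unfolding exp_bilipschitz_on_def by (meson order_refl)
    moreover obtain a d m L where "a \<in> NC" "d \<in> A" "m > 0" "P \<inter> N \<subseteq> fst a" "?ex ` (P \<inter> N) \<subseteq> fst d"
      "bilipschitz_in_charts a d m L ?ex (P \<inter> N)"
      by (rule exp_bilipschitz_onE[OF g'])
    moreover have "p \<in> P \<inter> N" using v p by blast
    ultimately show ?thesis using oP
      by (intro exI[of _ "P \<inter> N"] exI[of _ a] exI[of _ d], rule_tac exI[of _ m], rule_tac exI[of _ L]) simp
  qed
  note lip = lipeomorphism_of_local[OF normal_lip_atlas M.manifold_lip_atlas N(4) loc]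
  have "img \<subseteq> ?ex ` N"
  proof (rule subsetI)
    fix q assume "q \<in> img"
    then have "tzero q \<in> N" "?ex (tzero q) = q" using N(2) exp_zero by blast+
    then show "q \<in> ?ex ` N" by (metis imageI)
  qed
  then show ?thesis using N(1,2,3) DX lip by (intro exI[of _ N] exI[of _ "?ex ` N"]) blast
qed

end

theorem theorem13:
  fixes M :: "'m topology" and A :: "('m, real^'n) chart set"
    and g :: "('m, real^'n) metric_field" and \<Gamma> :: "('m, 'n::finite) symbols"
    and S :: "'s topology" and B :: "('s, real^'k) chart set"
    and \<phi> :: "'s \<Rightarrow> 'm" and J :: "'n set"
  assumes "Ck1_manifold 2 M A" and "connected_space M"
    and "pseudo_riemannian_metric 1 M A g"
    and "lipschitz_connection A \<Gamma>" and "metric_compatible A g \<Gamma>"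
    and "Ck1_manifold 1 S B"
    and "Ck1_embedding 1 S B M A \<phi>"
    and "\<forall>s\<in>topspace S.
           nondegenerate_on B s (\<lambda>u w. g (pushforward B A \<phi> u) (pushforward B A \<phi> w))"
    and "card J = CARD('n) - CARD('k)"
  shows "lipschitz_vector_bundle (normal_topology A g S B \<phi>)
           (subtopology M (\<phi> ` topspace S)) (image_charts S B \<phi>)
           fst tadd tscale (coord_space J) (normal_trivs M A g S B \<phi> J)
    \<and> (\<forall>q \<in> \<phi> ` topspace S. \<forall>a \<in> normal_charts M A g S B \<phi> J. \<forall>d\<in>A.
           tzero q \<in> fst a \<longrightarrow> q \<in> fst d \<longrightarrow>
           (\<exists>W L. W \<subseteq> snd a ` {v \<in> fst a \<inter> exp_dom M A \<Gamma>. exp_map M A \<Gamma> v \<in> fst d} \<and>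
                  has_strong_differential (UNIV \<times> coord_space J) W
                    (chart_rep a d (exp_map M A \<Gamma>)) L (snd a (tzero q))))
    \<and> (\<exists>N W. openin (normal_topology A g S B \<phi>) N \<and> tzero ` \<phi> ` topspace S \<subseteq> N \<and>
             N \<subseteq> exp_dom M A \<Gamma> \<and>
             openin M W \<and> \<phi> ` topspace S \<subseteq> W \<and>
             lipeomorphism (subtopology (normal_topology A g S B \<phi>) N)
               (normal_charts M A g S B \<phi> J) (subtopology M W) A (exp_map M A \<Gamma>))"
proof -
  interpret normal_exponential M A S B g \<phi> J \<Gamma>
  proof unfold_locales
    show "Ck1_manifold 1 M A" by (rule Ck1_manifold_2_imp_1[OF assms(1)])
  qed (use assms in blast)+
  have strong: "\<exists>W L. W \<subseteq> snd a ` {v \<in> fst a \<inter> exp_dom M A \<Gamma>. exp_map M A \<Gamma> v \<in> fst d} \<and>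
      has_strong_differential (UNIV \<times> coord_space J) W (chart_rep a d (exp_map M A \<Gamma>)) L (snd a (tzero q))"
    if q: "q \<in> \<phi> ` topspace S" and a: "a \<in> normal_charts M A g S B \<phi> J" and d: "d \<in> A" and za: "tzero q \<in> fst a" and qd: "q \<in> fst d"
    for q a d
  proof -
    obtain s where s: "s \<in> topspace S" "q = \<phi> s" using q by blast
    obtain b V e where b: "b \<in> B" "frame V e" "a = nchart b V e" using a unfolding normal_charts_eq by blast
    have z: "tzero (\<phi> s) \<in> fst (nchart b V e)" using za unfolding b(3) s(2) .
    have sV: "\<phi> s \<in> V" and sk: "\<phi> s \<in> fst (ichart b)"
      using nchart_elim(2,3)[OF z] by (simp_all add: tzero_def)
    have sb: "s \<in> fst b" using sk ichart_dom[OF b(1) s(1)] by blast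
    have "\<phi> s \<in> fst d" using qd s(2) by simp
    from exp_has_strong_differential[OF b(2,1) sb d this sV] obtain W where
      "W \<subseteq> snd a ` {v \<in> fst a \<inter> exp_dom M A \<Gamma>. exp_map M A \<Gamma> v \<in> fst d} \<and>
      has_strong_differential (UNIV \<times> coord_space J) W (chart_rep a d (exp_map M A \<Gamma>)) (exp_diff b e d s) (snd a (tzero q))"
      unfolding b(3)[symmetric] s(2)[symmetric] by (rule exE)
    then show ?thesis by (intro exI[of _ W] exI[of _ "exp_diff b e d s"])
  qed
  show ?thesis
    by (intro conjI normal_bundle_lipschitz ballI impI strong exp_lipeomorphism[OF assms(2)])
qed

end
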